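(* Let $\Psi:(\mathbb{R}\mathrm{P}^2)^{\times 10}\to\mathbb R$ be a nonnegative measurable function, and let $$\mu:=\mathop{\mathbb E}_{\mathbf u_1,\mathbf v_1,\ldots,\mathbf u_5,\mathbf v_5\sim\mathrm{Unif}(\mathbb{R}\mathrm{P}^2)\text{ i.i.d.}}\ \Psi(\mathbf u_1,\mathbf v_1,\ldots,\mathbf u_5,\mathbf v_5)\cdot\#\{E\in\mathcal E\mid \mathbf u_1^TE\mathbf v_1=\cdots=\mathbf u_5^TE\mathbf v_5=0\}$$ (that is, $\mu=\mathbb E\,\#(\mathcal E\cap L)$ where the distribution of $L=\{E\in\mathbb{R}\mathrm{P}^8\mid \mathbf u_1^TE\mathbf v_1=\cdots=\mathbf u_5^TE\mathbf v_5=0\}$ is defined by $\Psi$). Then $$\mu=\frac{\mathrm{vol}(\mathcal E)}{2^3}\ \mathop{\mathbb E}_{E\in\mathcal E}\ \mathop{\mathbb E}_{\mathbf a}\ \Psi\big((U,V).\phi(\mathbf a)\big)\cdot\left|\det\begin{bmatrix}\mathbf z_1&\cdots&\mathbf z_5\end{bmatrix}\right|,$$ where $(U,V)\in\mathrm{SO}(3)\times\mathrm{SO}(3)$ is such that $E=(U,V).E_0$, the first expected value is over the uniform distribution on $\mathcal E$, and the second expected value is over $\mathbf a=(a_i,b_i,r_i,s_i,\theta_i)_{i=1}^5$ with $a_i,b_i,r_i,s_i\sim N(0,1)$, $\theta_i\sim\mathrm{Unif}([0,2\pi))$, all independent. Here $$\mathbf z_i=\begin{bmatrix} b_ir_i\sin\theta_i,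 & b_ir_i\cos\theta_i, & a_is_i\sin\theta_i, & a_is_i\cos\theta_i, & r_is_i\end{bmatrix}^T\in\mathbb R^5,\qquad i=1,\ldots,5.$$
   Context: For $\mathbf t\in\mathbb R^3$ let $[\mathbf t]_\times\in\mathbb R^{3\times 3}$ be the matrix with $[\mathbf t]_\times\mathbf x=\mathbf t\times\mathbf x$ for all $\mathbf x\in\mathbb R^3$. Put $E(R,\mathbf t)=[\mathbf t]_\times R$ for $R\in\mathrm{SO}(3)$, $\mathbf t\in\mathbb R^3$, and $\widehat{\mathcal E}=\{E(R,\mathbf t)\mid R\in\mathrm{SO}(3),\ \mathbf t\in\mathbb R^3\}$. The essential variety $\mathcal E\subset\mathrm P(\mathbb R^{3\times 3})\cong\mathbb{R}\mathrm{P}^8$ is the image of $\widehat{\mathcal E}\setminus\{0\}$ under projectivization; it is a smooth $5$-dimensional submanifold. $\mathbb R^{3\times 3}$ carries the inner product $\langle A,B\rangle=\frac12\mathrm{Tr}(AB^T)$, and $\mathbb{R}\mathrm{P}^8$ carries the Riemannian metric for which the $2:1$ projection from the unit sphere of $\mathbb R^{3\times 3}$ is a local isometry; $\mathrm{vol}(\mathcal E)$ is the induced $5$-dimensional Riemannian volume, and the uniform distribution on $\mathcal E$ is the normalized volume measure. $E_0:=E(1_3,\mathbf e_1)=\begin{bmatrix}0&0&0\\0&0&-1\\0&1&0\end{bmatrix}$ (viewed in $\mathcal E$), with $1_3$ the identity matrix and $\mathbf e_1=(1,0,0)^T$. For $U,V\in\mathrm{SO}(3)$ put $(U,V).E:=UEV^T$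 on matrices (up to scaling), an action that is transitive on $\mathcal E$, and $(U,V).(\mathbf u_1,\mathbf v_1,\ldots,\mathbf u_5,\mathbf v_5):=(U\mathbf u_1,V\mathbf v_1,\ldots,U\mathbf u_5,V\mathbf v_5)$. For one tuple set $\phi(a,b,r,s,\theta)=(\mathbf u,\mathbf v)\in\mathbb R^3\times\mathbb R^3$ with $\mathbf u=(a,r\cos\theta,r\sin\theta)^T$ and $\mathbf v=(b,s\cos\theta,s\sin\theta)^T$; for $\mathbf a=(a_i,b_i,r_i,s_i,\theta_i)_{i=1}^5$ set $\phi(\mathbf a)=(\phi(a_i,b_i,r_i,s_i,\theta_i))_{i=1}^5=(\mathbf u_1,\mathbf v_1,\ldots,\mathbf u_5,\mathbf v_5)$. The function $\Psi$ is also regarded as a function on $(\mathbb R^3\setminus\{0\})^{\times 10}$ by composing with the projection $\mathbb R^3\setminus\{0\}\to\mathbb{R}\mathrm{P}^2$ in each factor. $\mathrm{Unif}(\mathbb{R}\mathrm{P}^2)$ is the law of $U\cdot\mathbf a_0$, with $\mathbf a_0\in\mathbb{R}\mathrm{P}^2$ fixed and $U$ Haar-distributed on $\mathrm O(3)$. $\#$ denotes the number of (real) points. *)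

theory Defs
  imports "HOL-Probability.Probability"
begin

section \<open>Real projective spaces\<close>

typedef (overloaded) 'a proj_space =
  "{span {x} | x :: 'a::euclidean_space. x \<noteq> 0}"
  morphisms line_of Abs_proj_space
  using nonzero_Basis by blast

text \<open>The projection onto the projective space; its value at \<open>0\<close> is irrelevant.\<close>

definition proj_pt :: "'a::euclidean_space \<Rightarrow> 'a proj_space" where
  "proj_pt x = Abs_proj_space (span {x})"

text \<open>Quotient topology of the projection from the nonzero vectors; \<open>borel\<close> on a projective space
  refers to it.\<close>

instantiation proj_space :: (euclidean_space) topological_space
begin

definition open_proj_space :: "'a proj_space set \<Rightarrow> bool" where
  "open_proj_space S \<longleftrightarrow> open {x. x \<noteq> 0 \<and> proj_pt x \<in> S}"

instance
proof
  have "{x::'a. x \<noteq> 0 \<and> proj_pt x \<in> (UNIV :: 'a proj_space set)} = - {0}"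
    by auto
  then show "open (UNIV :: 'a proj_space set)"
    by (simp add: open_proj_space_def open_Compl)
next
  fix S T :: "'a proj_space set"
  assume "open S" "open T"
  moreover have "{x. x \<noteq> 0 \<and> proj_pt x \<in> S \<inter> T}
      = {x. x \<noteq> 0 \<and> proj_pt x \<in> S} \<inter> {x. x \<noteq> 0 \<and> proj_pt x \<in> T}"
    by auto
  ultimately show "open (S \<inter> T)"
    by (simp only: open_proj_space_def open_Int)
next
  fix K :: "'a proj_space set set"
  assume "\<forall>S\<in>K. open S"
  moreover have "{x. x \<noteq> 0 \<and> proj_pt x \<in> \<Union>K}
      = (\<Union>S\<in>K. {x. x \<noteq> 0 \<and> proj_pt x \<in> S})"
    by auto
  ultimately show "open (\<Union>K)"
    by (simp only: open_proj_space_def open_UN)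
qed

end


section \<open>The essential variety\<close>

definition cross_matrix :: "real^3 \<Rightarrow> real^3^3" where
  "cross_matrix t = matrix (cross3 t)"

definition ess_matrix :: "real^3^3 \<Rightarrow> real^3 \<Rightarrow> real^3^3" where
  "ess_matrix R t = cross_matrix t ** R"

definition ess_cone :: "(real^3^3) set" where
  "ess_cone = {ess_matrix R t | R t. rotation_matrix R}"

definition ess_variety :: "(real^3^3) proj_space set" where
  "ess_variety = proj_pt ` (ess_cone - {0})"

definition E0 :: "real^3^3" where
  "E0 = ess_matrix (mat 1) (axis 1 1)"

text \<open>The equation \<open>u\<^sup>T E v = 0\<close>, homogeneous in each argument, hence required of all representatives.\<close>

definition epipolar :: "(real^3) proj_space \<Rightarrow> (real^3^3) proj_space \<Rightarrow> (real^3) proj_space \<Rightarrow> bool" where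
  "epipolar u E v \<longleftrightarrow> (\<forall>x\<in>line_of u. \<forall>A\<in>line_of E. \<forall>y\<in>line_of v. x \<bullet> (A *v y) = 0)"


section \<open>Riemannian volume of five-dimensional submanifolds\<close>

definition mat_inner :: "real^3^3 \<Rightarrow> real^3^3 \<Rightarrow> real" where
  "mat_inner A B = 1/2 * trace (A ** transpose B)"

text \<open>A local parametrization of an embedded five-dimensional submanifold \<open>M\<close> of the projective space of
  matrices, presented by a lift \<open>\<psi>\<close> to the unit sphere for \<open>mat_inner\<close>. As the projection from the
  sphere is a local isometry, the metric of \<open>M\<close> in this parametrization has the Gram matrix of
  the partial derivatives of the lift. Continuous differentiability suffices for the volume.\<close>

definition local_param ::
    "(real^3^3) proj_space set \<Rightarrow> (real^5) set \<Rightarrow> (real^5 \<Rightarrow> real^3^3) \<Rightarrow> bool" where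
  "local_param M W \<psi> \<longleftrightarrow>
     open W \<and>
     (\<forall>x\<in>W. \<psi> differentiable (at x)) \<and>
     (\<forall>h. continuous_on W (\<lambda>x. frechet_derivative \<psi> (at x) h)) \<and>
     (\<forall>x\<in>W. inj (frechet_derivative \<psi> (at x))) \<and>
     (\<forall>x\<in>W. mat_inner (\<psi> x) (\<psi> x) = 1) \<and>
     openin (top_of_set M) ((\<lambda>x. proj_pt (\<psi> x)) ` W) \<and>
     (\<exists>g. homeomorphism W ((\<lambda>x. proj_pt (\<psi> x)) ` W) (\<lambda>x. proj_pt (\<psi> x)) g)"

definition gram :: "(real^5 \<Rightarrow> real^3^3) \<Rightarrow> real^5 \<Rightarrow> real^5^5" where
  "gram \<psi> x = (\<chi> i j. mat_inner (frechet_derivative \<psi> (at x) (axis i 1))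
                               (frechet_derivative \<psi> (at x) (axis j 1)))"

text \<open>The Riemannian volume is the Borel measure on \<open>M\<close> with density \<open>sqrt (det g)\<close> with respect to
  Lebesgue measure in every local parametrization.\<close>

definition riemannian_volume ::
    "(real^3^3) proj_space set \<Rightarrow> (real^3^3) proj_space measure" where
  "riemannian_volume M = (THE \<nu>.
     sets \<nu> = sets (restrict_space borel M) \<and>
     (\<forall>W \<psi>. local_param M W \<psi> \<longrightarrow>
        (\<forall>B\<in>sets \<nu>. B \<subseteq> (\<lambda>x. proj_pt (\<psi> x)) ` W \<longrightarrow>
           emeasure \<nu> B =
             (\<integral>\<^sup>+ x \<in> {x\<in>W. proj_pt (\<psi> x) \<in> B}. ennreal (sqrt (det (gram \<psi> x))) \<partial>lborel))))"

abbreviation ess_volume :: "(real^3^3) proj_space measure" where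
  "ess_volume \<equiv> riemannian_volume ess_variety"

definition unif_ess :: "(real^3^3) proj_space measure" where
  "unif_ess = uniform_measure ess_volume ess_variety"


section \<open>Probability distributions\<close>

definition haar_O3 :: "(real^3^3) measure" where
  "haar_O3 = (THE H.
     prob_space H \<and>
     sets H = sets (restrict_space borel {U. orthogonal_matrix U}) \<and>
     (\<forall>U. orthogonal_matrix U \<longrightarrow> distr H H (\<lambda>X. U ** X) = H))"

definition unif_RP2 :: "(real^3) proj_space measure" where
  "unif_RP2 = distr haar_O3 borel (\<lambda>U. proj_pt (U *v axis 1 1))"

text \<open>The law of one tuple \<open>(a, b, r, s, \<theta>)\<close>.\<close>

type_synonym tuple = "real \<times> real \<times> real \<times> real \<times> real"

definition std_gauss :: "real measure" where
  "std_gauss = density lborel (\<lambda>x. ennreal (std_normal_density x))"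

definition tuple_law :: "tuple measure" where
  "tuple_law = std_gauss \<Otimes>\<^sub>M std_gauss \<Otimes>\<^sub>M std_gauss \<Otimes>\<^sub>M std_gauss
                 \<Otimes>\<^sub>M uniform_measure lborel {0..<2*pi}"

definition phi :: "tuple \<Rightarrow> (real^3) \<times> (real^3)" where
  "phi = (\<lambda>(a, b, r, s, \<theta>).
     (vector [a, r * cos \<theta>, r * sin \<theta>], vector [b, s * cos \<theta>, s * sin \<theta>]))"

definition zvec :: "tuple \<Rightarrow> real^5" where
  "zvec = (\<lambda>(a, b, r, s, \<theta>).
     vector [b * r * sin \<theta>, b * r * cos \<theta>, a * s * sin \<theta>, a * s * cos \<theta>, r * s])"

end

theory Submission
  imports Defs
begin

text \<open>
  A uniform point of the projective plane is the class of a standard Gaussian vector, so the left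
  hand side is an integral over tuples \<open>w = (u\<^sub>1, v\<^sub>1, \<dots>, u\<^sub>5, v\<^sub>5)\<close> of Gaussian vectors. Essential
  matrices are the \<open>\<plusminus>A E\<^sub>0 B\<^sup>T\<close> with rotations \<open>A\<close> and \<open>B\<close>, and by invariance of the Gaussian
  measure under rotations it suffices to count solutions in one chart \<open>\<psi>\<close> around \<open>E\<^sub>0\<close>.

  Fix all coordinates of \<open>w\<close> except the second coordinates \<open>x\<^sub>i\<close> of the \<open>u\<^sub>i\<close>. The equations
  \<open>u\<^sub>i \<bullet> (\<psi> p v\<^sub>i) = 0\<close> then say that \<open>x = h p\<close> for an explicit map \<open>h\<close> on a part of \<open>\<real>\<^sup>5\<close>, apart from a
  null set of tuples. The area formula for \<open>h\<close> and Tonelli turn the integral of the count into an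
  integral over \<open>p\<close> of an integral over the tuples incident with \<open>\<psi> p\<close>, weighted by
  \<open>\<bar>det (u\<^sub>i \<bullet> (\<partial>\<^sub>j\<psi> v\<^sub>i))\<bar>\<close>. For \<open>\<psi> p = \<plusminus>U E\<^sub>0 V\<^sup>T\<close> the incident pairs are \<open>(U u, V v)\<close> with
  \<open>(u\<^sub>2, u\<^sub>3)\<close> parallel to \<open>(v\<^sub>2, v\<^sub>3)\<close>, that is \<open>(u, v) = \<phi>(a, b, r, s, \<theta>)\<close>, and the weighted Gaussian
  measure on them is half the law of \<open>\<phi>(a, b, r, s, \<theta>)\<close>. The tangent space at \<open>E\<^sub>0\<close> consists of the
  matrices with \<open>Y\<^sub>1\<^sub>1 = Y\<^sub>2\<^sub>3 = Y\<^sub>3\<^sub>2 = 0\<close> and \<open>Y\<^sub>2\<^sub>2 = Y\<^sub>3\<^sub>3\<close>, hence the determinant is \<open>4\<close> times the volume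
  density times \<open>det [z\<^sub>1 \<dots> z\<^sub>5]\<close>, and the constant is \<open>4 / 2\<^sup>5 = 1 / 2\<^sup>3\<close>.
\<close>

text \<open>The direct route would be a coarea formula on the incidence variety. Solving each
  equation for one coordinate leaves a map between sets of dimension five, so the area formula for
  equal dimensions suffices; the chosen coordinate breaks the rotational symmetry, and
  \<open>slice_law\<close> removes every trace of it. The price is the set of tuples for which the
  coefficient of that coordinate vanishes at a solution; it is null as the differentiable image of a
  null set of the same ambient dimension. The 4 arises because the inner product in the tangent
  coordinates is diagonal with entries 1/2, 1/2, 1/2, 1/2, 1 and has determinant 1/16. The half law
  arises because the polar radius is signed, so that every point of the plane is reached twice. The
  Haar measure and the volume are definite descriptions, so their existence and uniqueness belong to
  the proof; finiteness and positivity of the volume allow the normalization of the uniform law to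
  cancel. The rotations \<open>U E\<close> and \<open>V E\<close> depend on \<open>E\<close> without
  any regularity. The measurability of the inner expectation in \<open>E\<close> is therefore read
  off from the integral over slices to which it is equal.\<close>

section \<open>The area formula\<close>

text \<open>For a finite value this is \<open>has_measure_differentiable_image\<close> rewritten
  with nonnegative integrals. As that result is an equivalence, a finite integral would force the
  image to have finite measure, so both sides are infinite together.\<close>

lemma emeasure_differentiable_image:
  fixes f :: "real^'n::{finite,wellorder} \<Rightarrow> real^'n::_"
  assumes S: "S \<in> sets lebesgue"
    and der: "\<And>x. x \<in> S \<Longrightarrow> (f has_derivative f' x) (at x within S)"
    and inj: "inj_on f S"
  shows "emeasure lebesgue (f ` S) = (\<integral>\<^sup>+x. ennreal \<bar>det (matrix (f' x))\<bar> * indicator S x \<partial>lebesgue)"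
proof -
  let ?J = "\<lambda>x. \<bar>det (matrix (f' x))\<bar> * indicator S x"
  have fS: "f ` S \<in> sets lebesgue"
    by (rule differentiable_image_in_sets_lebesgue[OF S])
       (use der in \<open>auto simp: differentiable_on_def differentiable_def\<close>)
  have Jm: "?J \<in> borel_measurable lebesgue"
  proof -
    have "(\<lambda>x. indicator S x *\<^sub>R \<bar>det (matrix (f' x))\<bar>) \<in> borel_measurable lebesgue"
      using borel_measurable_restrict_space_iff[of S lebesgue "\<lambda>x. \<bar>det (matrix (f' x))\<bar>"]
        borel_measurable_abs[OF borel_measurable_det_Jacobian[OF S der]] S by auto
    then show ?thesis by (simp add: mult.commute)
  qed
  have key: "f ` S \<in> lmeasurable \<and> measure lebesgue (f ` S) = r \<longleftrightarrow>
      (\<integral>\<^sup>+x. ennreal (?J x) \<partial>lebesgue) = ennreal r \<and> 0 \<le> r" for r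
  proof -
    have "f ` S \<in> lmeasurable \<and> measure lebesgue (f ` S) = r \<longleftrightarrow>
        ((\<lambda>x. \<bar>det (matrix (f' x))\<bar>) has_integral r) S"
      by (rule has_measure_differentiable_image[OF S der inj])
    also have "\<dots> \<longleftrightarrow> (?J has_integral r) UNIV"
      by (subst has_integral_restrict_UNIV[symmetric], rule has_integral_cong) (simp add: indicator_def)
    also have "\<dots> \<longleftrightarrow> (\<integral>\<^sup>+x. ennreal (?J x) \<partial>lebesgue) = ennreal r \<and> 0 \<le> r"
      using Jm by (subst has_integral_iff_nn_integral_lebesgue) auto
    finally show ?thesis .
  qed
  have "emeasure lebesgue (f ` S) = (\<integral>\<^sup>+x. ennreal (?J x) \<partial>lebesgue)"
  proof (cases "f ` S \<in> lmeasurable")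
    case True
    then show ?thesis
      using key[of "measure lebesgue (f ` S)"] by (simp add: emeasure_eq_measure2 fmeasurableD2)
  next
    case False
    then have "\<not> emeasure lebesgue (f ` S) < \<infinity>"
      using fS unfolding fmeasurable_def by blast
    then have "emeasure lebesgue (f ` S) = \<infinity>"
      by (metis infinity_ennreal_def less_top)
    moreover have "(\<integral>\<^sup>+x. ennreal (?J x) \<partial>lebesgue) = \<infinity>"
    proof (rule ccontr)
      assume "(\<integral>\<^sup>+x. ennreal (?J x) \<partial>lebesgue) \<noteq> \<infinity>"
      then obtain r where "0 \<le> r" "(\<integral>\<^sup>+x. ennreal (?J x) \<partial>lebesgue) = ennreal r"
        by (cases "\<integral>\<^sup>+x. ennreal (?J x) \<partial>lebesgue") auto
      then show False using key[of r] False by auto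
    qed
    ultimately show ?thesis by simp
  qed
  also have "\<dots> = (\<integral>\<^sup>+x. ennreal \<bar>det (matrix (f' x))\<bar> * indicator S x \<partial>lebesgue)"
    by (rule nn_integral_cong) (simp add: indicator_def)
  finally show ?thesis .
qed

text \<open>Both sides integrate \<open>F\<close> against the same measure: pushing the density
  \<open>\<bar>det (matrix (g' x))\<bar>\<close> on \<open>S\<close> forward along \<open>g\<close>
  gives Lebesgue measure on the image, as the preceding lemma shows when applied to the preimage of
  each Borel set.\<close>

lemma nn_integral_differentiable_image:
  fixes g :: "real^'n::{finite,wellorder} \<Rightarrow> real^'n::_"
  assumes S: "S \<in> sets lebesgue"
    and der: "\<And>x. x \<in> S \<Longrightarrow> (g has_derivative g' x) (at x within S)"
    and inj: "inj_on g S"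
    and F[measurable]: "F \<in> borel_measurable borel"
  shows "(\<integral>\<^sup>+y. F y * indicator (g ` S) y \<partial>lebesgue)
       = (\<integral>\<^sup>+x. F (g x) * ennreal \<bar>det (matrix (g' x))\<bar> * indicator S x \<partial>lebesgue)"
proof -
  let ?D = "\<lambda>x. ennreal \<bar>det (matrix (g' x))\<bar>"
  let ?N = "distr (density (lebesgue_on S) ?D) borel g"
  let ?P = "distr (lebesgue_on (g ` S)) borel (\<lambda>x. x)"
  have D[measurable]: "?D \<in> borel_measurable (lebesgue_on S)"
    using borel_measurable_abs[OF borel_measurable_det_Jacobian[OF S der]] by measurable
  have gS: "g ` S \<in> sets lebesgue"
    by (rule differentiable_image_in_sets_lebesgue[OF S])
       (use der in \<open>auto simp: differentiable_on_def differentiable_def\<close>)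
  have gm[measurable]: "g \<in> borel_measurable (lebesgue_on S)"
    by (rule continuous_imp_measurable_on_sets_lebesgue[OF _ S])
       (auto simp: continuous_on_eq_continuous_within intro: has_derivative_continuous[OF der])
  have idm[measurable]: "(\<lambda>x. x) \<in> borel_measurable (lebesgue_on (g ` S))"
    by (rule continuous_imp_measurable_on_sets_lebesgue[OF _ gS]) auto
  have "?N = ?P"
  proof (rule measure_eqI)
    fix B assume "B \<in> sets ?N"
    then have B[measurable]: "B \<in> sets borel" by simp
    let ?S = "g -` B \<inter> S"
    have S1: "?S \<in> sets (lebesgue_on S)"
      using measurable_sets[OF gm B] by (simp add: space_restrict_space)
    then have S': "?S \<in> sets lebesgue"
      using S by (auto simp: sets_restrict_space_iff)
    have "emeasure ?N B = (\<integral>\<^sup>+x. ?D x * indicator ?S x \<partial>lebesgue_on S)"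
      using gm B by (subst emeasure_distr) (simp_all add: emeasure_density[OF D S1] space_restrict_space)
    also have "\<dots> = (\<integral>\<^sup>+x. ?D x * indicator ?S x \<partial>lebesgue)"
      using S by (subst nn_integral_restrict_space) (auto intro!: nn_integral_cong simp: indicator_def)
    also have "\<dots> = emeasure lebesgue (g ` ?S)"
      by (subst emeasure_differentiable_image[OF S'])
         (use der inj in \<open>auto intro: inj_on_subset has_derivative_subset\<close>)
    also have "g ` ?S = B \<inter> g ` S" by auto
    also have "emeasure lebesgue (B \<inter> g ` S) = emeasure ?P B"
      using gS by (subst emeasure_distr)
        (auto simp: space_restrict_space emeasure_restrict_space)
    finally show "emeasure ?N B = emeasure ?P B" .
  qed simp
  then have "(\<integral>\<^sup>+y. F y \<partial>?N) = (\<integral>\<^sup>+y. F y \<partial>?P)" by simp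
  moreover have "(\<integral>\<^sup>+y. F y \<partial>?N) = (\<integral>\<^sup>+x. F (g x) * ?D x * indicator S x \<partial>lebesgue)"
  proof -
    have "(\<integral>\<^sup>+y. F y \<partial>?N) = (\<integral>\<^sup>+x. ?D x * F (g x) \<partial>lebesgue_on S)"
      using gm F D measurable_compose[OF gm F] by (simp add: nn_integral_distr nn_integral_density)
    also have "\<dots> = (\<integral>\<^sup>+x. F (g x) * ?D x * indicator S x \<partial>lebesgue)"
      using S by (simp add: nn_integral_restrict_space mult.commute)
    finally show ?thesis .
  qed
  moreover have "(\<integral>\<^sup>+y. F y \<partial>?P) = (\<integral>\<^sup>+y. F y * indicator (g ` S) y \<partial>lebesgue)"
    using gS by (subst nn_integral_distr) (auto simp: nn_integral_restrict_space)
  ultimately show ?thesis by simp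
qed

text \<open>The inverse function argument needs the derivative to be continuous in operator norm. In
  finite dimension this follows from continuity in each fixed direction, the form in which
  \<open>local_param\<close> provides it.\<close>

lemma locally_injective_C1:
  fixes f :: "real^'n \<Rightarrow> real^'n"
  assumes U: "open U" "a \<in> U"
    and der: "\<And>x. x \<in> U \<Longrightarrow> (f has_derivative f' x) (at x)"
    and cont: "\<And>h. continuous_on U (\<lambda>x. f' x h)"
    and a: "det (matrix (f' a)) \<noteq> 0"
  obtains r where "r > 0" "ball a r \<subseteq> U" "inj_on f (ball a r)"
proof -
  have lin: "linear (f' x)" if "x \<in> U" for x
    using der[OF that] has_derivative_linear by blast
  have "inj (f' a)" using a det_nz_iff_inj[OF lin[OF U(2)]] by simp
  then obtain g where g: "linear g" "g \<circ> f' a = id"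
    using linear_injective_left_inverse[OF lin[OF U(2)]] by blast
  have on: "\<exists>d>0. \<forall>x. dist a x < d \<longrightarrow> onorm (\<lambda>v. f' x v - f' a v) < e" if e: "e > 0" for e
  proof -
    \<comment> \<open>The operator norm of a difference is at most the sum of its norms on the basis
      vectors.\<close>
    let ?h = "\<lambda>x. \<Sum>b\<in>Basis. norm (f' x b - f' a b)"
    have "continuous_on U ?h"
      by (intro continuous_intros cont)
    then have hc: "isCont ?h a"
      using U continuous_on_eq_continuous_at by blast
    obtain d1 where d1: "d1 > 0" "\<And>x. dist x a < d1 \<Longrightarrow> dist (?h x) (?h a) < e"
      using continuous_at_eps_delta[THEN iffD1, rule_format, OF hc e] by blast
    obtain d2 where d2: "d2 > 0" "ball a d2 \<subseteq> U" using U openE by blast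
    have "onorm (\<lambda>v. f' x v - f' a v) < e" if "dist a x < min d1 d2" for x
    proof -
      have xU: "x \<in> U" using that d2 by auto
      have "onorm (\<lambda>v. f' x v - f' a v) \<le> ?h x"
        by (intro onorm_componentwise bounded_linear_sub has_derivative_bounded_linear[OF der[OF xU]]
            has_derivative_bounded_linear[OF der[OF U(2)]])
      also have "?h x < e"
      proof -
        have "?h x \<ge> 0" by (intro sum_nonneg) auto
        moreover have "dist (?h x) (?h a) < e"
          using that by (intro d1(2)) (simp add: dist_commute)
        ultimately show ?thesis by (simp add: dist_real_def)
      qed
      finally show ?thesis .
    qed
    then show ?thesis using d1(1) d2(1) by (intro exI[of _ "min d1 d2"]) auto
  qed
  show ?thesis
  proof (rule has_derivative_locally_injective[OF U(2) U(1) _ g(2) der on])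
    show "bounded_linear g" using g(1) by (simp add: linear_conv_bounded_linear)
  qed (use that in auto)
qed

lemma continuous_on_det:
  fixes f :: "'a::topological_space \<Rightarrow> real^'n^'n"
  assumes "\<And>i j. continuous_on U (\<lambda>x. f x $ i $ j)"
  shows "continuous_on U (\<lambda>x. det (f x))"
  unfolding det_def by (intro continuous_intros assms)

lemma continuous_on_det_matrix:
  fixes f' :: "'a::topological_space \<Rightarrow> real^'n \<Rightarrow> real^'n"
  assumes "\<And>h. continuous_on U (\<lambda>x. f' x h)"
  shows "continuous_on U (\<lambda>x. det (matrix (f' x)))"
  by (rule continuous_on_det) (simp add: matrix_def, intro continuous_intros assms)

text \<open>Where the Jacobian is nonzero, \<open>f\<close> is locally injective, and by Lindelof
  countably many sets of injectivity suffice. Made disjoint, they turn the count into a sum of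
  indicators of images, and each summand is an injective change of variables. The critical points
  have a null image by Sard's theorem on the left and weight zero on the right.\<close>

theorem area_formula:
  fixes f :: "real^'n::{finite,wellorder} \<Rightarrow> real^'n::_"
  assumes U: "open U"
    and der: "\<And>x. x \<in> U \<Longrightarrow> (f has_derivative f' x) (at x)"
    and cont: "\<And>h. continuous_on U (\<lambda>x. f' x h)"
    and A: "A \<in> sets borel" "A \<subseteq> U"
    and F[measurable]: "F \<in> borel_measurable borel"
  shows "(\<integral>\<^sup>+y. F y * emeasure (count_space UNIV) {x\<in>A. f x = y} \<partial>lborel)
       = (\<integral>\<^sup>+x. F (f x) * ennreal \<bar>det (matrix (f' x))\<bar> * indicator A x \<partial>lborel)"
proof -
  let ?D = "\<lambda>x. det (matrix (f' x))"
  define V where "V = {x\<in>U. ?D x \<noteq> 0}"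
  have cD: "continuous_on U ?D" by (rule continuous_on_det_matrix[OF cont])
  have "V = U \<inter> ?D -` (- {0})" by (auto simp: V_def)
  then have V: "open V"
    using continuous_open_preimage[OF cD U open_Compl[OF closed_singleton[of 0]]] by metis
  define \<F> where "\<F> = {B. open B \<and> B \<subseteq> V \<and> inj_on f B}"
  have VF: "\<Union>\<F> = V"
  proof
    show "V \<subseteq> \<Union>\<F>"
    proof
      fix a assume a: "a \<in> V"
      obtain r where "r > 0" "ball a r \<subseteq> V" "inj_on f (ball a r)"
      proof (rule locally_injective_C1[OF V a, of f f'])
        show "(f has_derivative f' x) (at x)" if "x \<in> V" for x using that der by (simp add: V_def)
        show "continuous_on V (\<lambda>x. f' x h)" for h
          by (rule continuous_on_subset[OF cont]) (auto simp: V_def)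
        show "?D a \<noteq> 0" using a by (simp add: V_def)
      qed
      then show "a \<in> \<Union>\<F>" unfolding \<F>_def by (auto intro!: exI[of _ "ball a r"])
    qed
  qed (auto simp: \<F>_def)
  obtain \<G> where G: "\<G> \<subseteq> \<F>" "countable \<G>" "\<Union>\<G> = \<Union>\<F>"
    using Lindelof[of \<F>] \<F>_def by auto
  \<comment> \<open>The empty set is inserted so that \<open>from_nat_into\<close> enumerates a
    nonempty family even when \<open>V\<close> is empty.\<close>
  define C where "C = from_nat_into (insert {} \<G>)"
  have rC: "range C = insert {} \<G>" unfolding C_def using G(2) by simp
  have CF: "C n \<in> \<F>" for n
  proof -
    have "C n \<in> insert {} \<G>" using rC by blast
    then show ?thesis using G(1) by (auto simp: \<F>_def)
  qed
  have UC: "(\<Union>n. C n) = V" using rC VF G(3) by auto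
  define S where "S n = A \<inter> disjointed C n" for n
  have Cb[measurable]: "C n \<in> sets borel" for n using CF[of n] \<F>_def by auto
  have Sb: "S n \<in> sets borel" for n
    unfolding S_def disjointed_def using A(1) by (intro sets.Int sets.Diff sets.finite_UN) auto
  have Sl: "S n \<in> sets lebesgue" for n using Sb by auto
  have dS: "disjoint_family S"
    using disjoint_family_disjointed[of C] unfolding S_def disjoint_family_on_def by blast
  have US: "(\<Union>n. S n) = A \<inter> V"
    unfolding S_def using UN_disjointed_eq[of C] UC by auto
  have SC: "S n \<subseteq> C n" for n using disjointed_subset[of C n] by (auto simp: S_def)
  have injS: "inj_on f (S n)" for n
    using CF[of n] SC[of n] by (auto simp: \<F>_def intro: inj_on_subset)
  have derS: "(f has_derivative f' x) (at x within T)" if "x \<in> A" for x T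
    using der A(2) that has_derivative_at_withinI by blast
  have fS: "f ` S n \<in> sets lebesgue" for n
    by (rule differentiable_image_in_sets_lebesgue[OF Sl])
       (use derS in \<open>auto simp: differentiable_on_def differentiable_def S_def\<close>)
  have "negligible (f ` (A - V))"
  proof (rule baby_Sard)
    fix x assume x: "x \<in> A - V"
    then show "(f has_derivative f' x) (at x within (A - V))" using derS by auto
    have "?D x = 0" using x A(2) by (auto simp: V_def)
    then have "\<not> inj ((*v) (matrix (f' x)))"
      using det_nz_iff_inj[OF matrix_vector_mul_linear[of "matrix (f' x)"]] by simp
    then show "rank (matrix (f' x)) < CARD('n)"
      by (simp add: less_rank_noninjective)
  qed simp
  then have null: "AE y in lebesgue. y \<notin> f ` (A - V)"
    using AE_not_in negligible_iff_null_sets by blast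
  have count: "emeasure (count_space UNIV) {x\<in>A. f x = y} = (\<Sum>n. indicator (f ` S n) y)"
    if "y \<notin> f ` (A - V)" for y
  proof -
    have "{x\<in>A. f x = y} = (\<Union>n. {x\<in>S n. f x = y})"
      using that US by blast
    also have "emeasure (count_space UNIV) \<dots> = (\<Sum>n. emeasure (count_space UNIV) {x\<in>S n. f x = y})"
      using dS by (intro suminf_emeasure[symmetric]) (auto simp: disjoint_family_on_def)
    also have "(\<lambda>n. emeasure (count_space UNIV) {x\<in>S n. f x = y}) = (\<lambda>n. indicator (f ` S n) y)"
    proof
     fix n show "emeasure (count_space UNIV) {x\<in>S n. f x = y} = indicator (f ` S n) y"
    proof (cases "y \<in> f ` S n")
      case True
      then obtain x where "x \<in> S n" "y = f x" by auto
      then have "{x\<in>S n. f x = y} = {x}" using injS[of n] by (auto dest: inj_onD)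
      then show ?thesis using True by simp
    next
      case False
      then have "{x\<in>S n. f x = y} = {}" by auto
      then show ?thesis using False by (simp only: emeasure_empty) simp
    qed
   qed
    finally show ?thesis .
  qed
  have Fl[measurable]: "F \<in> borel_measurable lebesgue" using F by (simp add: measurable_completion)
  have "(\<integral>\<^sup>+y. F y * emeasure (count_space UNIV) {x\<in>A. f x = y} \<partial>lborel)
      = (\<integral>\<^sup>+y. F y * emeasure (count_space UNIV) {x\<in>A. f x = y} \<partial>lebesgue)"
    by (simp add: nn_integral_completion)
  also have "\<dots> = (\<integral>\<^sup>+y. (\<Sum>n. F y * indicator (f ` S n) y) \<partial>lebesgue)"
    using null by (intro nn_integral_cong_AE) (auto simp: count)
  also have "\<dots> = (\<Sum>n. \<integral>\<^sup>+y. F y * indicator (f ` S n) y \<partial>lebesgue)"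
    using fS by (intro nn_integral_suminf) auto
  also have "\<dots> = (\<Sum>n. \<integral>\<^sup>+x. F (f x) * ennreal \<bar>?D x\<bar> * indicator (S n) x \<partial>lebesgue)"
    by (intro suminf_cong nn_integral_differentiable_image Sl injS F)
       (auto simp: S_def intro: derS)
  also have "\<dots> = (\<Sum>n. \<integral>\<^sup>+x. F (f x) * ennreal \<bar>?D x\<bar> * indicator (S n) x \<partial>lborel)"
    by (simp add: nn_integral_completion)
  also have "\<dots> = (\<integral>\<^sup>+x. (\<Sum>n. F (f x) * ennreal \<bar>?D x\<bar> * indicator (S n) x) \<partial>lborel)"
  proof (rule nn_integral_suminf[symmetric])
    fix n
    have fm: "f \<in> borel_measurable (restrict_space borel U)"
      by (intro borel_measurable_continuous_on_restrict has_derivative_continuous_on[where f' = f'])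
         (use der has_derivative_at_withinI in blast)
    have Dm: "?D \<in> borel_measurable (restrict_space borel U)"
      by (rule borel_measurable_continuous_on_restrict[OF cD])
    have "(\<lambda>x. F (f x) * ennreal \<bar>?D x\<bar>) \<in> borel_measurable (restrict_space borel U)"
      using fm Dm by measurable
    then have *: "(\<lambda>x. F (f x) * ennreal \<bar>?D x\<bar> * indicator U x) \<in> borel_measurable borel"
      using U by (subst (asm) borel_measurable_restrict_space_iff_ennreal) auto
    have [measurable]: "S n \<in> sets borel" by (rule Sb)
    have "(\<lambda>x. F (f x) * ennreal \<bar>?D x\<bar> * indicator U x * indicator (S n) x) \<in> borel_measurable borel"
      using * by measurable
    also have "(\<lambda>x. F (f x) * ennreal \<bar>?D x\<bar> * indicator U x * indicator (S n) x)
        = (\<lambda>x. F (f x) * ennreal \<bar>?D x\<bar> * indicator (S n) x)"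
      using A(2) by (auto simp: S_def indicator_def fun_eq_iff)
    finally show "(\<lambda>x. F (f x) * ennreal \<bar>?D x\<bar> * indicator (S n) x) \<in> borel_measurable lborel"
      by simp
  qed
  also have "\<dots> = (\<integral>\<^sup>+x. F (f x) * ennreal \<bar>?D x\<bar> * indicator A x \<partial>lborel)"
  proof (rule nn_integral_cong)
    fix x
    have "(\<Sum>n. F (f x) * ennreal \<bar>?D x\<bar> * indicator (S n) x)
        = F (f x) * ennreal \<bar>?D x\<bar> * indicator (A \<inter> V) x"
      using suminf_indicator[OF dS, of x] US by simp
    also have "\<dots> = F (f x) * ennreal \<bar>?D x\<bar> * indicator A x"
      using A(2) by (auto simp: V_def indicator_def)
    finally show "(\<Sum>n. F (f x) * ennreal \<bar>?D x\<bar> * indicator (S n) x)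
        = F (f x) * ennreal \<bar>?D x\<bar> * indicator A x" .
  qed
  finally show ?thesis .
qed

section \<open>Product measures\<close>

lemma prod_Basis_vec:
  fixes v :: "'a::euclidean_space^'n"
  shows "(\<Prod>b\<in>Basis. v \<bullet> b) = (\<Prod>i\<in>UNIV. \<Prod>b\<in>Basis. (v $ i) \<bullet> b)"
proof -
  let ?h = "\<lambda>z. axis (fst z) (snd z) :: 'a^'n"
  have eq: "Basis = ?h ` (UNIV \<times> (Basis :: 'a set))"
    by (auto simp: Basis_vec_def image_iff; blast)
  have inj: "inj_on ?h (UNIV \<times> Basis)"
    by (auto simp: inj_on_def axis_eq_axis nonzero_Basis)
  have "(\<Prod>b\<in>Basis. v \<bullet> b) = prod ((\<bullet>) v \<circ> ?h) (UNIV \<times> Basis)"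
    by (subst eq) (rule prod.reindex[OF inj])
  then show ?thesis by (simp add: prod.cartesian_product inner_axis case_prod_unfold)
qed

lemma mem_box_vec:
  fixes l u :: "'a::euclidean_space^'n"
  shows "x \<in> box l u \<longleftrightarrow> (\<forall>i. x $ i \<in> box (l $ i) (u $ i))"
  by (auto simp: mem_box Basis_vec_def inner_axis)

lemma measurable_vec_lambda:
  "(\<lambda>f. \<chi> i. f i) \<in> measurable (Pi\<^sub>M (UNIV::'n::finite set) (\<lambda>_. borel :: 'a::euclidean_space measure)) borel"
  by (subst measurable_cong_sets[OF sets_PiM_equal_borel refl])
     (intro borel_measurable_continuous_onI continuous_on_vec_lambda continuous_on_product_coordinates)

lemma lborel_eq_distr_PiM_vec:
  "(lborel :: ('a::euclidean_space^'n) measure)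
    = distr (Pi\<^sub>M UNIV (\<lambda>_. lborel)) borel (\<lambda>f. \<chi> i. f i)"
proof (rule lborel_eqI)
  fix l u :: "'a^'n" assume le: "\<And>b. b \<in> Basis \<Longrightarrow> l \<bullet> b \<le> u \<bullet> b"
  interpret product_sigma_finite "\<lambda>_::'n. lborel :: 'a measure" ..
  have s: "sets (Pi\<^sub>M UNIV (\<lambda>_::'n. lborel :: 'a measure)) = sets (Pi\<^sub>M UNIV (\<lambda>_. borel))"
    by (intro sets_PiM_cong) auto
  have m: "(\<lambda>f. \<chi> i. f i) \<in> measurable (Pi\<^sub>M (UNIV::'n set) (\<lambda>_. lborel :: 'a measure)) borel"
    using measurable_vec_lambda by (simp add: measurable_cong_sets[OF s refl])
  have lei: "(l $ i) \<bullet> b \<le> (u $ i) \<bullet> b" if "b \<in> Basis" for i b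
    using le[of "axis i b"] that by (auto simp: Basis_vec_def inner_axis)
  have "emeasure (distr (Pi\<^sub>M UNIV (\<lambda>_. lborel)) borel (\<lambda>f. \<chi> i. f i)) (box l u)
      = emeasure (Pi\<^sub>M UNIV (\<lambda>_. lborel)) (Pi\<^sub>E UNIV (\<lambda>i. box (l $ i) (u $ i)))"
    by (subst emeasure_distr[OF m]) (auto intro!: arg_cong2[where f=emeasure] simp: mem_box_vec space_PiM PiE_iff)
  also have "\<dots> = (\<Prod>i\<in>UNIV. emeasure lborel (box (l $ i) (u $ i)))"
    by (rule emeasure_PiM) auto
  also have "\<dots> = (\<Prod>i\<in>UNIV. ennreal (\<Prod>b\<in>Basis. (u $ i - l $ i) \<bullet> b))"
    using lei by (simp add: emeasure_lborel_box inner_diff_left)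
  also have "\<dots> = ennreal (prod ((\<bullet>) (u - l)) Basis)"
    using lei by (subst prod_Basis_vec, subst prod_ennreal) (auto intro!: prod_nonneg simp: inner_diff_left)
  finally show "emeasure (distr (Pi\<^sub>M UNIV (\<lambda>_. lborel)) borel (\<lambda>f. \<chi> i. f i)) (box l u)
      = ennreal (prod ((\<bullet>) (u - l)) Basis)" .
qed simp

text \<open>Checked on boxes, where both sides factor. It serves to collect the five coordinates
  that are solved for into one inner integral while all remaining coordinates stay fixed.\<close>

lemma PiM_pair_measure:
  assumes I: "finite I" and M: "\<And>i. sigma_finite_measure (M i)" and N: "\<And>i. sigma_finite_measure (N i)"
  shows "Pi\<^sub>M I (\<lambda>i. M i \<Otimes>\<^sub>M N i)
    = distr (Pi\<^sub>M I M \<Otimes>\<^sub>M Pi\<^sub>M I N) (Pi\<^sub>M I (\<lambda>i. M i \<Otimes>\<^sub>M N i)) (\<lambda>(x, y). \<lambda>i\<in>I. (x i, y i))"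
proof -
  interpret M: product_sigma_finite M by (simp add: product_sigma_finite_def M)
  interpret N: product_sigma_finite N by (simp add: product_sigma_finite_def N)
  interpret MN: product_sigma_finite "\<lambda>i. M i \<Otimes>\<^sub>M N i"
    unfolding product_sigma_finite_def
  proof
    fix i interpret sigma_finite_measure "M i" by (rule M)
    interpret N: sigma_finite_measure "N i" by (rule N)
    interpret pair_sigma_finite "M i" "N i" ..
    show "sigma_finite_measure (M i \<Otimes>\<^sub>M N i)" by unfold_locales
  qed
  interpret FM: finite_product_sigma_finite M I by standard (rule I)
  interpret FN: finite_product_sigma_finite N I by standard (rule I)
  let ?f = "\<lambda>(x, y). \<lambda>i\<in>I. (x i, y i)"
  have m[measurable]: "?f \<in> measurable (Pi\<^sub>M I M \<Otimes>\<^sub>M Pi\<^sub>M I N) (Pi\<^sub>M I (\<lambda>i. M i \<Otimes>\<^sub>M N i))"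
    by measurable
  show ?thesis
  proof (rule sym, rule MN.PiM_eqI[OF I])
    fix A assume A: "\<And>i. i \<in> I \<Longrightarrow> A i \<in> sets (M i \<Otimes>\<^sub>M N i)"
    have Af[measurable]: "Pi\<^sub>E I A \<in> sets (Pi\<^sub>M I (\<lambda>i. M i \<Otimes>\<^sub>M N i))"
      using A I by (intro sets_PiM_I_finite) auto
    have "emeasure (distr (Pi\<^sub>M I M \<Otimes>\<^sub>M Pi\<^sub>M I N) (Pi\<^sub>M I (\<lambda>i. M i \<Otimes>\<^sub>M N i)) ?f) (Pi\<^sub>E I A)
        = (\<integral>\<^sup>+z. indicator (Pi\<^sub>E I A) (?f z) \<partial>(Pi\<^sub>M I M \<Otimes>\<^sub>M Pi\<^sub>M I N))"
      by (subst nn_integral_indicator[symmetric], simp, subst nn_integral_distr) measurable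
    also have "\<dots> = (\<integral>\<^sup>+x. \<integral>\<^sup>+y. indicator (Pi\<^sub>E I A) (?f (x, y)) \<partial>Pi\<^sub>M I N \<partial>Pi\<^sub>M I M)"
      by (rule FN.nn_integral_fst[symmetric]) measurable
    also have "\<dots> = (\<integral>\<^sup>+x. \<integral>\<^sup>+y. (\<Prod>i\<in>I. indicator (A i) (x i, y i)) \<partial>Pi\<^sub>M I N \<partial>Pi\<^sub>M I M)"
      using I by (intro nn_integral_cong) (auto simp: indicator_def PiE_def prod.neutral Pi_def)
    also have "\<dots> = (\<integral>\<^sup>+x. (\<Prod>i\<in>I. \<integral>\<^sup>+y. indicator (A i) (x i, y) \<partial>N i) \<partial>Pi\<^sub>M I M)"
    proof (rule nn_integral_cong)
      fix x assume x: "x \<in> space (Pi\<^sub>M I M)"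
      show "(\<integral>\<^sup>+y. (\<Prod>i\<in>I. indicator (A i) (x i, y i)) \<partial>Pi\<^sub>M I N)
          = (\<Prod>i\<in>I. \<integral>\<^sup>+y. indicator (A i) (x i, y) \<partial>N i)"
      proof (rule N.product_nn_integral_prod[OF I])
        fix i assume i: "i \<in> I"
        then have [measurable]: "A i \<in> sets (M i \<Otimes>\<^sub>M N i)" "x i \<in> space (M i)"
          using A x by (auto simp: space_PiM)
        show "(\<lambda>y. indicator (A i) (x i, y)) \<in> borel_measurable (N i)" by measurable
      qed
    qed
    also have "\<dots> = (\<Prod>i\<in>I. \<integral>\<^sup>+x. \<integral>\<^sup>+y. indicator (A i) (x, y) \<partial>N i \<partial>M i)"
    proof (rule M.product_nn_integral_prod[OF I])
      fix i assume "i \<in> I"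
      then have [measurable]: "A i \<in> sets (M i \<Otimes>\<^sub>M N i)" using A by auto
      interpret sigma_finite_measure "N i" by (rule N)
      show "(\<lambda>x. \<integral>\<^sup>+y. indicator (A i) (x, y) \<partial>N i) \<in> borel_measurable (M i)" by measurable
    qed
    also have "\<dots> = (\<Prod>i\<in>I. emeasure (M i \<Otimes>\<^sub>M N i) (A i))"
    proof (rule prod.cong[OF refl])
      fix i assume i: "i \<in> I"
      show "(\<integral>\<^sup>+x. \<integral>\<^sup>+y. indicator (A i) (x, y) \<partial>N i \<partial>M i) = emeasure (M i \<Otimes>\<^sub>M N i) (A i)"
        using sigma_finite_measure.emeasure_pair_measure[OF N A[OF i]] by simp
    qed
    finally show "emeasure (distr (Pi\<^sub>M I M \<Otimes>\<^sub>M Pi\<^sub>M I N) (Pi\<^sub>M I (\<lambda>i. M i \<Otimes>\<^sub>M N i)) ?f) (Pi\<^sub>E I A)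
      = (\<Prod>i\<in>I. emeasure (M i \<Otimes>\<^sub>M N i) (A i))" .
  qed simp
qed

lemma PiM_density:
  assumes I: "finite I" and M: "\<And>i. sigma_finite_measure (M i)"
    and D: "\<And>i. sigma_finite_measure (density (M i) (f i))"
    and f[measurable]: "\<And>i. f i \<in> borel_measurable (M i)"
  shows "Pi\<^sub>M I (\<lambda>i. density (M i) (f i)) = density (Pi\<^sub>M I M) (\<lambda>x. \<Prod>i\<in>I. f i (x i))"
proof -
  interpret M: product_sigma_finite M by (simp add: product_sigma_finite_def M)
  interpret D: product_sigma_finite "\<lambda>i. density (M i) (f i)" by (simp add: product_sigma_finite_def D)
  show ?thesis
  proof (rule sym, rule D.PiM_eqI[OF I])
    show "sets (density (Pi\<^sub>M I M) (\<lambda>x. \<Prod>i\<in>I. f i (x i))) = sets (Pi\<^sub>M I (\<lambda>i. density (M i) (f i)))"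
      by (simp cong: sets_PiM_cong)
    fix A assume A: "\<And>i. i \<in> I \<Longrightarrow> A i \<in> sets (density (M i) (f i))"
    have [measurable]: "Pi\<^sub>E I A \<in> sets (Pi\<^sub>M I M)"
      using A I by (intro sets_PiM_I_finite) auto
    have "emeasure (density (Pi\<^sub>M I M) (\<lambda>x. \<Prod>i\<in>I. f i (x i))) (Pi\<^sub>E I A)
        = (\<integral>\<^sup>+x. (\<Prod>i\<in>I. f i (x i)) * indicator (Pi\<^sub>E I A) x \<partial>Pi\<^sub>M I M)"
      by (subst emeasure_density) measurable
    also have "\<dots> = (\<integral>\<^sup>+x. (\<Prod>i\<in>I. f i (x i) * indicator (A i) (x i)) \<partial>Pi\<^sub>M I M)"
      using I by (intro nn_integral_cong)
        (auto simp: indicator_def PiE_def Pi_def prod.distrib space_PiM)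
    also have "\<dots> = (\<Prod>i\<in>I. \<integral>\<^sup>+x. f i x * indicator (A i) x \<partial>M i)"
      using A by (intro M.product_nn_integral_prod[OF I]) auto
    also have "\<dots> = (\<Prod>i\<in>I. emeasure (density (M i) (f i)) (A i))"
      using A by (intro prod.cong[OF refl]) (simp add: emeasure_density)
    finally show "emeasure (density (Pi\<^sub>M I M) (\<lambda>x. \<Prod>i\<in>I. f i (x i))) (Pi\<^sub>E I A)
      = (\<Prod>i\<in>I. emeasure (density (M i) (f i)) (A i))" .
  qed
qed

lemma PiM_distr:
  fixes M :: "'b measure" and N :: "'c measure"
  assumes M: "prob_space M" and f: "f \<in> measurable M N"
  shows "Pi\<^sub>M (UNIV::'i::finite set) (\<lambda>_. distr M N f)
    = distr (Pi\<^sub>M UNIV (\<lambda>_. M)) (Pi\<^sub>M UNIV (\<lambda>_. N)) (\<lambda>w i. f (w i))"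
proof -
  have c: "compose UNIV f = (\<lambda>(w :: 'i \<Rightarrow> 'b) i. f (w i))"
    by (simp add: compose_def fun_eq_iff)
  have d: "distr M (distr M N f) f = distr M N f" by (rule distr_cong) auto
  have s: "sets (Pi\<^sub>M (UNIV::'i set) (\<lambda>_. distr M N f)) = sets (Pi\<^sub>M UNIV (\<lambda>_. N))"
    by (intro sets_PiM_cong) auto
  have "Pi\<^sub>M (UNIV::'i set) (\<lambda>_. distr M N f)
    = distr (Pi\<^sub>M UNIV (\<lambda>_. M)) (Pi\<^sub>M UNIV (\<lambda>_. distr M N f)) (\<lambda>w i. f (w i))"
    using distr_PiM_finite_prob_space'[of "UNIV::'i set" "\<lambda>_. M" "\<lambda>_. distr M N f" f] M f
      prob_space.prob_space_distr[OF M f]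
    unfolding c d by simp
  also have "\<dots> = distr (Pi\<^sub>M UNIV (\<lambda>_. M)) (Pi\<^sub>M UNIV (\<lambda>_. N)) (\<lambda>w i. f (w i))"
    by (rule distr_cong[OF refl s refl])
  finally show ?thesis .
qed

text \<open>All translates of \<open>S\<close> along \<open>b\<close> have the same measure.
  Averaging over a unit interval of translations and exchanging the integrals leaves, for each
  \<open>x\<close>, the length of a countable set of parameters.\<close>

lemma null_if_countable_on_lines:
  fixes S :: "'a::euclidean_space set"
  assumes S[measurable]: "S \<in> sets borel" and c: "\<And>x. countable {t::real. x + t *\<^sub>R b \<in> S}"
  shows "emeasure lborel S = 0"
proof -
  have tr: "(\<integral>\<^sup>+x. indicator S (x + t *\<^sub>R b) \<partial>lborel) = emeasure lborel S" for t :: real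
  proof -
    have "emeasure lborel S = emeasure (distr lborel borel ((+) (t *\<^sub>R b))) S"
      by (subst lborel_distr_plus) (rule refl)
    also have "\<dots> = (\<integral>\<^sup>+x. indicator S (x + t *\<^sub>R b) \<partial>lborel)"
      by (subst nn_integral_indicator[symmetric], simp, subst nn_integral_distr) (simp_all add: add.commute)
    finally show ?thesis by simp
  qed
  have "emeasure lborel S = (\<integral>\<^sup>+t. indicator {0..1::real} t * emeasure lborel S \<partial>lborel)"
    by (simp add: nn_integral_multc)
  also have "\<dots> = (\<integral>\<^sup>+t. \<integral>\<^sup>+x. indicator {0..1::real} t * indicator S (x + t *\<^sub>R b) \<partial>lborel \<partial>lborel)"
    by (subst nn_integral_cmult) (simp_all add: tr)
  also have "\<dots> = (\<integral>\<^sup>+x. \<integral>\<^sup>+t. indicator {0..1::real} t * indicator S (x + t *\<^sub>R b) \<partial>lborel \<partial>lborel)"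
    by (rule lborel_pair.Fubini') measurable
  also have "\<dots> = (\<integral>\<^sup>+x. 0 \<partial>(lborel :: 'a measure))"
  proof (rule nn_integral_cong)
    fix x :: 'a
    have "AE t in lborel. t \<notin> {t. x + t *\<^sub>R b \<in> S}"
      using countable_imp_null_set_lborel[OF c[of x]] by (rule AE_not_in)
    then have "(\<integral>\<^sup>+t. indicator {0..1::real} t * indicator S (x + t *\<^sub>R b) \<partial>lborel)
        = (\<integral>\<^sup>+t. 0 \<partial>(lborel :: real measure))"
      by (intro nn_integral_cong_AE) (auto elim!: eventually_mono simp: indicator_def)
    then show "(\<integral>\<^sup>+t. indicator {0..1::real} t * indicator S (x + t *\<^sub>R b) \<partial>lborel) = 0" by simp
  qed
  finally show ?thesis by simp
qed

section \<open>Counting solutions\<close>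

text \<open>Compact pieces are wanted because the projection of a closed set along a compact factor
  is closed, which makes the solvability of an equation a Borel condition.\<close>

lemma fsigma_Int_compact:
  fixes A B :: "'a::euclidean_space set"
  assumes "fsigma A" "fsigma B"
  obtains K :: "nat \<Rightarrow> 'a set" where "\<And>n. compact (K n)" "A \<inter> B = (\<Union>n. K n)"
proof -
  obtain F G :: "nat \<Rightarrow> 'a set" where F: "range F \<subseteq> Collect compact" "A = \<Union>(range F)"
    and G: "range G \<subseteq> Collect compact" "B = \<Union>(range G)"
    using assms unfolding fsigma_Union_compact by auto
  let ?K = "\<lambda>n. F (fst (prod_decode n)) \<inter> G (snd (prod_decode n))"
  have "compact (?K n)" for n using F G by (intro compact_Int) auto
  moreover have "A \<inter> B = (\<Union>n. ?K n)"
  proof (intro equalityI subsetI)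
    fix x assume "x \<in> A \<inter> B"
    then obtain i j where "x \<in> F i" "x \<in> G j" using F G by auto
    then have "x \<in> ?K (prod_encode (i, j))" by simp
    then show "x \<in> (\<Union>n. ?K n)" by blast
  qed (use F G in auto)
  ultimately show ?thesis by (rule that)
qed

lemma fsigma_Int: "fsigma A \<Longrightarrow> fsigma B \<Longrightarrow> fsigma (A \<inter> B)"
  for A B :: "'a::euclidean_space set"
proof -
  assume "fsigma A" "fsigma B"
  then show "fsigma (A \<inter> B)"
  proof (rule fsigma_Int_compact)
    fix K :: "nat \<Rightarrow> 'a set"
    assume K: "\<And>n. compact (K n)" "A \<inter> B = (\<Union>n. K n)"
    show "fsigma (A \<inter> B)"
      unfolding K(2) by (rule fsigma.intros) (rule compact_imp_closed[OF K(1)])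
  qed
qed

lemma fsigma_open: "open A \<Longrightarrow> fsigma A" for A :: "'a::euclidean_space set"
proof -
  assume "open A"
  show "fsigma A"
  proof (rule open_Union_compact_subsets[OF \<open>open A\<close>])
    fix C :: "nat \<Rightarrow> 'a set"
    assume C: "\<And>n. compact (C n)" "\<Union>(range C) = A"
    show "fsigma A"
      unfolding C(2)[symmetric] by (rule fsigma.intros) (rule compact_imp_closed[OF C(1)])
  qed
qed

lemma fsigma_closed: "closed A \<Longrightarrow> fsigma A"
  using fsigma.intros[of "\<lambda>_. A"] by simp

lemma disjoint_basis_separation:
  fixes T :: "'a::metric_space set"
  assumes T: "finite T" and B: "topological_basis B"
  obtains c where "\<And>x. x \<in> T \<Longrightarrow> c x \<in> B" "\<And>x. x \<in> T \<Longrightarrow> x \<in> c x" "disjoint (c ` T)" "inj_on c T"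
proof -
  \<comment> \<open>The element 1 keeps the minimum meaningful when \<open>T\<close> has fewer than
    two points.\<close>
  define D where "D = insert 1 {dist x y |x y. x \<in> T \<and> y \<in> T \<and> x \<noteq> y}"
  have "{dist x y |x y. x \<in> T \<and> y \<in> T \<and> x \<noteq> y} \<subseteq> (\<lambda>(x, y). dist x y) ` (T \<times> T)" by auto
  then have D: "finite D" unfolding D_def using T finite_subset by (simp add: finite_subset)
  define d where "d = Min D"
  have "0 < d" unfolding d_def using D by (subst Min_gr_iff) (auto simp: D_def)
  have d: "d \<le> dist x y" if "x \<in> T" "y \<in> T" "x \<noteq> y" for x y
    unfolding d_def using D that by (intro Min_le) (auto simp: D_def)
  have "\<exists>b\<in>B. x \<in> b \<and> b \<subseteq> ball x (d/2)" for x
    using topological_basisE[OF B open_ball, of x x "d/2"] \<open>0 < d\<close> by (metis centre_in_ball half_gt_zero)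
  then obtain c where c: "\<And>x. c x \<in> B" "\<And>x. x \<in> c x" "\<And>x. c x \<subseteq> ball x (d/2)" by metis
  have dj: "c x \<inter> c y = {}" if "x \<in> T" "y \<in> T" "x \<noteq> y" for x y
  proof -
    have "ball x (d/2) \<inter> ball y (d/2) = {}"
      using d[OF that] by (intro disjoint_ballI) auto
    then show ?thesis using c(3)[of x] c(3)[of y] by blast
  qed
  have "inj_on c T" by (rule inj_onI) (use dj c(2) in blast)
  moreover have "disjoint (c ` T)" unfolding disjoint_def by (metis dj imageE)
  ultimately show ?thesis using that c by blast
qed

text \<open>The count is a supremum over the countably many finite disjoint families of basic open
  sets: a family scores its cardinality if each member contains a solution, and 0 otherwise.
  Disjointness bounds every score by the count, and any finite set of solutions is separated by such
  a family. That a basic set contains a solution is a Borel condition on \<open>w\<close>, by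
  projecting along countably many compact sets.\<close>

lemma borel_measurable_count_solutions:
  fixes A :: "'a::euclidean_space set" and P :: "'a \<Rightarrow> 'w::euclidean_space \<Rightarrow> bool"
  assumes A: "fsigma A" and P: "closed {(x, w). P x w}"
  shows "(\<lambda>w. emeasure (count_space UNIV) {x\<in>A. P x w}) \<in> borel_measurable borel"
proof -
  obtain B :: "'a set set" where B: "countable B" "topological_basis B"
    using ex_countable_basis by blast
  define \<FF> where "\<FF> = {\<F>. finite \<F> \<and> \<F> \<subseteq> B \<and> disjoint \<F>}"
  have cF: "countable \<FF>"
    by (rule countable_subset[OF _ countable_Collect_finite_subset[OF B(1)]]) (auto simp: \<FF>_def)
  define hit where "hit c w \<longleftrightarrow> (\<exists>x\<in>A \<inter> c. P x w)" for c w
  have hit: "{w. hit c w} \<in> sets borel" if c: "c \<in> B" for c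
  proof -
    have "fsigma c" using topological_basis_open[OF B(2) c] by (rule fsigma_open)
    then obtain K where K: "\<And>n::nat. compact (K n)" "A \<inter> c = (\<Union>n. K n)"
      using fsigma_Int_compact[OF A] by metis
    have "{w. hit c w} = (\<Union>n. {w. \<exists>x. x \<in> K n \<and> (x, w) \<in> {(x, w). P x w}})"
      by (auto simp: hit_def K(2))
    also have "\<dots> \<in> sets borel"
      using closed_compact_projection[OF K(1) P] by (intro sets.countable_UN) auto
    finally show ?thesis .
  qed
  define S where "S \<F> w = (if \<forall>c\<in>\<F>. hit c w then of_nat (card \<F>) else 0 :: ennreal)" for \<F> w
  have Sm: "S \<F> \<in> borel_measurable borel" if "\<F> \<in> \<FF>" for \<F>
  proof -
    have "{w. \<forall>c\<in>\<F>. hit c w} = space borel \<inter> (\<Inter>c\<in>\<F>. {w. hit c w})" by auto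
    also have "\<dots> \<in> sets borel"
    proof (cases "\<F> = {}")
      case False
      then show ?thesis using that hit by (intro sets.Int sets.finite_INT) (auto simp: \<FF>_def)
    qed simp
    finally show ?thesis unfolding S_def by (intro measurable_If) auto
  qed
  have "emeasure (count_space UNIV) {x\<in>A. P x w} = (SUP \<F>\<in>\<FF>. S \<F> w)" for w
  proof (rule antisym)
    let ?X = "{x\<in>A. P x w}"
    have low: "of_nat (card T) \<le> (SUP \<F>\<in>\<FF>. S \<F> w)" if T: "finite T" "T \<subseteq> ?X" for T
    proof -
      obtain c where c: "\<And>x. x \<in> T \<Longrightarrow> c x \<in> B" "\<And>x. x \<in> T \<Longrightarrow> x \<in> c x" "disjoint (c ` T)" "inj_on c T"
        using disjoint_basis_separation[OF T(1) B(2)] by metis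
      have "c ` T \<in> \<FF>" using c T by (auto simp: \<FF>_def)
      moreover have "S (c ` T) w = of_nat (card T)"
        using c T by (auto simp: S_def hit_def card_image)
      ultimately show ?thesis by (metis SUP_upper)
    qed
    show "emeasure (count_space UNIV) ?X \<le> (SUP \<F>\<in>\<FF>. S \<F> w)"
    proof (cases "finite ?X")
      case True
      then show ?thesis using low[OF True] by (simp add: emeasure_count_space_finite)
    next
      case False
      have "of_nat n \<le> (SUP \<F>\<in>\<FF>. S \<F> w)" for n
        using infinite_arbitrarily_large[OF False, of n] low by metis
      then have "(SUP \<F>\<in>\<FF>. S \<F> w) = \<top>"
        by (metis ennreal_SUP_of_nat_eq_top SUP_least top.extremum_uniqueI)
      then show ?thesis by (metis top_greatest)
    qed
    show "(SUP \<F>\<in>\<FF>. S \<F> w) \<le> emeasure (count_space UNIV) ?X"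
    proof (rule SUP_least)
      fix \<F> assume F: "\<F> \<in> \<FF>"
      show "S \<F> w \<le> emeasure (count_space UNIV) ?X"
      proof (cases "(\<forall>c\<in>\<F>. hit c w) \<and> finite ?X")
        case True
        then obtain p where p: "\<And>c. c \<in> \<F> \<Longrightarrow> p c \<in> ?X \<and> p c \<in> c"
          unfolding hit_def by (metis (mono_tags, lifting) IntE mem_Collect_eq)
        have "inj_on p \<F>"
        proof (rule inj_onI, rule ccontr)
          fix c d assume cd: "c \<in> \<F>" "d \<in> \<F>" "p c = p d" "c \<noteq> d"
          then have "c \<inter> d = {}" using F unfolding \<FF>_def disjoint_def by blast
          then show False using p[OF cd(1)] p[OF cd(2)] cd(3) by auto
        qed
        then have "card \<F> \<le> card ?X"
          using True p by (intro card_inj_on_le[of p]) auto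
        then show ?thesis using True by (auto simp: S_def emeasure_count_space_finite)
      next
        case False
        then show ?thesis by (auto simp: S_def emeasure_count_space_infinite)
      qed
    qed
  qed
  then show ?thesis
    using borel_measurable_SUP[OF cF Sm] by (simp cong: measurable_cong)
qed

section \<open>Projective spaces\<close>

lemma line_of_proj_pt: "x \<noteq> 0 \<Longrightarrow> line_of (proj_pt x) = span {x}"
  unfolding proj_pt_def by (rule Abs_proj_space_inverse) auto

lemma proj_pt_cases:
  obtains x where "x \<noteq> 0" "l = proj_pt x"
proof -
  obtain x where "x \<noteq> 0" "line_of l = span {x}" using line_of[of l] by auto
  moreover then have "l = proj_pt x" unfolding proj_pt_def by (metis line_of_inverse)
  ultimately show ?thesis using that by blast
qed

lemma proj_pt_scaleR [simp]: "c \<noteq> 0 \<Longrightarrow> proj_pt (c *\<^sub>R x) = proj_pt x"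
proof -
  assume c: "c \<noteq> 0"
  have "k *\<^sub>R x \<in> range (\<lambda>k. k *\<^sub>R c *\<^sub>R x)" for k
    using c by (intro range_eqI[of _ _ "k / c"]) simp
  then have "span {c *\<^sub>R x} = span {x}"
    by (auto simp: span_singleton)
  then show ?thesis by (simp add: proj_pt_def)
qed

lemma proj_pt_minus [simp]: "proj_pt (- x) = proj_pt x"
  using proj_pt_scaleR[of "-1" x] by simp

lemma proj_pt_eq_iff:
  assumes "x \<noteq> 0" "y \<noteq> 0"
  shows "proj_pt x = proj_pt y \<longleftrightarrow> (\<exists>c. c \<noteq> 0 \<and> y = c *\<^sub>R x)"
proof
  assume "proj_pt x = proj_pt y"
  then have "span {x} = span {y}" using line_of_proj_pt assms by metis
  then have "y \<in> span {x}" using span_base[of y "{y}"] by auto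
  then obtain c where "y = c *\<^sub>R x" by (auto simp: span_singleton)
  then show "\<exists>c. c \<noteq> 0 \<and> y = c *\<^sub>R x" using assms by (metis scaleR_zero_left)
qed (use proj_pt_scaleR in metis)

lemma continuous_on_proj_pt: "continuous_on (- {0}) (proj_pt :: 'a::euclidean_space \<Rightarrow> _)"
proof -
  have "open ((- {0}) \<inter> proj_pt -` T)" if "open T" for T :: "'a proj_space set"
    using that by (simp add: open_proj_space_def vimage_def Int_def Compl_eq)
  then show ?thesis
    by (subst continuous_on_open_vimage) (auto simp: open_Compl Int_commute)
qed

lemma continuous_on_proj_compose:
  assumes "continuous_on S f" "\<And>x. x \<in> S \<Longrightarrow> f x \<noteq> 0"
  shows "continuous_on S (\<lambda>x. proj_pt (f x))"
  by (rule continuous_on_compose2[OF continuous_on_proj_pt assms(1)]) (use assms(2) in auto)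

text \<open>The universal property of the quotient topology over an open set of lines. The Borel
  section and the inverses of the charts obtain their continuity from it.\<close>

lemma continuous_on_proj_quotient:
  fixes g :: "'a::euclidean_space proj_space \<Rightarrow> 'b::topological_space"
  assumes D: "open D" and c: "continuous_on {x. x \<noteq> 0 \<and> proj_pt x \<in> D} (\<lambda>x. g (proj_pt x))"
  shows "continuous_on D g"
proof -
  let ?E = "{x. x \<noteq> 0 \<and> proj_pt x \<in> D}"
  have oE: "open ?E" using D by (simp add: open_proj_space_def)
  have "open (D \<inter> g -` T)" if T: "open T" for T
  proof -
    have "{x. x \<noteq> 0 \<and> proj_pt x \<in> D \<inter> g -` T} = ?E \<inter> (\<lambda>x. g (proj_pt x)) -` T" by auto
    also have "open \<dots>" using c oE T by (rule continuous_open_preimage)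
    finally show ?thesis by (simp add: open_proj_space_def)
  qed
  then show ?thesis using D by (subst continuous_on_open_vimage) (auto simp: Int_commute)
qed

text \<open>The value at 0 is unspecified, but a single exceptional point does not affect Borel
  measurability.\<close>

lemma borel_measurable_proj_pt [measurable]: "proj_pt \<in> borel_measurable borel"
  by (rule borel_measurable_continuous_countable_exceptions[of "{0}"])
     (auto intro: continuous_on_proj_pt)

text \<open>An unstructured choice of representative. Functions invariant under scaling descend
  through it to the projective space.\<close>

definition proj_rep :: "'a::euclidean_space proj_space \<Rightarrow> 'a" where
  "proj_rep l = (SOME x. x \<noteq> 0 \<and> l = proj_pt x)"

lemma proj_rep: "proj_rep l \<noteq> 0" "proj_pt (proj_rep l) = l"
proof -
  have "\<exists>x. x \<noteq> 0 \<and> l = proj_pt x" by (metis proj_pt_cases)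
  then have "proj_rep l \<noteq> 0 \<and> l = proj_pt (proj_rep l)" unfolding proj_rep_def by (rule someI_ex)
  then show "proj_rep l \<noteq> 0" "proj_pt (proj_rep l) = l" by auto
qed

lemma proj_rep_proj_pt: "x \<noteq> 0 \<Longrightarrow> \<exists>c. c \<noteq> 0 \<and> proj_rep (proj_pt x) = c *\<^sub>R x"
  using proj_rep[of "proj_pt x"] proj_pt_eq_iff by metis

text \<open>A Borel section of the projection: normalize the first nonvanishing coordinate to \<open>1\<close>.\<close>

definition proj_sec :: "(real^3) proj_space \<Rightarrow> real^3" where
  "proj_sec l = (let x = proj_rep l in
     if x $ 1 \<noteq> 0 then x /\<^sub>R (x $ 1) else if x $ 2 \<noteq> 0 then x /\<^sub>R (x $ 2) else x /\<^sub>R (x $ 3))"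

lemma proj_sec: "proj_sec l \<noteq> 0" "proj_pt (proj_sec l) = l"
proof -
  let ?x = "proj_rep l"
  have "?x $ 1 \<noteq> 0 \<or> ?x $ 2 \<noteq> 0 \<or> ?x $ 3 \<noteq> 0"
    using proj_rep(1)[of l] by (auto simp: vec_eq_iff forall_3)
  then obtain c where "c \<noteq> 0" "proj_sec l = c *\<^sub>R ?x"
    unfolding proj_sec_def Let_def by (metis inverse_nonzero_iff_nonzero)
  then show "proj_sec l \<noteq> 0" "proj_pt (proj_sec l) = l" by (auto simp: proj_rep)
qed

text \<open>On the open set of lines with nonvanishing coordinate \<open>i\<close>, division by that
  coordinate is continuous and independent of the representative; the section combines three such
  functions. It is needed later to see that the number of solutions is measurable in points of the
  projective plane.\<close>

lemma borel_measurable_proj_sec [measurable]: "proj_sec \<in> borel_measurable borel"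
proof -
  define D where "D i = {l :: (real^3) proj_space. proj_rep l $ i \<noteq> 0}" for i
  have D: "proj_pt x \<in> D i \<longleftrightarrow> x $ i \<noteq> 0" if "x \<noteq> 0" for x i
    using proj_rep_proj_pt[OF that] by (auto simp: D_def)
  have oD: "open (D i)" for i
  proof -
    have "{x. x \<noteq> 0 \<and> proj_pt x \<in> D i} = {x. x $ i \<noteq> 0}"
      by (intro Collect_cong) (metis D zero_index)
    moreover have "open {x :: real^3. x $ i \<noteq> 0}"
      by (intro open_Collect_neq continuous_intros)
    ultimately show ?thesis by (simp add: open_proj_space_def)
  qed
  let ?g = "\<lambda>i l. proj_rep l /\<^sub>R (proj_rep l $ i)"
  have c: "continuous_on (D i) (?g i)" for i
  proof (rule continuous_on_proj_quotient[OF oD])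
    have "continuous_on {x :: real^3. x \<noteq> 0 \<and> proj_pt x \<in> D i} (\<lambda>x. x /\<^sub>R (x $ i))"
      by (intro continuous_intros) (auto simp: D)
    moreover have "?g i (proj_pt x) = x /\<^sub>R (x $ i)" if "x \<in> {x. x \<noteq> 0 \<and> proj_pt x \<in> D i}" for x
      using proj_rep_proj_pt[of x] that by auto
    ultimately show "continuous_on {x. x \<noteq> 0 \<and> proj_pt x \<in> D i} (\<lambda>x. ?g i (proj_pt x))"
      by (subst continuous_on_cong[OF refl]) auto
  qed
  have m: "(\<lambda>l. if l \<in> D i then ?g i l else 0) \<in> borel_measurable borel" for i
    using oD by (intro borel_measurable_continuous_on_if c continuous_intros) auto
  have [measurable]: "D i \<in> sets borel" for i using oD by auto
  note m[measurable]
  have "(\<lambda>l. if l \<in> D 1 then (if l \<in> D 1 then ?g 1 l else 0) else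
      if l \<in> D 2 then (if l \<in> D 2 then ?g 2 l else 0) else (if l \<in> D 3 then ?g 3 l else 0))
    \<in> borel_measurable borel" by measurable
  also have "(\<lambda>l. if l \<in> D 1 then (if l \<in> D 1 then ?g 1 l else 0) else
      if l \<in> D 2 then (if l \<in> D 2 then ?g 2 l else 0) else (if l \<in> D 3 then ?g 3 l else 0)) = proj_sec"
    by (auto simp: proj_sec_def Let_def D_def fun_eq_iff)
  finally show ?thesis .
qed

section \<open>The Gaussian measure on three-space\<close>

lemma borel_measurable_vector_3 [measurable]:
  assumes [measurable]: "f \<in> borel_measurable M" "g \<in> borel_measurable M" "h \<in> borel_measurable M"
  shows "(\<lambda>x. vector [f x, g x, h x] :: real^3) \<in> borel_measurable M"
proof -
  have "(\<lambda>x. (\<chi> i. if i = 1 then f x else if i = 2 then g x else h x) :: real^3) \<in> borel_measurable M"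
  proof (rule borel_measurable_euclidean_space[THEN iffD2], rule ballI)
    fix b :: "real^3" assume "b \<in> Basis"
    then obtain i where "b = axis i 1" by (auto simp: Basis_vec_def)
    then show "(\<lambda>x. (\<chi> i. if i = 1 then f x else if i = 2 then g x else h x) \<bullet> b) \<in> borel_measurable M"
      by (simp add: inner_axis)
  qed
  also have "(\<lambda>x. (\<chi> i. if i = 1 then f x else if i = 2 then g x else h x) :: real^3)
      = (\<lambda>x. vector [f x, g x, h x])"
    by (auto simp: fun_eq_iff vec_eq_iff forall_3)
  finally show ?thesis .
qed

lemma borel_measurable_vec_nth [measurable]:
  "(\<lambda>x. x $ i) \<in> borel_measurable (borel :: (('a::euclidean_space)^'n) measure)"
  by (intro borel_measurable_continuous_onI continuous_intros)

lemma prod_3: "prod f (UNIV :: 3 set) = f 1 * f 2 * f 3"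
  unfolding UNIV_3 by (simp add: ac_simps)

lemma lborel_eq_distr_3:
  "(lborel :: (real^3) measure)
    = distr (lborel \<Otimes>\<^sub>M lborel \<Otimes>\<^sub>M lborel) borel (\<lambda>(x, y, z). vector [x, y, z])"
proof (rule lborel_eqI)
  fix l u :: "real^3" assume le: "\<And>b. b \<in> Basis \<Longrightarrow> l \<bullet> b \<le> u \<bullet> b"
  have lei: "l $ i \<le> u $ i" for i
    using le[of "axis i 1"] by (auto simp: inner_axis)
  have "emeasure (distr (lborel \<Otimes>\<^sub>M lborel \<Otimes>\<^sub>M lborel) borel (\<lambda>(x, y, z). vector [x, y, z])) (box l u)
      = emeasure (lborel \<Otimes>\<^sub>M lborel \<Otimes>\<^sub>M lborel) (box (l$1) (u$1) \<times> box (l$2) (u$2) \<times> box (l$3) (u$3))"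
    by (subst emeasure_distr)
       (auto intro!: arg_cong2[where f=emeasure] simp: mem_box_vec space_pair_measure forall_3)
  also have "\<dots> = ennreal (u$1 - l$1) * (ennreal (u$2 - l$2) * ennreal (u$3 - l$3))"
    using lei by (subst lborel_pair.P.emeasure_pair_measure_Times)
      (simp_all add: lborel.emeasure_pair_measure_Times)
  also have "\<dots> = ennreal (prod ((\<bullet>) (u - l)) Basis)"
  proof -
    have "prod ((\<bullet>) (u - l)) Basis = (u$1 - l$1) * ((u$2 - l$2) * (u$3 - l$3))"
      unfolding prod_Basis_vec prod_3 by (simp add: mult.assoc)
    then show ?thesis
      using lei[of 1] lei[of 2] lei[of 3] by (simp only: ennreal_mult' diff_ge_0_iff_ge)
  qed
  finally show "emeasure (distr (lborel \<Otimes>\<^sub>M lborel \<Otimes>\<^sub>M lborel) borel (\<lambda>(x, y, z). vector [x, y, z])) (box l u)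
      = ennreal (prod ((\<bullet>) (u - l)) Basis)" .
qed simp

lemma nn_integral_lborel_3:
  fixes f :: "real^3 \<Rightarrow> ennreal"
  assumes [measurable]: "f \<in> borel_measurable borel"
  shows "(\<integral>\<^sup>+x. f x \<partial>lborel) = (\<integral>\<^sup>+x. \<integral>\<^sup>+y. \<integral>\<^sup>+z. f (vector [x, y, z]) \<partial>lborel \<partial>lborel \<partial>lborel)"
  by (subst lborel_eq_distr_3, subst nn_integral_distr)
     (simp_all add: lborel.nn_integral_fst[symmetric] lborel_pair.P.nn_integral_fst[symmetric])

definition gauss3_density :: "real^3 \<Rightarrow> real" where
  "gauss3_density x = std_normal_density (x $ 1) * std_normal_density (x $ 2) * std_normal_density (x $ 3)"

definition gauss3 :: "(real^3) measure" where
  "gauss3 = density lborel (\<lambda>x. ennreal (gauss3_density x))"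

text \<open>The density depends on the norm only, which is the source of all rotational invariance
  below.\<close>

lemma gauss3_density_norm: "gauss3_density x = exp (- (norm x)\<^sup>2 / 2) / sqrt (2 * pi) ^ 3"
proof -
  have "(norm x)\<^sup>2 = (x $ 1)\<^sup>2 + (x $ 2)\<^sup>2 + (x $ 3)\<^sup>2"
    unfolding power2_norm_eq_inner by (simp add: inner_vec_def sum_3 power2_eq_square)
  then have "exp (- (norm x)\<^sup>2 / 2) = exp (- (x $ 1)\<^sup>2 / 2) * exp (- (x $ 2)\<^sup>2 / 2) * exp (- (x $ 3)\<^sup>2 / 2)"
    by (simp add: exp_add[symmetric] add_divide_distrib)
  then show ?thesis
    by (simp add: gauss3_density_def normal_density_def power3_eq_cube)
qed

lemma gauss3_density_nonneg [simp]: "0 \<le> gauss3_density x"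
  by (simp add: gauss3_density_def)

lemma borel_measurable_gauss3_density [measurable]: "gauss3_density \<in> borel_measurable borel"
  unfolding gauss3_density_def by measurable

lemma sets_gauss3 [simp, measurable_cong]: "sets gauss3 = sets borel"
  and space_gauss3 [simp]: "space gauss3 = UNIV"
  by (simp_all add: gauss3_def)

lemma nn_integral_std_normal: "(\<integral>\<^sup>+x. ennreal (std_normal_density x) \<partial>lborel) = 1"
proof -
  interpret prob_space "density lborel (\<lambda>x. ennreal (std_normal_density x))"
    by (rule prob_space_normal_density) simp
  show ?thesis using emeasure_space_1 by (simp add: emeasure_density)
qed

lemma prob_space_gauss3: "prob_space gauss3"
proof
  have "emeasure gauss3 (space gauss3) = (\<integral>\<^sup>+x. ennreal (gauss3_density x) \<partial>lborel)"
    by (simp add: gauss3_def emeasure_density)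
  also have "\<dots> = 1"
    by (subst nn_integral_lborel_3)
       (simp_all add: gauss3_density_def ennreal_mult' nn_integral_cmult nn_integral_multc nn_integral_std_normal mult.assoc)
  finally show "emeasure gauss3 (space gauss3) = 1" .
qed

lemma lborel_orthogonal:
  fixes A :: "real^'n::{finite,wellorder}^'n::_"
  assumes A: "orthogonal_matrix A"
  shows "distr lborel borel ((*v) A) = lborel"
proof (rule measure_eqI)
  have m[measurable]: "(*v) A \<in> borel_measurable borel"
    by (intro borel_measurable_continuous_onI matrix_vector_mult_linear_continuous_on)
  fix B assume "B \<in> sets (distr lborel borel ((*v) A))"
  then have [measurable]: "B \<in> sets borel" by simp
  have d: "\<bar>det A\<bar> = 1" using det_orthogonal_matrix[OF A] by auto
  have bij: "bij ((*v) A)"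
    using A by (simp add: invertible_eq_bij[symmetric] orthogonal_matrix_def invertible_def) blast
  have "emeasure lborel B = (\<integral>\<^sup>+y. indicator B y * indicator (range ((*v) A)) y \<partial>lebesgue)"
    using bij by (simp add: bij_def nn_integral_completion)
  also have "\<dots> = (\<integral>\<^sup>+x. indicator B (A *v x) * ennreal \<bar>det (matrix ((*v) A))\<bar> * indicator UNIV x \<partial>lebesgue)"
    using bij by (intro nn_integral_differentiable_image bounded_linear_imp_has_derivative
        matrix_vector_mul_bounded_linear) (auto simp: bij_def)
  also have "\<dots> = (\<integral>\<^sup>+x. indicator B (A *v x) \<partial>lborel)"
    by (simp add: nn_integral_completion d)
  also have "\<dots> = emeasure (distr lborel borel ((*v) A)) B"
    by (subst nn_integral_indicator[symmetric], simp, subst nn_integral_distr) simp_all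
  finally show "emeasure (distr lborel borel ((*v) A)) B = emeasure lborel B" by simp
qed simp

lemma nn_integral_lborel_orthogonal:
  fixes A :: "real^'n::{finite,wellorder}^'n::_"
  assumes "orthogonal_matrix A" and [measurable]: "f \<in> borel_measurable borel"
  shows "(\<integral>\<^sup>+x. f (A *v x) \<partial>lborel) = (\<integral>\<^sup>+x. f x \<partial>lborel)"
proof -
  have "(\<integral>\<^sup>+x. f x \<partial>lborel) = (\<integral>\<^sup>+x. f x \<partial>distr lborel borel ((*v) A))"
    using lborel_orthogonal[OF assms(1)] by simp
  also have "\<dots> = (\<integral>\<^sup>+x. f (A *v x) \<partial>lborel)"
    by (rule nn_integral_distr) (auto intro!: borel_measurable_continuous_onI matrix_vector_mult_linear_continuous_on)
  finally show ?thesis by simp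
qed

lemma borel_measurable_matrix_vector_mult [measurable]:
  "(*v) (A :: real^'n^'m) \<in> borel_measurable borel"
  by (intro borel_measurable_continuous_onI matrix_vector_mult_linear_continuous_on)

lemma norm_orthogonal_matrix: "orthogonal_matrix A \<Longrightarrow> norm (A *v x) = norm (x :: real^'n)"
  using orthogonal_transformation_norm[of "(*v) A"]
  by (simp add: orthogonal_transformation_matrix)

lemma gauss3_orthogonal:
  assumes A: "orthogonal_matrix A"
  shows "distr gauss3 borel ((*v) A) = gauss3"
proof (rule measure_eqI)
  fix B assume "B \<in> sets (distr gauss3 borel ((*v) A))"
  then have [measurable]: "B \<in> sets borel" by simp
  have g: "gauss3_density (A *v x) = gauss3_density x" for x
    using A by (simp add: gauss3_density_norm norm_orthogonal_matrix)
  have "emeasure (distr gauss3 borel ((*v) A)) B = (\<integral>\<^sup>+x. indicator B (A *v x) \<partial>gauss3)"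
    by (subst nn_integral_indicator[symmetric], simp, subst nn_integral_distr) simp_all
  also have "\<dots> = (\<integral>\<^sup>+x. ennreal (gauss3_density (A *v x)) * indicator B (A *v x) \<partial>lborel)"
    unfolding gauss3_def by (subst nn_integral_density) (simp_all add: g)
  also have "\<dots> = (\<integral>\<^sup>+x. ennreal (gauss3_density x) * indicator B x \<partial>lborel)"
    by (rule nn_integral_lborel_orthogonal[OF A]) measurable
  also have "\<dots> = emeasure gauss3 B"
    unfolding gauss3_def by (subst emeasure_density) simp_all
  finally show "emeasure (distr gauss3 borel ((*v) A)) B = emeasure gauss3 B" .
qed simp

section \<open>The Haar measure of the orthogonal group\<close>

abbreviation O3 :: "(real^3^3) measure" where
  "O3 \<equiv> restrict_space borel {U. orthogonal_matrix U}"

lemma space_O3: "space O3 = {U. orthogonal_matrix U}"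
  by (simp add: space_restrict_space)

lemma closed_orthogonal_matrix: "closed {U :: real^'n^'n. orthogonal_matrix U}"
proof -
  have "{U :: real^'n^'n. orthogonal_matrix U} = {U. transpose U ** U = mat 1}"
    by (simp add: orthogonal_matrix)
  moreover have "continuous_on UNIV (\<lambda>U :: real^'n^'n. transpose U ** U)"
    unfolding matrix_matrix_mult_def transpose_def by (intro continuous_intros)
  ultimately show ?thesis by (simp add: closed_Collect_eq)
qed

lemma orthogonal_matrix_borel [measurable]: "{U :: real^'n^'n. orthogonal_matrix U} \<in> sets borel"
  by (intro borel_closed closed_orthogonal_matrix)

lemma borel_measurable_matrix_mult [measurable]:
  fixes f g :: "'a \<Rightarrow> real^'n^'n"
  assumes [measurable]: "f \<in> borel_measurable M" "g \<in> borel_measurable M"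
  shows "(\<lambda>x. f x ** g x :: real^'n^'n) \<in> borel_measurable M"
proof -
  have "(\<lambda>p :: (real^'n^'n) \<times> (real^'n^'n). fst p ** snd p) \<in> borel_measurable borel"
    unfolding matrix_matrix_mult_def by (intro borel_measurable_continuous_onI continuous_intros)
  from measurable_compose[OF borel_measurable_Pair[OF assms] this] show ?thesis by simp
qed

lemma borel_measurable_transpose [measurable]: "transpose \<in> borel_measurable (borel :: (real^'n^'n) measure)"
  unfolding transpose_def by (intro borel_measurable_continuous_onI continuous_intros)

lemma measurable_O3_mult:
  "(\<lambda>p. fst p ** snd p) \<in> measurable (O3 \<Otimes>\<^sub>M O3) O3"
proof (rule measurable_restrict_space2)
  show "(\<lambda>p. fst p ** snd p) \<in> space (O3 \<Otimes>\<^sub>M O3) \<rightarrow> {U. orthogonal_matrix U}"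
    by (auto simp: space_pair_measure space_O3 orthogonal_matrix_mul)
  have i: "(\<lambda>x. x) \<in> borel_measurable O3" by (rule measurable_restrict_space1) simp
  have "fst \<in> borel_measurable (O3 \<Otimes>\<^sub>M O3)" by (rule measurable_compose[OF measurable_fst i])
  moreover have "snd \<in> borel_measurable (O3 \<Otimes>\<^sub>M O3)" by (rule measurable_compose[OF measurable_snd i])
  ultimately show "(\<lambda>p. fst p ** snd p) \<in> borel_measurable (O3 \<Otimes>\<^sub>M O3)" by measurable
qed

lemma measurable_O3_left: "orthogonal_matrix U \<Longrightarrow> (\<lambda>X. U ** X) \<in> measurable O3 O3"
  by (rule measurable_restrict_space2)
     (auto simp: space_O3 orthogonal_matrix_mul intro!: measurable_restrict_space1)

lemma measurable_O3_transpose: "transpose \<in> measurable O3 O3"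
  by (rule measurable_restrict_space2)
     (auto simp: space_O3 orthogonal_matrix_transpose intro!: measurable_restrict_space1)

text \<open>The property described in \<open>haar_O3\<close>, named so that uniqueness and existence
  can be treated separately.\<close>

definition left_haar :: "(real^3^3) measure \<Rightarrow> bool" where
  "left_haar H \<longleftrightarrow> prob_space H \<and> sets H = sets O3 \<and>
     (\<forall>U. orthogonal_matrix U \<longrightarrow> distr H H (\<lambda>X. U ** X) = H)"

text \<open>The image of a left invariant measure under inversion is right invariant, and convolving a left
  with a right invariant probability measure gives both of them back.\<close>

lemma left_haar_inverse:
  assumes H: "left_haar H" and K: "left_haar K" and B: "B \<in> sets O3"
  shows "emeasure H B = emeasure (distr K O3 transpose) B"
proof -
  interpret H: prob_space H using H by (simp add: left_haar_def)
  interpret K: prob_space K using K by (simp add: left_haar_def)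
  have sH[measurable_cong]: "sets H = sets O3" and sK[measurable_cong]: "sets K = sets O3"
    using H K by (auto simp: left_haar_def)
  have spH: "space H = {U. orthogonal_matrix U}" and spK: "space K = {U. orthogonal_matrix U}"
    using sets_eq_imp_space_eq[OF sH] sets_eq_imp_space_eq[OF sK] by (simp_all add: space_O3)
  note measurable_O3_transpose[measurable] measurable_O3_mult[measurable] B[measurable]
  have m: "(\<lambda>p. indicator B (transpose (snd p) ** fst p) :: ennreal) \<in> borel_measurable (H \<Otimes>\<^sub>M K)"
  proof -
    have "(\<lambda>p. (transpose (snd p), fst p)) \<in> measurable (H \<Otimes>\<^sub>M K) (O3 \<Otimes>\<^sub>M O3)" by measurable
    from measurable_compose[OF this measurable_O3_mult]
    have "(\<lambda>p. transpose (snd p) ** fst p) \<in> measurable (H \<Otimes>\<^sub>M K) O3" by simp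
    then show ?thesis by measurable
  qed
  interpret pair_sigma_finite H K ..
  have inv: "(\<integral>\<^sup>+x. indicator B (U ** x) \<partial>H) = emeasure H B" if U: "orthogonal_matrix U" for U
  proof -
    have [measurable]: "(\<lambda>X. U ** X) \<in> measurable H H"
      using measurable_O3_left[OF U] by (simp add: measurable_cong_sets[OF sH sH])
    have "emeasure H B = emeasure (distr H H (\<lambda>X. U ** X)) B"
      using H U by (simp add: left_haar_def)
    also have "\<dots> = (\<integral>\<^sup>+x. indicator B (U ** x) \<partial>H)"
      by (subst nn_integral_indicator[symmetric], simp add: sH, subst nn_integral_distr) (simp_all add: sH)
    finally show ?thesis by simp
  qed
  have "(\<integral>\<^sup>+y. \<integral>\<^sup>+x. indicator B (transpose y ** x) \<partial>H \<partial>K) = (\<integral>\<^sup>+y. emeasure H B \<partial>K)"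
    by (rule nn_integral_cong) (simp add: inv spK orthogonal_matrix_transpose)
  also have "\<dots> = emeasure H B" by (simp add: K.emeasure_space_1)
  finally have 1: "(\<integral>\<^sup>+y. \<integral>\<^sup>+x. indicator B (transpose y ** x) \<partial>H \<partial>K) = emeasure H B" .
  have inv2: "(\<integral>\<^sup>+y. indicator B (transpose y ** U) \<partial>K) = emeasure (distr K O3 transpose) B"
    if U: "orthogonal_matrix U" for U
  proof -
    have U': "orthogonal_matrix (transpose U)" using U by (simp add: orthogonal_matrix_transpose)
    have [measurable]: "(\<lambda>X. transpose U ** X) \<in> measurable K K"
      using measurable_O3_left[OF U'] by (simp add: measurable_cong_sets[OF sK sK])
    have "emeasure (distr K O3 transpose) B = (\<integral>\<^sup>+y. indicator B (transpose y) \<partial>K)"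
      by (subst nn_integral_indicator[symmetric], simp, subst nn_integral_distr) simp_all
    also have "\<dots> = (\<integral>\<^sup>+y. indicator B (transpose y) \<partial>distr K K (\<lambda>X. transpose U ** X))"
      using K U' by (simp add: left_haar_def)
    also have "\<dots> = (\<integral>\<^sup>+y. indicator B (transpose (transpose U ** y)) \<partial>K)"
      by (rule nn_integral_distr) measurable
    also have "\<dots> = (\<integral>\<^sup>+y. indicator B (transpose y ** U) \<partial>K)"
      by (simp add: matrix_transpose_mul)
    finally show ?thesis by simp
  qed
  have "(\<integral>\<^sup>+y. \<integral>\<^sup>+x. indicator B (transpose y ** x) \<partial>H \<partial>K)
      = (\<integral>\<^sup>+x. \<integral>\<^sup>+y. indicator B (transpose y ** x) \<partial>K \<partial>H)"
    using m by (intro Fubini') (simp add: case_prod_unfold)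
  also have "\<dots> = (\<integral>\<^sup>+x. emeasure (distr K O3 transpose) B \<partial>H)"
    by (rule nn_integral_cong) (simp add: inv2 spH)
  also have "\<dots> = emeasure (distr K O3 transpose) B" by (simp add: H.emeasure_space_1)
  finally show ?thesis using 1 by simp
qed

text \<open>Applied to the pairs \<open>H\<close>, \<open>K\<close> and \<open>K\<close>,
  \<open>K\<close>, the preceding lemma identifies both measures with the image of \<open>K\<close>
  under inversion.\<close>

lemma left_haar_unique:
  assumes "left_haar H" "left_haar K"
  shows "H = K"
  by (rule measure_eqI)
     (use assms left_haar_inverse[of H K] left_haar_inverse[of K K] in \<open>auto simp: left_haar_def\<close>)

lemma haar_O3_eq:
  assumes "left_haar H"
  shows "haar_O3 = H"
proof -
  have "haar_O3 = (THE H. left_haar H)" by (simp add: haar_O3_def left_haar_def)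
  also have "\<dots> = H" using assms left_haar_unique by blast
  finally show ?thesis .
qed

text \<open>Gram--Schmidt orthonormalization of the columns; the factor \<open>sgn\<close> makes it equivariant under
  all of \<open>O(3)\<close> and not only under rotations.\<close>

definition gram_schmidt :: "real^3 \<Rightarrow> real^3 \<Rightarrow> real^3 \<Rightarrow> real^3^3" where
  "gram_schmidt x y z = transpose (vector [sgn x, sgn (cross3 (cross3 x y) x), sgn (cross3 x y \<bullet> z) *\<^sub>R sgn (cross3 x y)])"

lemma orthogonal_matrix_rows_3:
  fixes a b c :: "real^3"
  assumes "a \<bullet> a = 1" "b \<bullet> b = 1" "c \<bullet> c = 1" "a \<bullet> b = 0" "a \<bullet> c = 0" "b \<bullet> c = 0"
  shows "orthogonal_matrix (transpose (vector [a, b, c]))"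
  using assms unfolding orthogonal_matrix
  by (simp add: matrix_matrix_mult_def vec_eq_iff forall_3 mat_def transpose_def inner_vec_def sum_3 mult.commute)

lemma orthogonal_gram_schmidt:
  assumes d: "cross3 x y \<bullet> z \<noteq> 0"
  shows "orthogonal_matrix (gram_schmidt x y z)"
proof -
  have nz: "cross3 x y \<noteq> 0" "x \<noteq> 0" using d by auto
  have nz2: "cross3 (cross3 x y) x \<noteq> 0"
    using norm_and_cross_eq_0[of "cross3 x y" x] nz by (auto simp: dot_cross_self)
  have s: "sgn v \<bullet> sgn v = 1" if "v \<noteq> 0" for v :: "real^3"
    using that by (simp add: dot_square_norm norm_sgn)
  have o: "sgn v \<bullet> sgn w = 0" if "v \<bullet> w = 0" for v w :: "real^3"
    using that by (simp add: sgn_div_norm)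
  have e: "sgn (cross3 x y \<bullet> z) * sgn (cross3 x y \<bullet> z) = 1" using d by (simp add: sgn_if)
  show ?thesis
    unfolding gram_schmidt_def
    by (rule orthogonal_matrix_rows_3)
       (simp_all add: s o nz nz2 d e dot_cross_self mult.assoc[symmetric])
qed

text \<open>A cross product of rotated vectors acquires the factor \<open>det A\<close>. In the
  second column it occurs twice, through the iterated product; in the third it comes once from the
  product and once from the sign of the triple product. As \<open>det A\<close> squares to 1, both
  columns are equivariant.\<close>

lemma gram_schmidt_equivariant:
  assumes A: "orthogonal_matrix A"
  shows "gram_schmidt (A *v x) (A *v y) (A *v z) = A ** gram_schmidt x y z"
proof -
  have dA: "det A * det A = 1" using det_orthogonal_matrix[OF A] by auto
  have in': "(A *v v) \<bullet> (A *v w) = v \<bullet> w" for v w :: "real^3"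
    using A by (metis orthogonal_matrix dot_lmul_matrix vector_transpose_matrix matrix_vector_mul_assoc matrix_vector_mul_lid)
  have sg: "sgn (A *v v) = A *v sgn v" for v :: "real^3"
    by (simp add: sgn_div_norm norm_orthogonal_matrix[OF A] matrix_vector_mult_scaleR)
  have c: "cross3 (A *v v) (A *v w) = det A *\<^sub>R (A *v cross3 v w)" for v w
    using cross_orthogonal_matrix[OF A] by simp
  have sd: "sgn (det A) = det A" using det_orthogonal_matrix[OF A] by auto
  have 2: "cross3 (cross3 (A *v x) (A *v y)) (A *v x) = A *v cross3 (cross3 x y) x"
    by (simp add: c cross_mult_left dA)
  have 3: "sgn (cross3 (A *v x) (A *v y) \<bullet> (A *v z)) *\<^sub>R sgn (cross3 (A *v x) (A *v y))
      = A *v (sgn (cross3 x y \<bullet> z) *\<^sub>R sgn (cross3 x y))"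
  proof -
    have "det A * s * det A = s" for s
    proof -
      have "det A * s * det A = (det A * det A) * s" by (simp only: mult_ac)
      then show ?thesis by (simp add: dA)
    qed
    then show ?thesis
      by (simp add: c in' sgn_mult sgn_scaleR sd sg matrix_vector_mult_scaleR)
  qed
  have t: "A ** transpose (vector [a, b, c]) = (transpose (vector [A *v a, A *v b, A *v c]) :: real^3^3)" for a b c :: "real^3"
    by (simp add: vec_eq_iff forall_3 matrix_matrix_mult_def matrix_vector_mult_def transpose_def sum_3)
  show ?thesis unfolding gram_schmidt_def 2 3 sg t ..
qed

lemma gauss3_triple_nondegenerate:
  "AE p in gauss3 \<Otimes>\<^sub>M gauss3 \<Otimes>\<^sub>M gauss3. cross3 (fst p) (fst (snd p)) \<bullet> snd (snd p) \<noteq> 0"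
proof -
  define S where "S = {p :: (real^3) \<times> (real^3) \<times> (real^3). cross3 (fst p) (fst (snd p)) \<bullet> snd (snd p) = 0}"
  have "closed S"
    unfolding S_def by (intro closed_Collect_eq continuous_intros continuous_on_cross)
  then have S: "S \<in> sets borel" by simp
  text \<open>Along the direction of the identity matrix the determinant is a monic cubic polynomial.\<close>
  have "emeasure lborel S = 0"
  proof (rule null_if_countable_on_lines[OF S, of "(axis 1 1, axis 2 1, axis 3 1)"])
    fix p :: "(real^3) \<times> (real^3) \<times> (real^3)"
    obtain x y z where p: "p = (x, y, z)" by (cases p) auto
    \<comment> \<open>These are the coefficients of det (X + t I) for the matrix X with rows x, y,
      z: the determinant, the sum of the principal minors of order two, the trace and 1.\<close>
    define q where "q = [: cross3 x y \<bullet> z,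
        x$1*y$2 + x$1*z$3 + y$2*z$3 - x$2*y$1 - x$3*z$1 - y$3*z$2, x$1 + y$2 + z$3, 1 :]"
    have "{t. p + t *\<^sub>R (axis 1 1, axis 2 1, axis 3 1) \<in> S} = {t. poly q t = 0}"
      by (auto simp: S_def p q_def cross3_simps axis_def)
    moreover have "q \<noteq> 0" by (simp add: q_def)
    ultimately show "countable {t. p + t *\<^sub>R (axis 1 1, axis 2 1, axis 3 1) \<in> S}"
      using poly_roots_finite[of q] countable_finite by simp
  qed
  then have "AE p in lborel \<Otimes>\<^sub>M lborel \<Otimes>\<^sub>M lborel. p \<notin> S"
    using S by (intro AE_not_in) (simp add: lborel_prod null_sets_def)
  moreover have "gauss3 \<Otimes>\<^sub>M gauss3 \<Otimes>\<^sub>M gauss3 = density (lborel \<Otimes>\<^sub>M lborel \<Otimes>\<^sub>M lborel)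
      (\<lambda>(x, y, z). ennreal (gauss3_density x) * (ennreal (gauss3_density y) * ennreal (gauss3_density z)))"
  proof -
    interpret g: prob_space "density lborel (\<lambda>x. ennreal (gauss3_density x))"
      using prob_space_gauss3 by (simp add: gauss3_def)
    interpret gg: pair_prob_space "density lborel (\<lambda>x. ennreal (gauss3_density x))" "density lborel (\<lambda>x. ennreal (gauss3_density x))" ..
    have 1: "gauss3 \<Otimes>\<^sub>M gauss3 = density (lborel \<Otimes>\<^sub>M lborel) (\<lambda>(y, z). ennreal (gauss3_density y) * ennreal (gauss3_density z))"
      unfolding gauss3_def by (rule pair_measure_density) (auto intro: lborel.sigma_finite_measure_axioms g.sigma_finite_measure_axioms)
    have "sigma_finite_measure (gauss3 \<Otimes>\<^sub>M gauss3)"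
      unfolding gauss3_def by (rule gg.sigma_finite_measure_axioms)
    then have "gauss3 \<Otimes>\<^sub>M density (lborel \<Otimes>\<^sub>M lborel) (\<lambda>(y, z). ennreal (gauss3_density y) * ennreal (gauss3_density z))
      = density (lborel \<Otimes>\<^sub>M lborel \<Otimes>\<^sub>M lborel) (\<lambda>(x, yz). ennreal (gauss3_density x) * (case yz of (y, z) \<Rightarrow> ennreal (gauss3_density y) * ennreal (gauss3_density z)))"
      unfolding 1 unfolding gauss3_def
      by (intro pair_measure_density) (auto intro: lborel_pair.P.sigma_finite_measure_axioms)
    then show ?thesis unfolding 1 by (simp add: case_prod_unfold)
  qed
  ultimately show ?thesis
    by (simp only:) (subst AE_density, measurable, auto simp: S_def elim!: eventually_mono)
qed

text \<open>The identity matrix is a default on the null set of dependent triples, chosen to keep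
  all values orthogonal.\<close>

definition haar_gs :: "(real^3^3) measure" where
  "haar_gs = distr (gauss3 \<Otimes>\<^sub>M gauss3 \<Otimes>\<^sub>M gauss3) O3
     (\<lambda>(x, y, z). if cross3 x y \<bullet> z \<noteq> 0 then gram_schmidt x y z else mat 1)"

lemma borel_measurable_cross3 [measurable]:
  assumes [measurable]: "f \<in> borel_measurable M" "g \<in> borel_measurable M"
  shows "(\<lambda>x. cross3 (f x) (g x)) \<in> borel_measurable M"
  unfolding cross3_def by measurable

lemma borel_measurable_vector3_vec [measurable]:
  assumes [measurable]: "f \<in> borel_measurable M" "g \<in> borel_measurable M" "h \<in> borel_measurable M"
  shows "(\<lambda>x. vector [f x, g x, h x] :: real^3^3) \<in> borel_measurable M"
proof -
  have "(\<lambda>p :: (real^3) \<times> (real^3) \<times> (real^3). (\<chi> i. if i = 1 then fst p else if i = 2 then fst (snd p) else snd (snd p)) :: real^3^3)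
    \<in> borel_measurable borel"
  proof (intro borel_measurable_continuous_onI continuous_on_vec_lambda)
    fix i :: 3
    show "continuous_on UNIV (\<lambda>p :: (real^3) \<times> (real^3) \<times> (real^3). if i = 1 then fst p else if i = 2 then fst (snd p) else snd (snd p))"
      by (cases "i = 1"; cases "i = 2") (auto intro!: continuous_intros)
  qed
  from measurable_compose[OF borel_measurable_Pair[OF assms(1) borel_measurable_Pair[OF assms(2,3)]] this]
  show ?thesis
    by (rule back_subst[of "\<lambda>f. f \<in> borel_measurable M"]) (simp add: fun_eq_iff vec_eq_iff forall_3)
qed

lemma borel_measurable_gram_schmidt [measurable]:
  assumes [measurable]: "f \<in> borel_measurable M" "g \<in> borel_measurable M" "h \<in> borel_measurable M"
  shows "(\<lambda>x. gram_schmidt (f x) (g x) (h x)) \<in> borel_measurable M"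
  unfolding gram_schmidt_def by measurable

lemma measurable_haar_gs:
  "(\<lambda>(x, y, z). if cross3 x y \<bullet> z \<noteq> 0 then gram_schmidt x y z else mat 1)
    \<in> measurable (gauss3 \<Otimes>\<^sub>M gauss3 \<Otimes>\<^sub>M gauss3) O3"
proof (rule measurable_restrict_space2)
  have "(\<lambda>p. if cross3 (fst p) (fst (snd p)) \<bullet> snd (snd p) \<noteq> 0 then gram_schmidt (fst p) (fst (snd p)) (snd (snd p)) else mat 1)
      \<in> borel_measurable (gauss3 \<Otimes>\<^sub>M gauss3 \<Otimes>\<^sub>M gauss3)"
    by measurable
  then show "(\<lambda>(x, y, z). if cross3 x y \<bullet> z \<noteq> 0 then gram_schmidt x y z else mat 1)
      \<in> borel_measurable (gauss3 \<Otimes>\<^sub>M gauss3 \<Otimes>\<^sub>M gauss3)"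
    by (simp add: case_prod_unfold)
qed (auto simp: orthogonal_gram_schmidt orthogonal_matrix_id)

text \<open>By equivariance, multiplying the orthonormalized matrix by \<open>A\<close> amounts to
  applying \<open>A\<close> to the three Gaussian vectors, and this preserves their joint
  law.\<close>

lemma left_haar_gs: "left_haar haar_gs"
  unfolding left_haar_def
proof (intro conjI allI impI)
  interpret g: prob_space gauss3 by (rule prob_space_gauss3)
  interpret gg: pair_prob_space gauss3 gauss3 ..
  interpret ggg: pair_prob_space gauss3 "gauss3 \<Otimes>\<^sub>M gauss3" ..
  show "prob_space haar_gs"
    unfolding haar_gs_def by (rule ggg.prob_space_distr[OF measurable_haar_gs])
  show s: "sets haar_gs = sets O3" by (simp add: haar_gs_def)
  fix A :: "real^3^3" assume A: "orthogonal_matrix A"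
  let ?G = "gauss3 \<Otimes>\<^sub>M gauss3 \<Otimes>\<^sub>M gauss3"
  let ?f = "\<lambda>(x, y, z). if cross3 x y \<bullet> z \<noteq> 0 then gram_schmidt x y z else mat 1"
  let ?r = "\<lambda>(x, y, z). (A *v x, A *v y, A *v z)"
  have AG: "distr ?G ?G ?r = ?G"
  proof -
    have "distr (gauss3 \<Otimes>\<^sub>M gauss3) (borel \<Otimes>\<^sub>M borel) (\<lambda>(x, y). (A *v x, A *v y)) = gauss3 \<Otimes>\<^sub>M gauss3"
      using pair_measure_distr[of "(*v) A" gauss3 borel "(*v) A" gauss3 borel] gauss3_orthogonal[OF A]
        g.sigma_finite_measure_axioms by simp
    then have "distr ?G (borel \<Otimes>\<^sub>M borel \<Otimes>\<^sub>M borel) (\<lambda>(x, y). (A *v x, (\<lambda>(x, y). (A *v x, A *v y)) y)) = ?G"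
      using pair_measure_distr[of "(*v) A" gauss3 borel "\<lambda>(x, y). (A *v x, A *v y)" "gauss3 \<Otimes>\<^sub>M gauss3" "borel \<Otimes>\<^sub>M borel"]
        gauss3_orthogonal[OF A] gg.sigma_finite_measure_axioms by simp
    moreover have "distr ?G (borel \<Otimes>\<^sub>M borel \<Otimes>\<^sub>M borel) (\<lambda>(x, y). (A *v x, (\<lambda>(x, y). (A *v x, A *v y)) y)) = distr ?G ?G ?r"
      by (rule distr_cong) (auto simp: case_prod_unfold intro!: sets_pair_measure_cong)
    ultimately show ?thesis by simp
  qed
  have rm: "?r \<in> measurable ?G ?G" by measurable
  have Lm: "(\<lambda>X. A ** X) \<in> measurable haar_gs haar_gs"
    using measurable_O3_left[OF A] by (simp add: measurable_cong_sets[OF s s])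
  have fm: "?f \<in> measurable ?G haar_gs"
    using measurable_haar_gs by (simp add: measurable_cong_sets[OF refl s])
  have "distr haar_gs haar_gs (\<lambda>X. A ** X) = distr (distr ?G haar_gs ?f) haar_gs (\<lambda>X. A ** X)"
    unfolding haar_gs_def by (intro distr_cong) auto
  also have "\<dots> = distr ?G haar_gs (\<lambda>p. A ** ?f p)"
    by (subst distr_distr[OF Lm fm]) (simp add: comp_def)
  also have "\<dots> = distr ?G haar_gs (\<lambda>p. ?f (?r p))"
  proof (rule distr_cong_AE)
    show "AE p in ?G. A ** ?f p = ?f (?r p)"
      using gauss3_triple_nondegenerate
    proof eventually_elim
      case (elim p)
      obtain x y z where p: "p = (x, y, z)" by (cases p) auto
      have "cross3 (A *v x) (A *v y) \<bullet> (A *v z) = det A * (cross3 x y \<bullet> z)"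
      proof -
        have "(A *v v) \<bullet> (A *v w) = v \<bullet> w" for v w :: "real^3"
          using A by (metis orthogonal_matrix dot_lmul_matrix vector_transpose_matrix matrix_vector_mul_assoc matrix_vector_mul_lid)
        then show ?thesis using cross_orthogonal_matrix[OF A, of x y] by simp
      qed
      moreover have "det A \<noteq> 0" using det_orthogonal_matrix[OF A] by auto
      ultimately show ?case
        using elim by (simp add: p gram_schmidt_equivariant[OF A])
    qed
    show "(\<lambda>p. A ** ?f p) \<in> measurable ?G haar_gs" by (rule measurable_compose[OF fm Lm])
    show "(\<lambda>p. ?f (?r p)) \<in> measurable ?G haar_gs" by (rule measurable_compose[OF rm fm])
  qed auto
  also have "\<dots> = distr (distr ?G ?G ?r) haar_gs ?f"
    by (subst distr_distr[OF fm rm]) (simp add: comp_def)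
  also have "\<dots> = haar_gs"
    unfolding AG by (subst (2) haar_gs_def) (intro distr_cong, auto simp: s)
  finally show "distr haar_gs haar_gs (\<lambda>X. A ** X) = haar_gs" .
qed

text \<open>The first column of the orthonormalization is the normalized first vector, and its line
  does not see the normalization. The other two Gaussian vectors are then integrated out.\<close>

theorem unif_RP2_eq: "unif_RP2 = distr gauss3 borel proj_pt"
proof -
  interpret g: prob_space gauss3 by (rule prob_space_gauss3)
  interpret gg: pair_prob_space gauss3 gauss3 ..
  interpret ggg: pair_prob_space gauss3 "gauss3 \<Otimes>\<^sub>M gauss3" ..
  let ?G = "gauss3 \<Otimes>\<^sub>M gauss3 \<Otimes>\<^sub>M gauss3"
  let ?f = "\<lambda>(x, y, z). if cross3 x y \<bullet> z \<noteq> 0 then gram_schmidt x y z else mat 1"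
  have m: "(\<lambda>U. proj_pt (U *v axis 1 1)) \<in> borel_measurable O3"
  proof -
    have "(\<lambda>U :: real^3^3. U *v axis 1 1) \<in> borel_measurable borel"
      unfolding matrix_vector_mult_def by (intro borel_measurable_continuous_onI continuous_intros)
    then show ?thesis by (intro measurable_restrict_space1) measurable
  qed
  have "unif_RP2 = distr haar_gs borel (\<lambda>U. proj_pt (U *v axis 1 1))"
    unfolding unif_RP2_def haar_O3_eq[OF left_haar_gs] ..
  also have "\<dots> = distr ?G borel (\<lambda>p. proj_pt (?f p *v axis 1 1))"
    unfolding haar_gs_def by (subst distr_distr[OF m measurable_haar_gs]) (simp add: comp_def)
  also have "\<dots> = distr ?G borel (\<lambda>p. proj_pt (fst p))"
  proof (rule distr_cong_AE)
    show "AE p in ?G. proj_pt (?f p *v axis 1 1) = proj_pt (fst p)"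
      using gauss3_triple_nondegenerate
    proof eventually_elim
      case (elim p)
      obtain x y z where p: "p = (x, y, z)" by (cases p) auto
      have "gram_schmidt x y z *v axis 1 1 = sgn x"
        by (simp add: gram_schmidt_def matrix_vector_mult_basis column_def transpose_def vec_eq_iff)
      moreover have "x \<noteq> 0" using elim p by auto
      ultimately show ?case using elim by (simp add: p sgn_div_norm)
    qed
    show "(\<lambda>p. proj_pt (?f p *v axis 1 1)) \<in> borel_measurable ?G"
      by (rule measurable_compose[OF measurable_haar_gs m])
  qed auto
  also have "\<dots> = distr (distr ?G gauss3 fst) borel proj_pt"
    by (subst distr_distr) (auto simp: comp_def)
  also have "distr ?G gauss3 fst = gauss3"
    by (rule gg.distr_pair_fst)
  finally show ?thesis .
qed

section \<open>Riemannian volume\<close>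

lemma mat_inner_eq_inner: "mat_inner A B = (A \<bullet> B) / 2"
  by (simp add: mat_inner_def trace_def matrix_matrix_mult_def transpose_def inner_vec_def)

text \<open>Differentiability of a continuous solution \<open>h\<close> of \<open>F (h x) = G x\<close> when the derivative of \<open>F\<close>
  has a left inverse; continuous differentiability of \<open>F\<close> is not needed, so this is not an instance
  of the inverse function theorem.\<close>

lemma has_derivative_lift:
  fixes F :: "'b::euclidean_space \<Rightarrow> 'c::euclidean_space" and h :: "'a::euclidean_space \<Rightarrow> 'b"
  assumes F: "(F has_derivative D2) (at (h a))" and L: "linear L" "\<And>v. L (D2 v) = v"
    and h: "isCont h a" and G: "(G has_derivative D1) (at a)"
    and eq: "\<forall>\<^sub>F x in at a. F (h x) = G x" "F (h a) = G a"
  shows "(h has_derivative (\<lambda>v. L (D1 v))) (at a)"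
proof -
  have bL: "bounded_linear L" using L(1) by (simp add: linear_conv_bounded_linear)
  have f: "((\<lambda>y. L (F y)) has_derivative (\<lambda>v. v)) (at (h a))"
    using bounded_linear.has_derivative[OF bL F] by (simp add: L(2))
  have g: "((\<lambda>x. L (G x)) has_derivative (\<lambda>v. L (D1 v))) (at a)"
    by (rule bounded_linear.has_derivative[OF bL G])
  let ?g = "\<lambda>x. L (G x)" and ?g' = "\<lambda>v. L (D1 v)" and ?f = "\<lambda>y. L (F y)"
  have bg: "bounded_linear ?g'" using g by (rule has_derivative_bounded_linear)
  obtain K where K: "K > 0" "\<And>v. norm (?g' v) \<le> norm v * K"
    using bounded_linear.pos_bounded[OF bg] by blast
  obtain d0 where d0: "d0 > 0" "\<And>x. x \<noteq> a \<Longrightarrow> dist x a < d0 \<Longrightarrow> F (h x) = G x"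
    using eq(1) unfolding eventually_at by blast
  have fg: "?f (h x) = ?g x" if "dist x a < d0" for x
    using d0(2)[of x] that eq(2) by (cases "x = a") auto
  show ?thesis
    unfolding has_derivative_at_alt
  proof (intro conjI bg allI impI)
    fix e :: real assume e: "e > 0"
    \<comment> \<open>The bound 1/2 lets the error of \<open>F\<close> be absorbed into the left
      side, which gives the Lipschitz estimate with constant 2 (K + 1). The other bound makes
      \<open>e1\<close> times this constant at most half of \<open>e\<close>; \<open>e2\<close>
      takes the other half.\<close>
    define e1 where "e1 = min (1/2) (e / (4 * (K + 1)))"
    have e1: "e1 > 0" "e1 \<le> 1/2" "e1 * (2 * (K + 1)) \<le> e / 2"
    proof -
      show "e1 > 0" using e K by (simp add: e1_def)
      show "e1 \<le> 1/2" unfolding e1_def by (rule min.cobounded1)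
      have "e1 \<le> e / (4 * (K + 1))" by (simp add: e1_def)
      then show "e1 * (2 * (K + 1)) \<le> e / 2" using K by (simp add: field_simps)
    qed
    define e2 where "e2 = min 1 (e / 2)"
    have e2: "e2 > 0" "e2 \<le> 1" "e2 \<le> e / 2" using e by (auto simp: e2_def)
    obtain d1 where d1: "d1 > 0" "\<And>y. norm (y - h a) < d1 \<Longrightarrow>
        norm (?f y - ?f (h a) - (y - h a)) \<le> e1 * norm (y - h a)"
      using f e1(1) unfolding has_derivative_at_alt by blast
    obtain d2 where d2: "d2 > 0" "\<And>x. norm (x - a) < d2 \<Longrightarrow>
        norm (?g x - ?g a - ?g' (x - a)) \<le> e2 * norm (x - a)"
      using g e2(1) unfolding has_derivative_at_alt by blast
    obtain d3 where d3: "d3 > 0" "\<And>x. dist x a < d3 \<Longrightarrow> dist (h x) (h a) < d1"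
      using continuous_at_eps_delta[THEN iffD1, rule_format, OF h d1(1)] by blast
    let ?d = "min d0 (min d2 d3)"
    have "norm (h x - h a - ?g' (x - a)) \<le> e * norm (x - a)" if x: "norm (x - a) < ?d" for x
    proof -
      have eq1: "?f (h x) - ?f (h a) = ?g x - ?g a"
        using fg[of x] fg[of a] x d0(1) by (simp add: dist_norm)
      have 1: "norm (?g x - ?g a - (h x - h a)) \<le> e1 * norm (h x - h a)"
        using d1(2)[of "h x"] d3(2)[of x] x eq1 by (simp add: dist_norm)
      have 2: "norm (?g x - ?g a - ?g' (x - a)) \<le> e2 * norm (x - a)"
        using d2(2) x by simp
      have "norm (?g x - ?g a) \<le> norm (?g' (x - a)) + e2 * norm (x - a)"
        using norm_triangle_ineq[of "?g' (x - a)" "?g x - ?g a - ?g' (x - a)"] 2 by simp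
      also have "\<dots> \<le> (K + 1) * norm (x - a)"
        using K(2)[of "x - a"] mult_right_mono[OF e2(2) norm_ge_zero[of "x - a"]] by (simp add: algebra_simps)
      finally have 3: "norm (?g x - ?g a) \<le> (K + 1) * norm (x - a)" .
      have "norm (h x - h a) \<le> norm (?g x - ?g a) + norm (?g x - ?g a - (h x - h a))"
        using norm_triangle_ineq4[of "?g x - ?g a" "?g x - ?g a - (h x - h a)"] by simp
      also have "\<dots> \<le> (K + 1) * norm (x - a) + 1/2 * norm (h x - h a)"
        using 1 3 mult_right_mono[OF e1(2) norm_ge_zero[of "h x - h a"]] by linarith
      finally have "norm (h x - h a) \<le> 2 * ((K + 1) * norm (x - a))" by linarith
      then have 4: "norm (h x - h a) \<le> 2 * (K + 1) * norm (x - a)" by (simp only: mult.assoc)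
      have eq2: "h x - h a - ?g' (x - a) = (?g x - ?g a - ?g' (x - a)) - (?g x - ?g a - (h x - h a))"
        by simp
      have "norm (h x - h a - ?g' (x - a))
          \<le> norm (?g x - ?g a - ?g' (x - a)) + norm (?g x - ?g a - (h x - h a))"
        by (subst eq2) (rule norm_triangle_ineq4)
      also have "\<dots> \<le> e2 * norm (x - a) + e1 * (2 * (K + 1) * norm (x - a))"
        using 1 2 mult_left_mono[OF 4, of e1] e1(1) by linarith
      also have "\<dots> = e2 * norm (x - a) + e1 * (2 * (K + 1)) * norm (x - a)" by simp
      also have "\<dots> \<le> e / 2 * norm (x - a) + e / 2 * norm (x - a)"
        by (intro add_mono mult_right_mono e2 e1) auto
      finally show ?thesis by simp
    qed
    then show "\<exists>d>0. \<forall>y. norm (y - a) < d \<longrightarrow> norm (h y - h a - ?g' (y - a)) \<le> e * norm (y - a)"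
      using d0(1) d2(1) d3(1) by (intro exI[of _ ?d]) auto
  qed
qed

section \<open>Local parametrizations and their transition maps\<close>

abbreviation chart :: "(real^5 \<Rightarrow> real^3^3) \<Rightarrow> real^5 \<Rightarrow> (real^3^3) proj_space" where
  "chart \<psi> x \<equiv> proj_pt (\<psi> x)"

definition vol_density :: "(real^5 \<Rightarrow> real^3^3) \<Rightarrow> real^5 \<Rightarrow> real" where
  "vol_density \<psi> x = sqrt (det (gram \<psi> x))"

lemma local_paramD:
  assumes "local_param M W \<psi>"
  shows "open W" "\<And>x. x \<in> W \<Longrightarrow> (\<psi> has_derivative frechet_derivative \<psi> (at x)) (at x)"
    "\<And>h. continuous_on W (\<lambda>x. frechet_derivative \<psi> (at x) h)"
    "\<And>x. x \<in> W \<Longrightarrow> inj (frechet_derivative \<psi> (at x))"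
    "\<And>x. x \<in> W \<Longrightarrow> mat_inner (\<psi> x) (\<psi> x) = 1"
    "\<And>x. x \<in> W \<Longrightarrow> \<psi> x \<noteq> 0"
    "chart \<psi> ` W \<subseteq> M"
    "continuous_on W \<psi>" "continuous_on W (chart \<psi>)" "inj_on (chart \<psi>) W"
proof -
  note * = assms[unfolded local_param_def]
  show "open W" "\<And>h. continuous_on W (\<lambda>x. frechet_derivative \<psi> (at x) h)"
    "\<And>x. x \<in> W \<Longrightarrow> inj (frechet_derivative \<psi> (at x))"
    "\<And>x. x \<in> W \<Longrightarrow> mat_inner (\<psi> x) (\<psi> x) = 1" using * by auto
  show d: "(\<psi> has_derivative frechet_derivative \<psi> (at x)) (at x)" if "x \<in> W" for x
    using * that frechet_derivative_works by blast
  show "\<psi> x \<noteq> 0" if "x \<in> W" for x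
    using * that by (auto simp: mat_inner_eq_inner) 
  show "chart \<psi> ` W \<subseteq> M" using * openin_imp_subset by blast
  show "continuous_on W \<psi>"
    using d by (meson has_derivative_continuous continuous_at_imp_continuous_on)
  show "continuous_on W (chart \<psi>)" using * by (auto simp: homeomorphism_def)
  show "inj_on (chart \<psi>) W" using * by (auto simp: homeomorphism_def inj_on_def) metis
qed

lemma local_param_image:
  assumes "local_param M W \<psi>"
  obtains T where "open T" "chart \<psi> ` W = M \<inter> T"
  using assms unfolding local_param_def by (metis openin_open)

lemma local_param_image_sets:
  assumes "local_param M W \<psi>"
  shows "chart \<psi> ` W \<in> sets (restrict_space borel M)"
proof -
  obtain T where "open T" "chart \<psi> ` W = M \<inter> T" by (rule local_param_image[OF assms])
  then show ?thesis by (auto simp: sets_restrict_space)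
qed

lemma local_param_chart_measurable:
  assumes "local_param M W \<psi>"
  shows "chart \<psi> \<in> measurable (restrict_space borel W) (restrict_space borel M)"
  by (rule measurable_restrict_space2)
     (use local_paramD(7,9)[OF assms] in \<open>auto simp: space_restrict_space intro: borel_measurable_continuous_on_restrict\<close>)

lemma local_param_vimage_borel:
  assumes \<psi>: "local_param M W \<psi>" and B: "B \<in> sets (restrict_space borel M)"
  shows "{x\<in>W. chart \<psi> x \<in> B} \<in> sets borel"
proof -
  have "chart \<psi> -` B \<inter> space (restrict_space borel W) \<in> sets (restrict_space borel W)"
    by (rule measurable_sets[OF local_param_chart_measurable[OF \<psi>] B])
  moreover have "chart \<psi> -` B \<inter> space (restrict_space borel W) = {x\<in>W. chart \<psi> x \<in> B}"
    by (auto simp: space_restrict_space)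
  ultimately show ?thesis
    using local_paramD(1)[OF \<psi>] by (auto simp: sets_restrict_space_iff)
qed

lemma continuous_on_gram:
  assumes "\<And>h. continuous_on W (\<lambda>x. frechet_derivative \<psi> (at x) h)"
  shows "continuous_on W (\<lambda>x. gram \<psi> x $ i $ j)"
  unfolding gram_def mat_inner_eq_inner by (simp, intro continuous_intros assms) simp

lemma continuous_on_vol_density:
  assumes "\<And>h. continuous_on W (\<lambda>x. frechet_derivative \<psi> (at x) h)"
  shows "continuous_on W (vol_density \<psi>)"
  unfolding vol_density_def[abs_def]
  by (intro continuous_intros continuous_on_det continuous_on_gram assms)

lemma measurable_vol_density:
  assumes "local_param M W \<psi>" and A: "A \<in> sets borel" "A \<subseteq> W"
  shows "(\<lambda>x. ennreal (vol_density \<psi> x) * indicator A x) \<in> borel_measurable borel"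
proof -
  have "vol_density \<psi> \<in> borel_measurable (restrict_space borel A)"
    using continuous_on_subset[OF continuous_on_vol_density[OF local_paramD(3)[OF assms(1)]] A(2)]
    by (rule borel_measurable_continuous_on_restrict)
  then have "(\<lambda>x. ennreal (vol_density \<psi> x)) \<in> borel_measurable (restrict_space borel A)" by measurable
  then show ?thesis using A by (subst (asm) borel_measurable_restrict_space_iff_ennreal) auto
qed

text \<open>Writing the sign as an inner product makes it continuous along two continuous lifts,
  hence locally constant.\<close>

lemma unit_proj_pt_eq:
  assumes "mat_inner A A = 1" "mat_inner B B = 1" "proj_pt A = proj_pt B"
  shows "B = mat_inner B A *\<^sub>R A" "mat_inner B A = 1 \<or> mat_inner B A = -1"
proof -
  have "A \<noteq> 0" "B \<noteq> 0" using assms by (auto simp: mat_inner_eq_inner)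
  then obtain c where c: "B = c *\<^sub>R A" using proj_pt_eq_iff assms(3) by metis
  have "mat_inner B A = c" "mat_inner B B = c * c"
    using assms(1) by (simp_all add: c mat_inner_eq_inner)
  then show "B = mat_inner B A *\<^sub>R A" "mat_inner B A = 1 \<or> mat_inner B A = -1"
    using c assms(2) square_eq_1_iff by auto
qed

text \<open>If J is the matrix of \<open>h'\<close>, the Gram matrix transforms into J^T G J, and
  the sign \<open>c\<close> enters it squared.\<close>

lemma gram_compose:
  assumes l: "linear h'" and D2: "linear (frechet_derivative \<psi>2 (at y))"
    and D: "\<And>v. frechet_derivative \<psi>1 (at x) v = c *\<^sub>R frechet_derivative \<psi>2 (at y) (h' v)" and c: "c * c = 1"
  shows "vol_density \<psi>1 x = \<bar>det (matrix h')\<bar> * vol_density \<psi>2 y"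
proof -
  let ?D = "frechet_derivative \<psi>2 (at y)"
  have h': "h' (axis i 1) = (\<Sum>k\<in>UNIV. matrix h' $ k $ i *\<^sub>R axis k 1)" for i
    by (simp add: vec_eq_iff matrix_def axis_def if_distrib cong: if_cong)
  have Dh: "?D (h' (axis i 1)) = (\<Sum>k\<in>UNIV. matrix h' $ k $ i *\<^sub>R ?D (axis k 1))" for i
    by (subst h') (simp add: linear_sum[OF D2] linear_cmul[OF D2])
  have "gram \<psi>1 x = transpose (matrix h') ** gram \<psi>2 y ** matrix h'"
    unfolding vec_eq_iff
  proof (intro allI)
    fix i j
    have "gram \<psi>1 x $ i $ j = mat_inner (?D (h' (axis i 1))) (?D (h' (axis j 1)))"
      using c by (simp add: gram_def D mat_inner_eq_inner mult.assoc[symmetric])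
    also have "\<dots> = (transpose (matrix h') ** gram \<psi>2 y ** matrix h') $ i $ j"
      unfolding Dh mat_inner_eq_inner gram_def matrix_matrix_mult_def transpose_def
      by (simp add: inner_sum_left inner_sum_right sum_divide_distrib sum_distrib_left sum_distrib_right mult_ac)
    finally show "gram \<psi>1 x $ i $ j = (transpose (matrix h') ** gram \<psi>2 y ** matrix h') $ i $ j" .
  qed
  then have "det (gram \<psi>1 x) = (det (matrix h'))\<^sup>2 * det (gram \<psi>2 y)"
    by (simp add: det_mul det_transpose power2_eq_square)
  then show ?thesis by (simp add: vol_density_def real_sqrt_mult)
qed

text \<open>The transition map \<open>h\<close> is first known only as a homeomorphism, from the
  inverse of the second chart. It is differentiable because the two lifts agree up to a locally
  constant sign and the injective derivative of the second one has a left inverse. The Gram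
  determinants then match the Jacobian in the change of variables.\<close>

lemma transition_volume:
  assumes 1: "local_param M W1 \<psi>1" and 2: "local_param M W2 \<psi>2"
    and B: "B \<in> sets (restrict_space borel M)" "B \<subseteq> chart \<psi>1 ` W1" "B \<subseteq> chart \<psi>2 ` W2"
  shows "(\<integral>\<^sup>+x. ennreal (vol_density \<psi>1 x) * indicator {x\<in>W1. chart \<psi>1 x \<in> B} x \<partial>lborel)
       = (\<integral>\<^sup>+x. ennreal (vol_density \<psi>2 x) * indicator {x\<in>W2. chart \<psi>2 x \<in> B} x \<partial>lborel)"
proof -
  let ?S1 = "{x\<in>W1. chart \<psi>1 x \<in> B}" and ?S2 = "{x\<in>W2. chart \<psi>2 x \<in> B}"
  have S1: "?S1 \<in> sets borel" and S2: "?S2 \<in> sets borel"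
    by (rule local_param_vimage_borel[OF 1 B(1)], rule local_param_vimage_borel[OF 2 B(1)])
  obtain g where g: "homeomorphism W2 (chart \<psi>2 ` W2) (chart \<psi>2) g"
    using 2 by (auto simp: local_param_def)
  define h where "h x = g (chart \<psi>1 x)" for x
  obtain T where T: "open T" "chart \<psi>2 ` W2 = M \<inter> T" by (rule local_param_image[OF 2])
  define U where "U = W1 \<inter> chart \<psi>1 -` T"
  have U: "open U" unfolding U_def
    using local_paramD(9,1)[OF 1] T(1) by (rule continuous_open_preimage)
  have UW: "U \<subseteq> W1" by (auto simp: U_def)
  have Uc: "chart \<psi>1 x \<in> chart \<psi>2 ` W2" if "x \<in> U" for x
    using that local_paramD(7)[OF 1] T(2) by (auto simp: U_def)
  have hU: "h x \<in> W2" "chart \<psi>2 (h x) = chart \<psi>1 x" if "x \<in> U" for x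
    using g Uc[OF that] unfolding h_def homeomorphism_def by auto
  have hc: "continuous_on U h"
    unfolding h_def
    by (rule continuous_on_compose2[of "chart \<psi>2 ` W2" g])
       (use g Uc continuous_on_subset[OF local_paramD(9)[OF 1] UW] in \<open>auto simp: homeomorphism_def\<close>)
  have S1U: "?S1 \<subseteq> U" using B(3) T(2) by (auto simp: U_def)
  have hinj: "inj_on h U"
    using hU(2) local_paramD(10)[OF 1] UW by (auto simp: inj_on_def) (metis subsetD)
  have im: "h ` ?S1 = ?S2"
  proof
    show "h ` ?S1 \<subseteq> ?S2" using S1U hU by auto
    show "?S2 \<subseteq> h ` ?S1"
    proof
      fix y assume y: "y \<in> ?S2"
      then obtain x where x: "x \<in> W1" "chart \<psi>1 x = chart \<psi>2 y" using B(2) by force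
      then have "h x = y" using g y by (auto simp: h_def homeomorphism_def)
      then show "y \<in> h ` ?S1" using x y by force
    qed
  qed
  have key: "\<exists>h'. (h has_derivative h') (at a) \<and> vol_density \<psi>1 a = \<bar>det (matrix h')\<bar> * vol_density \<psi>2 (h a)"
    if a: "a \<in> U" for a
  proof -
    let ?D1 = "frechet_derivative \<psi>1 (at a)" and ?D2 = "frechet_derivative \<psi>2 (at (h a))"
    \<comment> \<open>Both lifts are unit vectors on one line. The continuous function
      \<open>s\<close> takes the values 1 and -1 only, so it equals \<open>s a\<close> near
      \<open>a\<close>.\<close>
    define s where "s x = mat_inner (\<psi>2 (h x)) (\<psi>1 x)" for x
    have u: "mat_inner (\<psi>1 x) (\<psi>1 x) = 1" "mat_inner (\<psi>2 (h x)) (\<psi>2 (h x)) = 1"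
      "chart \<psi>1 x = chart \<psi>2 (h x)" if "x \<in> U" for x
      using that hU[OF that] UW local_paramD(5)[OF 1] local_paramD(5)[OF 2] by auto
    have s: "\<psi>2 (h x) = s x *\<^sub>R \<psi>1 x" "s x = 1 \<or> s x = -1" if "x \<in> U" for x
      unfolding s_def using unit_proj_pt_eq[OF u[OF that]] by simp_all
    have "continuous_on U s"
      unfolding s_def mat_inner_eq_inner
      by (intro continuous_intros continuous_on_compose2[OF local_paramD(8)[OF 2] hc]
          continuous_on_subset[OF local_paramD(8)[OF 1] UW]) (auto simp: hU)
    then have "isCont s a" using U a continuous_on_eq_continuous_at by blast
    then have "\<forall>\<^sub>F x in at a. dist (s x) (s a) < 1"
      unfolding isCont_def by (rule tendstoD) simp
    moreover have "\<forall>\<^sub>F x in at a. x \<in> U" using U a by (rule eventually_at_in_open')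
    ultimately have ev: "\<forall>\<^sub>F x in at a. \<psi>2 (h x) = s a *\<^sub>R \<psi>1 x"
    proof eventually_elim
      case (elim x)
      then have "s x = s a" using s(2)[of x] s(2)[OF a] by (auto simp: dist_real_def)
      then show ?case using s(1)[of x] elim by simp
    qed
    have d2: "(\<psi>2 has_derivative ?D2) (at (h a))" using local_paramD(2)[OF 2] hU(1)[OF a] .
    have d1: "(\<psi>1 has_derivative ?D1) (at a)" using local_paramD(2)[OF 1] a UW by blast
    have l2: "linear ?D2" using d2 by (rule has_derivative_linear)
    obtain L where L: "linear L" "L \<circ> ?D2 = id"
      using linear_injective_left_inverse[OF l2] local_paramD(4)[OF 2] hU(1)[OF a] by blast
    define h' where "h' v = L (s a *\<^sub>R ?D1 v)" for v
    have hd: "(h has_derivative h') (at a)"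
      unfolding h'_def
    proof (rule has_derivative_lift[OF d2 L(1) _ _ _ ev s(1)[OF a]])
      show "L (?D2 v) = v" for v using L(2) by (metis comp_apply id_apply)
      show "isCont h a" using hc U a continuous_on_eq_continuous_at by blast
      show "((\<lambda>x. s a *\<^sub>R \<psi>1 x) has_derivative (\<lambda>v. s a *\<^sub>R ?D1 v)) (at a)"
        by (intro derivative_intros d1)
    qed
    have dc: "((\<lambda>x. s a *\<^sub>R \<psi>2 (h x)) has_derivative (\<lambda>v. s a *\<^sub>R ?D2 (h' v))) (at a)"
      using has_derivative_compose[OF hd d2] by (intro derivative_intros)
    obtain d where d: "d > 0" "\<And>x. x \<noteq> a \<Longrightarrow> dist x a < d \<Longrightarrow> \<psi>2 (h x) = s a *\<^sub>R \<psi>1 x"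
      using ev unfolding eventually_at by blast
    have e1: "s a *\<^sub>R \<psi>2 (h x) = \<psi>1 x" if "dist x a < d" for x
    proof -
      have "\<psi>2 (h x) = s a *\<^sub>R \<psi>1 x" using d(2)[of x] that s(1)[OF a] by (cases "x = a") auto
      then show ?thesis using s(2)[OF a] by auto
    qed
    have "(\<psi>1 has_derivative (\<lambda>v. s a *\<^sub>R ?D2 (h' v))) (at a)"
      by (rule has_derivative_transform_within[OF dc d(1)]) (auto intro: e1)
    then have D1: "?D1 = (\<lambda>v. s a *\<^sub>R ?D2 (h' v))" by (rule has_derivative_unique[OF d1])
    have ss: "s a * s a = 1" using s(2)[OF a] by auto
    have "vol_density \<psi>1 a = \<bar>det (matrix h')\<bar> * vol_density \<psi>2 (h a)"
      by (rule gram_compose[OF has_derivative_linear[OF hd] l2 _ ss]) (simp only: D1)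
    then show ?thesis using hd by blast
  qed
  then obtain h' where h': "\<And>a. a \<in> U \<Longrightarrow> (h has_derivative h' a) (at a)"
    "\<And>a. a \<in> U \<Longrightarrow> vol_density \<psi>1 a = \<bar>det (matrix (h' a))\<bar> * vol_density \<psi>2 (h a)" by metis
  have "(\<integral>\<^sup>+x. ennreal (vol_density \<psi>2 x) * indicator ?S2 x \<partial>lborel)
      = (\<integral>\<^sup>+y. (ennreal (vol_density \<psi>2 y) * indicator ?S2 y) * indicator (h ` ?S1) y \<partial>lebesgue)"
    unfolding nn_integral_completion im by (intro nn_integral_cong) (auto simp: indicator_def)
  also have "\<dots> = (\<integral>\<^sup>+x. (ennreal (vol_density \<psi>2 (h x)) * indicator ?S2 (h x)) * ennreal \<bar>det (matrix (h' x))\<bar> * indicator ?S1 x \<partial>lebesgue)"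
    using S1 S1U h'(1) by (intro nn_integral_differentiable_image measurable_vol_density[OF 2 S2] inj_on_subset[OF hinj S1U])
      (auto intro: has_derivative_at_withinI)
  also have "\<dots> = (\<integral>\<^sup>+x. ennreal (vol_density \<psi>1 x) * indicator ?S1 x \<partial>lborel)"
    unfolding nn_integral_completion
  proof (intro nn_integral_cong)
    fix x
    show "(ennreal (vol_density \<psi>2 (h x)) * indicator ?S2 (h x)) * ennreal \<bar>det (matrix (h' x))\<bar> * indicator ?S1 x
        = ennreal (vol_density \<psi>1 x) * indicator ?S1 x"
    proof (cases "x \<in> ?S1")
      case True
      then have "h x \<in> ?S2" using im by blast
      then show ?thesis using True S1U h'(2)[of x]
        by (auto simp: subset_iff ennreal_mult'' mult.commute)
    qed simp
  qed
  finally show ?thesis ..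
qed

text \<open>A finite atlas is disjointified into the pieces \<open>atlas_piece\<close>; \<open>atlas_dom\<close> are their
  preimages under the charts.\<close>

definition atlas_piece :: "(nat \<Rightarrow> (real^5) set) \<Rightarrow> (nat \<Rightarrow> real^5 \<Rightarrow> real^3^3) \<Rightarrow> nat \<Rightarrow> (real^3^3) proj_space set" where
  "atlas_piece W \<psi> k = chart (\<psi> k) ` W k - (\<Union>j<k. chart (\<psi> j) ` W j)"

definition atlas_dom :: "(nat \<Rightarrow> (real^5) set) \<Rightarrow> (nat \<Rightarrow> real^5 \<Rightarrow> real^3^3) \<Rightarrow> nat \<Rightarrow> (real^5) set" where
  "atlas_dom W \<psi> k = {x\<in>W k. chart (\<psi> k) x \<in> atlas_piece W \<psi> k}"

locale atlas =
  fixes M :: "(real^3^3) proj_space set" and n :: nat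
    and W :: "nat \<Rightarrow> (real^5) set" and \<psi> :: "nat \<Rightarrow> real^5 \<Rightarrow> real^3^3"
  assumes param: "\<And>k. k < n \<Longrightarrow> local_param M (W k) (\<psi> k)"
    and cover: "M = (\<Union>k<n. chart (\<psi> k) ` W k)"
    and nonempty: "M \<noteq> {}"
begin

abbreviation "SM \<equiv> restrict_space borel M"
abbreviation "piece \<equiv> atlas_piece W \<psi>"
abbreviation "pdom \<equiv> atlas_dom W \<psi>"

lemma space_SM: "space SM = M" by (simp add: space_restrict_space)

lemma piece_sets: "k < n \<Longrightarrow> piece k \<in> sets SM"
  unfolding atlas_piece_def
  by (intro sets.Diff sets.finite_UN local_param_image_sets param) auto

lemma dom_borel: "k < n \<Longrightarrow> pdom k \<in> sets borel"
  unfolding atlas_dom_def by (intro local_param_vimage_borel[OF param piece_sets]) auto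

lemma dom_subset: "pdom k \<subseteq> W k"
  by (auto simp: atlas_dom_def)

lemma piece_eq: "piece k = chart (\<psi> k) ` pdom k"
  by (auto simp: atlas_dom_def atlas_piece_def)

lemma piece_disjoint: "disjoint_family_on piece {..<n}"
proof -
  have "piece j \<inter> piece k = {}" if "j < k" for j k
    using that unfolding atlas_piece_def by blast
  then show ?thesis
    unfolding disjoint_family_on_def by (metis Int_commute nat_neq_iff)
qed

lemma piece_cover: "(\<Union>k<n. piece k) = M"
proof
  show "(\<Union>k<n. piece k) \<subseteq> M" unfolding cover atlas_piece_def by auto
  show "M \<subseteq> (\<Union>k<n. piece k)"
  proof
    fix E assume "E \<in> M"
    then obtain k where k: "k < n" "E \<in> chart (\<psi> k) ` W k" using cover by blast
    define j where "j = (LEAST j. E \<in> chart (\<psi> j) ` W j)"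
    have "E \<in> chart (\<psi> j) ` W j" unfolding j_def using k(2) by (rule LeastI)
    moreover have "j \<le> k" unfolding j_def using k(2) by (rule Least_le)
    moreover have "\<And>i. i < j \<Longrightarrow> E \<notin> chart (\<psi> i) ` W i" unfolding j_def by (rule not_less_Least)
    ultimately show "E \<in> (\<Union>k<n. piece k)" using k(1) by (auto simp: atlas_piece_def intro!: bexI[of _ j])
  qed
qed

text \<open>The images of the earlier charts are relatively open in \<open>M\<close>, so the domain
  is an open set minus an open set. This is the form that the measurability of the solution count
  asks for.\<close>

lemma fsigma_dom: "k < n \<Longrightarrow> fsigma (pdom k)"
proof -
  assume k: "k < n"
  have "\<exists>T. open T \<and> chart (\<psi> j) ` W j = M \<inter> T" if "j < n" for j
    using local_param_image[OF param[OF that]] by metis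
  then obtain T where T: "\<And>j. j < n \<Longrightarrow> open (T j)" "\<And>j. j < n \<Longrightarrow> chart (\<psi> j) ` W j = M \<inter> T j" by metis
  let ?O = "W k \<inter> chart (\<psi> k) -` (\<Union>j<k. T j)"
  have W: "open (W k)" using local_paramD(1)[OF param[OF k]] .
  have "open ?O"
    by (rule continuous_open_preimage[OF local_paramD(9)[OF param[OF k]] W]) (use T k in auto)
  then have "closed (- ?O)" by (rule closed_Compl)
  then have "fsigma (W k \<inter> - ?O)"
    using W by (intro fsigma_Int fsigma_open fsigma_closed)
  moreover have "pdom k = W k \<inter> - ?O"
    using local_paramD(7)[OF param[OF k]] T(2) k unfolding atlas_dom_def atlas_piece_def by force
  ultimately show ?thesis by simp
qed

text \<open>The sum over the charts is written as one image measure on the disjoint union of copies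
  of the coordinate space. The density vanishes outside the domains, so the arbitrary point of
  \<open>M\<close> used there carries no mass.\<close>

definition vol :: "(real^3^3) proj_space measure" where
  "vol = distr (density (count_space {..<n} \<Otimes>\<^sub>M lborel)
      (\<lambda>(k, x). ennreal (vol_density (\<psi> k) x) * indicator (pdom k) x)) SM
      (\<lambda>(k, x). if x \<in> pdom k then chart (\<psi> k) x else (SOME E. E \<in> M))"

lemma nn_integral_vol:
  assumes f: "f \<in> borel_measurable SM"
  shows "(\<integral>\<^sup>+E. f E \<partial>vol)
    = (\<Sum>k<n. \<integral>\<^sup>+x. f (chart (\<psi> k) x) * (ennreal (vol_density (\<psi> k) x) * indicator (pdom k) x) \<partial>lborel)"
proof -
  let ?P = "count_space {..<n} \<Otimes>\<^sub>M (lborel :: (real^5) measure)"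
  let ?d = "\<lambda>(k, x). ennreal (vol_density (\<psi> k) x) * indicator (pdom k) x"
  let ?g = "\<lambda>(k, x). if x \<in> pdom k then chart (\<psi> k) x else (SOME E. E \<in> M)"
  have dm: "?d \<in> borel_measurable ?P"
    by (rule measurable_pair_measure_countable1)
       (auto intro!: measurable_vol_density[OF param dom_borel dom_subset])
  have gm: "?g \<in> measurable ?P SM"
  proof (rule measurable_pair_measure_countable1)
    fix k assume "k \<in> {..<n}"
    then have k: "k < n" by simp
    have "(SOME E. E \<in> M) \<in> space SM" using nonempty by (simp add: space_SM some_in_eq)
    moreover have "chart (\<psi> k) \<in> measurable (restrict_space borel (pdom k)) SM"
      using continuous_on_subset[OF local_paramD(9)[OF param[OF k]] dom_subset[of k]]
        local_paramD(7)[OF param[OF k]] dom_subset[of k]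
      by (intro measurable_restrict_space2 borel_measurable_continuous_on_restrict) (auto simp: space_restrict_space)
    ultimately show "(\<lambda>x. ?g (k, x)) \<in> measurable lborel SM"
      using dom_borel[OF k] by (simp, subst measurable_If_restrict_space_iff) (auto simp: Compl_eq)
  qed simp
  have fg: "(\<lambda>z. f (?g z)) \<in> borel_measurable ?P" by (rule measurable_compose[OF gm f])
  have "(\<integral>\<^sup>+E. f E \<partial>vol) = (\<integral>\<^sup>+z. ?d z * f (?g z) \<partial>?P)"
    unfolding vol_def using gm f fg dm
    by (subst nn_integral_distr) (simp_all add: nn_integral_density)
  also have "\<dots> = (\<integral>\<^sup>+k. \<integral>\<^sup>+x. ?d (k, x) * f (?g (k, x)) \<partial>lborel \<partial>count_space {..<n})"
    using dm fg by (intro lborel.nn_integral_fst[symmetric]) auto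
  also have "\<dots> = (\<Sum>k<n. \<integral>\<^sup>+x. ?d (k, x) * f (?g (k, x)) \<partial>lborel)"
    by (simp add: nn_integral_count_space_finite)
  also have "\<dots> = (\<Sum>k<n. \<integral>\<^sup>+x. f (chart (\<psi> k) x) * (ennreal (vol_density (\<psi> k) x) * indicator (pdom k) x) \<partial>lborel)"
    by (intro sum.cong refl nn_integral_cong) (auto simp: indicator_def mult.commute)
  finally show ?thesis .
qed

lemma sets_vol: "sets vol = sets SM" by (simp add: vol_def)

lemma emeasure_vol:
  assumes B: "B \<in> sets SM"
  shows "emeasure vol B
    = (\<Sum>k<n. \<integral>\<^sup>+x. ennreal (vol_density (\<psi> k) x) * indicator {x\<in>W k. chart (\<psi> k) x \<in> B \<inter> piece k} x \<partial>lborel)"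
proof -
  have "emeasure vol B = (\<integral>\<^sup>+E. indicator B E \<partial>vol)" using B by (simp add: sets_vol)
  also have "\<dots> = (\<Sum>k<n. \<integral>\<^sup>+x. indicator B (chart (\<psi> k) x) * (ennreal (vol_density (\<psi> k) x) * indicator (pdom k) x) \<partial>lborel)"
    using B by (intro nn_integral_vol) simp
  also have "\<dots> = (\<Sum>k<n. \<integral>\<^sup>+x. ennreal (vol_density (\<psi> k) x) * indicator {x\<in>W k. chart (\<psi> k) x \<in> B \<inter> piece k} x \<partial>lborel)"
    by (intro sum.cong refl nn_integral_cong) (auto simp: indicator_def atlas_dom_def)
  finally show ?thesis .
qed

lemma chart_integral_split:
  assumes p: "local_param M X \<phi>" and B: "B \<in> sets SM"
  shows "(\<integral>\<^sup>+x. ennreal (vol_density \<phi> x) * indicator {x\<in>X. chart \<phi> x \<in> B} x \<partial>lborel)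
    = (\<Sum>k<n. \<integral>\<^sup>+x. ennreal (vol_density \<phi> x) * indicator {x\<in>X. chart \<phi> x \<in> B \<inter> piece k} x \<partial>lborel)"
proof -
  have BM: "B \<subseteq> M" using sets.sets_into_space[OF B] by (simp add: space_SM)
  have "indicator {x\<in>X. chart \<phi> x \<in> B} x = (\<Sum>k<n. indicator {x\<in>X. chart \<phi> x \<in> B \<inter> piece k} x :: ennreal)" for x
  proof (cases "x \<in> X \<and> chart \<phi> x \<in> B")
    case True
    then obtain k where k: "k < n" "chart \<phi> x \<in> piece k" using BM piece_cover by blast
    have "(\<Sum>j<n. indicator {x\<in>X. chart \<phi> x \<in> B \<inter> piece j} x :: ennreal)
        = (\<Sum>j<n. if j = k then 1 else 0)"
      using True k piece_disjoint by (intro sum.cong refl) (auto simp: indicator_def disjoint_family_on_def)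
    then show ?thesis using True k by simp
  qed (auto simp: indicator_def)
  then have "(\<integral>\<^sup>+x. ennreal (vol_density \<phi> x) * indicator {x\<in>X. chart \<phi> x \<in> B} x \<partial>lborel)
      = (\<integral>\<^sup>+x. (\<Sum>k<n. ennreal (vol_density \<phi> x) * indicator {x\<in>X. chart \<phi> x \<in> B \<inter> piece k} x) \<partial>lborel)"
    by (simp add: sum_distrib_left)
  also have "\<dots> = (\<Sum>k<n. \<integral>\<^sup>+x. ennreal (vol_density \<phi> x) * indicator {x\<in>X. chart \<phi> x \<in> B \<inter> piece k} x \<partial>lborel)"
    using local_param_vimage_borel[OF p sets.Int[OF B piece_sets]]
    by (intro nn_integral_sum) (auto intro!: measurable_vol_density[OF p] simp del: Int_iff)
  finally show ?thesis .
qed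

text \<open>On each piece the arbitrary parametrization is compared with the chart of the atlas that
  covers this piece.\<close>

lemma vol_chart:
  assumes p: "local_param M X \<phi>" and B: "B \<in> sets SM" "B \<subseteq> chart \<phi> ` X"
  shows "emeasure vol B = (\<integral>\<^sup>+x. ennreal (vol_density \<phi> x) * indicator {x\<in>X. chart \<phi> x \<in> B} x \<partial>lborel)"
proof -
  have "(\<integral>\<^sup>+x. ennreal (vol_density (\<psi> k) x) * indicator {x\<in>W k. chart (\<psi> k) x \<in> B \<inter> piece k} x \<partial>lborel)
      = (\<integral>\<^sup>+x. ennreal (vol_density \<phi> x) * indicator {x\<in>X. chart \<phi> x \<in> B \<inter> piece k} x \<partial>lborel)" if k: "k < n" for k
    using B piece_sets[OF k] by (intro transition_volume[OF param[OF k] p]) (auto simp: atlas_piece_def)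
  then show ?thesis
    unfolding emeasure_vol[OF B(1)] chart_integral_split[OF p B(1)] by (intro sum.cong) auto
qed

text \<open>Existence is the preceding lemma. For uniqueness, a measure with the prescribed values
  in all charts is determined on subsets of a single piece, and finitely many pieces partition
  \<open>M\<close>.\<close>

lemma riemannian_volume_eq: "riemannian_volume M = vol"
  unfolding riemannian_volume_def
proof (rule the_equality, intro conjI allI impI ballI)
  show "sets vol = sets SM" by (rule sets_vol)
  fix X \<phi> B assume "local_param M X \<phi>" "B \<in> sets vol" "B \<subseteq> chart \<phi> ` X"
  then show "emeasure vol B = (\<integral>\<^sup>+x\<in>{x\<in>X. chart \<phi> x \<in> B}. ennreal (sqrt (det (gram \<phi> x))) \<partial>lborel)"
    using vol_chart[of X \<phi> B] by (simp add: sets_vol vol_density_def)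
next
  fix \<nu> assume \<nu>: "sets \<nu> = sets SM \<and> (\<forall>X \<phi>. local_param M X \<phi> \<longrightarrow>
      (\<forall>B\<in>sets \<nu>. B \<subseteq> chart \<phi> ` X \<longrightarrow>
        emeasure \<nu> B = (\<integral>\<^sup>+x\<in>{x\<in>X. chart \<phi> x \<in> B}. ennreal (sqrt (det (gram \<phi> x))) \<partial>lborel)))"
  show "\<nu> = vol"
  proof (rule measure_eqI)
    show "sets \<nu> = sets vol" using \<nu> by (simp add: sets_vol)
    fix B assume "B \<in> sets \<nu>"
    then have B: "B \<in> sets SM" using \<nu> by simp
    then have "B \<subseteq> M" using sets.sets_into_space by (metis space_SM)
    then have "emeasure \<nu> B = emeasure \<nu> (\<Union>k<n. B \<inter> piece k)"
      using piece_cover by (intro arg_cong2[where f=emeasure]) auto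
    also have "\<dots> = (\<Sum>k<n. emeasure \<nu> (B \<inter> piece k))"
      using \<nu> B piece_sets piece_disjoint
      by (intro sum_emeasure[symmetric]) (auto simp: disjoint_family_on_def)
    also have "\<dots> = (\<Sum>k<n. \<integral>\<^sup>+x. ennreal (vol_density (\<psi> k) x) * indicator {x\<in>W k. chart (\<psi> k) x \<in> B \<inter> piece k} x \<partial>lborel)"
    proof (intro sum.cong refl)
      fix k assume "k \<in> {..<n}"
      then have k: "k < n" by simp
      have "B \<inter> piece k \<in> sets \<nu>" "B \<inter> piece k \<subseteq> chart (\<psi> k) ` W k"
        using \<nu> B piece_sets[OF k] by (auto simp: atlas_piece_def)
      then show "emeasure \<nu> (B \<inter> piece k) = (\<integral>\<^sup>+x. ennreal (vol_density (\<psi> k) x) * indicator {x\<in>W k. chart (\<psi> k) x \<in> B \<inter> piece k} x \<partial>lborel)"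
        using \<nu> param[OF k] unfolding vol_density_def by blast
    qed
    also have "\<dots> = emeasure vol B" using emeasure_vol[OF B] ..
    finally show "emeasure \<nu> B = emeasure vol B" .
  qed
qed

end

section \<open>The essential variety\<close>

lemma rotation_matrix_orthogonal: "rotation_matrix A \<Longrightarrow> orthogonal_matrix A"
  by (simp add: rotation_matrix_def)

lemma rotation_matrix_mul: "rotation_matrix A \<Longrightarrow> rotation_matrix B \<Longrightarrow> rotation_matrix (A ** B)"
  for A B :: "real^'n^'n"
  by (simp add: rotation_matrix_def orthogonal_matrix_mul det_mul)

lemma rotation_matrix_transpose: "rotation_matrix (transpose A) \<longleftrightarrow> rotation_matrix A"
  by (simp add: rotation_matrix_def orthogonal_matrix_transpose det_transpose)

lemma rotation_matrix_mat_1: "rotation_matrix (mat 1)"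
  by (simp add: rotation_matrix_def orthogonal_matrix_id)

lemma orthogonal_matrix_cancel:
  fixes A B :: "real^'n^'n"
  assumes "orthogonal_matrix A"
  shows "transpose A ** A = mat 1" "A ** transpose A = mat 1"
    "transpose A ** (A ** B) = B" "A ** (transpose A ** B) = B"
    "B ** transpose A ** A = B" "B ** A ** transpose A = B"
    "transpose A *v (A *v x) = x" "A *v (transpose A *v x) = x"
proof -
  show *: "transpose A ** A = mat 1" "A ** transpose A = mat 1"
    using assms by (auto simp: orthogonal_matrix_def)
  show "transpose A ** (A ** B) = B" "A ** (transpose A ** B) = B"
    using * by (simp_all add: matrix_mul_assoc)
  show "B ** transpose A ** A = B" "B ** A ** transpose A = B"
    using * by (simp_all add: matrix_mul_assoc[symmetric])
  show "transpose A *v (A *v x) = x" "A *v (transpose A *v x) = x"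
    using * by (simp_all only: matrix_vector_mul_assoc matrix_vector_mul_lid)
qed

lemma matrix_scaleR_left: "(c *\<^sub>R A) ** B = c *\<^sub>R (A ** B)"
  and matrix_scaleR_right: "A ** (c *\<^sub>R B) = c *\<^sub>R (A ** B)" for A B :: "real^'n^'n"
  by (simp_all add: scalar_matrix_assoc matrix_scalar_ac)

lemma matrix_minus_left: "(- A) ** B = - (A ** B)" for A B :: "real^'n^'n"
  using matrix_scaleR_left[of "-1" A B] by simp

lemma transpose_scaleR: "transpose (c *\<^sub>R A) = c *\<^sub>R transpose A" for A :: "real^'n^'n"
  by (simp add: vec_eq_iff transpose_def)

lemma cross_matrix_vec: "cross_matrix t *v x = cross3 t x"
  unfolding cross_matrix_def
  using bilinear_cross[unfolded bilinear_def] by (simp add: matrix_works)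

lemma E0_eq: "E0 = cross_matrix (axis 1 1)"
  by (simp add: E0_def ess_matrix_def)

lemma E0_vec: "E0 *v x = cross3 (axis 1 1) x"
  by (simp add: E0_eq cross_matrix_vec)

lemma E0_entries:
  "E0 = vector [vector [0, 0, 0], vector [0, 0, -1], vector [0, 1, 0]]"
  by (simp add: E0_eq cross_matrix_def matrix_def vec_eq_iff forall_3 cross3_def axis_def)

lemma transpose_E0: "transpose E0 = - E0"
  by (simp add: E0_entries transpose_def vec_eq_iff forall_3)

lemma cross_matrix_rotate:
  assumes "rotation_matrix A"
  shows "cross_matrix (A *v t) ** A = A ** cross_matrix t"
  unfolding matrix_eq
  by (simp add: matrix_vector_mul_assoc[symmetric] cross_matrix_vec cross_rotation_matrix[OF assms])

definition ess_rot :: "real^3^3 \<Rightarrow> real^3^3 \<Rightarrow> real^3^3" where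
  "ess_rot A B = A ** E0 ** transpose B"

lemma ess_rot_eq_ess_matrix:
  assumes "rotation_matrix A" "rotation_matrix B"
  shows "ess_rot A B = ess_matrix (A ** transpose B) (A *v axis 1 1)"
  unfolding ess_rot_def ess_matrix_def E0_eq
  by (simp add: cross_matrix_rotate[OF assms(1), symmetric] matrix_mul_assoc)

text \<open>\<open>E0\<close> is a partial isometry, its nonzero singular values being 1, and
  orthogonal factors preserve this. On unit representatives the equation is a relation among matrix
  entries that can be differentiated, and it yields the tangent spaces.\<close>

lemma ess_rot_cubic:
  assumes "orthogonal_matrix A" "orthogonal_matrix B"
  shows "ess_rot A B ** transpose (ess_rot A B) ** ess_rot A B = ess_rot A B"
proof -
  have c: "E0 ** transpose E0 ** E0 = E0"
    by (simp add: E0_entries transpose_def vec_eq_iff forall_3 matrix_matrix_mult_def sum_3)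
  have "ess_rot A B ** transpose (ess_rot A B) ** ess_rot A B
      = A ** (E0 ** (transpose B ** B) ** transpose E0 ** (transpose A ** A) ** E0) ** transpose B"
    by (simp add: ess_rot_def matrix_transpose_mul matrix_mul_assoc transpose_transpose)
  then show ?thesis
    by (simp add: orthogonal_matrix_cancel[OF assms(1)] orthogonal_matrix_cancel[OF assms(2)] c ess_rot_def)
qed

lemma mat_inner_rotate:
  assumes "orthogonal_matrix A" "orthogonal_matrix B"
  shows "mat_inner (A ** X ** transpose B) (A ** Y ** transpose B) = mat_inner X Y"
proof -
  have "A ** X ** transpose B ** transpose (A ** Y ** transpose B)
      = A ** X ** (transpose B ** B) ** transpose Y ** transpose A"
    by (simp add: matrix_transpose_mul matrix_mul_assoc)
  also have "\<dots> = A ** (X ** transpose Y ** transpose A)"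
    by (simp add: orthogonal_matrix_cancel[OF assms(2)] matrix_mul_assoc)
  finally have "trace (A ** X ** transpose B ** transpose (A ** Y ** transpose B))
      = trace (X ** transpose Y ** transpose A ** A)"
    by (metis trace_mul_sym)
  then show ?thesis
    by (simp add: mat_inner_def orthogonal_matrix_cancel[OF assms(1)])
qed

lemma mat_inner_E0: "mat_inner E0 E0 = 1"
  by (simp add: mat_inner_eq_inner E0_entries inner_vec_def sum_3)

lemma mat_inner_ess_rot:
  assumes "orthogonal_matrix A" "orthogonal_matrix B"
  shows "mat_inner (ess_rot A B) (ess_rot A B) = 1"
  unfolding ess_rot_def mat_inner_rotate[OF assms] by (rule mat_inner_E0)

lemma unit_nonzero: "mat_inner A A = 1 \<Longrightarrow> A \<noteq> 0"
  by (auto simp: mat_inner_eq_inner)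

lemma ess_rot_nonzero:
  "orthogonal_matrix A \<Longrightarrow> orthogonal_matrix B \<Longrightarrow> ess_rot A B \<noteq> 0"
  by (rule unit_nonzero[OF mat_inner_ess_rot])

text \<open>For a unit vector t choose a rotation A with A e_1 = t. Then [t]_x A = A [e_1]_x, so
  [t]_x R = A E_0 (R^T A)^T; this explains the choice of \<open>?B\<close>.\<close>

lemma ess_variety_eq:
  "ess_variety = {proj_pt (ess_rot A B) | A B. rotation_matrix A \<and> rotation_matrix B}"
proof (intro equalityI subsetI)
  fix l assume "l \<in> ess_variety"
  then obtain R t where Rt: "rotation_matrix R" "ess_matrix R t \<noteq> 0" "l = proj_pt (ess_matrix R t)"
    unfolding ess_variety_def ess_cone_def by blast
  have "t \<noteq> 0"
  proof
    assume "t = 0"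
    have "cross_matrix 0 = 0"
      by (simp add: cross_matrix_def matrix_def vec_eq_iff)
    with \<open>t = 0\<close> have "cross_matrix t = 0" by simp
    then show False using Rt(2) by (simp add: ess_matrix_def)
  qed
  then have n: "norm (t /\<^sub>R norm t) = 1" by simp
  have c2: "2 \<le> CARD(3)" by simp
  obtain A :: "real^3^3" where A: "rotation_matrix A" "A *v axis 1 1 = t /\<^sub>R norm t"
    using rotation_matrix_exists_basis[OF c2 n] by metis
  let ?B = "transpose R ** A"
  have B: "rotation_matrix ?B"
    using A(1) Rt(1) by (simp add: rotation_matrix_mul rotation_matrix_transpose)
  have "A ** transpose ?B = R"
    using orthogonal_matrix_cancel[OF rotation_matrix_orthogonal[OF A(1)]]
    by (simp add: matrix_transpose_mul matrix_mul_assoc)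
  then have "ess_rot A ?B = ess_matrix R (t /\<^sub>R norm t)"
    using ess_rot_eq_ess_matrix[OF A(1) B] A(2) by simp
  also have "\<dots> = (1 / norm t) *\<^sub>R ess_matrix R t"
    unfolding matrix_eq ess_matrix_def
    by (simp add: matrix_vector_mul_assoc[symmetric] cross_matrix_vec cross_mult_left scaleR_matrix_vector_assoc[symmetric] divide_inverse)
  finally have "proj_pt (ess_rot A ?B) = l"
    using \<open>t \<noteq> 0\<close> Rt(3) by simp
  then show "l \<in> {proj_pt (ess_rot A B) | A B. rotation_matrix A \<and> rotation_matrix B}"
    using A(1) B by blast
next
  fix l assume "l \<in> {proj_pt (ess_rot A B) | A B. rotation_matrix A \<and> rotation_matrix B}"
  then obtain A B where AB: "rotation_matrix A" "rotation_matrix B" "l = proj_pt (ess_rot A B)" by blast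
  then have "ess_rot A B \<in> ess_cone - {0}"
    using ess_rot_eq_ess_matrix[OF AB(1,2)] ess_rot_nonzero[of A B]
    by (auto simp: ess_cone_def rotation_matrix_mul rotation_matrix_transpose rotation_matrix_orthogonal)
  then show "l \<in> ess_variety" using AB(3) by (auto simp: ess_variety_def)
qed

text \<open>A unit representative equals some \<open>ess_rot A B\<close> up to sign, and the
  equation is odd.\<close>

lemma ess_variety_unit_cubic:
  assumes "mat_inner E E = 1" "proj_pt E \<in> ess_variety"
  shows "E ** transpose E ** E = E"
proof -
  obtain A B where AB: "rotation_matrix A" "rotation_matrix B" "proj_pt E = proj_pt (ess_rot A B)"
    using assms(2) by (auto simp: ess_variety_eq)
  note o = AB(1,2)[THEN rotation_matrix_orthogonal]
  have "E = mat_inner E (ess_rot A B) *\<^sub>R ess_rot A B" "mat_inner E (ess_rot A B) = 1 \<or> mat_inner E (ess_rot A B) = -1"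
    using unit_proj_pt_eq[OF mat_inner_ess_rot[OF o] assms(1) AB(3)[symmetric]] by auto
  then obtain c where c: "E = c *\<^sub>R ess_rot A B" "c = 1 \<or> c = -1" by metis
  then show ?thesis
    using ess_rot_cubic[OF o] by (auto simp: transpose_scaleR matrix_scaleR_left matrix_scaleR_right)
qed

lemma continuous_on_matrix_mult [continuous_intros]:
  fixes f g :: "'a::topological_space \<Rightarrow> real^'n^'n"
  assumes "continuous_on S f" "continuous_on S g"
  shows "continuous_on S (\<lambda>x. f x ** g x)"
  unfolding matrix_matrix_mult_def by (intro continuous_intros assms)

lemma continuous_on_transpose [continuous_intros]:
  fixes f :: "'a::topological_space \<Rightarrow> real^'n^'n"
  assumes "continuous_on S f"
  shows "continuous_on S (\<lambda>x. transpose (f x))"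
  unfolding transpose_def by (intro continuous_intros assms)

lemma compact_rotation_matrix: "compact {A :: real^'n^'n. rotation_matrix A}"
proof -
  have "{A :: real^'n^'n. rotation_matrix A} = {A. orthogonal_matrix A} \<inter> {A. det A = 1}"
    by (auto simp: rotation_matrix_def)
  moreover have "continuous_on UNIV (\<lambda>A :: real^'n^'n. det A)"
    by (rule continuous_on_det) (intro continuous_intros)
  ultimately have "closed {A :: real^'n^'n. rotation_matrix A}"
    by (simp add: closed_Int closed_orthogonal_matrix closed_Collect_eq)
  moreover have "norm A \<le> sqrt (real CARD('n))" if A: "rotation_matrix A" for A :: "real^'n^'n"
  proof -
    have "norm (row i A) = 1" for i
      using A by (simp add: rotation_matrix_def orthogonal_matrix_orthonormal_rows)
    then have "norm (A $ i) = 1" for i by (simp add: row_def vec_lambda_eta)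
    then have "norm A = sqrt (\<Sum>i\<in>(UNIV::'n set). 1)"
      by (simp add: norm_vec_def L2_set_def)
    then show ?thesis by simp
  qed
  then have "bounded {A :: real^'n^'n. rotation_matrix A}"
    unfolding bounded_iff by blast
  ultimately show ?thesis by (simp add: compact_eq_bounded_closed)
qed

lemma compact_ess_variety: "compact ess_variety"
proof -
  let ?R = "{A :: real^3^3. rotation_matrix A}"
  have "continuous_on (?R \<times> ?R) (\<lambda>p. proj_pt (ess_rot (fst p) (snd p)))"
    by (rule continuous_on_proj_compose)
       (auto simp: ess_rot_nonzero rotation_matrix_orthogonal ess_rot_def intro!: continuous_intros,
        use ess_rot_nonzero rotation_matrix_orthogonal in \<open>auto simp: ess_rot_def\<close>)
  then have "compact ((\<lambda>p. proj_pt (ess_rot (fst p) (snd p))) ` (?R \<times> ?R))"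
    by (intro compact_continuous_image compact_Times compact_rotation_matrix)
  moreover have "(\<lambda>p. proj_pt (ess_rot (fst p) (snd p))) ` (?R \<times> ?R) = ess_variety"
    by (auto simp: ess_variety_eq image_iff; blast)
  ultimately show ?thesis by simp
qed

lemma ess_variety_rotate:
  assumes "rotation_matrix A" "rotation_matrix B" "E \<noteq> 0" "proj_pt E \<in> ess_variety"
  shows "proj_pt (A ** E ** transpose B) \<in> ess_variety"
proof -
  obtain C D where CD: "rotation_matrix C" "rotation_matrix D" "proj_pt E = proj_pt (ess_rot C D)"
    using assms(4) by (auto simp: ess_variety_eq)
  then obtain c where c: "c \<noteq> 0" "E = c *\<^sub>R ess_rot C D"
    using proj_pt_eq_iff[of "ess_rot C D" E] assms(3) ess_rot_nonzero[of C D] rotation_matrix_orthogonal by metis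
  have "A ** E ** transpose B = c *\<^sub>R ess_rot (A ** C) (B ** D)"
    by (simp add: c(2) ess_rot_def matrix_scaleR_left matrix_scaleR_right matrix_transpose_mul matrix_mul_assoc)
  then show ?thesis
    using c(1) assms(1,2) CD(1,2) by (auto simp: ess_variety_eq intro!: exI rotation_matrix_mul)
qed

subsection \<open>Continuously differentiable families of matrices\<close>

text \<open>Continuity of the derivative in each fixed direction is the form used by
  \<open>local_param\<close>.\<close>

definition C1 :: "('a::real_normed_vector \<Rightarrow> 'b::real_normed_vector) \<Rightarrow> bool" where
  "C1 f \<longleftrightarrow> (\<exists>f'. (\<forall>x. (f has_derivative f' x) (at x)) \<and> (\<forall>h. continuous_on UNIV (\<lambda>x. f' x h)))"

lemma C1_has_derivative: "C1 f \<Longrightarrow> (f has_derivative frechet_derivative f (at x)) (at x)"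
  unfolding C1_def using frechet_derivative_works differentiable_def by blast

lemma C1_continuous: "C1 f \<Longrightarrow> continuous_on UNIV f"
  using C1_has_derivative has_derivative_continuous by (meson continuous_at_imp_continuous_on)

lemma C1_frechet_continuous: "C1 f \<Longrightarrow> continuous_on UNIV (\<lambda>x. frechet_derivative f (at x) h)"
proof -
  assume "C1 f"
  then obtain f' where f': "\<And>x. (f has_derivative f' x) (at x)" "\<And>h. continuous_on UNIV (\<lambda>x. f' x h)"
    unfolding C1_def by metis
  have "frechet_derivative f (at x) = f' x" for x
    using frechet_derivative_at[OF f'(1)] by simp
  then show ?thesis using f'(2) by simp
qed

lemma C1_const: "C1 (\<lambda>x. c)"
  unfolding C1_def by (intro exI[of _ "\<lambda>x h. 0"]) auto

lemma C1_bounded_bilinear: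
  assumes b: "bounded_bilinear pr" and f: "C1 f" and g: "C1 g"
  shows "C1 (\<lambda>x. pr (f x) (g x))"
proof -
  obtain f' g' where f': "\<And>x. (f has_derivative f' x) (at x)" "\<And>h. continuous_on UNIV (\<lambda>x. f' x h)"
    and g': "\<And>x. (g has_derivative g' x) (at x)" "\<And>h. continuous_on UNIV (\<lambda>x. g' x h)"
    using f g unfolding C1_def by metis
  show ?thesis
    unfolding C1_def
  proof (intro exI conjI allI)
    show "((\<lambda>x. pr (f x) (g x)) has_derivative (\<lambda>h. pr (f x) (g' x h) + pr (f' x h) (g x))) (at x)" for x
      by (rule bounded_bilinear.FDERIV[OF b f'(1) g'(1)])
    show "continuous_on UNIV (\<lambda>x. pr (f x) (g' x h) + pr (f' x h) (g x))" for h
      by (intro continuous_intros bounded_bilinear.continuous_on[OF b] f'(2) g'(2) C1_continuous f g)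
  qed
qed

lemma bounded_bilinear_matrix_mult: "bounded_bilinear (\<lambda>A B :: real^'n^'n. A ** B)"
  unfolding bilinear_conv_bounded_bilinear[symmetric] bilinear_def
  by (intro conjI allI linearI)
     (simp_all add: vec_eq_iff matrix_matrix_mult_def sum.distrib algebra_simps sum_distrib_left)

lemma C1_matrix_mult: "C1 f \<Longrightarrow> C1 g \<Longrightarrow> C1 (\<lambda>x. f x ** g x)"
  for f g :: "'a::real_normed_vector \<Rightarrow> real^'n^'n"
  by (rule C1_bounded_bilinear[OF bounded_bilinear_matrix_mult])

lemma C1_bounded_linear:
  assumes "bounded_linear l" "C1 f" shows "C1 (\<lambda>x. l (f x))"
proof -
  obtain f' where f': "\<And>x. (f has_derivative f' x) (at x)" "\<And>h. continuous_on UNIV (\<lambda>x. f' x h)"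
    using assms(2) unfolding C1_def by metis
  show ?thesis unfolding C1_def
    by (intro exI[of _ "\<lambda>x h. l (f' x h)"] conjI allI bounded_linear.has_derivative[OF assms(1) f'(1)]
        bounded_linear.continuous_on[OF assms(1) f'(2)])
qed

lemma C1_transpose: "C1 f \<Longrightarrow> C1 (\<lambda>x. transpose (f x) :: real^'n^'n)"
  by (rule C1_bounded_linear)
     (simp add: linear_conv_bounded_linear[symmetric] linear_iff transpose_def vec_eq_iff)

lemma C1_rotation_family: "C1 (\<lambda>p :: real^'n. cos (p $ i) *\<^sub>R A + sin (p $ i) *\<^sub>R B + C)"
  unfolding C1_def
proof (intro exI conjI allI)
  have d: "((\<lambda>p :: real^'n. p $ i) has_derivative (\<lambda>h. h $ i)) (at x)" for x
    by (intro bounded_linear_imp_has_derivative bounded_linear_vec_nth)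
  show "((\<lambda>p. cos (p $ i) *\<^sub>R A + sin (p $ i) *\<^sub>R B + C) has_derivative
      (\<lambda>h. (- sin (x $ i) * h $ i) *\<^sub>R A + (cos (x $ i) * h $ i) *\<^sub>R B)) (at x)" for x :: "real^'n"
    by (auto intro!: derivative_eq_intros d simp: mult.commute)
  show "continuous_on UNIV (\<lambda>x. (- sin (x $ i) * h $ i) *\<^sub>R A + (cos (x $ i) * h $ i) *\<^sub>R B)" for h :: "real^'n"
    by (intro continuous_intros)
qed

subsection \<open>A chart around the base point\<close>

definition Rx :: "real \<Rightarrow> real^3^3" where
  "Rx t = vector [vector [1, 0, 0], vector [0, cos t, - sin t], vector [0, sin t, cos t]]"
definition Ry :: "real \<Rightarrow> real^3^3" where
  "Ry t = vector [vector [cos t, 0, sin t], vector [0, 1, 0], vector [- sin t, 0, cos t]]"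
definition Rz :: "real \<Rightarrow> real^3^3" where
  "Rz t = vector [vector [cos t, - sin t, 0], vector [sin t, cos t, 0], vector [0, 0, 1]]"

lemma rotation_Rx: "rotation_matrix (Rx t)" and rotation_Ry: "rotation_matrix (Ry t)"
  and rotation_Rz: "rotation_matrix (Rz t)"
  by (simp_all add: rotation_matrix_def orthogonal_matrix det_3 Rx_def Ry_def Rz_def vec_eq_iff forall_3
      matrix_matrix_mult_def sum_3 transpose_def mat_def power2_eq_square[symmetric] mult.commute)

lemma C1_Rx: "C1 (\<lambda>p :: real^'n. Rx (p $ i))" and C1_Ry: "C1 (\<lambda>p :: real^'n. Ry (p $ i))"
  and C1_Rz: "C1 (\<lambda>p :: real^'n. Rz (p $ i))"
proof -
  have "Rx t = cos t *\<^sub>R vector [vector [0, 0, 0], vector [0, 1, 0], vector [0, 0, 1]]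
      + sin t *\<^sub>R vector [vector [0, 0, 0], vector [0, 0, -1], vector [0, 1, 0]]
      + vector [vector [1, 0, 0], vector [0, 0, 0], vector [0, 0, 0]]" for t
    by (simp add: Rx_def vec_eq_iff forall_3)
  then show "C1 (\<lambda>p :: real^'n. Rx (p $ i))" by (simp only: C1_rotation_family)
  have "Ry t = cos t *\<^sub>R vector [vector [1, 0, 0], vector [0, 0, 0], vector [0, 0, 1]]
      + sin t *\<^sub>R vector [vector [0, 0, 1], vector [0, 0, 0], vector [-1, 0, 0]]
      + vector [vector [0, 0, 0], vector [0, 1, 0], vector [0, 0, 0]]" for t
    by (simp add: Ry_def vec_eq_iff forall_3)
  then show "C1 (\<lambda>p :: real^'n. Ry (p $ i))" by (simp only: C1_rotation_family)
  have "Rz t = cos t *\<^sub>R vector [vector [1, 0, 0], vector [0, 1, 0], vector [0, 0, 0]]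
      + sin t *\<^sub>R vector [vector [0, -1, 0], vector [1, 0, 0], vector [0, 0, 0]]
      + vector [vector [0, 0, 0], vector [0, 0, 0], vector [0, 0, 1]]" for t
    by (simp add: Rz_def vec_eq_iff forall_3)
  then show "C1 (\<lambda>p :: real^'n. Rz (p $ i))" by (simp only: C1_rotation_family)
qed

definition frame :: "real \<Rightarrow> real \<Rightarrow> real^3^3" where "frame a b = Rz a ** Ry b"

text \<open>\<open>frame a b\<close> sends the first axis to the unit vector of longitude a and
  latitude -b. As \<open>E0\<close> commutes with the rotations about the first axis, the pair
  (\<open>Rx t\<close>, \<open>Rx t\<close>) fixes it; so a rotation about this axis is kept on one
  side only, and the six angles of two rotations reduce to five.\<close>

definition left_rot :: "real^5 \<Rightarrow> real^3^3" where "left_rot p = frame (p $ 1) (p $ 2) ** Rx (p $ 3)"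

definition right_rot :: "real^5 \<Rightarrow> real^3^3" where "right_rot p = frame (p $ 4) (p $ 5)"

definition ess_param :: "real^5 \<Rightarrow> real^3^3" where "ess_param p = ess_rot (left_rot p) (right_rot p)"

lemma rotation_frame: "rotation_matrix (frame a b)"
  and rotation_left_rot: "rotation_matrix (left_rot p)"
  and rotation_right_rot: "rotation_matrix (right_rot p)"
  by (simp_all add: frame_def left_rot_def right_rot_def rotation_matrix_mul rotation_Rx rotation_Ry rotation_Rz)

lemma C1_left_rot: "C1 left_rot" and C1_right_rot: "C1 right_rot"
  unfolding left_rot_def[abs_def] right_rot_def[abs_def] frame_def
  by (intro C1_matrix_mult C1_Rx C1_Ry C1_Rz)+

lemma C1_ess_param: "C1 ess_param"
  unfolding ess_param_def[abs_def] ess_rot_def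
  by (intro C1_matrix_mult C1_transpose C1_const C1_left_rot C1_right_rot)

lemma frame_axis: "frame a b *v axis 1 1 = vector [cos a * cos b, sin a * cos b, - sin b]"
  by (simp add: frame_def Ry_def Rz_def vec_eq_iff forall_3 matrix_matrix_mult_def matrix_vector_mult_def sum_3 axis_def)

lemma left_rot_axis: "left_rot p *v axis 1 1 = frame (p $ 1) (p $ 2) *v axis 1 1"
  unfolding left_rot_def matrix_vector_mul_assoc[symmetric]
  by (rule arg_cong[of _ _ "(*v) _"])
     (simp add: Rx_def vec_eq_iff forall_3 matrix_vector_mult_def sum_3 axis_def)

text \<open>The frame whose first axis points in the direction of t, with its angles read off by
  arctangents; valid in the half space of positive first coordinate.\<close>

definition polar_dir :: "real^3 \<Rightarrow> real^3^3" where
  "polar_dir t = frame (arctan (t $ 2 / t $ 1)) (arctan (- (t $ 3) / sqrt ((t $ 1)\<^sup>2 + (t $ 2)\<^sup>2)))"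

lemma polar_dir_axis:
  assumes t: "t $ 1 > 0"
  shows "norm t *\<^sub>R (polar_dir t *v axis 1 1) = t"
proof -
  define x y z where "x = t $ 1" "y = t $ 2" "z = t $ 3"
  note d = x_y_z_def
  have x: "x > 0" using t d by simp
  define r where "r = sqrt (x\<^sup>2 + y\<^sup>2)"
  have r2: "r\<^sup>2 = x\<^sup>2 + y\<^sup>2" by (simp add: r_def)
  have r: "r > 0" using x by (simp add: r_def add_pos_nonneg)
  have n: "norm t = sqrt (r\<^sup>2 + z\<^sup>2)"
    unfolding norm_eq_sqrt_inner using r2[unfolded power2_eq_square] by (simp add: inner_vec_def sum_3 d power2_eq_square)
  have n0: "norm t > 0" unfolding n using r by (simp add: add_pos_nonneg)
  have 1: "sqrt (1 + (y / x)\<^sup>2) = r / x"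
  proof -
    have "1 + (y / x)\<^sup>2 = (r / x)\<^sup>2" using x r2 by (simp add: field_simps)
    then show ?thesis using x r by simp
  qed
  have 2: "sqrt (1 + (- z / r)\<^sup>2) = norm t / r"
  proof -
    have "1 + (- z / r)\<^sup>2 = (norm t / r)\<^sup>2" using r by (simp add: n field_simps)
    then show ?thesis using n0 r by simp
  qed
  have c1: "cos (arctan (y / x)) = x / r" "sin (arctan (y / x)) = y / r"
    using x r by (simp_all only: cos_arctan sin_arctan 1) (simp_all)
  have c2: "cos (arctan (- z / r)) = r / norm t" "sin (arctan (- z / r)) = - z / norm t"
    using r n0 by (simp_all only: cos_arctan sin_arctan 2) (simp_all)
  have "polar_dir t *v axis 1 1 = vector [x / r * (r / norm t), y / r * (r / norm t), - (- z / norm t)]"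
    unfolding polar_dir_def frame_axis d[symmetric] r_def[symmetric] c1 c2 ..
  then show ?thesis using r n0 x by (simp add: vec_eq_iff forall_3 d)
qed

lemma polar_dir_frame:
  assumes c: "c > 0" and "\<bar>a\<bar> < pi / 2" "\<bar>b\<bar> < pi / 2"
  shows "polar_dir (c *\<^sub>R (frame a b *v axis 1 1)) = frame a b"
    "arctan ((c *\<^sub>R (frame a b *v axis 1 1)) $ 2 / (c *\<^sub>R (frame a b *v axis 1 1)) $ 1) = a"
    "arctan (- ((c *\<^sub>R (frame a b *v axis 1 1)) $ 3) / sqrt (((c *\<^sub>R (frame a b *v axis 1 1)) $ 1)\<^sup>2 + ((c *\<^sub>R (frame a b *v axis 1 1)) $ 2)\<^sup>2)) = b"
proof -
  let ?t = "c *\<^sub>R (frame a b *v axis 1 1)"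
  have ca: "cos a > 0" and cb: "cos b > 0" using assms by (auto intro: cos_gt_zero_pi)
  have s: "sqrt ((?t $ 1)\<^sup>2 + (?t $ 2)\<^sup>2) = c * cos b"
  proof -
    have "(?t $ 1)\<^sup>2 + (?t $ 2)\<^sup>2 = (c * cos b)\<^sup>2 * ((cos a)\<^sup>2 + (sin a)\<^sup>2)"
      unfolding frame_axis
      by (simp add: power2_eq_square algebra_simps del: sin_cos_squared_add sin_cos_squared_add2 sin_cos_squared_add3)
    then show ?thesis using c cb by simp
  qed
  have at: "arctan (sin x / cos x) = x" if "\<bar>x\<bar> < pi / 2" for x
    using arctan_tan[of x] that by (simp add: tan_def abs_less_iff)
  show 1: "arctan (?t $ 2 / ?t $ 1) = a"
    using c ca cb assms(2) at by (simp add: frame_axis)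
  show 2: "arctan (- (?t $ 3) / sqrt ((?t $ 1)\<^sup>2 + (?t $ 2)\<^sup>2)) = b"
    unfolding s using c cb assms(3) at by (simp add: frame_axis)
  show "polar_dir ?t = frame a b" unfolding polar_dir_def 1 2 ..
qed

section \<open>Recovering the five angles from the matrix\<close>

lemma ess_param_alt:
  "ess_param q = frame (q $ 1) (q $ 2) ** (Rx (q $ 3) ** E0) ** transpose (frame (q $ 4) (q $ 5))"
  by (simp add: ess_param_def ess_rot_def left_rot_def right_rot_def matrix_mul_assoc)

lemma mat_vec_axis: "(A *v axis j 1) $ i = A $ i $ j" for A :: "real^'n^'m"
  by (simp add: matrix_vector_mult_basis column_def)

lemma axis_nth: "axis k x $ i = (if i = k then x else 0)"
  by (simp add: axis_def)

text \<open>The column space of A E_0 B^T is the plane orthogonal to A e_1, so two columns determine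
  this axis. The product is quadratic in the matrix and hence the same for both unit representatives
  of a line.\<close>

lemma cross_col:
  assumes "rotation_matrix A" "rotation_matrix B"
  shows "cross3 (column 2 (ess_rot A B)) (column 3 (ess_rot A B)) = (B $ 1 $ 1) *\<^sub>R (A *v axis 1 1)"
proof -
  have c: "column j (ess_rot A B) = A *v cross3 (axis 1 1) (transpose B *v axis j 1)" for j
    unfolding matrix_vector_mult_basis[symmetric] ess_rot_def
    by (simp only: matrix_vector_mul_assoc[symmetric] E0_vec)
  have rB: "rotation_matrix (transpose B)" using assms(2) by (simp add: rotation_matrix_transpose)
  have "cross3 (cross3 (axis 1 1) a) (cross3 (axis 1 1) b) = (axis 1 1 \<bullet> cross3 a b) *\<^sub>R axis 1 1" for a b
    by (simp add: cross3_simps axis_def)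
  then have "cross3 (cross3 (axis 1 1) (transpose B *v axis 2 1)) (cross3 (axis 1 1) (transpose B *v axis 3 1))
      = (axis 1 1 \<bullet> (transpose B *v cross3 (axis 2 1) (axis 3 1))) *\<^sub>R axis 1 1"
    by (simp only: cross_rotation_matrix[OF rB])
  also have "axis 1 1 \<bullet> (transpose B *v cross3 (axis 2 1) (axis 3 1)) = B $ 1 $ 1"
    by (simp add: cross_basis matrix_vector_mult_basis column_def transpose_def inner_axis')
  finally show ?thesis
    unfolding c cross_rotation_matrix[OF assms(1)] by (simp only: matrix_vector_mult_scaleR)
qed

lemma cross_row:
  assumes "rotation_matrix A" "rotation_matrix B"
  shows "cross3 (row 2 (ess_rot A B)) (row 3 (ess_rot A B)) = (A $ 1 $ 1) *\<^sub>R (B *v axis 1 1)"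
proof -
  have "transpose (ess_rot A B) = - ess_rot B A"
    by (simp add: ess_rot_def matrix_transpose_mul transpose_E0 matrix_mul_assoc transpose_transpose)
       (metis (no_types) matrix_minus_left matrix_scaleR_right scaleR_minus1_left)
  then have "row j (ess_rot A B) = - column j (ess_rot B A)" for j
    by (simp add: row_def column_def transpose_def vec_eq_iff)
  then show ?thesis using cross_col[OF assms(2,1)] by simp
qed

definition pol_col :: "real^3^3 \<Rightarrow> real^3" where "pol_col E = cross3 (column 2 E) (column 3 E)"
definition pol_row :: "real^3^3 \<Rightarrow> real^3" where "pol_row E = cross3 (row 2 E) (row 3 E)"

text \<open>Undoing both frames leaves \<open>Rx (p $ 3) ** E0\<close> at the point
  \<open>ess_param p\<close>, from which the third angle can be read.\<close>

definition ess_core :: "real^3^3 \<Rightarrow> real^3^3" where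
  "ess_core E = transpose (polar_dir (pol_col E)) ** E ** polar_dir (pol_row E)"

text \<open>At \<open>ess_param p\<close> the two quantities are the product of the cosines of the
  angles 1, 2, 4, 5 and twice the cosine of the third angle. Both are positive on the box of angles
  below pi/2.\<close>

definition ess_dom :: "(real^3^3) set" where
  "ess_dom = {E. pol_col E $ 1 > 0 \<and> ess_core E $ 3 $ 2 - ess_core E $ 2 $ 3 \<noteq> 0}"

text \<open>The third entry is the arctangent of (2 sin) / (2 cos) of the third angle. Every entry
  is invariant under nonzero scaling of the matrix, so the map descends to lines.\<close>

definition ess_coord :: "real^3^3 \<Rightarrow> real^5" where
  "ess_coord E = (let t = pol_col E; s = pol_row E; F = ess_core E in
     vector [arctan (t $ 2 / t $ 1), arctan (- (t $ 3) / sqrt ((t $ 1)\<^sup>2 + (t $ 2)\<^sup>2)),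
       arctan (- (F $ 2 $ 2 + F $ 3 $ 3) / (F $ 3 $ 2 - F $ 2 $ 3)),
       arctan (s $ 2 / s $ 1), arctan (- (s $ 3) / sqrt ((s $ 1)\<^sup>2 + (s $ 2)\<^sup>2))])"

lemma exhaust_5: fixes x :: 5 shows "x = 1 \<or> x = 2 \<or> x = 3 \<or> x = 4 \<or> x = 5"
proof (induct x)
  case (of_int z)
  then have "z = 0 \<or> z = 1 \<or> z = 2 \<or> z = 3 \<or> z = 4" by fastforce
  then show ?case by auto
qed

lemma forall_5: "(\<forall>i::5. P i) \<longleftrightarrow> P 1 \<and> P 2 \<and> P 3 \<and> P 4 \<and> P 5"
  by (metis exhaust_5)

lemma UNIV_5: "UNIV = {1, 2, 3, 4, 5::5}"
  using exhaust_5 by auto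

lemma sum_5: "sum f (UNIV::5 set) = f 1 + f 2 + f 3 + f 4 + f 5"
  unfolding UNIV_5 by (simp add: ac_simps)

lemma vector_5 [simp]:
  "(vector [a, b, c, d, e] :: ('a::zero)^5) $ 1 = a"
  "(vector [a, b, c, d, e] :: ('a::zero)^5) $ 2 = b"
  "(vector [a, b, c, d, e] :: ('a::zero)^5) $ 3 = c"
  "(vector [a, b, c, d, e] :: ('a::zero)^5) $ 4 = d"
  "(vector [a, b, c, d, e] :: ('a::zero)^5) $ 5 = e"
  unfolding vector_def by simp_all

lemma pol_row_1: "pol_row E $ 1 = pol_col E $ 1"
  by (simp add: pol_row_def pol_col_def row_def column_def cross3_def)

lemma pol_scaleR: "pol_col (c *\<^sub>R E) = c\<^sup>2 *\<^sub>R pol_col E" "pol_row (c *\<^sub>R E) = c\<^sup>2 *\<^sub>R pol_row E"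
  by (simp_all add: pol_col_def pol_row_def row_def column_def cross3_simps power2_eq_square)

lemma sqrt_sum_squares_scale: "0 \<le> k \<Longrightarrow> sqrt ((k * x)\<^sup>2 + (k * y)\<^sup>2) = k * sqrt (x\<^sup>2 + y\<^sup>2)"
  by (simp add: power_mult_distrib distrib_left[symmetric] real_sqrt_mult)

lemma polar_dir_scaleR:
  assumes "c > 0" shows "polar_dir (c *\<^sub>R t) = polar_dir t"
proof -
  have "sqrt ((c * t $ 1)\<^sup>2 + (c * t $ 2)\<^sup>2) = c * sqrt ((t $ 1)\<^sup>2 + (t $ 2)\<^sup>2)"
    using assms by (simp add: power_mult_distrib distrib_left[symmetric] real_sqrt_mult)
  then show ?thesis using assms by (simp add: polar_dir_def)
qed

lemma ess_core_scaleR: "c \<noteq> 0 \<Longrightarrow> ess_core (c *\<^sub>R E) = c *\<^sub>R ess_core E"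
  by (simp add: ess_core_def pol_scaleR polar_dir_scaleR matrix_scaleR_left matrix_scaleR_right)

lemma ess_dom_scaleR: "c \<noteq> 0 \<Longrightarrow> c *\<^sub>R E \<in> ess_dom \<longleftrightarrow> E \<in> ess_dom"
  by (simp add: ess_dom_def ess_core_scaleR pol_scaleR zero_less_mult_iff right_diff_distrib[symmetric])

lemma ess_coord_scaleR:
  assumes "c \<noteq> 0" shows "ess_coord (c *\<^sub>R E) = ess_coord E"
proof -
  have s: "sqrt ((c\<^sup>2 * x)\<^sup>2 + (c\<^sup>2 * y)\<^sup>2) = c\<^sup>2 * sqrt (x\<^sup>2 + y\<^sup>2)" for x y
    by (rule sqrt_sum_squares_scale) simp
  have f: "(- (c * x) - c * y) / (c * z - c * w) = (- x - y) / (z - w)" for x y z w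
  proof -
    have "(- (c * x) - c * y) / (c * z - c * w) = (c * (- x - y)) / (c * (z - w))"
      by (simp add: algebra_simps)
    then show ?thesis using assms by simp
  qed
  show ?thesis
    using assms by (simp add: ess_coord_def Let_def ess_core_scaleR pol_scaleR s f)
qed

lemma continuous_on_polar_dir:
  assumes f: "continuous_on S f" and p: "\<And>x. x \<in> S \<Longrightarrow> f x $ 1 > 0"
  shows "continuous_on S (\<lambda>x. polar_dir (f x))"
proof -
  have r: "continuous_on UNIV Rz" "continuous_on UNIV Ry"
  proof -
    have "continuous_on UNIV (\<lambda>x :: real. Rz ((\<chi> i. x :: real^1) $ 1))" "continuous_on UNIV (\<lambda>x :: real. Ry ((\<chi> i. x :: real^1) $ 1))"
      by (rule continuous_on_compose2[OF C1_continuous[OF C1_Rz]]; auto intro!: continuous_intros)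
         (rule continuous_on_compose2[OF C1_continuous[OF C1_Ry]]; auto intro!: continuous_intros)
    then show "continuous_on UNIV Rz" "continuous_on UNIV Ry" by simp_all
  qed
  have n: "sqrt ((f x $ 1)\<^sup>2 + (f x $ 2)\<^sup>2) \<noteq> 0" if "x \<in> S" for x
    using p[OF that] by auto
  show ?thesis
    unfolding polar_dir_def frame_def
    by (intro continuous_intros continuous_on_compose2[OF r(1)] continuous_on_compose2[OF r(2)] f)
       (use p n in \<open>auto, fastforce\<close>)
qed

lemma continuous_on_pol: "continuous_on S pol_col" "continuous_on S pol_row"
  unfolding pol_col_def[abs_def] pol_row_def[abs_def] column_def row_def
  by (intro continuous_intros continuous_on_cross)+

lemma continuous_on_ess_core: "continuous_on {E. pol_col E $ 1 > 0} ess_core"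
  unfolding ess_core_def[abs_def]
  by (intro continuous_intros continuous_on_polar_dir continuous_on_pol) (auto simp: pol_row_1)

lemma open_ess_dom: "open ess_dom"
proof -
  let ?S = "{E. pol_col E $ 1 > 0}"
  have S: "open ?S"
    by (intro open_Collect_less continuous_intros continuous_on_pol)
  have "continuous_on ?S (\<lambda>E. ess_core E $ 3 $ 2 - ess_core E $ 2 $ 3)"
    by (intro continuous_intros continuous_on_ess_core)
  then have "open (?S \<inter> (\<lambda>E. ess_core E $ 3 $ 2 - ess_core E $ 2 $ 3) -` (- {0}))"
    using S by (rule continuous_open_preimage) auto
  moreover have "?S \<inter> (\<lambda>E. ess_core E $ 3 $ 2 - ess_core E $ 2 $ 3) -` (- {0}) = ess_dom"
    by (auto simp: ess_dom_def)
  ultimately show ?thesis by simp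
qed

lemma continuous_on_vector_5:
  fixes a b c d e :: "'a::topological_space \<Rightarrow> real"
  assumes "continuous_on S a" "continuous_on S b" "continuous_on S c" "continuous_on S d" "continuous_on S e"
  shows "continuous_on S (\<lambda>x. vector [a x, b x, c x, d x, e x] :: real^5)"
proof -
  have "continuous_on S (\<lambda>x. \<chi> i. (vector [a x, b x, c x, d x, e x] :: real^5) $ i)"
  proof (rule continuous_on_vec_lambda)
    fix i :: 5
    show "continuous_on S (\<lambda>x. (vector [a x, b x, c x, d x, e x] :: real^5) $ i)"
      using exhaust_5[of i] assms by auto
  qed
  then show ?thesis by simp
qed

lemma continuous_on_ess_coord: "continuous_on ess_dom ess_coord"
proof -
  have c: "continuous_on ess_dom ess_core"
    by (rule continuous_on_subset[OF continuous_on_ess_core]) (auto simp: ess_dom_def)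
  show ?thesis
    unfolding ess_coord_def[abs_def] Let_def
    by (intro continuous_on_vector_5 continuous_intros continuous_on_pol c)
       (auto simp: ess_dom_def pol_row_1)
qed

definition ess_box :: "(real^5) set" where "ess_box = {p. \<forall>i. \<bar>p $ i\<bar> < pi / 2}"

lemma Rx_E0: "Rx t ** E0 = vector [vector [0, 0, 0], vector [0, - sin t, - cos t], vector [0, cos t, - sin t]]"
  by (simp add: Rx_def E0_entries vec_eq_iff forall_3 matrix_matrix_mult_def sum_3)

lemma ess_coord_param:
  assumes p: "p \<in> ess_box"
  shows "ess_param p \<in> ess_dom" "ess_coord (ess_param p) = p"
proof -
  have b: "\<bar>p $ i\<bar> < pi / 2" for i using p by (simp add: ess_box_def)
  have cs: "cos (p $ i) > 0" for i using b[of i] by (intro cos_gt_zero_pi) auto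
  let ?f = "frame (p $ 1) (p $ 2)" and ?g = "frame (p $ 4) (p $ 5)"
  have c1: "right_rot p $ 1 $ 1 = cos (p $ 4) * cos (p $ 5)"
    by (simp add: right_rot_def frame_def Rz_def Ry_def matrix_matrix_mult_def sum_3)
  have c2: "left_rot p $ 1 $ 1 = cos (p $ 1) * cos (p $ 2)"
    using arg_cong[OF left_rot_axis[of p], of "\<lambda>v. v $ 1", unfolded mat_vec_axis frame_axis]
    by (simp add: mat_vec_axis[symmetric] frame_axis)
  have r: "right_rot p *v axis 1 1 = ?g *v axis 1 1" by (simp add: right_rot_def)
  let ?c = "cos (p $ 4) * cos (p $ 5)" and ?d = "cos (p $ 1) * cos (p $ 2)"
  have cpos: "?c > 0" "?d > 0" using cs by simp_all
  have t: "pol_col (ess_param p) = ?c *\<^sub>R (?f *v axis 1 1)"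
    unfolding pol_col_def ess_param_def cross_col[OF rotation_left_rot rotation_right_rot] c1 left_rot_axis ..
  have s: "pol_row (ess_param p) = ?d *\<^sub>R (?g *v axis 1 1)"
    unfolding pol_row_def ess_param_def cross_row[OF rotation_left_rot rotation_right_rot] c2 r ..
  note P = polar_dir_frame[OF cpos(1) b[of 1] b[of 2]] and Q = polar_dir_frame[OF cpos(2) b[of 4] b[of 5]]
  have core: "ess_core (ess_param p) = Rx (p $ 3) ** E0"
    unfolding ess_core_def t s P(1) Q(1)
    by (simp add: ess_param_def ess_rot_def left_rot_def right_rot_def matrix_mul_assoc
        orthogonal_matrix_cancel[OF rotation_matrix_orthogonal[OF rotation_frame]])
  have "pol_col (ess_param p) $ 1 > 0"
    unfolding t frame_axis using cs by simp
  then show "ess_param p \<in> ess_dom"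
    using cs[of 3] by (simp add: ess_dom_def core Rx_E0)
  have "arctan (sin (p $ 3) / cos (p $ 3)) = p $ 3"
    using arctan_tan[of "p $ 3"] b[of 3] by (simp add: tan_def abs_less_iff)
  then have "arctan (- (- sin (p $ 3) + - sin (p $ 3)) / (cos (p $ 3) - - cos (p $ 3))) = p $ 3"
    by (simp add: mult_2[symmetric])
  then show "ess_coord (ess_param p) = p"
    unfolding ess_coord_def Let_def t s core Rx_E0 P(2,3) Q(2,3)
    by (simp add: vec_eq_iff forall_5)
qed

text \<open>With E proportional to A E_0 B^T, the reconstructed frames P and Q carry the first axis
  to the same multiple \<open>\<sigma>\<close> of the axes of A and B. What remains between the
  frames is therefore a rotation \<open>R\<close> about the first axis, and its angle is the third
  coordinate.\<close>

lemma ess_param_coord: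
  assumes E: "E \<noteq> 0" "proj_pt E \<in> ess_variety" "E \<in> ess_dom"
  shows "proj_pt (ess_param (ess_coord E)) = proj_pt E"
proof -
  obtain A B where AB: "rotation_matrix A" "rotation_matrix B" "proj_pt E = proj_pt (ess_rot A B)"
    using E(2) by (auto simp: ess_variety_eq)
  note oAB = AB(1,2)[THEN rotation_matrix_orthogonal]
  let ?X = "ess_rot A B"
  obtain k where k: "k \<noteq> 0" "E = k *\<^sub>R ?X"
    using proj_pt_eq_iff[OF ess_rot_nonzero[OF oAB] E(1)] AB(3) by metis
  have X: "?X \<in> ess_dom" "ess_coord E = ess_coord ?X"
    using E(3) k ess_dom_scaleR ess_coord_scaleR by auto
  let ?t = "pol_col ?X" and ?s = "pol_row ?X"
  have t: "?t = (B $ 1 $ 1) *\<^sub>R (A *v axis 1 1)" and s: "?s = (A $ 1 $ 1) *\<^sub>R (B *v axis 1 1)"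
    unfolding pol_col_def pol_row_def using cross_col[OF AB(1,2)] cross_row[OF AB(1,2)] by auto
  have t1: "?t $ 1 > 0" using X(1) by (simp add: ess_dom_def)
  then have s1: "?s $ 1 > 0" by (simp add: pol_row_1)
  let ?P = "polar_dir ?t" and ?Q = "polar_dir ?s"
  have rP: "rotation_matrix ?P" and rQ: "rotation_matrix ?Q" by (simp_all add: polar_dir_def rotation_frame)
  note oP = rP[THEN rotation_matrix_orthogonal] and oQ = rQ[THEN rotation_matrix_orthogonal]
  have AB11: "B $ 1 $ 1 * A $ 1 $ 1 > 0"
    using t1 unfolding t by (simp add: matrix_vector_mult_basis column_def)
  \<comment> \<open>The entries \<open>A $ 1 $ 1\<close> and \<open>B $ 1 $ 1\<close> have a
    positive product, so one sign serves for both frames.\<close>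
  define \<sigma> where "\<sigma> = sgn (A $ 1 $ 1)"
  have \<sigma>: "\<sigma> = sgn (B $ 1 $ 1)" "\<sigma> * \<sigma> = 1" "\<sigma> = 1 \<or> \<sigma> = -1"
    using AB11 by (auto simp: \<sigma>_def sgn_if zero_less_mult_iff)
  have Pe: "?P *v axis 1 1 = \<sigma> *\<^sub>R (A *v axis 1 1)"
  proof -
    have "norm ?t = \<bar>B $ 1 $ 1\<bar>" unfolding t by (simp add: norm_orthogonal_matrix[OF oAB(1)])
    then have "\<bar>B $ 1 $ 1\<bar> *\<^sub>R (?P *v axis 1 1) = (B $ 1 $ 1) *\<^sub>R (A *v axis 1 1)"
      using polar_dir_axis[OF t1] t by metis
    moreover have "B $ 1 $ 1 = \<bar>B $ 1 $ 1\<bar> * \<sigma>" unfolding \<sigma>(1) by (simp add: abs_sgn_eq mult.commute sgn_mult_abs abs_mult_sgn)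
    moreover have "\<bar>B $ 1 $ 1\<bar> \<noteq> 0" using AB11 by auto
    ultimately show ?thesis by (metis scaleR_left_imp_eq scaleR_scaleR)
  qed
  have Qe: "?Q *v axis 1 1 = \<sigma> *\<^sub>R (B *v axis 1 1)"
  proof -
    have "norm ?s = \<bar>A $ 1 $ 1\<bar>" unfolding s by (simp add: norm_orthogonal_matrix[OF oAB(2)])
    then have "\<bar>A $ 1 $ 1\<bar> *\<^sub>R (?Q *v axis 1 1) = (A $ 1 $ 1) *\<^sub>R (B *v axis 1 1)"
      using polar_dir_axis[OF s1] s by metis
    moreover have "A $ 1 $ 1 = \<bar>A $ 1 $ 1\<bar> * \<sigma>" unfolding \<sigma>_def by (simp add: abs_mult_sgn)
    moreover have "\<bar>A $ 1 $ 1\<bar> \<noteq> 0" using AB11 by auto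
    ultimately show ?thesis by (metis scaleR_left_imp_eq scaleR_scaleR)
  qed
  define C where "C = transpose ?P ** A"
  define D where "D = transpose ?Q ** B"
  have rC: "rotation_matrix C" and rD: "rotation_matrix D"
    unfolding C_def D_def using rP rQ AB(1,2) by (simp_all add: rotation_matrix_mul rotation_matrix_transpose)
  note oC = rC[THEN rotation_matrix_orthogonal] and oD = rD[THEN rotation_matrix_orthogonal]
  have Ce: "C *v axis 1 1 = \<sigma> *\<^sub>R axis 1 1"
  proof -
    have "A *v axis 1 1 = \<sigma> *\<^sub>R (?P *v axis 1 1)" using Pe \<sigma>(2) by simp
    then show ?thesis
      unfolding C_def matrix_vector_mul_assoc[symmetric]
      by (simp only: matrix_vector_mult_scaleR orthogonal_matrix_cancel[OF oP])
  qed
  have De: "D *v axis 1 1 = \<sigma> *\<^sub>R axis 1 1"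
  proof -
    have "B *v axis 1 1 = \<sigma> *\<^sub>R (?Q *v axis 1 1)" using Qe \<sigma>(2) by simp
    then show ?thesis
      unfolding D_def matrix_vector_mul_assoc[symmetric]
      by (simp only: matrix_vector_mult_scaleR orthogonal_matrix_cancel[OF oQ])
  qed
  define R where "R = C ** transpose D"
  have rR: "rotation_matrix R" using rC rD by (simp add: R_def rotation_matrix_mul rotation_matrix_transpose)
  note oR = rR[THEN rotation_matrix_orthogonal]
  have Dte: "transpose D *v axis 1 1 = \<sigma> *\<^sub>R axis 1 1"
  proof -
    have "transpose D *v (D *v axis 1 1) = axis 1 1" by (rule orthogonal_matrix_cancel[OF oD])
    then have "\<sigma> *\<^sub>R (transpose D *v axis 1 1) = axis 1 1" unfolding De by (simp only: matrix_vector_mult_scaleR)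
    then have "\<sigma> *\<^sub>R \<sigma> *\<^sub>R (transpose D *v axis 1 1) = \<sigma> *\<^sub>R axis 1 1" by simp
    then show ?thesis using \<sigma>(2) by simp
  qed
  have Re: "R *v axis 1 1 = axis 1 1"
    unfolding R_def matrix_vector_mul_assoc[symmetric] Dte
    using \<sigma>(2) by (simp only: matrix_vector_mult_scaleR Ce scaleR_scaleR scaleR_one)
  have Rte: "transpose R *v axis 1 1 = axis 1 1"
    using orthogonal_matrix_cancel(7)[OF oR, of "axis 1 1"] unfolding Re .
  define c s where "c = R $ 2 $ 2" "s = R $ 3 $ 2"
  have R1: "R $ 1 $ 1 = 1" "R $ 2 $ 1 = 0" "R $ 3 $ 1 = 0"
    using Re by (simp_all add: vec_eq_iff forall_3 mat_vec_axis axis_nth)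
  have R2: "R $ 1 $ 2 = 0" "R $ 1 $ 3 = 0"
    using Rte by (simp_all add: transpose_def vec_eq_iff forall_3 mat_vec_axis axis_nth del: transpose_matrix_vector)
  have "R *v axis 3 1 = cross3 (axis 1 1) (R *v axis 2 1)"
    using cross_rotation_matrix[OF rR, of "axis 1 1" "axis 2 1"] by (simp add: Re cross_basis)
  then have R3: "R $ 2 $ 3 = - s" "R $ 3 $ 3 = c"
    by (simp_all add: vec_eq_iff forall_3 cross3_def mat_vec_axis axis_nth c_s_def)
  have cs: "c\<^sup>2 + s\<^sup>2 = 1"
  proof -
    have "(transpose R ** R) $ 2 $ 2 = 1" using orthogonal_matrix_cancel(1)[OF oR] by (simp add: mat_def)
    then show ?thesis by (simp add: matrix_matrix_mult_def transpose_def sum_3 R2 c_s_def power2_eq_square)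
  qed
  have core: "ess_core ?X = \<sigma> *\<^sub>R (E0 ** R)"
  proof -
    have "ess_core ?X = C ** E0 ** transpose D"
      by (simp add: ess_core_def ess_rot_def C_def D_def matrix_transpose_mul matrix_mul_assoc transpose_transpose)
    also have "\<dots> = cross_matrix (C *v axis 1 1) ** R"
      unfolding E0_eq cross_matrix_rotate[OF rC, symmetric] R_def by (simp add: matrix_mul_assoc)
    also have "cross_matrix (C *v axis 1 1) = \<sigma> *\<^sub>R E0"
      unfolding Ce matrix_eq E0_eq
      by (simp add: cross_matrix_vec cross_mult_left scaleR_matrix_vector_assoc[symmetric])
    finally show ?thesis by (simp add: matrix_scaleR_left)
  qed
  have E0R: "E0 ** R = vector [vector [0, 0, 0], vector [0, - s, - c], vector [0, c, - s]]"
    by (simp add: E0_entries vec_eq_iff forall_3 matrix_matrix_mult_def sum_3 R1 R2 R3 c_s_def[symmetric])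
  have c0: "c \<noteq> 0" using X(1) by (auto simp: ess_dom_def core E0R)
  define \<tau> where "\<tau> = ess_coord ?X $ 3"
  have \<tau>: "\<tau> = arctan (s / c)"
  proof -
    have "- (\<sigma> * - s + \<sigma> * - s) / (\<sigma> * c - \<sigma> * - c) = s / c"
      using \<sigma>(3) c0 by auto
    then show ?thesis by (simp add: \<tau>_def ess_coord_def Let_def core E0R)
  qed
  have sq: "sqrt (1 + (s / c)\<^sup>2) = 1 / \<bar>c\<bar>"
  proof -
    have "1 + (s / c)\<^sup>2 = (1 / \<bar>c\<bar>)\<^sup>2" using c0 cs by (simp add: field_simps)
    then show ?thesis by simp
  qed
  \<comment> \<open>The arctangent finds the angle only modulo pi. The resulting factor
    \<open>sgn c\<close> is harmless for the line.\<close>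
  have ct: "cos \<tau> = sgn c * c" "sin \<tau> = sgn c * s"
    unfolding \<tau> cos_arctan sin_arctan sq using c0 by (auto simp: sgn_if)
  have Rx: "Rx \<tau> ** E0 = (sgn c * \<sigma>) *\<^sub>R ess_core ?X"
    unfolding Rx_E0 core E0R using \<sigma>(2,3) by (auto simp: vec_eq_iff forall_3 ct)
  have fr: "frame (ess_coord ?X $ 1) (ess_coord ?X $ 2) = ?P" "frame (ess_coord ?X $ 4) (ess_coord ?X $ 5) = ?Q"
    by (simp_all add: ess_coord_def Let_def polar_dir_def)
  have "ess_param (ess_coord ?X) = ?P ** (Rx \<tau> ** E0) ** transpose ?Q"
    unfolding ess_param_alt fr \<tau>_def[symmetric] ..
  also have "\<dots> = (sgn c * \<sigma>) *\<^sub>R (?P ** ess_core ?X ** transpose ?Q)"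
    unfolding Rx by (simp only: matrix_scaleR_left matrix_scaleR_right)
  also have "?P ** ess_core ?X ** transpose ?Q = ?X"
    unfolding ess_core_def
    by (simp add: matrix_mul_assoc orthogonal_matrix_cancel[OF oP] orthogonal_matrix_cancel[OF oQ])
  finally have "proj_pt (ess_param (ess_coord ?X)) = proj_pt ?X"
    using c0 \<sigma>(3) by (auto simp: sgn_if)
  then show ?thesis using X(2) AB(3) by simp
qed

subsection \<open>A finite atlas\<close>

text \<open>A scaling invariant continuous left inverse \<open>g\<close> on an open cone descends to
  an open set of lines and becomes the inverse homeomorphism. Since \<open>\<psi>\<close> also
  inverts \<open>g\<close> on \<open>M\<close>, the image of the chart is the part of
  \<open>M\<close> in the preimage of \<open>W\<close>, hence relatively open.\<close>

lemma local_param_of_inverse: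
  assumes W: "open W" and C: "C1 \<psi>"
    and inj: "\<And>x. x \<in> W \<Longrightarrow> inj (frechet_derivative \<psi> (at x))"
    and unit: "\<And>x. x \<in> W \<Longrightarrow> mat_inner (\<psi> x) (\<psi> x) = 1"
    and \<Omega>: "open \<Omega>" "0 \<notin> \<Omega>" "\<And>c E. c \<noteq> 0 \<Longrightarrow> c *\<^sub>R E \<in> \<Omega> \<longleftrightarrow> E \<in> \<Omega>"
    and g: "continuous_on \<Omega> g" "\<And>c E. c \<noteq> 0 \<Longrightarrow> g (c *\<^sub>R E) = g E"
    and im: "\<And>x. x \<in> W \<Longrightarrow> \<psi> x \<in> \<Omega> \<and> g (\<psi> x) = x \<and> proj_pt (\<psi> x) \<in> M"
    and retr: "\<And>E. E \<in> \<Omega> \<Longrightarrow> proj_pt E \<in> M \<Longrightarrow> g E \<in> W \<Longrightarrow> proj_pt (\<psi> (g E)) = proj_pt E"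
  shows "local_param M W \<psi>"
proof -
  define D where "D = {l. proj_rep l \<in> \<Omega>}"
  define h where "h l = g (proj_rep l)" for l
  have D: "proj_pt E \<in> D \<longleftrightarrow> E \<in> \<Omega>" and h: "h (proj_pt E) = g E" if "E \<noteq> 0" for E
    using proj_rep_proj_pt[OF that] \<Omega>(3) g(2) by (auto simp: D_def h_def)
  have "{E. E \<noteq> 0 \<and> proj_pt E \<in> D} = \<Omega>"
  proof (rule set_eqI)
    fix E show "E \<in> {E. E \<noteq> 0 \<and> proj_pt E \<in> D} \<longleftrightarrow> E \<in> \<Omega>"
      using D[of E] \<Omega>(2) by (cases "E = 0") auto
  qed
  then have oD: "open D" using \<Omega>(1) by (simp add: open_proj_space_def)
  have ch: "continuous_on D h"
  proof (rule continuous_on_proj_quotient[OF oD])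
    have "continuous_on {E. E \<noteq> 0 \<and> proj_pt E \<in> D} g"
      by (rule continuous_on_subset[OF g(1)]) (use D in auto)
    then show "continuous_on {E. E \<noteq> 0 \<and> proj_pt E \<in> D} (\<lambda>E. h (proj_pt E))"
      by (rule continuous_on_eq) (simp add: h)
  qed
  define T where "T = D \<inter> h -` W"
  have T: "open T" unfolding T_def by (rule continuous_open_preimage[OF ch oD W])
  have nz: "\<psi> x \<noteq> 0" if "x \<in> W" for x using unit[OF that] by (rule unit_nonzero)
  have hc: "h (chart \<psi> x) = x" "chart \<psi> x \<in> D" if "x \<in> W" for x
    using im[OF that] h[OF nz[OF that]] D[OF nz[OF that]] by auto
  have image: "chart \<psi> ` W = M \<inter> T"
  proof
    show "chart \<psi> ` W \<subseteq> M \<inter> T" using hc im by (auto simp: T_def)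
    show "M \<inter> T \<subseteq> chart \<psi> ` W"
    proof
      fix l assume l: "l \<in> M \<inter> T"
      obtain E where E: "E \<noteq> 0" "l = proj_pt E" by (rule proj_pt_cases)
      have "E \<in> \<Omega>" "g E \<in> W" "proj_pt E \<in> M"
        using l D[OF E(1)] h[OF E(1)] by (auto simp: T_def E(2))
      then have "chart \<psi> (g E) = l" "g E \<in> W" using retr E(2) by auto
      then show "l \<in> chart \<psi> ` W" by blast
    qed
  qed
  have cc: "continuous_on W (chart \<psi>)"
    by (rule continuous_on_proj_compose[OF continuous_on_subset[OF C1_continuous[OF C]] nz]) auto
  have "homeomorphism W (chart \<psi> ` W) (chart \<psi>) h"
    unfolding homeomorphism_def
    using hc cc continuous_on_subset[OF ch, of "chart \<psi> ` W"] by (auto simp: image_subset_iff image_image)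
  then show ?thesis
    unfolding local_param_def using W inj unit image T
    by (auto intro: differentiableI[OF C1_has_derivative[OF C]] continuous_on_subset[OF C1_frechet_continuous[OF C]]
        simp: openin_open)
qed

text \<open>The quadratic form of the Gram matrix at v is the squared length of the image of v under
  the derivative, so both maps have the same kernel.\<close>

lemma det_gram_nonzero:
  assumes D: "linear (frechet_derivative \<psi> (at x))"
  shows "det (gram \<psi> x) \<noteq> 0 \<longleftrightarrow> inj (frechet_derivative \<psi> (at x))"
proof -
  let ?D = "frechet_derivative \<psi> (at x)"
  have v: "?D v = (\<Sum>k\<in>UNIV. v $ k *\<^sub>R ?D (axis k 1))" for v
  proof -
    have "v = (\<Sum>k\<in>UNIV. v $ k *\<^sub>R axis k 1)" by (simp add: vec_eq_iff axis_def if_distrib cong: if_cong)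
    then have "?D v = ?D (\<Sum>k\<in>UNIV. v $ k *\<^sub>R axis k 1)" by simp
    then show ?thesis by (simp add: linear_sum[OF D] linear_cmul[OF D])
  qed
  have g: "(gram \<psi> x *v v) $ i = mat_inner (?D (axis i 1)) (?D v)" for v i
    unfolding v[of v] by (simp add: gram_def matrix_vector_mult_def mat_inner_eq_inner inner_sum_right sum_divide_distrib mult.commute)
  have q: "v \<bullet> (gram \<psi> x *v v) = mat_inner (?D v) (?D v)" for v
    unfolding inner_vec_def[of v] g by (subst (2) v) (simp add: mat_inner_eq_inner inner_sum_left sum_divide_distrib)
  have "inj ((*v) (gram \<psi> x)) \<longleftrightarrow> inj ?D"
    unfolding linear_injective_0[OF matrix_vector_mul_linear] linear_injective_0[OF D]
  proof (intro iffI allI impI)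
    fix v assume a: "\<forall>v. gram \<psi> x *v v = 0 \<longrightarrow> v = 0" and "?D v = 0"
    then have "(gram \<psi> x *v v) $ i = 0" for i by (simp add: g mat_inner_eq_inner)
    then have "gram \<psi> x *v v = 0" by (simp add: vec_eq_iff)
    then show "v = 0" using a by blast
  next
    fix v assume a: "\<forall>v. ?D v = 0 \<longrightarrow> v = 0" and "gram \<psi> x *v v = 0"
    then have "mat_inner (?D v) (?D v) = 0" using q[of v] by simp
    then have "?D v = 0" by (simp add: mat_inner_eq_inner)
    then show "v = 0" using a by blast
  qed
  then show ?thesis
    using det_nz_iff_inj[OF matrix_vector_mul_linear[of "gram \<psi> x"]] by simp
qed

text \<open>The coordinate domain is cut down so that the chart is regular with bounded volume density and
  the second coordinate of \<open>U (0, -y\<^sub>3, y\<^sub>2)\<close> does not vanish identically.\<close>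

definition ess_patch :: "(real^5) set" where
  "ess_patch = {p\<in>ess_box. det (gram ess_param p) \<noteq> 0 \<and>
     vol_density ess_param p < vol_density ess_param 0 + 1 \<and> left_rot p $ 2 $ 2 \<noteq> 0}"

lemma open_ess_patch: "open ess_patch"
proof -
  have "open ess_box" unfolding ess_box_def forall_5
    by (intro open_Collect_conj open_Collect_less continuous_intros)
  moreover have 1: "continuous_on UNIV (\<lambda>p. det (gram ess_param p))"
    by (intro continuous_on_det continuous_on_gram C1_frechet_continuous C1_ess_param)
  moreover have 2: "continuous_on UNIV (vol_density ess_param)"
    by (intro continuous_on_vol_density C1_frechet_continuous C1_ess_param)
  moreover have 3: "continuous_on UNIV (\<lambda>p. left_rot p $ 2 $ 2)"
    by (intro continuous_intros C1_continuous C1_left_rot)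
  ultimately have "open (ess_box \<inter> {p. det (gram ess_param p) \<noteq> 0} \<inter>
      {p. vol_density ess_param p < vol_density ess_param 0 + 1} \<inter> {p. left_rot p $ 2 $ 2 \<noteq> 0})"
    by (intro open_Int open_Collect_neq open_Collect_less 1 2 3 continuous_on_const)
  moreover have "ess_box \<inter> {p. det (gram ess_param p) \<noteq> 0} \<inter>
      {p. vol_density ess_param p < vol_density ess_param 0 + 1} \<inter> {p. left_rot p $ 2 $ 2 \<noteq> 0} = ess_patch"
    by (auto simp: ess_patch_def)
  ultimately show ?thesis by simp
qed

lemma ess_param_0: "ess_param 0 = E0" "left_rot 0 = mat 1"
proof -
  have "frame 0 0 = mat 1" "Rx 0 = mat 1"
    by (simp_all add: frame_def Rx_def Ry_def Rz_def mat_def vec_eq_iff forall_3 matrix_matrix_mult_def sum_3)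
  then show "ess_param 0 = E0" "left_rot 0 = mat 1"
    by (simp_all add: ess_param_alt left_rot_def transpose_mat)
qed

text \<open>Restricting to the line through 0 in direction \<open>h\<close> replaces the derivative
  of the matrix product by the derivative of a trigonometric function of one variable.\<close>

lemma ess_param_derivative_entry:
  assumes "((\<lambda>t. ess_param (t *\<^sub>R h) $ i $ j) has_field_derivative c) (at 0)"
  shows "frechet_derivative ess_param (at 0) h $ i $ j = c"
proof -
  let ?D = "frechet_derivative ess_param (at 0)"
  have lin: "linear ?D" using C1_has_derivative[OF C1_ess_param] has_derivative_linear by blast
  have sc: "((\<lambda>t. t *\<^sub>R h) has_derivative (\<lambda>t. t *\<^sub>R h)) (at (0::real))"
    by (intro bounded_linear_imp_has_derivative bounded_linear_scaleR_left)
  have "(ess_param has_derivative ?D) (at (0 *\<^sub>R h))"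
    using C1_has_derivative[OF C1_ess_param, of 0] by simp
  from has_derivative_compose[OF sc this]
  have "((\<lambda>t. ess_param (t *\<^sub>R h)) has_derivative (\<lambda>t. ?D (t *\<^sub>R h))) (at 0)" .
  then have "((\<lambda>t. ess_param (t *\<^sub>R h) $ i $ j) has_derivative (\<lambda>t. ?D (t *\<^sub>R h) $ i $ j)) (at 0)"
    by (intro bounded_linear.has_derivative[OF bounded_linear_vec_nth])
  moreover have "(\<lambda>t. ?D (t *\<^sub>R h) $ i $ j) = (*) (?D h $ i $ j)"
    by (rule ext) (simp add: linear_cmul[OF lin])
  ultimately have "((\<lambda>t. ess_param (t *\<^sub>R h) $ i $ j) has_field_derivative ?D h $ i $ j) (at 0)"
    unfolding has_field_derivative_def by (simp only:)
  then show ?thesis using assms DERIV_unique by blast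
qed

lemma inj_ess_param_derivative_0: "inj (frechet_derivative ess_param (at 0))"
proof -
  let ?D = "frechet_derivative ess_param (at 0)"
  have lin: "linear ?D" using C1_has_derivative[OF C1_ess_param] has_derivative_linear by blast
  note entries = ess_param_alt frame_def Rx_def Ry_def Rz_def E0_entries matrix_matrix_mult_def transpose_def sum_3
  \<comment> \<open>Five entries of the derivative are, up to sign, the five coordinates of
    \<open>h\<close>, so the kernel is trivial.\<close>
  have D: "?D h $ 1 $ 3 = h $ 1" for h
    by (rule ess_param_derivative_entry, simp add: entries) (auto intro!: derivative_eq_intros)
  have D2: "?D h $ 1 $ 2 = h $ 2" for h
    by (rule ess_param_derivative_entry, simp add: entries) (auto intro!: derivative_eq_intros)
  have D3: "?D h $ 2 $ 2 = - h $ 3" for h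
    by (rule ess_param_derivative_entry, simp add: entries) (auto intro!: derivative_eq_intros)
  have D4: "?D h $ 3 $ 1 = - h $ 4" for h
    by (rule ess_param_derivative_entry, simp add: entries) (auto intro!: derivative_eq_intros)
  have D5: "?D h $ 2 $ 1 = - h $ 5" for h
    by (rule ess_param_derivative_entry, simp add: entries) (auto intro!: derivative_eq_intros)
  show ?thesis
    unfolding linear_injective_0[OF lin]
  proof (intro allI impI)
    fix h assume "?D h = 0"
    then show "h = 0" using D[of h] D2[of h] D3[of h] D4[of h] D5[of h] by (simp add: vec_eq_iff[of h] forall_5)
  qed
qed

lemma zero_in_ess_patch: "0 \<in> ess_patch"
proof -
  have lin: "linear (frechet_derivative ess_param (at 0))"
    using C1_has_derivative[OF C1_ess_param] has_derivative_linear by blast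
  show ?thesis
    using inj_ess_param_derivative_0 det_gram_nonzero[OF lin]
    by (simp add: ess_patch_def ess_box_def ess_param_0 mat_def)
qed

text \<open>All charts are rotated copies of one parametrization. They share its Gram matrix, and
  rotating the Gaussian vectors reduces each of them to the base chart.\<close>

definition ess_chart :: "real^3^3 \<Rightarrow> real^3^3 \<Rightarrow> real^5 \<Rightarrow> real^3^3" where
  "ess_chart A B p = A ** ess_param p ** transpose B"

lemma ess_chart_frechet:
  "frechet_derivative (ess_chart A B) (at p) h = A ** frechet_derivative ess_param (at p) h ** transpose B"
proof -
  have "bounded_linear (\<lambda>X. A ** X ** transpose B)"
    using bounded_linear_compose[OF bounded_bilinear.bounded_linear_left[OF bounded_bilinear_matrix_mult, of "transpose B"]
        bounded_bilinear.bounded_linear_right[OF bounded_bilinear_matrix_mult, of A]] by simp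
  from bounded_linear.has_derivative[OF this C1_has_derivative[OF C1_ess_param, of p]]
  have "(ess_chart A B has_derivative (\<lambda>h. A ** frechet_derivative ess_param (at p) h ** transpose B)) (at p)"
    by (simp add: ess_chart_def[abs_def])
  from frechet_derivative_at[OF this] show ?thesis by metis
qed

lemma C1_ess_chart: "C1 (ess_chart A B)"
  unfolding ess_chart_def[abs_def] by (intro C1_matrix_mult C1_const C1_ess_param)

lemma gram_ess_chart:
  assumes "orthogonal_matrix A" "orthogonal_matrix B"
  shows "gram (ess_chart A B) p = gram ess_param p"
  by (simp add: gram_def ess_chart_frechet mat_inner_rotate[OF assms])

lemma vol_density_ess_chart:
  "orthogonal_matrix A \<Longrightarrow> orthogonal_matrix B \<Longrightarrow> vol_density (ess_chart A B) p = vol_density ess_param p"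
  by (simp add: vol_density_def gram_ess_chart)

lemma ess_chart_rot: "ess_chart A B p = ess_rot (A ** left_rot p) (B ** right_rot p)"
  by (simp add: ess_chart_def ess_param_def ess_rot_def matrix_transpose_mul matrix_mul_assoc)

lemma local_param_ess_chart:
  assumes "rotation_matrix A" "rotation_matrix B"
  shows "local_param ess_variety ess_patch (ess_chart A B)"
proof -
  note o = assms[THEN rotation_matrix_orthogonal]
  have rr: "rotation_matrix (A ** left_rot p)" "rotation_matrix (B ** right_rot p)" for p
    using assms by (simp_all add: rotation_matrix_mul rotation_left_rot rotation_right_rot)
  note oo = rr[THEN rotation_matrix_orthogonal]
  let ?T = "\<lambda>E. transpose A ** E ** B"
  have T: "?T (ess_chart A B p) = ess_param p" for p
    by (simp add: ess_chart_def matrix_mul_assoc orthogonal_matrix_cancel[OF o(1)] orthogonal_matrix_cancel[OF o(2)])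
  have T': "A ** ?T E ** transpose B = E" for E
    by (simp add: matrix_mul_assoc orthogonal_matrix_cancel[OF o(1)] orthogonal_matrix_cancel[OF o(2)])
  have cT: "continuous_on S ?T" for S by (intro continuous_intros)
  show ?thesis
  proof (rule local_param_of_inverse[where \<Omega> = "{E. ?T E \<in> ess_dom}" and g = "\<lambda>E. ess_coord (?T E)"])
    show "open ess_patch" by (rule open_ess_patch)
    show "C1 (ess_chart A B)" by (rule C1_ess_chart)
    show "inj (frechet_derivative (ess_chart A B) (at x))" if "x \<in> ess_patch" for x
    proof (subst det_gram_nonzero[symmetric])
      show "linear (frechet_derivative (ess_chart A B) (at x))"
        using C1_has_derivative[OF C1_ess_chart] has_derivative_linear by blast
      show "det (gram (ess_chart A B) x) \<noteq> 0"
        using that by (simp add: gram_ess_chart[OF o] ess_patch_def)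
    qed
    show "mat_inner (ess_chart A B x) (ess_chart A B x) = 1" for x
      unfolding ess_chart_rot by (rule mat_inner_ess_rot[OF oo])
    show "open {E. ?T E \<in> ess_dom}"
      using open_vimage[OF open_ess_dom cT[of UNIV]] by (simp add: vimage_def)
    have "pol_col 0 = 0" by (simp add: pol_col_def column_def cross3_def vec_eq_iff forall_3)
    then show "0 \<notin> {E. ?T E \<in> ess_dom}" by (simp add: ess_dom_def)
    show "c *\<^sub>R E \<in> {E. ?T E \<in> ess_dom} \<longleftrightarrow> E \<in> {E. ?T E \<in> ess_dom}" if "c \<noteq> 0" for c E
      using that by (simp add: matrix_scaleR_left matrix_scaleR_right ess_dom_scaleR)
    show "continuous_on {E. ?T E \<in> ess_dom} (\<lambda>E. ess_coord (?T E))"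
      by (rule continuous_on_compose2[OF continuous_on_ess_coord cT]) auto
    show "ess_coord (?T (c *\<^sub>R E)) = ess_coord (?T E)" if "c \<noteq> 0" for c E
      using that by (simp add: matrix_scaleR_left matrix_scaleR_right ess_coord_scaleR)
    show "ess_chart A B x \<in> {E. ?T E \<in> ess_dom} \<and> ess_coord (?T (ess_chart A B x)) = x \<and> chart (ess_chart A B) x \<in> ess_variety"
      if "x \<in> ess_patch" for x
    proof -
      have "chart (ess_chart A B) x \<in> ess_variety" using rr by (auto simp: ess_chart_rot ess_variety_eq)
      then show ?thesis using that ess_coord_param[of x] by (simp add: T ess_patch_def)
    qed
    show "chart (ess_chart A B) (ess_coord (?T E)) = proj_pt E"
      if E: "E \<in> {E. ?T E \<in> ess_dom}" "proj_pt E \<in> ess_variety" for E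
    proof -
      have "?T E \<in> ess_dom" using E by simp
      then have nz: "?T E \<noteq> 0" using \<open>pol_col 0 = 0\<close> by (auto simp: ess_dom_def)
      then have "E \<noteq> 0" by auto
      have "proj_pt (?T E) \<in> ess_variety"
        using ess_variety_rotate[of "transpose A" "transpose B" E] assms E(2) \<open>E \<noteq> 0\<close>
        by (simp add: rotation_matrix_transpose transpose_transpose)
      then have "proj_pt (ess_param (ess_coord (?T E))) = proj_pt (?T E)"
        using ess_param_coord nz \<open>?T E \<in> ess_dom\<close> by blast
      moreover have "ess_param q \<noteq> 0" for q
        unfolding ess_param_def by (intro ess_rot_nonzero rotation_matrix_orthogonal rotation_left_rot rotation_right_rot)
      ultimately obtain c where c: "c \<noteq> 0" "?T E = c *\<^sub>R ess_param (ess_coord (?T E))"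
        using proj_pt_eq_iff nz by metis
      have "E = A ** ?T E ** transpose B" using T' by simp
      also have "\<dots> = c *\<^sub>R ess_chart A B (ess_coord (?T E))"
        by (subst c(2)) (simp add: ess_chart_def matrix_scaleR_left matrix_scaleR_right)
      finally have "proj_pt E = proj_pt (c *\<^sub>R ess_chart A B (ess_coord (?T E)))" by (rule arg_cong)
      then show ?thesis using c(1) by simp
    qed
  qed
qed

text \<open>The point of \<open>ess_rot A B\<close> is the centre of the chart rotated by A and B,
  so the rotated charts cover. Compactness leaves finitely many.\<close>

lemma ess_atlas:
  obtains n A B where "\<And>k. k < n \<Longrightarrow> rotation_matrix (A k)" "\<And>k. k < n \<Longrightarrow> rotation_matrix (B k)"
    "atlas ess_variety n (\<lambda>_. ess_patch) (\<lambda>k :: nat. ess_chart (A k) (B k))"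
proof -
  let ?R = "{AB :: (real^3^3) \<times> (real^3^3). rotation_matrix (fst AB) \<and> rotation_matrix (snd AB)}"
  let ?c = "\<lambda>AB. chart (ess_chart (fst AB) (snd AB)) ` ess_patch"
  have "\<forall>AB\<in>?R. \<exists>T. open T \<and> ?c AB = ess_variety \<inter> T"
  proof
    fix AB assume "AB \<in> ?R"
    then have "local_param ess_variety ess_patch (ess_chart (fst AB) (snd AB))" by (intro local_param_ess_chart) auto
    then show "\<exists>T. open T \<and> ?c AB = ess_variety \<inter> T" by (rule local_param_image) blast
  qed
  from bchoice[OF this] obtain T where T: "\<And>AB. AB \<in> ?R \<Longrightarrow> open (T AB)" "\<And>AB. AB \<in> ?R \<Longrightarrow> ?c AB = ess_variety \<inter> T AB"
    by blast
  have "ess_variety \<subseteq> (\<Union>AB\<in>?R. T AB)"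
  proof
    fix l assume l: "l \<in> ess_variety"
    then obtain A B where AB: "rotation_matrix A" "rotation_matrix B" "l = proj_pt (ess_rot A B)"
      by (auto simp: ess_variety_eq)
    have "chart (ess_chart A B) 0 = l" by (simp add: AB(3) ess_chart_def ess_param_0 ess_rot_def)
    then have "l \<in> ?c (A, B)" using zero_in_ess_patch by force
    then show "l \<in> (\<Union>AB\<in>?R. T AB)" using T(2)[of "(A, B)"] AB by auto
  qed
  then obtain C where C: "C \<subseteq> ?R" "finite C" "ess_variety \<subseteq> (\<Union>AB\<in>C. T AB)"
    using compactE_image[OF compact_ess_variety, of ?R T] T(1) by blast
  obtain f :: "nat \<Rightarrow> _" and n where f: "C = f ` {..<n}"
    using C(2) by (metis finite_imp_nat_seg_image_inj_on lessThan_def)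
  have fR: "f k \<in> ?R" if "k < n" for k using C(1) f that by auto
  have cov: "ess_variety = (\<Union>k<n. ?c (f k))"
  proof
    show "ess_variety \<subseteq> (\<Union>k<n. ?c (f k))" using C(3) T(2)[OF fR] unfolding f by blast
    show "(\<Union>k<n. ?c (f k)) \<subseteq> ess_variety" using T(2)[OF fR] by blast
  qed
  have ne: "ess_variety \<noteq> {}" using rotation_matrix_mat_1 by (auto simp: ess_variety_eq)
  show ?thesis
  proof (rule that[of n "\<lambda>k. fst (f k)" "\<lambda>k. snd (f k)"])
    show "rotation_matrix (fst (f k))" "rotation_matrix (snd (f k))" if "k < n" for k using fR[OF that] by auto
    show "atlas ess_variety n (\<lambda>_. ess_patch) (\<lambda>k. ess_chart (fst (f k)) (snd (f k)))"
      by standard (use fR cov ne in \<open>auto intro: local_param_ess_chart\<close>)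
  qed
qed

subsection \<open>Tangent spaces\<close>

text \<open>The hypothesis is the cubic equation linearized at \<open>E0\<close>, and the
  conclusions are four of its entries. Four independent conditions on nine entries leave dimension
  five, so they describe the whole tangent space.\<close>

lemma tangent_E0:
  assumes "Y ** transpose E0 ** E0 + E0 ** transpose Y ** E0 + E0 ** transpose E0 ** Y = Y"
  shows "Y $ 1 $ 1 = 0" "Y $ 2 $ 3 = 0" "Y $ 3 $ 2 = 0" "Y $ 3 $ 3 = Y $ 2 $ 2"
proof -
  have e: "(Y ** transpose E0 ** E0 + E0 ** transpose Y ** E0 + E0 ** transpose E0 ** Y) $ i $ j = Y $ i $ j" for i j
    using assms by simp
  show "Y $ 1 $ 1 = 0" using e[of 1 1] by (simp add: E0_entries matrix_matrix_mult_def transpose_def sum_3)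
  show "Y $ 2 $ 3 = 0" using e[of 2 3] by (simp add: E0_entries matrix_matrix_mult_def transpose_def sum_3)
  show "Y $ 3 $ 2 = 0" using e[of 3 2] by (simp add: E0_entries matrix_matrix_mult_def transpose_def sum_3)
  show "Y $ 3 $ 3 = Y $ 2 $ 2" using e[of 3 3] by (simp add: E0_entries matrix_matrix_mult_def transpose_def sum_3)
qed

text \<open>Differentiating \<open>E E\<^sup>T E = E\<close>.\<close>

lemma local_param_tangent:
  assumes p: "local_param ess_variety W \<psi>" and x: "x \<in> W"
    and AB: "orthogonal_matrix A" "orthogonal_matrix B" and c: "\<psi> x = c *\<^sub>R ess_rot A B" "c * c = 1"
    and Y: "Y = transpose A ** frechet_derivative \<psi> (at x) h ** B"
  shows "Y $ 1 $ 1 = 0" "Y $ 2 $ 3 = 0" "Y $ 3 $ 2 = 0" "Y $ 3 $ 3 = Y $ 2 $ 2"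
proof -
  let ?E = "\<psi> x" and ?X = "frechet_derivative \<psi> (at x) h"
  have d: "(\<psi> has_derivative frechet_derivative \<psi> (at x)) (at x)" by (rule local_paramD(2)[OF p x])
  have bt: "bounded_linear (transpose :: real^3^3 \<Rightarrow> real^3^3)"
    by (simp add: linear_conv_bounded_linear[symmetric] linear_iff transpose_def vec_eq_iff)
  note mm = bounded_bilinear.FDERIV[OF bounded_bilinear_matrix_mult]
  have d1: "((\<lambda>x. \<psi> x ** transpose (\<psi> x) ** \<psi> x) has_derivative
      (\<lambda>h. \<psi> x ** transpose (\<psi> x) ** frechet_derivative \<psi> (at x) h +
        (\<psi> x ** transpose (frechet_derivative \<psi> (at x) h) + frechet_derivative \<psi> (at x) h ** transpose (\<psi> x)) ** \<psi> x)) (at x)"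
    by (intro mm bounded_linear.has_derivative[OF bt] d)
  have "(\<psi> has_derivative
      (\<lambda>h. \<psi> x ** transpose (\<psi> x) ** frechet_derivative \<psi> (at x) h +
        (\<psi> x ** transpose (frechet_derivative \<psi> (at x) h) + frechet_derivative \<psi> (at x) h ** transpose (\<psi> x)) ** \<psi> x)) (at x)"
    by (rule has_derivative_transform_within_open[OF d1 local_paramD(1)[OF p] x])
       (use local_paramD(5,7)[OF p] in \<open>auto intro!: ess_variety_unit_cubic\<close>)
  then have X: "?E ** transpose ?E ** ?X + (?E ** transpose ?X + ?X ** transpose ?E) ** ?E = ?X"
    by (rule fun_cong[OF has_derivative_unique[OF _ d]])
  have XY: "?X = A ** Y ** transpose B"
    unfolding Y by (simp add: matrix_mul_assoc orthogonal_matrix_cancel[OF AB(1)] orthogonal_matrix_cancel[OF AB(2)])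
  have r: "A ** P ** transpose B ** transpose (A ** Q ** transpose B) ** (A ** S ** transpose B)
      = A ** (P ** transpose Q ** S) ** transpose B" for P Q S
    by (simp add: matrix_transpose_mul matrix_mul_assoc transpose_transpose
        orthogonal_matrix_cancel[OF AB(1)] orthogonal_matrix_cancel[OF AB(2)])
  have add: "(P + Q) ** S = P ** S + Q ** S" for P Q S :: "real^3^3"
    by (simp add: vec_eq_iff matrix_matrix_mult_def sum.distrib algebra_simps)
  have c1: "c *\<^sub>R c *\<^sub>R P = P" for P :: "real^3^3" using c(2) by simp
  have "A ** (E0 ** transpose E0 ** Y) ** transpose B + (A ** (E0 ** transpose Y ** E0) ** transpose B
      + A ** (Y ** transpose E0 ** E0) ** transpose B) = A ** Y ** transpose B"
    using X unfolding c(1) XY ess_rot_def add transpose_scaleR matrix_scaleR_left matrix_scaleR_right scaleR_add_right c1 r .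
  then have "A ** (Y ** transpose E0 ** E0 + E0 ** transpose Y ** E0 + E0 ** transpose E0 ** Y) ** transpose B = A ** Y ** transpose B"
    by (simp add: add matrix_add_ldistrib add_ac)
  then have "transpose A ** (A ** (Y ** transpose E0 ** E0 + E0 ** transpose Y ** E0 + E0 ** transpose E0 ** Y) ** transpose B) ** B
      = transpose A ** (A ** Y ** transpose B) ** B" by simp
  then have "Y ** transpose E0 ** E0 + E0 ** transpose Y ** E0 + E0 ** transpose E0 ** Y = Y"
    by (simp add: matrix_mul_assoc orthogonal_matrix_cancel[OF AB(1)] orthogonal_matrix_cancel[OF AB(2)])
  then show "Y $ 1 $ 1 = 0" "Y $ 2 $ 3 = 0" "Y $ 3 $ 2 = 0" "Y $ 3 $ 3 = Y $ 2 $ 2"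
    by (rule tangent_E0)+
qed

text \<open>The entries are ordered to match \<open>zvec\<close>: on tangent matrices the bilinear
  form u^T Y v at (u, v) = \<open>phi a\<close> is the dot product of \<open>zvec a\<close> with
  this vector.\<close>

definition tangent_coord :: "real^3^3 \<Rightarrow> real^5" where
  "tangent_coord Y = vector [Y $ 3 $ 1, Y $ 2 $ 1, Y $ 1 $ 3, Y $ 1 $ 2, Y $ 2 $ 2]"

text \<open>Let the columns of C be the coordinates of the partial derivatives, rotated to the
  tangent space at \<open>E0\<close>. The matrix on the left is the product of the matrix of the z_i
  with C, while the Gram matrix is C^T G C with a constant G. Hence both determinants are multiples
  of det C.\<close>

lemma local_param_bilinear_det:
  assumes p: "local_param ess_variety W \<psi>" and x: "x \<in> W"
    and AB: "orthogonal_matrix A" "orthogonal_matrix B" and c: "\<psi> x = c *\<^sub>R ess_rot A B" "c * c = 1"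
  shows "\<bar>det (\<chi> i j. (A *v fst (phi (a i))) \<bullet> (frechet_derivative \<psi> (at x) (axis j 1) *v (B *v snd (phi (a i)))))\<bar>
    = 4 * vol_density \<psi> x * \<bar>det (transpose (\<chi> i. zvec (a i)))\<bar>"
    and "0 \<le> vol_density \<psi> x"
proof -
  define X where "X j = frechet_derivative \<psi> (at x) (axis j 1)" for j
  define Y where "Y j = transpose A ** X j ** B" for j
  have Y: "Y j $ 1 $ 1 = 0" "Y j $ 2 $ 3 = 0" "Y j $ 3 $ 2 = 0" "Y j $ 3 $ 3 = Y j $ 2 $ 2" for j
    using local_param_tangent[OF p x AB c, of "Y j" "axis j 1"] by (simp_all add: Y_def X_def)
  define C :: "real^5^5" where "C = (\<chi> k j. tangent_coord (Y j) $ k)"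
  \<comment> \<open>The factor 1/2 of \<open>mat_inner\<close> stays on the four entries that occur
    once. The last coordinate occurs twice, as the entries (2,2) and (3,3), and gets weight 1. The
    determinant 1/16 makes the volume density equal to |det C| / 4.\<close>
  define G :: "real^5^5" where "G = (\<chi> k l. if k = l then if k = 5 then 1 else 1/2 else 0)"
  have XY: "X j = A ** Y j ** transpose B" for j
    by (simp add: Y_def matrix_mul_assoc orthogonal_matrix_cancel[OF AB(1)] orthogonal_matrix_cancel[OF AB(2)])
  have inner: "(A *v v) \<bullet> (A *v w) = v \<bullet> w" for v w
    using AB(1) by (metis orthogonal_matrix dot_lmul_matrix vector_transpose_matrix matrix_vector_mul_assoc matrix_vector_mul_lid)
  have z: "(A *v fst (phi b)) \<bullet> (X j *v (B *v snd (phi b))) = (\<Sum>k\<in>UNIV. zvec b $ k * C $ k $ j)" for b j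
  proof -
    have "X j *v (B *v y) = A *v (Y j *v y)" for y
      unfolding XY by (simp only: matrix_vector_mul_assoc matrix_mul_assoc[symmetric] orthogonal_matrix_cancel[OF AB(2)] matrix_mul_rid)
    then have "(A *v fst (phi b)) \<bullet> (X j *v (B *v snd (phi b))) = fst (phi b) \<bullet> (Y j *v snd (phi b))"
      by (simp add: inner)
    also have "\<dots> = (\<Sum>k\<in>UNIV. zvec b $ k * C $ k $ j)"
    proof -
      obtain a' b' r s \<theta> where b: "b = (a', b', r, s, \<theta>)" by (cases b) auto
      have "r * s * Y j $ 2 $ 2 = r * s * Y j $ 2 $ 2 * ((cos \<theta>)\<^sup>2 + (sin \<theta>)\<^sup>2)" by simp
      then show ?thesis
        unfolding b phi_def zvec_def C_def tangent_coord_def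
        by (simp add: sum_5 inner_vec_def sum_3 matrix_vector_mult_def Y algebra_simps power2_eq_square
          del: sin_cos_squared_add sin_cos_squared_add2 sin_cos_squared_add3)
    qed
    finally show ?thesis .
  qed
  have "(\<chi> i j. (A *v fst (phi (a i))) \<bullet> (frechet_derivative \<psi> (at x) (axis j 1) *v (B *v snd (phi (a i)))))
      = (\<chi> i. zvec (a i)) ** C"
    by (simp add: vec_eq_iff X_def[symmetric] z matrix_matrix_mult_def)
  then have 1: "det (\<chi> i j. (A *v fst (phi (a i))) \<bullet> (frechet_derivative \<psi> (at x) (axis j 1) *v (B *v snd (phi (a i)))))
      = det (\<chi> i. zvec (a i)) * det C"
    by (simp add: det_mul)
  have "gram \<psi> x = transpose C ** (G ** C)"
  proof -
    have "gram \<psi> x $ i $ j = (transpose C ** (G ** C)) $ i $ j" for i j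
    proof -
      have "gram \<psi> x $ i $ j = mat_inner (Y i) (Y j)"
        by (simp add: gram_def X_def[symmetric] XY mat_inner_rotate[OF AB])
      also have "\<dots> = (transpose C ** (G ** C)) $ i $ j"
        by (simp add: mat_inner_eq_inner inner_vec_def sum_3 Y matrix_matrix_mult_def transpose_def sum_5 G_def C_def
            tangent_coord_def add_divide_distrib)
      finally show ?thesis .
    qed
    then show ?thesis by (simp add: vec_eq_iff)
  qed
  moreover have "det G = 1 / 16"
  proof -
    have "det G = prod (\<lambda>i. G $ i $ i) UNIV" by (rule det_diagonal) (simp add: G_def)
    also have "\<dots> = 1 / 16" unfolding UNIV_5 by (simp add: G_def)
    finally show ?thesis .
  qed
  ultimately have "det (gram \<psi> x) = (det C / 4)\<^sup>2"
    by (simp add: det_mul det_transpose power2_eq_square)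
  then have 2: "vol_density \<psi> x = \<bar>det C\<bar> / 4" by (simp add: vol_density_def)
  show "\<bar>det (\<chi> i j. (A *v fst (phi (a i))) \<bullet> (frechet_derivative \<psi> (at x) (axis j 1) *v (B *v snd (phi (a i)))))\<bar>
    = 4 * vol_density \<psi> x * \<bar>det (transpose (\<chi> i. zvec (a i)))\<bar>"
    unfolding 1 2 by (simp add: abs_mult det_transpose)
  show "0 \<le> vol_density \<psi> x" unfolding 2 by simp
qed

text \<open>The upper bound will give finite total volume. Positivity gives nonzero volume and lets
  functions on the variety be recovered by dividing by the density.\<close>

lemma vol_density_ess_patch:
  assumes x: "x \<in> ess_patch" and AB: "rotation_matrix A" "rotation_matrix B"
  shows "0 < vol_density (ess_chart A B) x" "vol_density (ess_chart A B) x \<le> vol_density ess_param 0 + 1"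
proof -
  note o = AB[THEN rotation_matrix_orthogonal]
  have oo: "orthogonal_matrix (A ** left_rot x)" "orthogonal_matrix (B ** right_rot x)"
    using AB by (simp_all add: rotation_matrix_orthogonal rotation_matrix_mul rotation_left_rot rotation_right_rot)
  have "0 \<le> vol_density (ess_chart A B) x"
    by (rule local_param_bilinear_det(2)[OF local_param_ess_chart[OF AB] x oo, of 1]) (simp_all add: ess_chart_rot)
  moreover have "vol_density (ess_chart A B) x \<noteq> 0"
    using x by (simp add: vol_density_def gram_ess_chart[OF o] ess_patch_def)
  ultimately show "0 < vol_density (ess_chart A B) x" by simp
  show "vol_density (ess_chart A B) x \<le> vol_density ess_param 0 + 1"
    using x by (simp add: vol_density_ess_chart[OF o] ess_patch_def)
qed

text \<open>Finite, because finitely many charts with bounded density live on a bounded domain;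
  nonzero, because one chart already has positive density on a nonempty open set.\<close>

lemma emeasure_ess_volume:
  "emeasure ess_volume ess_variety \<noteq> 0 \<and> emeasure ess_volume ess_variety \<noteq> \<infinity>"
proof (rule ess_atlas, intro conjI)
  fix n :: nat and A B
  assume AB: "\<And>k. k < n \<Longrightarrow> rotation_matrix (A k)" "\<And>k. k < n \<Longrightarrow> rotation_matrix (B k)"
    and at: "atlas ess_variety n (\<lambda>_. ess_patch) (\<lambda>k :: nat. ess_chart (A k) (B k))"
  interpret atlas ess_variety n "\<lambda>_. ess_patch" "\<lambda>k. ess_chart (A k) (B k)" by (rule at)
  have M: "ess_variety \<in> sets SM" using sets.top[of SM] by (simp add: space_SM)
  have n: "0 < n" using nonempty cover by (cases n) auto
  have "ess_patch \<subseteq> cball 0 (pi / 2 * 5)"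
  proof
    fix p assume "p \<in> ess_patch"
    then have "\<bar>p $ i\<bar> \<le> pi / 2" for i by (simp add: ess_patch_def ess_box_def less_imp_le)
    then have "norm p \<le> (\<Sum>i\<in>(UNIV :: 5 set). pi / 2)"
      using norm_le_l1_cart[of p] sum_mono[of UNIV "\<lambda>i. \<bar>p $ i\<bar>" "\<lambda>_. pi / 2"] by fastforce
    then show "p \<in> cball 0 (pi / 2 * 5)" by (simp add: mult.commute)
  qed
  then have "emeasure lborel ess_patch \<le> emeasure lborel (cball (0 :: real^5) (pi / 2 * 5))"
    by (rule emeasure_mono) simp
  also have "\<dots> < \<infinity>" by (rule emeasure_lborel_cball_finite)
  finally have fin: "emeasure lborel ess_patch < \<infinity>" .
  let ?K = "vol_density ess_param 0 + 1"
  have "(\<integral>\<^sup>+x. ennreal (vol_density (ess_chart (A k) (B k)) x) * indicator {x\<in>ess_patch. chart (ess_chart (A k) (B k)) x \<in> ess_variety \<inter> piece k} x \<partial>lborel) \<noteq> \<infinity>"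
    if k: "k < n" for k
  proof -
    have "(\<integral>\<^sup>+x. ennreal (vol_density (ess_chart (A k) (B k)) x) * indicator {x\<in>ess_patch. chart (ess_chart (A k) (B k)) x \<in> ess_variety \<inter> piece k} x \<partial>lborel)
        \<le> (\<integral>\<^sup>+x. ennreal ?K * indicator ess_patch x \<partial>lborel)"
      using vol_density_ess_patch(2) AB[OF k] by (intro nn_integral_mono) (auto simp: indicator_def intro: ennreal_leI)
    also have "\<dots> = ennreal ?K * emeasure lborel ess_patch"
      using open_ess_patch by (intro nn_integral_cmult_indicator) auto
    also have "\<dots> < \<infinity>" using fin by (simp add: ennreal_mult_less_top)
    finally show ?thesis by simp
  qed
  then show "emeasure ess_volume ess_variety \<noteq> \<infinity>"
    unfolding riemannian_volume_eq emeasure_vol[OF M] by simp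
  show "emeasure ess_volume ess_variety \<noteq> 0"
  proof
    assume "emeasure ess_volume ess_variety = 0"
    let ?\<psi> = "ess_chart (A 0) (B 0)"
    have p: "local_param ess_variety ess_patch ?\<psi>" using param n by blast
    have "emeasure vol (chart ?\<psi> ` ess_patch) \<le> emeasure vol ess_variety"
      using local_paramD(7)[OF p] M by (intro emeasure_mono) (auto simp: sets_vol)
    then have "emeasure vol (chart ?\<psi> ` ess_patch) = 0"
      using \<open>emeasure ess_volume ess_variety = 0\<close> by (simp add: riemannian_volume_eq)
    then have "(\<integral>\<^sup>+x. ennreal (vol_density ?\<psi> x) * indicator ess_patch x \<partial>lborel) = 0"
      using vol_chart[OF p local_param_image_sets[OF p] order_refl]
      by (simp add: indicator_def cong: conj_cong nn_integral_cong if_cong)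
    moreover have "(\<lambda>x. ennreal (vol_density ?\<psi> x) * indicator ess_patch x) \<in> borel_measurable borel"
      using open_ess_patch by (intro measurable_vol_density[OF p]) auto
    ultimately have "AE x in lborel. ennreal (vol_density ?\<psi> x) * indicator ess_patch x = 0"
      by (subst (asm) nn_integral_0_iff_AE) auto
    then have "AE x in lborel. x \<notin> ess_patch"
      using vol_density_ess_patch(1) AB n
      by (elim eventually_mono) (auto simp: indicator_def split: if_splits, fastforce)
    then have "emeasure lborel ess_patch = 0"
      using open_ess_patch by (subst (asm) AE_iff_measurable[of ess_patch]) auto
    then have "ess_patch \<in> null_sets lebesgue"
      using open_ess_patch by (intro null_sets_completionI) (simp add: null_sets_def)
    then have "negligible ess_patch" by (simp add: negligible_iff_null_sets)
    moreover have "ess_patch \<noteq> {}" using zero_in_ess_patch by blast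
    ultimately show False using open_ess_patch open_not_negligible by blast
  qed
qed

section \<open>The conditional law on the incidence variety\<close>

lemma nn_integral_swap:
  assumes "sigma_finite_measure M" "sigma_finite_measure N"
    and "(\<lambda>(x, y). f x y) \<in> borel_measurable (M \<Otimes>\<^sub>M N)"
  shows "(\<integral>\<^sup>+y. \<integral>\<^sup>+x. f x y \<partial>M \<partial>N) = (\<integral>\<^sup>+x. \<integral>\<^sup>+y. f x y \<partial>N \<partial>M)"
proof -
  interpret pair_sigma_finite M N using assms(1,2) by (simp add: pair_sigma_finite_def)
  show ?thesis by (rule Fubini'[OF assms(3)])
qed

lemma sets_std_gauss [simp, measurable_cong]: "sets std_gauss = sets borel"
  and space_std_gauss [simp]: "space std_gauss = UNIV"
  by (simp_all add: std_gauss_def)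

lemma prob_space_std_gauss: "prob_space std_gauss"
  unfolding std_gauss_def by (rule prob_space_normal_density) simp

lemma nn_integral_std_gauss:
  assumes [measurable]: "f \<in> borel_measurable borel"
  shows "(\<integral>\<^sup>+x. f x \<partial>std_gauss) = (\<integral>\<^sup>+x. ennreal (std_normal_density x) * f x \<partial>lborel)"
  unfolding std_gauss_def by (subst nn_integral_density) simp_all

lemma nn_integral_gauss3:
  assumes [measurable]: "f \<in> borel_measurable borel"
  shows "(\<integral>\<^sup>+x. f x \<partial>gauss3) = (\<integral>\<^sup>+x. \<integral>\<^sup>+y. \<integral>\<^sup>+z. f (vector [x, y, z]) \<partial>std_gauss \<partial>std_gauss \<partial>std_gauss)"
proof -
  interpret g: prob_space std_gauss by (rule prob_space_std_gauss)
  have "(\<integral>\<^sup>+x. f x \<partial>gauss3) = (\<integral>\<^sup>+x. ennreal (gauss3_density x) * f x \<partial>lborel)"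
    unfolding gauss3_def by (subst nn_integral_density) simp_all
  also have "\<dots> = (\<integral>\<^sup>+x. \<integral>\<^sup>+y. \<integral>\<^sup>+z. ennreal (gauss3_density (vector [x, y, z])) * f (vector [x, y, z]) \<partial>lborel \<partial>lborel \<partial>lborel)"
    by (rule nn_integral_lborel_3) measurable
  also have "\<dots> = (\<integral>\<^sup>+x. \<integral>\<^sup>+y. \<integral>\<^sup>+z. f (vector [x, y, z]) \<partial>std_gauss \<partial>std_gauss \<partial>std_gauss)"
    by (simp add: nn_integral_std_gauss gauss3_density_def ennreal_mult' mult.assoc nn_integral_cmult)
  finally show ?thesis .
qed

section \<open>Linear and polar coordinates in the plane\<close>

lemma nn_integral_linear_2:
  fixes G :: "real \<Rightarrow> real \<Rightarrow> ennreal"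
  assumes [measurable]: "(\<lambda>(x, y). G x y) \<in> borel_measurable (borel \<Otimes>\<^sub>M borel)" and d: "a * d - b * c \<noteq> 0"
  shows "(\<integral>\<^sup>+x. \<integral>\<^sup>+y. G x y \<partial>lborel \<partial>lborel)
    = ennreal \<bar>a * d - b * c\<bar> * (\<integral>\<^sup>+s. \<integral>\<^sup>+t. G (a * s + b * t) (c * s + d * t) \<partial>lborel \<partial>lborel)"
proof -
  \<comment> \<open>For a nonzero the map is a composition of one-dimensional affine changes, y =
    (c/a) x + e t and x = b t + a s, where a e is the determinant.\<close>
  have main: "(\<integral>\<^sup>+x. \<integral>\<^sup>+y. G x y \<partial>lborel \<partial>lborel)
    = ennreal \<bar>a * d - b * c\<bar> * (\<integral>\<^sup>+t. \<integral>\<^sup>+s. G (a * s + b * t) (c * s + d * t) \<partial>lborel \<partial>lborel)"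
    if a: "a \<noteq> 0" and d: "a * d - b * c \<noteq> 0" for a b c d :: real
  proof -
    let ?e = "(a * d - b * c) / a"
    have e: "?e \<noteq> 0" using that by simp
    have eq: "c / a * (b * t + a * s) + ?e * t = c * s + d * t" for s t
      using a by (simp add: field_simps)
    have "(\<integral>\<^sup>+x. \<integral>\<^sup>+y. G x y \<partial>lborel \<partial>lborel)
        = (\<integral>\<^sup>+x. ennreal \<bar>?e\<bar> * (\<integral>\<^sup>+t. G x (c / a * x + ?e * t) \<partial>lborel) \<partial>lborel)"
      by (intro nn_integral_cong nn_integral_real_affine e) measurable
    also have "\<dots> = ennreal \<bar>?e\<bar> * (\<integral>\<^sup>+x. \<integral>\<^sup>+t. G x (c / a * x + ?e * t) \<partial>lborel \<partial>lborel)"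
      by (rule nn_integral_cmult) measurable
    also have "(\<integral>\<^sup>+x. \<integral>\<^sup>+t. G x (c / a * x + ?e * t) \<partial>lborel \<partial>lborel)
        = (\<integral>\<^sup>+t. \<integral>\<^sup>+x. G x (c / a * x + ?e * t) \<partial>lborel \<partial>lborel)"
      by (rule lborel_pair.Fubini'[symmetric]) measurable
    also have "\<dots> = (\<integral>\<^sup>+t. ennreal \<bar>a\<bar> * (\<integral>\<^sup>+s. G (b * t + a * s) (c / a * (b * t + a * s) + ?e * t) \<partial>lborel) \<partial>lborel)"
      by (intro nn_integral_cong nn_integral_real_affine[OF _ a]) measurable
    also have "\<dots> = ennreal \<bar>a\<bar> * (\<integral>\<^sup>+t. \<integral>\<^sup>+s. G (a * s + b * t) (c * s + d * t) \<partial>lborel \<partial>lborel)"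
      unfolding eq by (subst nn_integral_cmult) (simp_all add: add.commute)
    also have "ennreal \<bar>?e\<bar> * (ennreal \<bar>a\<bar> * (\<integral>\<^sup>+t. \<integral>\<^sup>+s. G (a * s + b * t) (c * s + d * t) \<partial>lborel \<partial>lborel))
        = ennreal \<bar>a * d - b * c\<bar> * (\<integral>\<^sup>+t. \<integral>\<^sup>+s. G (a * s + b * t) (c * s + d * t) \<partial>lborel \<partial>lborel)"
    proof -
      have "ennreal \<bar>?e\<bar> * ennreal \<bar>a\<bar> = ennreal \<bar>a * d - b * c\<bar>"
        using a by (simp add: ennreal_mult'[symmetric] abs_divide)
      then show ?thesis by (simp only: mult.assoc[symmetric])
    qed
    finally show ?thesis .
  qed
  show ?thesis
  proof (cases "a = 0")
    case False
    have "(\<integral>\<^sup>+t. \<integral>\<^sup>+s. G (a * s + b * t) (c * s + d * t) \<partial>lborel \<partial>lborel)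
        = (\<integral>\<^sup>+s. \<integral>\<^sup>+t. G (a * s + b * t) (c * s + d * t) \<partial>lborel \<partial>lborel)"
      by (rule lborel_pair.Fubini') measurable
    then show ?thesis using main[OF False d] by simp
  next
    \<comment> \<open>Exchanging the two new variables replaces \<open>a\<close> by
      \<open>b\<close>, which is then nonzero.\<close>
    case True
    then have b: "b \<noteq> 0" and d': "b * c - a * d \<noteq> 0" using d by auto
    have "\<bar>a * d - b * c\<bar> = \<bar>b * c - a * d\<bar>" by simp
    then show ?thesis using main[OF b d'] by (simp add: add.commute)
  qed
qed

lemma lborel_eq_distr_2:
  "(lborel :: (real^2) measure) = distr (lborel \<Otimes>\<^sub>M lborel) borel (\<lambda>(x, y). vector [x, y])"
proof (rule lborel_eqI)
  have m[measurable]: "(\<lambda>(x, y). vector [x, y] :: real^2) \<in> borel_measurable (lborel \<Otimes>\<^sub>M lborel)"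
  proof -
    have "(\<lambda>p. (\<chi> i. if i = 1 then fst p else snd p) :: real^2) \<in> borel_measurable (lborel \<Otimes>\<^sub>M lborel)"
    proof (rule borel_measurable_euclidean_space[THEN iffD2], rule ballI)
      fix b :: "real^2" assume "b \<in> Basis"
      then obtain i where "b = axis i 1" by (auto simp: Basis_vec_def)
      then show "(\<lambda>p. (\<chi> i. if i = 1 then fst p else snd p) \<bullet> b) \<in> borel_measurable (lborel \<Otimes>\<^sub>M lborel)"
        by (simp add: inner_axis)
    qed
    then show ?thesis
      by (rule back_subst[of "\<lambda>f. f \<in> borel_measurable (lborel \<Otimes>\<^sub>M lborel)"]) (auto simp: fun_eq_iff vec_eq_iff forall_2)
  qed
  fix l u :: "real^2" assume le: "\<And>b. b \<in> Basis \<Longrightarrow> l \<bullet> b \<le> u \<bullet> b"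
  have lei: "l $ i \<le> u $ i" for i using le[of "axis i 1"] by (auto simp: inner_axis)
  have "emeasure (distr (lborel \<Otimes>\<^sub>M lborel) borel (\<lambda>(x, y). vector [x, y])) (box l u)
      = emeasure (lborel \<Otimes>\<^sub>M lborel) (box (l$1) (u$1) \<times> box (l$2) (u$2))"
    by (subst emeasure_distr) (auto intro!: arg_cong2[where f=emeasure] simp: mem_box_vec space_pair_measure forall_2)
  also have "\<dots> = ennreal (u$1 - l$1) * ennreal (u$2 - l$2)"
    using lei by (simp add: lborel.emeasure_pair_measure_Times)
  also have "\<dots> = ennreal (prod ((\<bullet>) (u - l)) Basis)"
  proof -
    have "prod ((\<bullet>) (u - l)) Basis = (u$1 - l$1) * (u$2 - l$2)"
      unfolding prod_Basis_vec UNIV_2 by simp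
    then show ?thesis using lei[of 1] lei[of 2] by (simp only: ennreal_mult' diff_ge_0_iff_ge)
  qed
  finally show "emeasure (distr (lborel \<Otimes>\<^sub>M lborel) borel (\<lambda>(x, y). vector [x, y])) (box l u)
      = ennreal (prod ((\<bullet>) (u - l)) Basis)" .
qed simp

lemma nn_integral_lborel_2:
  assumes f[measurable]: "f \<in> borel_measurable (borel :: (real^2) measure)"
  shows "(\<integral>\<^sup>+x. f x \<partial>lborel) = (\<integral>\<^sup>+x. \<integral>\<^sup>+y. f (vector [x, y]) \<partial>lborel \<partial>lborel)"
proof -
  have m[measurable]: "(\<lambda>(x, y). vector [x, y] :: real^2) \<in> borel_measurable (lborel \<Otimes>\<^sub>M lborel)"
  proof -
    have "continuous_on UNIV (\<lambda>p. (\<chi> i. if i = 1 then fst p else snd p) :: real^2)"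
    proof (rule continuous_on_vec_lambda)
      fix i :: 2 show "continuous_on UNIV (\<lambda>p :: real \<times> real. if i = 1 then fst p else snd p)"
        by (cases "i = 1") (auto intro!: continuous_intros)
    qed
    then have "(\<lambda>p. (\<chi> i. if i = 1 then fst p else snd p) :: real^2) \<in> borel_measurable (lborel \<Otimes>\<^sub>M lborel)"
      by (simp add: lborel_prod borel_measurable_continuous_onI)
    then show ?thesis
      by (rule back_subst[of "\<lambda>f. f \<in> borel_measurable (lborel \<Otimes>\<^sub>M lborel)"]) (auto simp: fun_eq_iff vec_eq_iff forall_2)
  qed
  have "(\<integral>\<^sup>+x. f x \<partial>lborel) = (\<integral>\<^sup>+p. f (case p of (x, y) \<Rightarrow> vector [x, y]) \<partial>(lborel \<Otimes>\<^sub>M lborel))"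
    by (subst lborel_eq_distr_2, subst nn_integral_distr) simp_all
  also have "\<dots> = (\<integral>\<^sup>+x. \<integral>\<^sup>+y. f (vector [x, y]) \<partial>lborel \<partial>lborel)"
    by (subst lborel.nn_integral_fst[symmetric]) simp_all
  finally show ?thesis .
qed

text \<open>The half-open interval of angles makes the polar map injective. Its image misses the
  origin alone, and its Jacobian determinant is the radius.\<close>

lemma nn_integral_polar_pos:
  fixes g :: "real \<Rightarrow> real \<Rightarrow> ennreal"
  assumes g[measurable]: "(\<lambda>(x, y). g x y) \<in> borel_measurable (borel \<Otimes>\<^sub>M borel)"
  shows "(\<integral>\<^sup>+x. \<integral>\<^sup>+y. g x y \<partial>lborel \<partial>lborel)
    = (\<integral>\<^sup>+s. \<integral>\<^sup>+\<theta>. ennreal s * g (s * cos \<theta>) (s * sin \<theta>) * indicator {0<..} s * indicator {0..<2*pi} \<theta> \<partial>lborel \<partial>lborel)"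
proof -
  define S where "S = {z :: real^2. z $ 1 > 0 \<and> 0 \<le> z $ 2 \<and> z $ 2 < 2 * pi}"
  define P where "P z = (vector [z $ 1 * cos (z $ 2), z $ 1 * sin (z $ 2)] :: real^2)" for z :: "real^2"
  define P' where "P' z h = (vector [h $ 1 * cos (z $ 2) - z $ 1 * sin (z $ 2) * h $ 2,
      h $ 1 * sin (z $ 2) + z $ 1 * cos (z $ 2) * h $ 2] :: real^2)" for z h :: "real^2"
  have Sb[measurable]: "S \<in> sets borel" unfolding S_def by measurable
  have der: "(P has_derivative P' z) (at z within S)" for z
  proof -
    have n: "((\<lambda>z :: real^2. z $ i) has_derivative (\<lambda>h. h $ i)) (at z within S)" for i
      by (intro bounded_linear_imp_has_derivative bounded_linear_vec_nth)
    have "((\<lambda>z. z $ 1 * cos (z $ 2)) has_derivative (\<lambda>h. h $ 1 * cos (z $ 2) - z $ 1 * sin (z $ 2) * h $ 2)) (at z within S)"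
      by (rule derivative_eq_intros n refl)+ (simp add: fun_eq_iff algebra_simps)
    moreover have "((\<lambda>z. z $ 1 * sin (z $ 2)) has_derivative (\<lambda>h. h $ 1 * sin (z $ 2) + z $ 1 * cos (z $ 2) * h $ 2)) (at z within S)"
      by (rule derivative_eq_intros n refl)+ (simp add: fun_eq_iff algebra_simps)
    ultimately have "((\<lambda>z. P z $ i) has_derivative (\<lambda>h. P' z h $ i)) (at z within S)" for i
      using exhaust_2[of i] by (auto simp: P_def P'_def)
    then show ?thesis
      by (subst has_derivative_componentwise_within) (auto simp: Basis_vec_def inner_axis)
  qed
  have det: "det (matrix (P' z)) = z $ 1" for z
  proof -
    have "det (matrix (P' z)) = z $ 1 * ((cos (z $ 2))\<^sup>2 + (sin (z $ 2))\<^sup>2)"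
      unfolding det_2 matrix_def P'_def
      by (simp add: axis_def power2_eq_square algebra_simps del: sin_cos_squared_add sin_cos_squared_add2 sin_cos_squared_add3)
    then show ?thesis by simp
  qed
  have inj: "inj_on P S"
  proof (rule inj_onI)
    fix z w assume zw: "z \<in> S" "w \<in> S" "P z = P w"
    then have e: "z $ 1 * cos (z $ 2) = w $ 1 * cos (w $ 2)" "z $ 1 * sin (z $ 2) = w $ 1 * sin (w $ 2)"
      by (simp_all add: P_def vec_eq_iff forall_2)
    have sq: "(x * cos t)\<^sup>2 + (x * sin t)\<^sup>2 = x\<^sup>2" for x t :: real
      by (simp add: power_mult_distrib distrib_left[symmetric])
    have "(z $ 1)\<^sup>2 = (w $ 1)\<^sup>2"
      using sq[of "z $ 1" "z $ 2"] sq[of "w $ 1" "w $ 2"] e by simp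
    then have 1: "z $ 1 = w $ 1" using zw by (simp add: S_def)
    then have "cos (z $ 2) = cos (w $ 2)" "sin (z $ 2) = sin (w $ 2)" using e zw by (auto simp: S_def)
    then obtain n :: int where n: "z $ 2 = w $ 2 + 2 * pi * n"
      using sin_cos_eq_iff[of "z $ 2" "w $ 2"] by auto
    have "n = 0"
    proof -
      have "\<bar>2 * pi * real_of_int n\<bar> < 2 * pi" using n zw unfolding S_def mem_Collect_eq by linarith
      then have "2 * pi * \<bar>real_of_int n\<bar> < 2 * pi * 1" by (simp add: abs_mult)
      then have "\<bar>real_of_int n\<bar> < 1" by simp
      then show ?thesis by linarith
    qed
    then show "z = w" using n 1 by (simp add: vec_eq_iff forall_2)
  qed
  have im: "P ` S = - {0}"
  proof
    show "P ` S \<subseteq> - {0}"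
    proof (clarsimp simp: P_def S_def vec_eq_iff forall_2)
      fix z :: "real^2" assume "sin (z $ 2) = 0" "cos (z $ 2) = 0"
      then show False using sin_cos_squared_add[of "z $ 2"] by simp
    qed
    show "- {0} \<subseteq> P ` S"
    proof
      fix y :: "real^2" assume "y \<in> - {0}"
      then have ny: "norm y > 0" by simp
      have "(y $ 1 / norm y)\<^sup>2 + (y $ 2 / norm y)\<^sup>2 = 1"
      proof -
        have "(norm y)\<^sup>2 = (y $ 1)\<^sup>2 + (y $ 2)\<^sup>2"
          unfolding power2_norm_eq_inner by (simp add: inner_vec_def sum_2 power2_eq_square)
        then have "(y $ 1 / norm y)\<^sup>2 + (y $ 2 / norm y)\<^sup>2 = (norm y)\<^sup>2 / (norm y)\<^sup>2"
          by (simp only: power_divide add_divide_distrib)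
        then show ?thesis using ny by simp
      qed
      then obtain t where t: "0 \<le> t" "t < 2 * pi" "y $ 1 / norm y = cos t" "y $ 2 / norm y = sin t"
        by (rule sincos_total_2pi)
      have "y = P (vector [norm y, t])"
        using ny by (simp add: P_def vec_eq_iff forall_2 t(3,4)[symmetric])
      moreover have "(vector [norm y, t] :: real^2) \<in> S" using ny t by (simp add: S_def)
      ultimately show "y \<in> P ` S" by blast
    qed
  qed
  define F where "F z = g (z $ 1) (z $ 2)" for z :: "real^2"
  have F[measurable]: "F \<in> borel_measurable borel" unfolding F_def by measurable
  have "(\<integral>\<^sup>+x. \<integral>\<^sup>+y. g x y \<partial>lborel \<partial>lborel) = (\<integral>\<^sup>+z. F z \<partial>lborel)"
    by (subst nn_integral_lborel_2) (simp_all add: F_def)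
  also have "\<dots> = (\<integral>\<^sup>+z. F z * indicator (P ` S) z \<partial>lebesgue)"
  proof -
    have "AE z in lborel. z \<noteq> (0 :: real^2)" by (rule AE_lborel_singleton)
    then have "(\<integral>\<^sup>+z. F z \<partial>lborel) = (\<integral>\<^sup>+z. F z * indicator (P ` S) z \<partial>lborel)"
      unfolding im by (intro nn_integral_cong_AE) (auto elim!: eventually_mono)
    then show ?thesis by (simp add: nn_integral_completion)
  qed
  also have "\<dots> = (\<integral>\<^sup>+z. F (P z) * ennreal \<bar>det (matrix (P' z))\<bar> * indicator S z \<partial>lebesgue)"
    by (rule nn_integral_differentiable_image[OF _ der inj F]) simp
  also have "\<dots> = (\<integral>\<^sup>+z. F (P z) * ennreal \<bar>z $ 1\<bar> * indicator S z \<partial>lborel)"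
    by (simp add: det nn_integral_completion)
  also have "\<dots> = (\<integral>\<^sup>+s. \<integral>\<^sup>+\<theta>. g (s * cos \<theta>) (s * sin \<theta>) * ennreal \<bar>s\<bar> * indicator S (vector [s, \<theta>]) \<partial>lborel \<partial>lborel)"
    by (subst nn_integral_lborel_2) (simp_all add: F_def P_def)
  also have "\<dots> = (\<integral>\<^sup>+s. \<integral>\<^sup>+\<theta>. ennreal s * g (s * cos \<theta>) (s * sin \<theta>) * indicator {0<..} s * indicator {0..<2*pi} \<theta> \<partial>lborel \<partial>lborel)"
    by (intro nn_integral_cong) (auto simp: S_def indicator_def mult.commute)
  finally show ?thesis .
qed

text \<open>The radius is allowed to be negative, so that every point is hit twice.\<close>

lemma nn_integral_polar:
  fixes g :: "real \<Rightarrow> real \<Rightarrow> ennreal"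
  assumes g[measurable]: "(\<lambda>(x, y). g x y) \<in> borel_measurable (borel \<Otimes>\<^sub>M borel)"
  shows "2 * (\<integral>\<^sup>+x. \<integral>\<^sup>+y. g x y \<partial>lborel \<partial>lborel)
    = (\<integral>\<^sup>+s. \<integral>\<^sup>+\<theta>. ennreal \<bar>s\<bar> * g (s * cos \<theta>) (s * sin \<theta>) * indicator {0..<2*pi} \<theta> \<partial>lborel \<partial>lborel)"
proof -
  let ?I = "\<lambda>h. \<integral>\<^sup>+x. \<integral>\<^sup>+y. h x y \<partial>lborel \<partial>lborel :: ennreal"
  let ?h = "\<lambda>s \<theta>. ennreal \<bar>s\<bar> * g (s * cos \<theta>) (s * sin \<theta>) * indicator {0..<2*pi} \<theta>"
  have pos: "?I g = ?I (\<lambda>s \<theta>. ?h s \<theta> * indicator {0<..} s)"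
    unfolding nn_integral_polar_pos[OF g] by (intro nn_integral_cong) (auto simp: indicator_def)
  have gm: "(\<lambda>(x, y). g (- x) (- y)) \<in> borel_measurable (borel \<Otimes>\<^sub>M borel)" by measurable
  have inner: "(\<integral>\<^sup>+y. g x y \<partial>lborel) = (\<integral>\<^sup>+y. g x (- y) \<partial>lborel)" for x
    using nn_integral_real_affine[of "g x" "-1" 0] by simp
  \<comment> \<open>The point reflection of the plane accounts for the negative radii: it keeps the
    angle and changes the sign of s.\<close>
  have "?I g = (\<integral>\<^sup>+x. \<integral>\<^sup>+y. g (- x) y \<partial>lborel \<partial>lborel)"
    using nn_integral_real_affine[of "\<lambda>x. \<integral>\<^sup>+y. g x y \<partial>lborel" "-1" 0] by simp
  also have "\<dots> = ?I (\<lambda>x y. g (- x) (- y))" unfolding inner ..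
  also have "\<dots> = (\<integral>\<^sup>+s. \<integral>\<^sup>+\<theta>. ennreal s * g (- (s * cos \<theta>)) (- (s * sin \<theta>)) * indicator {0<..} s * indicator {0..<2*pi} \<theta> \<partial>lborel \<partial>lborel)"
    by (rule nn_integral_polar_pos[OF gm])
  also have "\<dots> = (\<integral>\<^sup>+s. \<integral>\<^sup>+\<theta>. ?h (- s) \<theta> * indicator {..<0} (- s) \<partial>lborel \<partial>lborel)"
    by (intro nn_integral_cong) (auto simp: indicator_def)
  also have "\<dots> = ?I (\<lambda>s \<theta>. ?h s \<theta> * indicator {..<0} s)"
    using nn_integral_real_affine[of "\<lambda>s. \<integral>\<^sup>+\<theta>. ?h s \<theta> * indicator {..<0} s \<partial>lborel" "-1" 0] by simp
  finally have neg: "?I g = ?I (\<lambda>s \<theta>. ?h s \<theta> * indicator {..<0} s)" .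
  have "2 * ?I g = ?I g + ?I g" by (simp add: mult_2)
  also have "\<dots> = ?I (\<lambda>s \<theta>. ?h s \<theta> * indicator {0<..} s) + ?I (\<lambda>s \<theta>. ?h s \<theta> * indicator {..<0} s)"
    using pos neg by simp
  also have "\<dots> = (\<integral>\<^sup>+s. (\<integral>\<^sup>+\<theta>. ?h s \<theta> * indicator {0<..} s \<partial>lborel) + (\<integral>\<^sup>+\<theta>. ?h s \<theta> * indicator {..<0} s \<partial>lborel) \<partial>lborel)"
    by (rule nn_integral_add[symmetric]) measurable
  also have "\<dots> = ?I ?h"
  proof (rule nn_integral_cong)
    fix s :: real
    show "(\<integral>\<^sup>+\<theta>. ?h s \<theta> * indicator {0<..} s \<partial>lborel) + (\<integral>\<^sup>+\<theta>. ?h s \<theta> * indicator {..<0} s \<partial>lborel) = (\<integral>\<^sup>+\<theta>. ?h s \<theta> \<partial>lborel)"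
      by (cases s "0 :: real" rule: linorder_cases) simp_all
  qed
  finally show ?thesis .
qed

section \<open>Slicing a pair of Gaussian vectors\<close>

definition cond_base :: "(real \<times> real \<times> (real^3)) measure" where
  "cond_base = std_gauss \<Otimes>\<^sub>M std_gauss \<Otimes>\<^sub>M gauss3"

text \<open>Here \<open>\<rho>\<close> stands for (u_1, u_3, v), and \<open>x\<close> is the missing
  second coordinate of u. The function \<open>solve\<close> gives the \<open>x\<close> at which u^T
  E v = 0.\<close>

definition slice :: "real \<times> real \<times> (real^3) \<Rightarrow> real \<Rightarrow> (real^3) \<times> (real^3)" where
  "slice \<rho> x = (vector [fst \<rho>, x, fst (snd \<rho>)], snd (snd \<rho>))"

definition solve :: "real^3^3 \<Rightarrow> real \<times> real \<times> (real^3) \<Rightarrow> real" where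
  "solve E \<rho> = - (fst \<rho> * (E *v snd (snd \<rho>)) $ 1 + fst (snd \<rho>) * (E *v snd (snd \<rho>)) $ 3) / (E *v snd (snd \<rho>)) $ 2"

text \<open>Because of \<open>x / 0 = 0\<close> this vanishes where \<open>solve\<close> is meaningless.\<close>

definition cond_kernel :: "real^3^3 \<Rightarrow> real \<times> real \<times> (real^3) \<Rightarrow> real" where
  "cond_kernel E \<rho> = std_normal_density (solve E \<rho>) / \<bar>(E *v snd (snd \<rho>)) $ 2\<bar>"

lemma prob_space_cond_base: "prob_space cond_base"
  and sets_cond_base [measurable_cong]: "sets cond_base = sets (borel \<Otimes>\<^sub>M borel \<Otimes>\<^sub>M borel)"
proof -
  interpret g: prob_space std_gauss by (rule prob_space_std_gauss)
  interpret g3: prob_space gauss3 by (rule prob_space_gauss3)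
  interpret p: pair_prob_space std_gauss gauss3 ..
  interpret pp: pair_prob_space std_gauss "std_gauss \<Otimes>\<^sub>M gauss3" ..
  show "prob_space cond_base" unfolding cond_base_def by (rule pp.prob_space_axioms)
  show "sets cond_base = sets (borel \<Otimes>\<^sub>M borel \<Otimes>\<^sub>M borel)"
    unfolding cond_base_def by (intro sets_pair_measure_cong) auto
qed

lemma nn_integral_cond_base:
  assumes [measurable]: "f \<in> borel_measurable (borel \<Otimes>\<^sub>M borel \<Otimes>\<^sub>M borel)"
  shows "(\<integral>\<^sup>+\<rho>. f \<rho> \<partial>cond_base) = (\<integral>\<^sup>+x. \<integral>\<^sup>+z. \<integral>\<^sup>+v. f (x, z, v) \<partial>gauss3 \<partial>std_gauss \<partial>std_gauss)"
proof -
  interpret g: prob_space std_gauss by (rule prob_space_std_gauss)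
  interpret g3: prob_space gauss3 by (rule prob_space_gauss3)
  interpret p: pair_prob_space std_gauss gauss3 ..
  show ?thesis unfolding cond_base_def
    by (subst p.nn_integral_fst[symmetric], simp, subst g3.nn_integral_fst[symmetric]) simp_all
qed

lemma gauss3_pair_slice:
  "gauss3 \<Otimes>\<^sub>M gauss3 = distr (cond_base \<Otimes>\<^sub>M std_gauss) (borel \<Otimes>\<^sub>M borel) (\<lambda>(\<rho>, x). slice \<rho> x)"
proof (rule measure_eqI)
  interpret g: prob_space std_gauss by (rule prob_space_std_gauss)
  interpret g3: prob_space gauss3 by (rule prob_space_gauss3)
  interpret p: pair_prob_space std_gauss gauss3 ..
  show "sets (gauss3 \<Otimes>\<^sub>M gauss3) = sets (distr (cond_base \<Otimes>\<^sub>M std_gauss) (borel \<Otimes>\<^sub>M borel) (\<lambda>(\<rho>, x). slice \<rho> x))"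
    unfolding sets_distr by (intro sets_pair_measure_cong) auto
  fix B assume "B \<in> sets (gauss3 \<Otimes>\<^sub>M gauss3)"
  also have "sets (gauss3 \<Otimes>\<^sub>M gauss3) = sets (borel \<Otimes>\<^sub>M borel)" by (intro sets_pair_measure_cong) auto
  finally have B[measurable]: "B \<in> sets (borel \<Otimes>\<^sub>M borel)" .
  let ?b = "indicator B :: _ \<Rightarrow> ennreal"
  have sm[measurable]: "(\<lambda>(\<rho>, x). slice \<rho> x) \<in> measurable (cond_base \<Otimes>\<^sub>M std_gauss) (borel \<Otimes>\<^sub>M borel)"
    unfolding slice_def by measurable
  have "emeasure (gauss3 \<Otimes>\<^sub>M gauss3) B = (\<integral>\<^sup>+u. \<integral>\<^sup>+v. ?b (u, v) \<partial>gauss3 \<partial>gauss3)"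
    by (rule g3.emeasure_pair_measure) (simp add: cong: sets_pair_measure_cong)
  also have "\<dots> = (\<integral>\<^sup>+y. \<integral>\<^sup>+x. \<integral>\<^sup>+z. \<integral>\<^sup>+v. ?b (vector [y, x, z], v) \<partial>gauss3 \<partial>std_gauss \<partial>std_gauss \<partial>std_gauss)"
    by (rule nn_integral_gauss3) measurable
  also have "\<dots> = (\<integral>\<^sup>+y. \<integral>\<^sup>+x. (\<integral>\<^sup>+q. ?b (vector [y, x, fst q], snd q) \<partial>(std_gauss \<Otimes>\<^sub>M gauss3)) \<partial>std_gauss \<partial>std_gauss)"
    by (intro nn_integral_cong) (subst g3.nn_integral_fst[symmetric], measurable)
  also have "\<dots> = (\<integral>\<^sup>+y. (\<integral>\<^sup>+q. (\<integral>\<^sup>+x. ?b (vector [y, x, fst q], snd q) \<partial>std_gauss) \<partial>(std_gauss \<Otimes>\<^sub>M gauss3)) \<partial>std_gauss)"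
    by (intro nn_integral_cong nn_integral_swap g.sigma_finite_measure_axioms p.sigma_finite_measure_axioms) measurable
  also have "\<dots> = (\<integral>\<^sup>+y. \<integral>\<^sup>+z. \<integral>\<^sup>+v. (\<integral>\<^sup>+x. ?b (vector [y, x, z], v) \<partial>std_gauss) \<partial>gauss3 \<partial>std_gauss \<partial>std_gauss)"
    by (intro nn_integral_cong) (subst g3.nn_integral_fst[symmetric], measurable)
  also have "\<dots> = (\<integral>\<^sup>+\<rho>. \<integral>\<^sup>+x. ?b (slice \<rho> x) \<partial>std_gauss \<partial>cond_base)"
    unfolding slice_def by (subst nn_integral_cond_base) simp_all
  also have "\<dots> = (\<integral>\<^sup>+q. ?b (case q of (\<rho>, x) \<Rightarrow> slice \<rho> x) \<partial>(cond_base \<Otimes>\<^sub>M std_gauss))"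
    by (subst g.nn_integral_fst[symmetric]) simp_all
  also have "\<dots> = emeasure (distr (cond_base \<Otimes>\<^sub>M std_gauss) (borel \<Otimes>\<^sub>M borel) (\<lambda>(\<rho>, x). slice \<rho> x)) B"
    by (subst nn_integral_indicator[symmetric], simp, subst nn_integral_distr) simp_all
  finally show "emeasure (gauss3 \<Otimes>\<^sub>M gauss3) B = emeasure (distr (cond_base \<Otimes>\<^sub>M std_gauss) (borel \<Otimes>\<^sub>M borel) (\<lambda>(\<rho>, x). slice \<rho> x)) B" .
qed

lemma borel_measurable_mat_vec [measurable]:
  fixes A :: "'x \<Rightarrow> real^'n^'m"
  assumes [measurable]: "A \<in> borel_measurable M" "g \<in> borel_measurable M"
  shows "(\<lambda>x. A x *v g x) \<in> borel_measurable M"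
proof -
  have "(\<lambda>p :: (real^'n^'m) \<times> (real^'n). fst p *v snd p) \<in> borel_measurable borel"
    unfolding matrix_vector_mult_def by (intro borel_measurable_continuous_onI continuous_intros)
  from measurable_compose[OF borel_measurable_Pair[OF assms] this] show ?thesis by simp
qed

lemma borel_measurable_solve [measurable]:
  assumes [measurable]: "E \<in> borel_measurable M" "r \<in> measurable M (borel \<Otimes>\<^sub>M borel \<Otimes>\<^sub>M borel)"
  shows "(\<lambda>x. solve (E x) (r x)) \<in> borel_measurable M"
  unfolding solve_def by measurable

lemma borel_measurable_cond_kernel [measurable]:
  assumes [measurable]: "E \<in> borel_measurable M" "r \<in> measurable M (borel \<Otimes>\<^sub>M borel \<Otimes>\<^sub>M borel)"
  shows "(\<lambda>x. cond_kernel (E x) (r x)) \<in> borel_measurable M"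
  unfolding cond_kernel_def by measurable

lemma measurable_slice [measurable]:
  assumes [measurable]: "r \<in> measurable M (borel \<Otimes>\<^sub>M borel \<Otimes>\<^sub>M borel)" "x \<in> borel_measurable M"
  shows "(\<lambda>w. slice (r w) (x w)) \<in> measurable M (borel \<Otimes>\<^sub>M borel)"
  unfolding slice_def by measurable

text \<open>The fibre \<open>{u. u \<bullet> n = 0}\<close> in the coordinates \<open>(u\<^sub>1, u\<^sub>3)\<close> and in an orthonormal basis.\<close>

lemma nn_integral_plane:
  fixes f :: "real^3 \<Rightarrow> ennreal" and n \<alpha> \<beta> :: "real^3"
  assumes f[measurable]: "f \<in> borel_measurable borel"
    and n: "n $ 2 \<noteq> 0" "\<alpha> \<bullet> n = 0" "\<beta> \<bullet> n = 0" and c: "cross3 \<alpha> \<beta> = k *\<^sub>R n" "\<bar>k\<bar> = 1 / r" and r: "r > 0"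
  shows "(\<integral>\<^sup>+x. \<integral>\<^sup>+z. f (vector [x, - (x * n $ 1 + z * n $ 3) / n $ 2, z]) * ennreal (1 / \<bar>n $ 2\<bar>) \<partial>lborel \<partial>lborel)
    = (\<integral>\<^sup>+a. \<integral>\<^sup>+t. f (a *\<^sub>R \<alpha> + t *\<^sub>R \<beta>) * ennreal (1 / r) \<partial>lborel \<partial>lborel)"
proof -
  let ?d = "\<alpha> $ 1 * \<beta> $ 3 - \<beta> $ 1 * \<alpha> $ 3"
  \<comment> \<open>The Jacobian of passing from (a, t) to (u_1, u_3) is, up to sign, the second
    coordinate of the cross product, that is, k times n_2. It cancels the weight 1 / |n_2| and
    leaves |k| = 1 / r.\<close>
  have "cross3 \<alpha> \<beta> $ 2 = - ?d" by (simp add: cross3_def algebra_simps)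
  then have d: "?d = - (k * n $ 2)" using c(1) by simp
  have k: "k \<noteq> 0" using c(2) r by auto
  have G: "(\<lambda>(x, z). f (vector [x, - (x * n $ 1 + z * n $ 3) / n $ 2, z]) * ennreal (1 / \<bar>n $ 2\<bar>)) \<in> borel_measurable (borel \<Otimes>\<^sub>M borel)"
    by measurable
  have v: "vector [\<alpha> $ 1 * a + \<beta> $ 1 * t, - ((\<alpha> $ 1 * a + \<beta> $ 1 * t) * n $ 1 + (\<alpha> $ 3 * a + \<beta> $ 3 * t) * n $ 3) / n $ 2, \<alpha> $ 3 * a + \<beta> $ 3 * t]
      = a *\<^sub>R \<alpha> + t *\<^sub>R \<beta>" for a t
  proof -
    have "\<alpha> $ 1 * n $ 1 + \<alpha> $ 2 * n $ 2 + \<alpha> $ 3 * n $ 3 = 0" "\<beta> $ 1 * n $ 1 + \<beta> $ 2 * n $ 2 + \<beta> $ 3 * n $ 3 = 0"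
      using n by (simp_all add: inner_vec_def sum_3)
    then have e: "\<alpha> $ 1 * n $ 1 + \<alpha> $ 3 * n $ 3 = - (\<alpha> $ 2 * n $ 2)" "\<beta> $ 1 * n $ 1 + \<beta> $ 3 * n $ 3 = - (\<beta> $ 2 * n $ 2)"
      by linarith+
    have "- ((\<alpha> $ 1 * a + \<beta> $ 1 * t) * n $ 1 + (\<alpha> $ 3 * a + \<beta> $ 3 * t) * n $ 3)
        = - (a * (\<alpha> $ 1 * n $ 1 + \<alpha> $ 3 * n $ 3) + t * (\<beta> $ 1 * n $ 1 + \<beta> $ 3 * n $ 3))"
      by (simp add: algebra_simps)
    also have "\<dots> = (a * \<alpha> $ 2 + t * \<beta> $ 2) * n $ 2" unfolding e by (simp add: algebra_simps)
    finally show ?thesis using n(1) by (simp add: vec_eq_iff forall_3 mult.commute)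
  qed
  have "(\<integral>\<^sup>+x. \<integral>\<^sup>+z. f (vector [x, - (x * n $ 1 + z * n $ 3) / n $ 2, z]) * ennreal (1 / \<bar>n $ 2\<bar>) \<partial>lborel \<partial>lborel)
      = ennreal \<bar>?d\<bar> * (\<integral>\<^sup>+a. \<integral>\<^sup>+t. f (a *\<^sub>R \<alpha> + t *\<^sub>R \<beta>) * ennreal (1 / \<bar>n $ 2\<bar>) \<partial>lborel \<partial>lborel)"
    by (subst nn_integral_linear_2[OF G, of "\<alpha> $ 1" "\<beta> $ 3" "\<beta> $ 1" "\<alpha> $ 3"]) (use d k n(1) in \<open>auto simp only: v, simp\<close>)
  also have "\<dots> = (\<integral>\<^sup>+a. \<integral>\<^sup>+t. ennreal \<bar>?d\<bar> * (f (a *\<^sub>R \<alpha> + t *\<^sub>R \<beta>) * ennreal (1 / \<bar>n $ 2\<bar>)) \<partial>lborel \<partial>lborel)"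
    by (subst nn_integral_cmult[symmetric], measurable, intro nn_integral_cong nn_integral_cmult[symmetric], measurable)
  also have "\<dots> = (\<integral>\<^sup>+a. \<integral>\<^sup>+t. f (a *\<^sub>R \<alpha> + t *\<^sub>R \<beta>) * ennreal (1 / r) \<partial>lborel \<partial>lborel)"
  proof (intro nn_integral_cong)
    fix a t
    have "ennreal \<bar>?d\<bar> * ennreal (1 / \<bar>n $ 2\<bar>) = ennreal (1 / r)"
      using n(1) by (simp add: d c(2)[symmetric] ennreal_mult'[symmetric] abs_mult)
    then show "ennreal \<bar>?d\<bar> * (f (a *\<^sub>R \<alpha> + t *\<^sub>R \<beta>) * ennreal (1 / \<bar>n $ 2\<bar>)) = f (a *\<^sub>R \<alpha> + t *\<^sub>R \<beta>) * ennreal (1 / r)"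
      by (simp only: mult.left_commute[of "ennreal \<bar>?d\<bar>"])
  qed
  finally show ?thesis .
qed

lemma nn_integral_std_gauss_sgn:
  assumes [measurable]: "f \<in> borel_measurable borel" and s: "s \<noteq> 0"
  shows "(\<integral>\<^sup>+t. f (t * sgn s) \<partial>std_gauss) = (\<integral>\<^sup>+t. f t \<partial>std_gauss)"
proof -
  have "(\<integral>\<^sup>+t. f (- t) \<partial>std_gauss) = (\<integral>\<^sup>+t. f t \<partial>std_gauss)"
    using nn_integral_real_affine[of "\<lambda>t. ennreal (std_normal_density t) * f t" "-1" 0]
    by (simp add: nn_integral_std_gauss normal_density_def)
  then show ?thesis using s by (cases "s > 0") auto
qed

section \<open>The law of one tuple as an iterated integral\<close>

abbreviation unif_angle :: "real measure" where "unif_angle \<equiv> uniform_measure lborel {0..<2*pi}"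

lemma prob_space_unif_angle: "prob_space unif_angle"
  by (rule prob_space_uniform_measure) (simp_all)

lemma nn_integral_unif_angle:
  assumes [measurable]: "f \<in> borel_measurable borel"
  shows "(\<integral>\<^sup>+x. f x \<partial>unif_angle) = ennreal (1 / (2 * pi)) * (\<integral>\<^sup>+x. f x * indicator {0..<2*pi} x \<partial>lborel)"
  by (subst nn_integral_uniform_measure) (simp_all add: divide_ennreal_def inverse_ennreal mult.commute inverse_eq_divide)

lemma prob_space_tuple_law: "prob_space tuple_law"
  and sets_tuple_law [measurable_cong]: "sets tuple_law = sets borel"
  and nn_integral_tuple_law: "f \<in> borel_measurable borel \<Longrightarrow> (\<integral>\<^sup>+x. f x \<partial>tuple_law)
    = (\<integral>\<^sup>+a. \<integral>\<^sup>+b. \<integral>\<^sup>+r. \<integral>\<^sup>+s. \<integral>\<^sup>+\<theta>. f (a, b, r, s, \<theta>) \<partial>unif_angle \<partial>std_gauss \<partial>std_gauss \<partial>std_gauss \<partial>std_gauss)"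
proof -
  interpret g: prob_space std_gauss by (rule prob_space_std_gauss)
  interpret t: prob_space unif_angle by (rule prob_space_unif_angle)
  interpret p1: pair_prob_space std_gauss unif_angle ..
  interpret p2: pair_prob_space std_gauss "std_gauss \<Otimes>\<^sub>M unif_angle" ..
  interpret p3: pair_prob_space std_gauss "std_gauss \<Otimes>\<^sub>M std_gauss \<Otimes>\<^sub>M unif_angle" ..
  interpret p4: pair_prob_space std_gauss "std_gauss \<Otimes>\<^sub>M std_gauss \<Otimes>\<^sub>M std_gauss \<Otimes>\<^sub>M unif_angle" ..
  show "prob_space tuple_law" unfolding tuple_law_def by (rule p4.prob_space_axioms)
  show s: "sets tuple_law = sets borel"
    unfolding tuple_law_def borel_prod[symmetric] by (intro sets_pair_measure_cong) auto
  assume f: "f \<in> borel_measurable borel"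
  then have "f \<in> borel_measurable tuple_law" by (simp add: measurable_cong_sets[OF s refl])
  then have [measurable]: "f \<in> borel_measurable (std_gauss \<Otimes>\<^sub>M std_gauss \<Otimes>\<^sub>M std_gauss \<Otimes>\<^sub>M std_gauss \<Otimes>\<^sub>M unif_angle)"
    by (simp add: tuple_law_def)
  show "(\<integral>\<^sup>+x. f x \<partial>tuple_law)
    = (\<integral>\<^sup>+a. \<integral>\<^sup>+b. \<integral>\<^sup>+r. \<integral>\<^sup>+s. \<integral>\<^sup>+\<theta>. f (a, b, r, s, \<theta>) \<partial>unif_angle \<partial>std_gauss \<partial>std_gauss \<partial>std_gauss \<partial>std_gauss)"
    unfolding tuple_law_def
    by (simp add: p3.nn_integral_fst[symmetric] p2.nn_integral_fst[symmetric] p1.nn_integral_fst[symmetric] t.nn_integral_fst[symmetric])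
qed

lemma nn_integral_tuple_law_reorder:
  fixes F :: "tuple \<Rightarrow> ennreal"
  assumes [measurable]: "F \<in> borel_measurable (borel \<Otimes>\<^sub>M borel \<Otimes>\<^sub>M borel \<Otimes>\<^sub>M borel \<Otimes>\<^sub>M borel)"
  shows "(\<integral>\<^sup>+b. \<integral>\<^sup>+s. \<integral>\<^sup>+\<theta>. \<integral>\<^sup>+a. \<integral>\<^sup>+r. F (a, b, r, s, \<theta>) \<partial>std_gauss \<partial>std_gauss \<partial>unif_angle \<partial>std_gauss \<partial>std_gauss)
    = (\<integral>\<^sup>+a. \<integral>\<^sup>+b. \<integral>\<^sup>+r. \<integral>\<^sup>+s. \<integral>\<^sup>+\<theta>. F (a, b, r, s, \<theta>) \<partial>unif_angle \<partial>std_gauss \<partial>std_gauss \<partial>std_gauss \<partial>std_gauss)"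
proof -
  interpret g: prob_space std_gauss by (rule prob_space_std_gauss)
  interpret t: prob_space unif_angle by (rule prob_space_unif_angle)
  note sw = nn_integral_cong nn_integral_swap g.sigma_finite_measure_axioms t.sigma_finite_measure_axioms
  have "(\<integral>\<^sup>+b. \<integral>\<^sup>+s. \<integral>\<^sup>+\<theta>. \<integral>\<^sup>+a. \<integral>\<^sup>+r. F (a, b, r, s, \<theta>) \<partial>std_gauss \<partial>std_gauss \<partial>unif_angle \<partial>std_gauss \<partial>std_gauss)
    = (\<integral>\<^sup>+b. \<integral>\<^sup>+s. \<integral>\<^sup>+a. \<integral>\<^sup>+\<theta>. \<integral>\<^sup>+r. F (a, b, r, s, \<theta>) \<partial>std_gauss \<partial>unif_angle \<partial>std_gauss \<partial>std_gauss \<partial>std_gauss)"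
    by (intro sw) measurable
  also have "\<dots> = (\<integral>\<^sup>+b. \<integral>\<^sup>+a. \<integral>\<^sup>+s. \<integral>\<^sup>+\<theta>. \<integral>\<^sup>+r. F (a, b, r, s, \<theta>) \<partial>std_gauss \<partial>unif_angle \<partial>std_gauss \<partial>std_gauss \<partial>std_gauss)"
    by (rule nn_integral_cong, rule nn_integral_swap[OF g.sigma_finite_measure_axioms g.sigma_finite_measure_axioms]) measurable
  also have "\<dots> = (\<integral>\<^sup>+a. \<integral>\<^sup>+b. \<integral>\<^sup>+s. \<integral>\<^sup>+\<theta>. \<integral>\<^sup>+r. F (a, b, r, s, \<theta>) \<partial>std_gauss \<partial>unif_angle \<partial>std_gauss \<partial>std_gauss \<partial>std_gauss)"
    by (rule nn_integral_swap[OF g.sigma_finite_measure_axioms g.sigma_finite_measure_axioms]) measurable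
  also have "\<dots> = (\<integral>\<^sup>+a. \<integral>\<^sup>+b. \<integral>\<^sup>+s. \<integral>\<^sup>+r. \<integral>\<^sup>+\<theta>. F (a, b, r, s, \<theta>) \<partial>unif_angle \<partial>std_gauss \<partial>std_gauss \<partial>std_gauss \<partial>std_gauss)"
    by (rule nn_integral_cong, rule nn_integral_cong, rule nn_integral_cong,
        rule nn_integral_swap[OF g.sigma_finite_measure_axioms t.sigma_finite_measure_axioms]) measurable
  also have "\<dots> = (\<integral>\<^sup>+a. \<integral>\<^sup>+b. \<integral>\<^sup>+r. \<integral>\<^sup>+s. \<integral>\<^sup>+\<theta>. F (a, b, r, s, \<theta>) \<partial>unif_angle \<partial>std_gauss \<partial>std_gauss \<partial>std_gauss \<partial>std_gauss)"
    by (rule nn_integral_cong, rule nn_integral_cong,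
        rule nn_integral_swap[OF g.sigma_finite_measure_axioms g.sigma_finite_measure_axioms]) measurable
  finally show ?thesis .
qed

lemma AE_gauss3_row:
  fixes q :: "real^3" assumes "q \<noteq> 0"
  shows "AE y in gauss3. q \<bullet> y \<noteq> 0"
proof -
  have "negligible {y. q \<bullet> y = 0}" using assms by (intro negligible_hyperplane) auto
  then have "AE y in lebesgue. y \<notin> {y. q \<bullet> y = 0}"
    using AE_not_in negligible_iff_null_sets by blast
  then have "AE y in lborel. q \<bullet> y \<noteq> 0" by (simp add: AE_completion_iff)
  then show ?thesis unfolding gauss3_def by (subst AE_density) auto
qed

text \<open>For v = V y the vectors u with u^T E v = 0 form the plane orthogonal to U (0, -y_3,
  y_2), with orthonormal basis U e_1 and U w, where w = (0, y_2, y_3) / r and r is the norm of (y_2,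
  y_3). On this plane the kernel becomes a standard Gaussian measure times 1 / (sqrt (2 pi) r),
  independently of the coordinate solved for. In polar coordinates (y_2, y_3) = s (cos, sin) the
  Jacobian |s| cancels 1 / r, the two factors 1 / sqrt (2 pi) form the density of a uniform angle,
  and the double covering by signed s accounts for the 2. The condition on the second row of E makes
  the coefficient of u_2 nonzero for almost every y.\<close>

theorem slice_law:
  fixes f :: "(real^3) \<times> (real^3) \<Rightarrow> ennreal"
  assumes U: "rotation_matrix U" and V: "rotation_matrix V"
    and E: "E = c *\<^sub>R ess_rot U V" "c * c = 1" "E $ 2 \<noteq> 0"
    and f[measurable]: "f \<in> borel_measurable (borel \<Otimes>\<^sub>M borel)"
  shows "(\<integral>\<^sup>+\<rho>. ennreal (2 * cond_kernel E \<rho>) * f (slice \<rho> (solve E \<rho>)) \<partial>cond_base)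
    = (\<integral>\<^sup>+a. f (U *v fst (phi a), V *v snd (phi a)) \<partial>tuple_law)"
proof -
  interpret g: prob_space std_gauss by (rule prob_space_std_gauss)
  interpret g3: prob_space gauss3 by (rule prob_space_gauss3)
  interpret t: prob_space unif_angle by (rule prob_space_unif_angle)
  note oU = U[THEN rotation_matrix_orthogonal] and oV = V[THEN rotation_matrix_orthogonal]
  have [measurable]: "E \<in> space borel" by simp
  define H where "H \<rho> = ennreal (2 * cond_kernel E \<rho>) * f (slice \<rho> (solve E \<rho>))" for \<rho>
  have H[measurable]: "H \<in> borel_measurable (borel \<Otimes>\<^sub>M borel \<Otimes>\<^sub>M borel)"
    unfolding H_def by measurable
  define K where "K v = (\<integral>\<^sup>+x. \<integral>\<^sup>+z. H (x, z, v) \<partial>std_gauss \<partial>std_gauss)" for v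
  have K[measurable]: "K \<in> borel_measurable borel" unfolding K_def by measurable
  have "(\<integral>\<^sup>+\<rho>. ennreal (2 * cond_kernel E \<rho>) * f (slice \<rho> (solve E \<rho>)) \<partial>cond_base)
      = (\<integral>\<^sup>+x. \<integral>\<^sup>+z. \<integral>\<^sup>+v. H (x, z, v) \<partial>gauss3 \<partial>std_gauss \<partial>std_gauss)"
    unfolding H_def by (rule nn_integral_cond_base) measurable
  also have "\<dots> = (\<integral>\<^sup>+x. \<integral>\<^sup>+v. \<integral>\<^sup>+z. H (x, z, v) \<partial>std_gauss \<partial>gauss3 \<partial>std_gauss)"
    by (rule nn_integral_cong, rule nn_integral_swap[OF g3.sigma_finite_measure_axioms g.sigma_finite_measure_axioms]) measurable
  also have "\<dots> = (\<integral>\<^sup>+v. K v \<partial>gauss3)"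
    unfolding K_def by (rule nn_integral_swap[OF g3.sigma_finite_measure_axioms g.sigma_finite_measure_axioms]) measurable
  also have "\<dots> = (\<integral>\<^sup>+y. K (V *v y) \<partial>gauss3)"
    by (subst gauss3_orthogonal[OF oV, symmetric], rule nn_integral_distr) measurable
  also have "\<dots> = (\<integral>\<^sup>+y. 2 * (\<integral>\<^sup>+a. \<integral>\<^sup>+t. ennreal (1 / (sqrt (2 * pi) * sqrt ((y $ 2)\<^sup>2 + (y $ 3)\<^sup>2))) *
      f (U *v vector [a, t * (y $ 2 / sqrt ((y $ 2)\<^sup>2 + (y $ 3)\<^sup>2)), t * (y $ 3 / sqrt ((y $ 2)\<^sup>2 + (y $ 3)\<^sup>2))], V *v y) \<partial>std_gauss \<partial>std_gauss) \<partial>gauss3)"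
  proof (rule nn_integral_cong_AE)
    have row: "(E *v (V *v y)) $ 2 = (transpose V *v (E $ 2)) \<bullet> y" for y
      by (simp add: matrix_vector_mul_component dot_lmul_matrix)
    have nz: "transpose V *v (E $ 2) \<noteq> 0"
    proof
      assume "transpose V *v (E $ 2) = 0"
      then have "V *v (transpose V *v (E $ 2)) = V *v 0" by (rule arg_cong)
      then have "E $ 2 = 0" by (simp only: orthogonal_matrix_cancel[OF oV] matrix_vector_mult_0_right)
      then show False using E(3) by simp
    qed
    show "AE y in gauss3. K (V *v y) = 2 * (\<integral>\<^sup>+a. \<integral>\<^sup>+t. ennreal (1 / (sqrt (2 * pi) * sqrt ((y $ 2)\<^sup>2 + (y $ 3)\<^sup>2))) *
      f (U *v vector [a, t * (y $ 2 / sqrt ((y $ 2)\<^sup>2 + (y $ 3)\<^sup>2)), t * (y $ 3 / sqrt ((y $ 2)\<^sup>2 + (y $ 3)\<^sup>2))], V *v y) \<partial>std_gauss \<partial>std_gauss)"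
      using AE_gauss3_row[OF nz]
    proof eventually_elim
      case (elim y)
      define n where "n = E *v (V *v y)"
      define r where "r = sqrt ((y $ 2)\<^sup>2 + (y $ 3)\<^sup>2)"
      define w where "w = (vector [0, y $ 2 / r, y $ 3 / r] :: real^3)"
      have n2: "n $ 2 \<noteq> 0" using elim row by (simp add: n_def)
      have nU: "n = c *\<^sub>R (U *v vector [0, - (y $ 3), y $ 2])"
      proof -
        have "E *v (V *v y) = c *\<^sub>R (U *v (E0 *v (transpose V *v (V *v y))))"
          unfolding E(1) ess_rot_def scaleR_matrix_vector_assoc[symmetric]
          by (simp only: matrix_vector_mul_assoc matrix_mul_assoc)
        also have "E0 *v (transpose V *v (V *v y)) = vector [0, - (y $ 3), y $ 2]"
          unfolding orthogonal_matrix_cancel[OF oV] E0_vec by (simp add: cross3_def axis_def vec_eq_iff forall_3)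
        finally show ?thesis by (simp add: n_def)
      qed
      have "\<not> (y $ 2 = 0 \<and> y $ 3 = 0)"
      proof
        assume "y $ 2 = 0 \<and> y $ 3 = 0"
        then have "(vector [0, - (y $ 3), y $ 2] :: real^3) = 0" by (simp add: vec_eq_iff forall_3)
        then show False using n2 nU by simp
      qed
      then have r: "r > 0" unfolding r_def by (auto simp: sum_power2_gt_zero_iff)
      have r2: "r\<^sup>2 = (y $ 2)\<^sup>2 + (y $ 3)\<^sup>2" by (simp add: r_def)
      have inU: "(U *v p) \<bullet> (U *v q) = p \<bullet> q" for p q
        using oU by (metis orthogonal_matrix dot_lmul_matrix vector_transpose_matrix matrix_vector_mul_assoc matrix_vector_mul_lid)
      let ?\<alpha> = "U *v axis 1 1" and ?\<beta> = "U *v w"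
      have 1: "?\<alpha> \<bullet> n = 0" "?\<beta> \<bullet> n = 0"
        unfolding nU inner_scaleR_right inU by (simp_all add: w_def inner_vec_def sum_3 axis_def)
      have 2: "cross3 ?\<alpha> ?\<beta> = (c / r) *\<^sub>R n"
      proof -
        have "cross3 (axis 1 1) w = (1 / r) *\<^sub>R vector [0, - (y $ 3), y $ 2]"
          by (simp add: w_def cross3_def axis_def vec_eq_iff forall_3)
        then have "cross3 ?\<alpha> ?\<beta> = (1 / r) *\<^sub>R (U *v vector [0, - (y $ 3), y $ 2])"
          by (simp only: cross_rotation_matrix[OF U] matrix_vector_mult_scaleR)
        then show ?thesis using E(2) by (simp add: nU)
      qed
      have "\<bar>c\<bar> = 1" using E(2) square_eq_1_iff[of c] by auto
      then have 3: "\<bar>c / r\<bar> = 1 / r" using r by simp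
      define Gf where "Gf u = ennreal (2 * gauss3_density u) * f (u, V *v y)" for u
      have [measurable]: "Gf \<in> borel_measurable borel" unfolding Gf_def by measurable
      have dens: "gauss3_density (a *\<^sub>R ?\<alpha> + t *\<^sub>R ?\<beta>) = std_normal_density a * std_normal_density t * (1 / sqrt (2 * pi))" for a t
      proof -
        have "w \<bullet> w = ((y $ 2)\<^sup>2 + (y $ 3)\<^sup>2) / r\<^sup>2"
          by (simp add: w_def inner_vec_def sum_3 power2_eq_square add_divide_distrib)
        then have ww: "w \<bullet> w = 1" using r by (simp add: r2[symmetric])
        have "(norm (a *\<^sub>R ?\<alpha> + t *\<^sub>R ?\<beta>))\<^sup>2 = a\<^sup>2 + t\<^sup>2"
          unfolding power2_norm_eq_inner
          by (simp add: inner_add_left inner_add_right inU ww) (simp add: w_def inner_vec_def sum_3 axis_def power2_eq_square)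
        then show ?thesis
          by (simp add: gauss3_density_norm normal_density_def power3_eq_cube exp_add[symmetric] add_divide_distrib)
      qed
      have e2: "ennreal p * X * ennreal q = ennreal (p * q) * X" if "0 \<le> p" "0 \<le> q" for p q X
        using that by (simp add: ennreal_mult mult_ac)
      have e3: "ennreal p * (ennreal q * (ennreal k * X)) = ennreal (p * q * k) * X" if "0 \<le> p" "0 \<le> q" "0 \<le> k" for p q k X
        using that by (simp add: ennreal_mult mult.assoc)
      have "K (V *v y) = (\<integral>\<^sup>+x. \<integral>\<^sup>+z. Gf (vector [x, - (x * n $ 1 + z * n $ 3) / n $ 2, z]) * ennreal (1 / \<bar>n $ 2\<bar>) \<partial>lborel \<partial>lborel)"
      proof -
        have Heq: "H (x, z, V *v y) = ennreal (2 * (std_normal_density (- (x * n $ 1 + z * n $ 3) / n $ 2) / \<bar>n $ 2\<bar>))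
            * f (vector [x, - (x * n $ 1 + z * n $ 3) / n $ 2, z], V *v y)" for x z
          by (simp add: H_def cond_kernel_def solve_def slice_def n_def)
        then have "ennreal (std_normal_density x) * (ennreal (std_normal_density z) * H (x, z, V *v y))
            = Gf (vector [x, - (x * n $ 1 + z * n $ 3) / n $ 2, z]) * ennreal (1 / \<bar>n $ 2\<bar>)" for x z
          unfolding Heq Gf_def by (subst e3, simp, simp, simp, subst e2) (simp_all add: gauss3_density_def mult_ac)
        then show ?thesis
          unfolding K_def by (simp add: nn_integral_std_gauss nn_integral_cmult[symmetric])
      qed
      also have "\<dots> = (\<integral>\<^sup>+a. \<integral>\<^sup>+t. Gf (a *\<^sub>R ?\<alpha> + t *\<^sub>R ?\<beta>) * ennreal (1 / r) \<partial>lborel \<partial>lborel)"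
        by (rule nn_integral_plane[OF _ n2 1 2 3 r]) measurable
      also have "\<dots> = (\<integral>\<^sup>+a. ennreal (std_normal_density a) * (\<integral>\<^sup>+t. ennreal (std_normal_density t) *
          (2 * (ennreal (1 / (sqrt (2 * pi) * r)) * f (a *\<^sub>R ?\<alpha> + t *\<^sub>R ?\<beta>, V *v y))) \<partial>lborel) \<partial>lborel)"
      proof -
        have "Gf (a *\<^sub>R ?\<alpha> + t *\<^sub>R ?\<beta>) * ennreal (1 / r)
          = ennreal (std_normal_density a) * (ennreal (std_normal_density t) *
          (2 * (ennreal (1 / (sqrt (2 * pi) * r)) * f (a *\<^sub>R ?\<alpha> + t *\<^sub>R ?\<beta>, V *v y))))" for a t
        proof -
          let ?F = "f (a *\<^sub>R ?\<alpha> + t *\<^sub>R ?\<beta>, V *v y)"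
          have "2 * (ennreal (1 / (sqrt (2 * pi) * r)) * ?F) = ennreal (2 * (1 / (sqrt (2 * pi) * r))) * ?F"
            using ennreal_mult'[of 2 "1 / (sqrt (2 * pi) * r)"] by (simp add: mult.assoc)
          then show ?thesis unfolding Gf_def dens using r
            by (simp only:) (subst e2, simp, simp, subst e3, simp, simp, simp, simp add: mult_ac)
        qed
        then show ?thesis by (simp add: nn_integral_cmult[symmetric])
      qed
      also have "\<dots> = (\<integral>\<^sup>+a. \<integral>\<^sup>+t. 2 * (ennreal (1 / (sqrt (2 * pi) * r)) * f (a *\<^sub>R ?\<alpha> + t *\<^sub>R ?\<beta>, V *v y)) \<partial>std_gauss \<partial>std_gauss)"
        by (simp add: nn_integral_std_gauss)
      also have "\<dots> = 2 * (\<integral>\<^sup>+a. \<integral>\<^sup>+t. ennreal (1 / (sqrt (2 * pi) * r)) * f (a *\<^sub>R ?\<alpha> + t *\<^sub>R ?\<beta>, V *v y) \<partial>std_gauss \<partial>std_gauss)"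
        by (subst nn_integral_cmult[symmetric], measurable, intro nn_integral_cong nn_integral_cmult, measurable)
      also have "(\<lambda>a t. a *\<^sub>R ?\<alpha> + t *\<^sub>R ?\<beta>) = (\<lambda>a t. U *v vector [a, t * (y $ 2 / r), t * (y $ 3 / r)])"
      proof (intro ext)
        fix a t
        have "a *\<^sub>R axis 1 1 + t *\<^sub>R w = vector [a, t * (y $ 2 / r), t * (y $ 3 / r)]"
          by (simp add: w_def axis_def vec_eq_iff forall_3)
        then show "a *\<^sub>R ?\<alpha> + t *\<^sub>R ?\<beta> = U *v vector [a, t * (y $ 2 / r), t * (y $ 3 / r)]"
          by (metis matrix_vector_mult_scaleR matrix_vector_right_distrib)
      qed
      finally show ?case unfolding r_def by (metis (no_types, lifting))
    qed
  qed
  also have "\<dots> = (\<integral>\<^sup>+b. \<integral>\<^sup>+s. \<integral>\<^sup>+\<theta>. \<integral>\<^sup>+a. \<integral>\<^sup>+t. f (U *v vector [a, t * cos \<theta>, t * sin \<theta>], V *v vector [b, s * cos \<theta>, s * sin \<theta>])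
      \<partial>std_gauss \<partial>std_gauss \<partial>unif_angle \<partial>std_gauss \<partial>std_gauss)"
  proof -
    define K2 where "K2 y = (\<integral>\<^sup>+a. \<integral>\<^sup>+t. ennreal (1 / (sqrt (2 * pi) * sqrt ((y $ 2)\<^sup>2 + (y $ 3)\<^sup>2))) *
      f (U *v vector [a, t * (y $ 2 / sqrt ((y $ 2)\<^sup>2 + (y $ 3)\<^sup>2)), t * (y $ 3 / sqrt ((y $ 2)\<^sup>2 + (y $ 3)\<^sup>2))], V *v y) \<partial>std_gauss \<partial>std_gauss)" for y :: "real^3"
    define F where "F z = (case z of (a, b, r, s, \<theta>) \<Rightarrow> f (U *v vector [a, r * cos \<theta>, r * sin \<theta>], V *v vector [b, s * cos \<theta>, s * sin \<theta>]))" for z :: tuple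
    have F[measurable]: "F \<in> borel_measurable (borel \<Otimes>\<^sub>M borel \<Otimes>\<^sub>M borel \<Otimes>\<^sub>M borel \<Otimes>\<^sub>M borel)"
      unfolding F_def by measurable
    have [measurable]: "K2 \<in> borel_measurable borel" unfolding K2_def by measurable
    have "(\<integral>\<^sup>+y. 2 * K2 y \<partial>gauss3) = (\<integral>\<^sup>+b. \<integral>\<^sup>+x. \<integral>\<^sup>+z. 2 * K2 (vector [b, x, z]) \<partial>std_gauss \<partial>std_gauss \<partial>std_gauss)"
      by (rule nn_integral_gauss3) measurable
    also have "\<dots> = (\<integral>\<^sup>+b. \<integral>\<^sup>+s. \<integral>\<^sup>+\<theta>. \<integral>\<^sup>+a. \<integral>\<^sup>+t. F (a, b, t, s, \<theta>) \<partial>std_gauss \<partial>std_gauss \<partial>unif_angle \<partial>std_gauss \<partial>std_gauss)"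
    proof (rule nn_integral_cong)
      fix b :: real
      let ?g = "\<lambda>x z. ennreal (std_normal_density x) * (ennreal (std_normal_density z) * K2 (vector [b, x, z]))"
      have "(\<integral>\<^sup>+x. \<integral>\<^sup>+z. 2 * K2 (vector [b, x, z]) \<partial>std_gauss \<partial>std_gauss) = 2 * (\<integral>\<^sup>+x. \<integral>\<^sup>+z. ?g x z \<partial>lborel \<partial>lborel)"
        by (simp add: nn_integral_std_gauss nn_integral_cmult)
      also have "\<dots> = (\<integral>\<^sup>+s. \<integral>\<^sup>+\<theta>. ennreal \<bar>s\<bar> * ?g (s * cos \<theta>) (s * sin \<theta>) * indicator {0..<2*pi} \<theta> \<partial>lborel \<partial>lborel)"
        by (rule nn_integral_polar) measurable
      also have "\<dots> = (\<integral>\<^sup>+s. ennreal (std_normal_density s) * (ennreal (1 / (2 * pi)) *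
          (\<integral>\<^sup>+\<theta>. (\<integral>\<^sup>+a. \<integral>\<^sup>+t. F (a, b, t, s, \<theta>) \<partial>std_gauss \<partial>std_gauss) * indicator {0..<2*pi} \<theta> \<partial>lborel)) \<partial>lborel)"
      proof (rule nn_integral_cong_AE)
        have "AE s in lborel. s \<noteq> (0 :: real)" by (rule AE_lborel_singleton)
        then show "AE s in lborel. (\<integral>\<^sup>+\<theta>. ennreal \<bar>s\<bar> * ?g (s * cos \<theta>) (s * sin \<theta>) * indicator {0..<2*pi} \<theta> \<partial>lborel)
          = ennreal (std_normal_density s) * (ennreal (1 / (2 * pi)) *
          (\<integral>\<^sup>+\<theta>. (\<integral>\<^sup>+a. \<integral>\<^sup>+t. F (a, b, t, s, \<theta>) \<partial>std_gauss \<partial>std_gauss) * indicator {0..<2*pi} \<theta> \<partial>lborel))"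
        proof eventually_elim
          case (elim s)
          have "ennreal \<bar>s\<bar> * ?g (s * cos \<theta>) (s * sin \<theta>)
            = ennreal (std_normal_density s) * (ennreal (1 / (2 * pi)) * (\<integral>\<^sup>+a. \<integral>\<^sup>+t. F (a, b, t, s, \<theta>) \<partial>std_gauss \<partial>std_gauss))" for \<theta>
          proof -
            have r: "sqrt ((s * cos \<theta>)\<^sup>2 + (s * sin \<theta>)\<^sup>2) = \<bar>s\<bar>"
            proof -
              have "(s * cos \<theta>)\<^sup>2 + (s * sin \<theta>)\<^sup>2 = s\<^sup>2 * ((cos \<theta>)\<^sup>2 + (sin \<theta>)\<^sup>2)"
                by (simp only: power_mult_distrib distrib_left)
              then show ?thesis by simp
            qed
            \<comment> \<open>For negative s the unit vector w points opposite to the angle. The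
              resulting sign is moved to t, whose law is symmetric.\<close>
            have sg: "t * (s * x / \<bar>s\<bar>) = t * sgn s * x" for t x using elim by (simp add: sgn_real_def abs_if)
            have "K2 (vector [b, s * cos \<theta>, s * sin \<theta>]) = (\<integral>\<^sup>+a. \<integral>\<^sup>+t. ennreal (1 / (sqrt (2 * pi) * \<bar>s\<bar>)) * F (a, b, t * sgn s, s, \<theta>) \<partial>std_gauss \<partial>std_gauss)"
              unfolding K2_def by (simp only: vector_3 r sg F_def prod.case)
            also have "\<dots> = ennreal (1 / (sqrt (2 * pi) * \<bar>s\<bar>)) * (\<integral>\<^sup>+a. \<integral>\<^sup>+t. F (a, b, t * sgn s, s, \<theta>) \<partial>std_gauss \<partial>std_gauss)"
              by (subst nn_integral_cmult[symmetric], measurable, intro nn_integral_cong nn_integral_cmult, measurable)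
            also have "(\<integral>\<^sup>+a. \<integral>\<^sup>+t. F (a, b, t * sgn s, s, \<theta>) \<partial>std_gauss \<partial>std_gauss) = (\<integral>\<^sup>+a. \<integral>\<^sup>+t. F (a, b, t, s, \<theta>) \<partial>std_gauss \<partial>std_gauss)"
              by (intro nn_integral_cong nn_integral_std_gauss_sgn[OF _ elim]) measurable
            finally have k: "K2 (vector [b, s * cos \<theta>, s * sin \<theta>]) = ennreal (1 / (sqrt (2 * pi) * \<bar>s\<bar>)) * (\<integral>\<^sup>+a. \<integral>\<^sup>+t. F (a, b, t, s, \<theta>) \<partial>std_gauss \<partial>std_gauss)" .
            have nd: "std_normal_density (s * cos \<theta>) * std_normal_density (s * sin \<theta>) = std_normal_density s * (1 / sqrt (2 * pi))"
            proof -
              have "(s * cos \<theta>)\<^sup>2 + (s * sin \<theta>)\<^sup>2 = s\<^sup>2 * ((cos \<theta>)\<^sup>2 + (sin \<theta>)\<^sup>2)"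
                by (simp only: power_mult_distrib distrib_left)
              then have "exp (- (s * cos \<theta>)\<^sup>2 / 2) * exp (- (s * sin \<theta>)\<^sup>2 / 2) = exp (- s\<^sup>2 / 2)"
                by (simp only: exp_add[symmetric]) (simp add: add_divide_distrib[symmetric])
              then show ?thesis by (simp add: normal_density_def)
            qed
            have e4: "ennreal p * (ennreal q * (ennreal k * (ennreal l * X))) = ennreal (p * q * k * l) * X"
              if "0 \<le> p" "0 \<le> q" "0 \<le> k" "0 \<le> l" for p q k l X
              using that by (simp add: ennreal_mult mult.assoc)
            have "\<bar>s\<bar> * std_normal_density (s * cos \<theta>) * std_normal_density (s * sin \<theta>) * (1 / (sqrt (2 * pi) * \<bar>s\<bar>))
              = (std_normal_density (s * cos \<theta>) * std_normal_density (s * sin \<theta>)) * (1 / sqrt (2 * pi))"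
              using elim by simp
            also have "\<dots> = std_normal_density s * (1 / (2 * pi))" unfolding nd by simp
            finally have "\<bar>s\<bar> * std_normal_density (s * cos \<theta>) * std_normal_density (s * sin \<theta>) * (1 / (sqrt (2 * pi) * \<bar>s\<bar>))
              = std_normal_density s * (1 / (2 * pi))" .
            note eq = this
            let ?X = "\<integral>\<^sup>+a. \<integral>\<^sup>+t. F (a, b, t, s, \<theta>) \<partial>std_gauss \<partial>std_gauss"
            have "ennreal \<bar>s\<bar> * ?g (s * cos \<theta>) (s * sin \<theta>)
              = ennreal (\<bar>s\<bar> * std_normal_density (s * cos \<theta>) * std_normal_density (s * sin \<theta>) * (1 / (sqrt (2 * pi) * \<bar>s\<bar>))) * ?X"
              unfolding k by (rule e4) simp_all
            also have "\<dots> = ennreal (std_normal_density s * (1 / (2 * pi))) * ?X" by (simp only: eq)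
            also have "\<dots> = ennreal (std_normal_density s) * (ennreal (1 / (2 * pi)) * ?X)"
              by (subst ennreal_mult) (simp_all add: mult.assoc)
            finally show ?thesis .
          qed
          then show ?case by (simp add: nn_integral_cmult mult.assoc)
        qed
      qed
      also have "\<dots> = (\<integral>\<^sup>+s. \<integral>\<^sup>+\<theta>. \<integral>\<^sup>+a. \<integral>\<^sup>+t. F (a, b, t, s, \<theta>) \<partial>std_gauss \<partial>std_gauss \<partial>unif_angle \<partial>std_gauss)"
      proof -
        have m: "(\<lambda>s. \<integral>\<^sup>+\<theta>. \<integral>\<^sup>+a. \<integral>\<^sup>+t. F (a, b, t, s, \<theta>) \<partial>std_gauss \<partial>std_gauss \<partial>unif_angle) \<in> borel_measurable borel"
          by measurable
        show ?thesis unfolding nn_integral_std_gauss[OF m] by (simp add: nn_integral_unif_angle)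
      qed
      finally show "(\<integral>\<^sup>+x. \<integral>\<^sup>+z. 2 * K2 (vector [b, x, z]) \<partial>std_gauss \<partial>std_gauss)
        = (\<integral>\<^sup>+s. \<integral>\<^sup>+\<theta>. \<integral>\<^sup>+a. \<integral>\<^sup>+t. F (a, b, t, s, \<theta>) \<partial>std_gauss \<partial>std_gauss \<partial>unif_angle \<partial>std_gauss)" .
    qed
    finally show ?thesis unfolding K2_def F_def by simp
  qed
  also have "\<dots> = (\<integral>\<^sup>+a. \<integral>\<^sup>+b. \<integral>\<^sup>+r. \<integral>\<^sup>+s. \<integral>\<^sup>+\<theta>. f (U *v vector [a, r * cos \<theta>, r * sin \<theta>], V *v vector [b, s * cos \<theta>, s * sin \<theta>])
      \<partial>unif_angle \<partial>std_gauss \<partial>std_gauss \<partial>std_gauss \<partial>std_gauss)"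
    using nn_integral_tuple_law_reorder[of "\<lambda>(a, b, r, s, \<theta>). f (U *v vector [a, r * cos \<theta>, r * sin \<theta>], V *v vector [b, s * cos \<theta>, s * sin \<theta>])"]
    by simp
  also have "\<dots> = (\<integral>\<^sup>+a. f (U *v fst (phi a), V *v snd (phi a)) \<partial>tuple_law)"
  proof (subst nn_integral_tuple_law)
    have "phi \<in> measurable borel (borel \<Otimes>\<^sub>M borel)"
      unfolding phi_def borel_prod[symmetric] by measurable
    then show "(\<lambda>a. f (U *v fst (phi a), V *v snd (phi a))) \<in> borel_measurable borel" by measurable
  qed (simp add: phi_def)
  finally show ?thesis .
qed

section \<open>The kinematic formula in the base chart\<close>

lemma sets_PiM_borel_pair [simp]:
  "sets (Pi\<^sub>M UNIV (\<lambda>_::'i::finite. gauss3 \<Otimes>\<^sub>M gauss3)) = sets (Pi\<^sub>M UNIV (\<lambda>_::'i. borel \<Otimes>\<^sub>M borel))"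
  by (intro sets_PiM_cong refl sets_pair_measure_cong) auto

lemma measurable_lambda_PiM_UNIV:
  assumes "\<And>i. (\<lambda>x. f x i) \<in> measurable M (N i)"
  shows "f \<in> measurable M (Pi\<^sub>M UNIV N)"
proof -
  have "(\<lambda>x. \<lambda>i\<in>UNIV. f x i) \<in> measurable M (Pi\<^sub>M UNIV N)"
    by (rule measurable_restrict) (rule assms)
  moreover have "(\<lambda>x. \<lambda>i\<in>UNIV. f x i) = f" by (simp add: fun_eq_iff)
  ultimately show ?thesis by simp
qed

lemma measurable_slice_PiM:
  "(\<lambda>z i. slice (fst z i) (snd z i)) \<in> measurable
     (Pi\<^sub>M UNIV (\<lambda>_::'i::finite. cond_base) \<Otimes>\<^sub>M Pi\<^sub>M UNIV (\<lambda>_::'i. std_gauss)) (Pi\<^sub>M UNIV (\<lambda>_. borel \<Otimes>\<^sub>M borel))"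
  by (rule measurable_lambda_PiM_UNIV) measurable

text \<open>The second coordinates of all the u_i become one inner Gaussian vector. With
  \<open>\<rho>\<close> fixed, this vector is the target variable of the area formula.\<close>

lemma gauss3_pair_PiM_slice:
  "Pi\<^sub>M (UNIV :: 'i::finite set) (\<lambda>_. gauss3 \<Otimes>\<^sub>M gauss3)
    = distr (Pi\<^sub>M UNIV (\<lambda>_::'i. cond_base) \<Otimes>\<^sub>M Pi\<^sub>M UNIV (\<lambda>_::'i. std_gauss)) (Pi\<^sub>M UNIV (\<lambda>_. borel \<Otimes>\<^sub>M borel))
        (\<lambda>z i. slice (fst z i) (snd z i))"
proof -
  interpret g: prob_space std_gauss by (rule prob_space_std_gauss)
  interpret b: prob_space cond_base by (rule prob_space_cond_base)
  interpret p: pair_prob_space cond_base std_gauss ..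
  let ?B = "borel \<Otimes>\<^sub>M borel :: ((real^3) \<times> (real^3)) measure"
  let ?C = "Pi\<^sub>M UNIV (\<lambda>_::'i. cond_base) \<Otimes>\<^sub>M Pi\<^sub>M UNIV (\<lambda>_::'i. std_gauss)"
  have sm: "(\<lambda>(\<rho>, x). slice \<rho> x) \<in> measurable (cond_base \<Otimes>\<^sub>M std_gauss) ?B" by measurable
  have "Pi\<^sub>M (UNIV :: 'i set) (\<lambda>_. gauss3 \<Otimes>\<^sub>M gauss3)
      = Pi\<^sub>M (UNIV :: 'i set) (\<lambda>_. distr (cond_base \<Otimes>\<^sub>M std_gauss) ?B (\<lambda>(\<rho>, x). slice \<rho> x))"
    unfolding gauss3_pair_slice ..
  also have "\<dots> = distr (Pi\<^sub>M UNIV (\<lambda>_. cond_base \<Otimes>\<^sub>M std_gauss)) (Pi\<^sub>M UNIV (\<lambda>_. ?B)) (\<lambda>w i. (\<lambda>(\<rho>, x). slice \<rho> x) (w i))"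
    by (rule PiM_distr[OF p.prob_space_axioms sm])
  also have "Pi\<^sub>M (UNIV :: 'i set) (\<lambda>_. cond_base \<Otimes>\<^sub>M std_gauss)
      = distr ?C (Pi\<^sub>M UNIV (\<lambda>_. cond_base \<Otimes>\<^sub>M std_gauss)) (\<lambda>(x, y). \<lambda>i\<in>UNIV. (x i, y i))"
    by (rule PiM_pair_measure) (simp_all add: b.sigma_finite_measure_axioms g.sigma_finite_measure_axioms)
  also have "distr (distr ?C (Pi\<^sub>M UNIV (\<lambda>_. cond_base \<Otimes>\<^sub>M std_gauss)) (\<lambda>(x, y). \<lambda>i\<in>UNIV. (x i, y i)))
      (Pi\<^sub>M UNIV (\<lambda>_. ?B)) (\<lambda>w i. (\<lambda>(\<rho>, x). slice \<rho> x) (w i))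
    = distr ?C (Pi\<^sub>M UNIV (\<lambda>_. ?B)) ((\<lambda>w i. (\<lambda>(\<rho>, x). slice \<rho> x) (w i)) \<circ> (\<lambda>(x, y). \<lambda>i\<in>UNIV. (x i, y i)))"
  proof (rule distr_distr)
    show "(\<lambda>w i. (\<lambda>(\<rho>, x). slice \<rho> x) (w i)) \<in> measurable (Pi\<^sub>M UNIV (\<lambda>_. cond_base \<Otimes>\<^sub>M std_gauss)) (Pi\<^sub>M UNIV (\<lambda>_. ?B))"
      by (rule measurable_lambda_PiM_UNIV) measurable
    show "(\<lambda>(x, y). \<lambda>i\<in>UNIV. (x i, y i)) \<in> measurable ?C (Pi\<^sub>M UNIV (\<lambda>_. cond_base \<Otimes>\<^sub>M std_gauss))"
      by measurable
  qed
  also have "(\<lambda>w i. (\<lambda>(\<rho>, x). slice \<rho> x) (w i)) \<circ> (\<lambda>(x, y). \<lambda>i\<in>UNIV. (x i, y i)) = (\<lambda>z i. slice (fst z i) (snd z i))"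
    by (auto simp: fun_eq_iff)
  finally show ?thesis .
qed

lemma nn_integral_gauss3_pair_PiM:
  assumes F: "F \<in> borel_measurable (Pi\<^sub>M UNIV (\<lambda>_::'i::finite. borel \<Otimes>\<^sub>M borel))"
  shows "(\<integral>\<^sup>+w. F w \<partial>Pi\<^sub>M UNIV (\<lambda>_::'i. gauss3 \<Otimes>\<^sub>M gauss3))
    = (\<integral>\<^sup>+\<rho>. \<integral>\<^sup>+x. F (\<lambda>i. slice (\<rho> i) (x i)) \<partial>Pi\<^sub>M UNIV (\<lambda>_. std_gauss) \<partial>Pi\<^sub>M UNIV (\<lambda>_. cond_base))"
proof -
  interpret g: prob_space "Pi\<^sub>M UNIV (\<lambda>_::'i. std_gauss)"
    by (rule prob_space_PiM[OF prob_space_std_gauss])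
  show ?thesis
    unfolding gauss3_pair_PiM_slice
    using measurable_compose[OF measurable_slice_PiM F]
    by (subst nn_integral_distr[OF measurable_slice_PiM]) (simp_all add: F g.nn_integral_fst[symmetric])
qed

lemma AE_gauss3_pair_PiM:
  assumes "AE w in Pi\<^sub>M UNIV (\<lambda>_::'i::finite. gauss3 \<Otimes>\<^sub>M gauss3). P w"
  shows "AE \<rho> in Pi\<^sub>M UNIV (\<lambda>_::'i. cond_base). AE x in Pi\<^sub>M UNIV (\<lambda>_. std_gauss). P (\<lambda>i. slice (\<rho> i) (x i))"
proof -
  interpret g: prob_space "Pi\<^sub>M UNIV (\<lambda>_::'i. std_gauss)"
    by (rule prob_space_PiM[OF prob_space_std_gauss])
  interpret b: prob_space "Pi\<^sub>M UNIV (\<lambda>_::'i. cond_base)"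
    by (rule prob_space_PiM[OF prob_space_cond_base])
  interpret pair_sigma_finite "Pi\<^sub>M UNIV (\<lambda>_::'i. cond_base)" "Pi\<^sub>M UNIV (\<lambda>_::'i. std_gauss)" ..
  have "AE z in Pi\<^sub>M UNIV (\<lambda>_::'i. cond_base) \<Otimes>\<^sub>M Pi\<^sub>M UNIV (\<lambda>_::'i. std_gauss). P (\<lambda>i. slice (fst z i) (snd z i))"
    using assms unfolding gauss3_pair_PiM_slice by (rule AE_distrD[OF measurable_slice_PiM])
  from AE_pair[OF this] show ?thesis by simp
qed

lemma PiM_std_gauss:
  "Pi\<^sub>M (UNIV :: 'n::finite set) (\<lambda>_. std_gauss) = density (Pi\<^sub>M UNIV (\<lambda>_. lborel)) (\<lambda>x. \<Prod>i\<in>UNIV. ennreal (std_normal_density (x i)))"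
proof -
  interpret g: prob_space std_gauss by (rule prob_space_std_gauss)
  show ?thesis
    unfolding std_gauss_def
    by (rule PiM_density)
       (use g.sigma_finite_measure_axioms lborel.sigma_finite_measure_axioms in \<open>simp_all add: std_gauss_def\<close>)
qed

lemma measurable_vec_lambda_lborel:
  "vec_lambda \<in> borel_measurable (Pi\<^sub>M UNIV (\<lambda>_::'n::finite. lborel :: 'a::euclidean_space measure))"
proof -
  have "sets (Pi\<^sub>M UNIV (\<lambda>_::'n. lborel :: 'a measure)) = sets (Pi\<^sub>M UNIV (\<lambda>_. borel))"
    by (intro sets_PiM_cong) auto
  from measurable_cong_sets[OF this refl] show ?thesis using measurable_vec_lambda[where 'n = 'n and 'a = 'a] by blast
qed

lemma nn_integral_PiM_std_gauss:
  assumes H: "H \<in> borel_measurable (Pi\<^sub>M UNIV (\<lambda>_::'n::finite. borel))"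
  shows "(\<integral>\<^sup>+x. H x \<partial>Pi\<^sub>M UNIV (\<lambda>_::'n. std_gauss))
    = (\<integral>\<^sup>+x. (\<Prod>i\<in>UNIV. ennreal (std_normal_density (x $ i))) * H (\<lambda>i. x $ i) \<partial>(lborel :: (real^'n) measure))"
proof -
  have "sets (Pi\<^sub>M UNIV (\<lambda>_::'n. lborel :: real measure)) = sets (Pi\<^sub>M UNIV (\<lambda>_. borel))"
    by (intro sets_PiM_cong) auto
  from measurable_cong_sets[OF this refl] have H'[measurable]: "H \<in> borel_measurable (Pi\<^sub>M UNIV (\<lambda>_::'n. lborel))"
    using H by blast
  have nm: "(\<lambda>x :: real^'n. \<lambda>i. x $ i) \<in> measurable borel (Pi\<^sub>M UNIV (\<lambda>_. borel))"
    by (rule measurable_lambda_PiM_UNIV) measurable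
  have [measurable]: "(\<lambda>x :: real^'n. H (\<lambda>i. x $ i)) \<in> borel_measurable borel"
    by (rule measurable_compose[OF nm H])
  have "(\<integral>\<^sup>+x. H x \<partial>Pi\<^sub>M UNIV (\<lambda>_::'n. std_gauss))
      = (\<integral>\<^sup>+x. (\<Prod>i\<in>UNIV. ennreal (std_normal_density (x i))) * H x \<partial>Pi\<^sub>M UNIV (\<lambda>_::'n. lborel))"
    unfolding PiM_std_gauss by (subst nn_integral_density) measurable
  also have "\<dots> = (\<integral>\<^sup>+x. (\<Prod>i\<in>UNIV. ennreal (std_normal_density (x $ i))) * H (\<lambda>i. x $ i) \<partial>(lborel :: (real^'n) measure))"
    by (subst lborel_eq_distr_PiM_vec, subst nn_integral_distr[OF measurable_vec_lambda_lborel]) (simp_all add: vec_lambda_inverse)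
  finally show ?thesis .
qed

text \<open>The Gaussian density is positive everywhere, so Gaussian null sets are Lebesgue
  null.\<close>

lemma AE_PiM_std_gauss:
  assumes "AE x in Pi\<^sub>M UNIV (\<lambda>_::'n::finite. std_gauss). P x"
  shows "AE x in (lborel :: (real^'n) measure). P (\<lambda>i. x $ i)"
proof -
  from AE_E[OF assms] obtain N where N: "{x \<in> space (Pi\<^sub>M UNIV (\<lambda>_::'n. std_gauss)). \<not> P x} \<subseteq> N"
    "emeasure (Pi\<^sub>M UNIV (\<lambda>_::'n. std_gauss)) N = 0" "N \<in> sets (Pi\<^sub>M UNIV (\<lambda>_::'n. std_gauss))" by blast
  have sp: "space (Pi\<^sub>M UNIV (\<lambda>_::'n. std_gauss)) = UNIV"
    by (auto simp: space_PiM std_gauss_def)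
  have "sets (Pi\<^sub>M UNIV (\<lambda>_::'n. std_gauss)) = sets (Pi\<^sub>M UNIV (\<lambda>_. borel))"
    by (intro sets_PiM_cong) (auto simp: std_gauss_def)
  with N(3) have Ns: "N \<in> sets (Pi\<^sub>M UNIV (\<lambda>_::'n. borel :: real measure))" by simp
  have nm: "(\<lambda>x :: real^'n. \<lambda>i. x $ i) \<in> measurable borel (Pi\<^sub>M UNIV (\<lambda>_. borel))"
    by (rule measurable_lambda_PiM_UNIV) measurable
  have ind[measurable]: "(\<lambda>x. indicator N x :: ennreal) \<in> borel_measurable (Pi\<^sub>M UNIV (\<lambda>_::'n. borel))"
    using Ns by measurable
  have im: "(\<lambda>x :: real^'n. indicator N (\<lambda>i. x $ i) :: ennreal) \<in> borel_measurable borel"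
    by (rule measurable_compose[OF nm ind])
  have dm: "(\<lambda>x :: real^'n. \<Prod>i\<in>UNIV. ennreal (std_normal_density (x $ i))) \<in> borel_measurable borel"
    by measurable
  have "(\<integral>\<^sup>+x. (\<Prod>i\<in>UNIV. ennreal (std_normal_density (x $ i))) * indicator N (\<lambda>i. x $ i) \<partial>(lborel :: (real^'n) measure)) = 0"
    unfolding nn_integral_PiM_std_gauss[OF ind, symmetric] using N by simp
  then have "AE x in (lborel :: (real^'n) measure). (\<Prod>i\<in>UNIV. ennreal (std_normal_density (x $ i))) * indicator N (\<lambda>i. x $ i) = 0"
    by (subst (asm) nn_integral_0_iff_AE) (use im dm in simp_all)
  then show ?thesis
  proof eventually_elim
    case (elim x)
    have "std_normal_density t \<noteq> 0" for t by (simp add: std_normal_density_def)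
    then have "(\<Prod>i\<in>UNIV. ennreal (std_normal_density (x $ i))) \<noteq> 0"
      by (simp add: prod_zero_iff)
    with elim have "(\<lambda>i. x $ i) \<notin> N" by (auto simp: indicator_def split: if_splits)
    with N(1) sp show ?case by auto
  qed
qed

text \<open>On indicators \<open>slice_law\<close> says that two measures on pairs of vectors
  coincide, hence so do their products. The product of densities on the left is the density of the
  product measure.\<close>

lemma slice_law_PiM:
  fixes H :: "('i::finite \<Rightarrow> (real^3) \<times> (real^3)) \<Rightarrow> ennreal"
  assumes U: "rotation_matrix U" and V: "rotation_matrix V"
    and E: "E = c *\<^sub>R ess_rot U V" "c * c = 1" "E $ 2 \<noteq> 0"
    and H[measurable]: "H \<in> borel_measurable (Pi\<^sub>M UNIV (\<lambda>_. borel \<Otimes>\<^sub>M borel))"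
  shows "(\<integral>\<^sup>+\<rho>. (\<Prod>i\<in>UNIV. ennreal (2 * cond_kernel E (\<rho> i))) * H (\<lambda>i. slice (\<rho> i) (solve E (\<rho> i))) \<partial>Pi\<^sub>M UNIV (\<lambda>_. cond_base))
    = (\<integral>\<^sup>+a. H (\<lambda>i. (U *v fst (phi (a i)), V *v snd (phi (a i)))) \<partial>Pi\<^sub>M UNIV (\<lambda>_. tuple_law))"
proof -
  interpret b: prob_space cond_base by (rule prob_space_cond_base)
  interpret t: prob_space tuple_law by (rule prob_space_tuple_law)
  let ?B = "borel \<Otimes>\<^sub>M borel :: ((real^3) \<times> (real^3)) measure"
  let ?k = "\<lambda>\<rho>. ennreal (2 * cond_kernel E \<rho>)"
  let ?s = "\<lambda>\<rho>. slice \<rho> (solve E \<rho>)"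
  let ?u = "\<lambda>a. (U *v fst (phi a), V *v snd (phi a))"
  have [measurable]: "?s \<in> measurable cond_base ?B" "?k \<in> borel_measurable cond_base" by measurable
  have "phi \<in> measurable borel (borel \<Otimes>\<^sub>M borel)"
    unfolding phi_def borel_prod[symmetric] by measurable
  then have [measurable]: "phi \<in> measurable tuple_law (borel \<Otimes>\<^sub>M borel)"
    by (simp add: measurable_cong_sets[OF sets_tuple_law refl])
  have um[measurable]: "?u \<in> measurable tuple_law ?B" by measurable
  have sm: "?s \<in> measurable (density cond_base ?k) ?B" by measurable
  have eq: "distr (density cond_base ?k) ?B ?s = distr tuple_law ?B ?u"
  proof (rule measure_eqI)
    fix B assume "B \<in> sets (distr (density cond_base ?k) ?B ?s)"
    then have [measurable]: "B \<in> sets ?B" by simp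
    have "emeasure (distr (density cond_base ?k) ?B ?s) B = (\<integral>\<^sup>+\<rho>. ?k \<rho> * indicator B (?s \<rho>) \<partial>cond_base)"
      by (subst nn_integral_indicator[symmetric], simp, subst nn_integral_distr[OF sm], simp, subst nn_integral_density) simp_all
    also have "\<dots> = (\<integral>\<^sup>+a. indicator B (?u a) \<partial>tuple_law)"
      by (rule slice_law[OF U V E]) measurable
    also have "\<dots> = emeasure (distr tuple_law ?B ?u) B"
      by (subst nn_integral_indicator[symmetric], simp, subst nn_integral_distr) simp_all
    finally show "emeasure (distr (density cond_base ?k) ?B ?s) B = emeasure (distr tuple_law ?B ?u) B" .
  qed simp
  \<comment> \<open>Its image is also an image of the probability measure \<open>tuple_law\<close>,
    so its total mass is 1. Probability is what the product of image measures requires.\<close>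
  have pk: "prob_space (density cond_base ?k)"
  proof -
    have "prob_space (distr (density cond_base ?k) ?B ?s)" unfolding eq by (rule t.prob_space_distr[OF um])
    then have "emeasure (distr (density cond_base ?k) ?B ?s) (space ?B) = 1"
      using prob_space.emeasure_space_1 by fastforce
    then have "emeasure (density cond_base ?k) (?s -` space ?B \<inter> space (density cond_base ?k)) = 1"
      by (subst (asm) emeasure_distr[OF sm]) auto
    moreover have "?s -` space ?B \<inter> space (density cond_base ?k) = space (density cond_base ?k)"
      by (auto simp: space_pair_measure)
    ultimately show ?thesis by (intro prob_spaceI) simp
  qed
  have P1: "Pi\<^sub>M (UNIV :: 'i set) (\<lambda>_. distr (density cond_base ?k) ?B ?s)
    = distr (Pi\<^sub>M UNIV (\<lambda>_. density cond_base ?k)) (Pi\<^sub>M UNIV (\<lambda>_. ?B)) (\<lambda>w i. ?s (w i))"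
    by (rule PiM_distr[OF pk sm])
  have P2: "Pi\<^sub>M (UNIV :: 'i set) (\<lambda>_. distr tuple_law ?B ?u)
    = distr (Pi\<^sub>M UNIV (\<lambda>_. tuple_law)) (Pi\<^sub>M UNIV (\<lambda>_. ?B)) (\<lambda>w i. ?u (w i))"
    by (rule PiM_distr[OF t.prob_space_axioms um])
  have P3: "Pi\<^sub>M (UNIV :: 'i set) (\<lambda>_. density cond_base ?k) = density (Pi\<^sub>M UNIV (\<lambda>_. cond_base)) (\<lambda>\<rho>. \<Prod>i\<in>UNIV. ?k (\<rho> i))"
  proof (rule PiM_density)
    interpret prob_space "density cond_base ?k" by (rule pk)
    show "sigma_finite_measure (density cond_base ?k)" ..
    show "sigma_finite_measure cond_base" ..
  qed simp_all
  have m1: "(\<lambda>\<rho> i. ?s (\<rho> i)) \<in> measurable (Pi\<^sub>M (UNIV :: 'i set) (\<lambda>_. cond_base)) (Pi\<^sub>M UNIV (\<lambda>_. ?B))"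
    by (rule measurable_lambda_PiM_UNIV) measurable
  have m2: "(\<lambda>\<rho> i. ?s (\<rho> i)) \<in> measurable (Pi\<^sub>M (UNIV :: 'i set) (\<lambda>_. density cond_base ?k)) (Pi\<^sub>M UNIV (\<lambda>_. ?B))"
    by (rule measurable_lambda_PiM_UNIV) measurable
  have m3: "(\<lambda>\<rho> i. ?u (\<rho> i)) \<in> measurable (Pi\<^sub>M (UNIV :: 'i set) (\<lambda>_. tuple_law)) (Pi\<^sub>M UNIV (\<lambda>_. ?B))"
    by (rule measurable_lambda_PiM_UNIV) measurable
  have mk: "(\<lambda>\<rho>. \<Prod>i\<in>UNIV. ?k (\<rho> i)) \<in> borel_measurable (Pi\<^sub>M (UNIV :: 'i set) (\<lambda>_. cond_base))" by measurable
  have "(\<integral>\<^sup>+\<rho>. (\<Prod>i\<in>UNIV. ?k (\<rho> i)) * H (\<lambda>i. ?s (\<rho> i)) \<partial>Pi\<^sub>M UNIV (\<lambda>_. cond_base))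
      = (\<integral>\<^sup>+\<rho>. H (\<lambda>i. ?s (\<rho> i)) \<partial>Pi\<^sub>M UNIV (\<lambda>_. density cond_base ?k))"
    unfolding P3 using mk measurable_compose[OF m1 H] by (subst nn_integral_density) auto
  also have "\<dots> = (\<integral>\<^sup>+w. H w \<partial>Pi\<^sub>M UNIV (\<lambda>_. distr (density cond_base ?k) ?B ?s))"
    unfolding P1 by (subst nn_integral_distr[OF m2]) (simp_all add: H)
  also have "\<dots> = (\<integral>\<^sup>+a. H (\<lambda>i. ?u (a i)) \<partial>Pi\<^sub>M UNIV (\<lambda>_. tuple_law))"
    unfolding eq P2 by (subst nn_integral_distr[OF m3]) (simp_all add: H)
  finally show ?thesis .
qed

section \<open>The exceptional null set of tuples\<close>

lemma differentiable_vec_lambda: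
  assumes "\<And>i. (\<lambda>x. f i x) differentiable (at x within S)"
  shows "(\<lambda>x. \<chi> i. (f i x :: 'b::euclidean_space)) differentiable (at x within S)"
  unfolding differentiable_componentwise_within[of "\<lambda>x. \<chi> i. f i x"]
  by (auto simp: Basis_vec_def inner_axis assms)

lemma differentiable_vec_nth:
  "f differentiable (at x within S) \<Longrightarrow> (\<lambda>x. f x $ i) differentiable (at x within S)"
  using bounded_linear.has_derivative[OF bounded_linear_vec_nth] unfolding differentiable_def by blast

lemma differentiable_vector_3:
  assumes "f differentiable (at x within S)" "g differentiable (at x within S)" "h differentiable (at x within S)"
  shows "(\<lambda>x. vector [f x, g x, h x] :: real^3) differentiable (at x within S)"
proof -
  have "(\<lambda>x. vector [f x, g x, h x] :: real^3) = (\<lambda>x. \<chi> i. (if i = 1 then f else if i = 2 then g else h) x)"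
    by (auto simp: fun_eq_iff vec_eq_iff forall_3)
  moreover have "(\<lambda>x. \<chi> i::3. (if i = 1 then f else if i = 2 then g else h) x) differentiable (at x within S)"
    by (rule differentiable_vec_lambda) (use assms in auto)
  ultimately show ?thesis by simp
qed

lemma differentiable_matrix_vector_mult:
  fixes A :: "'a::real_normed_vector \<Rightarrow> real^'n^'m"
  assumes "A differentiable (at x within S)" "f differentiable (at x within S)"
  shows "(\<lambda>x. A x *v f x) differentiable (at x within S)"
  unfolding matrix_vector_mult_def
  by (intro differentiable_vec_lambda differentiable_sum ballI differentiable_mult differentiable_vec_nth assms) simp

lemma differentiable_sin_cos:
  fixes f :: "'a::real_normed_vector \<Rightarrow> real"
  assumes "f differentiable (at x within S)"
  shows "(\<lambda>x. sin (f x)) differentiable (at x within S)" "(\<lambda>x. cos (f x)) differentiable (at x within S)"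
  using has_derivative_sin has_derivative_cos assms unfolding differentiable_def by blast+

definition vec_tuple :: "real^5 \<Rightarrow> tuple" where
  "vec_tuple x = (x $ 1, x $ 2, x $ 3, x $ 4, x $ 5)"

text \<open>Parametrizes the tuples incident with some \<open>ess_param p\<close>, from a space of the same dimension
  \<open>30\<close> as the space of all tuples; hence it maps null sets to null sets.\<close>

definition incidence_param :: "(real^5) \<times> ((real^5)^5) \<Rightarrow> ((real^3) \<times> (real^3))^5" where
  "incidence_param z = (\<chi> i. (left_rot (fst z) *v fst (phi (vec_tuple (snd z $ i))),
     right_rot (fst z) *v snd (phi (vec_tuple (snd z $ i)))))"

lemma differentiable_incidence_param: "incidence_param differentiable (at z)"
proof -
  have L: "(\<lambda>z :: (real^5) \<times> ((real^5)^5). left_rot (fst z)) differentiable (at z)"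
    and R: "(\<lambda>z :: (real^5) \<times> ((real^5)^5). right_rot (fst z)) differentiable (at z)"
    using C1_has_derivative[OF C1_left_rot] C1_has_derivative[OF C1_right_rot]
      has_derivative_compose[OF has_derivative_fst[OF has_derivative_ident]]
    unfolding differentiable_def by blast+
  have s: "(\<lambda>z :: (real^5) \<times> ((real^5)^5). snd z) differentiable F" for F
    using has_derivative_snd[OF has_derivative_ident] unfolding differentiable_def by blast
  show ?thesis
    unfolding incidence_param_def[abs_def] phi_def vec_tuple_def prod.case fst_conv snd_conv
    by (intro differentiable_vec_lambda differentiable_Pair differentiable_matrix_vector_mult L R
        differentiable_vector_3 differentiable_mult differentiable_sin_cos differentiable_vec_nth s)
qed

text \<open>Polar coordinates for (a, b) turn the equation into r sin (c + t - alpha) = 0, where r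
  is nonzero because a is.\<close>

lemma countable_sin_cos_zeros:
  assumes a: "a \<noteq> (0::real)"
  shows "countable {t. a * sin (c + t) = b * cos (c + t)}"
proof -
  obtain r \<alpha> where r: "a = r * cos \<alpha>" "b = r * sin \<alpha>" using polar_Ex[of a b] by blast
  have "{t. a * sin (c + t) = b * cos (c + t)} \<subseteq> range (\<lambda>k::int. of_int k * pi + \<alpha> - c)"
  proof
    fix t assume "t \<in> {t. a * sin (c + t) = b * cos (c + t)}"
    then have "r * sin (c + t - \<alpha>) = 0" using r by (simp add: sin_diff algebra_simps)
    with a r have "sin (c + t - \<alpha>) = 0" by auto
    then obtain k :: int where "c + t - \<alpha> = of_int k * pi" by (auto simp: sin_zero_iff_int2)
    then show "t \<in> range (\<lambda>k::int. of_int k * pi + \<alpha> - c)" by (intro image_eqI[of _ _ k]) auto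
  qed
  then show ?thesis by (rule countable_subset) simp
qed

text \<open>Coordinates 4 and 5 of a tuple are s and theta. With L = \<open>left_rot p\<close>, the
  second coordinate of E v at an incident tuple is s (L_23 cos theta - L_22 sin theta); the
  condition says that it vanishes for some i.\<close>

definition incidence_bad :: "((real^5) \<times> ((real^5)^5)) set" where
  "incidence_bad = {(p, a). p \<in> ess_patch \<and>
     (\<exists>i. a $ i $ 4 = 0 \<or> left_rot p $ 2 $ 2 * sin (a $ i $ 5) = left_rot p $ 2 $ 3 * cos (a $ i $ 5))}"

text \<open>Lines in direction of the coordinate s meet the first condition in at most one point.
  Lines in direction of the angle meet the second in a countable set, because L_22 is nonzero on
  \<open>ess_patch\<close>.\<close>

lemma negligible_incidence_bad: "negligible incidence_bad"
proof -
  let ?S = "\<lambda>i. {z :: (real^5) \<times> ((real^5)^5). snd z $ i $ 4 = 0}"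
  let ?T = "\<lambda>i. {z :: (real^5) \<times> ((real^5)^5). fst z \<in> ess_patch \<and>
     left_rot (fst z) $ 2 $ 2 * sin (snd z $ i $ 5) = left_rot (fst z) $ 2 $ 3 * cos (snd z $ i $ 5)}"
  have lb: "(\<lambda>z :: (real^5) \<times> ((real^5)^5). left_rot (fst z)) \<in> borel_measurable borel"
    by (intro borel_measurable_continuous_onI continuous_on_compose2[OF C1_continuous[OF C1_left_rot]] continuous_intros) auto
  have le: "(\<lambda>z :: (real^5) \<times> ((real^5)^5). left_rot (fst z) $ i $ j) \<in> borel_measurable borel" for i j
    using lb by measurable
  have sn: "(\<lambda>z :: (real^5) \<times> ((real^5)^5). snd z $ i $ j) \<in> borel_measurable borel" for i j
    by (intro borel_measurable_continuous_onI continuous_intros)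
  have pb: "{z :: (real^5) \<times> ((real^5)^5). fst z \<in> ess_patch} \<in> sets borel"
    using borel_open[OF open_vimage_fst[OF open_ess_patch]] by (simp add: vimage_def)
  have S: "?S i \<in> null_sets lborel" for i
  proof -
    have b: "?S i \<in> sets borel" using sn[of i 4] by measurable
    have "emeasure lborel (?S i) = 0"
    proof (rule null_if_countable_on_lines[OF b, where b = "(0, axis i (axis 4 1))"])
      fix x :: "(real^5) \<times> ((real^5)^5)"
      have "{t. x + t *\<^sub>R (0, axis i (axis 4 1)) \<in> ?S i} \<subseteq> {- (snd x $ i $ 4)}"
        by (auto simp: axis_def)
      then show "countable {t. x + t *\<^sub>R (0, axis i (axis 4 1)) \<in> ?S i}"
        by (rule countable_subset) simp
    qed
    with b show ?thesis by (simp add: null_sets_def)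
  qed
  have T: "?T i \<in> null_sets lborel" for i
  proof -
    have "{z \<in> space borel. left_rot (fst z) $ 2 $ 2 * sin (snd z $ i $ (5::5)) = left_rot (fst z) $ 2 $ 3 * cos (snd z $ i $ (5::5))} \<in> sets borel"
    proof -
      have [measurable]: "(\<lambda>z :: (real^5) \<times> ((real^5)^5). sin (snd z $ i $ 5)) \<in> borel_measurable borel"
        "(\<lambda>z :: (real^5) \<times> ((real^5)^5). cos (snd z $ i $ 5)) \<in> borel_measurable borel"
        using sn[of i 5] by measurable
      note le[measurable]
      show ?thesis by measurable
    qed
    with pb have b: "?T i \<in> sets borel"
      using sets.Int[OF pb, of "{z. left_rot (fst z) $ 2 $ 2 * sin (snd z $ i $ 5) = left_rot (fst z) $ 2 $ 3 * cos (snd z $ i $ 5)}"]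
      by (simp add: Int_def)
    have "emeasure lborel (?T i) = 0"
    proof (rule null_if_countable_on_lines[OF b, where b = "(0, axis i (axis 5 1))"])
      fix x :: "(real^5) \<times> ((real^5)^5)"
      show "countable {t. x + t *\<^sub>R (0, axis i (axis 5 1)) \<in> ?T i}"
      proof (cases "fst x \<in> ess_patch")
        case True
        then have "left_rot (fst x) $ 2 $ 2 \<noteq> 0" by (simp add: ess_patch_def)
        from countable_sin_cos_zeros[OF this, of "snd x $ i $ 5" "left_rot (fst x) $ 2 $ 3"]
        show ?thesis by (rule countable_subset[rotated]) (auto simp: axis_def)
      qed simp
    qed
    with b show ?thesis by (simp add: null_sets_def)
  qed
  have "incidence_bad \<subseteq> (\<Union>i. ?S i \<union> ?T i)" by (auto simp: incidence_bad_def)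
  moreover have "(\<Union>i. ?S i \<union> ?T i) \<in> null_sets lborel"
    by (intro null_sets_UN' null_sets.Un S T) auto
  then have "negligible (\<Union>i. ?S i \<union> ?T i)"
    unfolding negligible_iff_null_sets by (rule null_sets_completionI)
  ultimately show ?thesis by (rule negligible_subset[rotated])
qed

text \<open>Signed radii let two parallel vectors share one angle, also when either of them is
  zero.\<close>

lemma parallel_polar:
  fixes a b c d :: real
  assumes "a * d = b * c"
  obtains r s \<theta> where "a = r * cos \<theta>" "b = r * sin \<theta>" "c = s * cos \<theta>" "d = s * sin \<theta>"
proof (cases "a = 0 \<and> b = 0")
  case True
  obtain s \<theta> where "c = s * cos \<theta>" "d = s * sin \<theta>" using polar_Ex by blast
  with True show ?thesis using that[of 0] by simp
next
  case False
  obtain r \<theta> where r: "a = r * cos \<theta>" "b = r * sin \<theta>" using polar_Ex by blast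
  with False have "r \<noteq> 0" by auto
  with assms r have "cos \<theta> * d = sin \<theta> * c" by simp
  then have "c = (c * cos \<theta> + d * sin \<theta>) * cos \<theta>" "d = (c * cos \<theta> + d * sin \<theta>) * sin \<theta>"
    using sin_cos_squared_add[of \<theta>] by algebra+
  with r show ?thesis by (rule that)
qed

text \<open>Off this set, every solution p in the patch is one at which all five equations can be
  solved for the second coordinates.\<close>

definition ess_bad :: "(5 \<Rightarrow> (real^3) \<times> (real^3)) set" where
  "ess_bad = {w. \<exists>p\<in>ess_patch. (\<forall>i. fst (w i) \<bullet> (ess_param p *v snd (w i)) = 0) \<and>
     (\<exists>i. (ess_param p *v snd (w i)) $ 2 = 0)}"

text \<open>Rotating the vectors back to the frame of \<open>E0\<close> turns incidence into
  parallelism of the last two coordinates, and parallel pairs are exactly what \<open>phi\<close>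
  parametrizes.\<close>

lemma ess_bad_subset: "ess_bad \<subseteq> {w. vec_lambda w \<in> incidence_param ` incidence_bad}"
proof
  fix w assume "w \<in> ess_bad"
  then obtain p k where p: "p \<in> ess_patch" and z: "\<And>i. fst (w i) \<bullet> (ess_param p *v snd (w i)) = 0"
    and k: "(ess_param p *v snd (w k)) $ 2 = 0"
    unfolding ess_bad_def by blast
  let ?L = "left_rot p" and ?R = "right_rot p"
  define x where "x i = transpose ?L *v fst (w i)" for i
  define y where "y i = transpose ?R *v snd (w i)" for i
  have o: "orthogonal_matrix ?L" "orthogonal_matrix ?R"
    by (simp_all add: rotation_matrix_orthogonal rotation_left_rot rotation_right_rot)
  have w: "w i = (?L *v x i, ?R *v y i)" for i
    unfolding prod_eq_iff fst_conv snd_conv x_def y_def matrix_vector_mul_assoc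
    using o by (simp only: orthogonal_matrix_def matrix_vector_mul_lid)
  have E: "ess_param p *v snd (w i) = ?L *v vector [0, - (y i $ 3), y i $ 2]" for i
    by (simp add: ess_param_def ess_rot_def y_def matrix_vector_mul_assoc[symmetric] E0_vec
        cross3_def axis_def)
  have par: "x i $ 2 * y i $ 3 = x i $ 3 * y i $ 2" for i
  proof -
    have "x i \<bullet> vector [0, - (y i $ 3), y i $ 2] = fst (w i) \<bullet> (?L *v vector [0, - (y i $ 3), y i $ 2])"
      by (simp add: x_def dot_lmul_matrix[symmetric] vector_transpose_matrix)
    also have "\<dots> = 0" using z[of i] E by simp
    finally show ?thesis by (simp add: inner_vec_def sum_3)
  qed
  have "\<exists>r s \<theta>. x i $ 2 = r * cos \<theta> \<and> x i $ 3 = r * sin \<theta> \<and> y i $ 2 = s * cos \<theta> \<and> y i $ 3 = s * sin \<theta>" for i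
    using parallel_polar[OF par[of i]] by metis
  then obtain r s \<theta> where rs: "\<And>i. x i $ 2 = r i * cos (\<theta> i)" "\<And>i. x i $ 3 = r i * sin (\<theta> i)"
    "\<And>i. y i $ 2 = s i * cos (\<theta> i)" "\<And>i. y i $ 3 = s i * sin (\<theta> i)" by metis
  define a :: "(real^5)^5" where "a = (\<chi> i. vector [x i $ 1, y i $ 1, r i, s i, \<theta> i])"
  have "phi (vec_tuple (a $ i)) = (x i, y i)" for i
    by (simp add: phi_def vec_tuple_def a_def vector_5 vec_eq_iff forall_3 rs)
  then have "vec_lambda w = incidence_param (p, a)"
    by (simp add: incidence_param_def vec_eq_iff w)
  moreover have "?L $ 2 $ 2 * (- (s k * sin (\<theta> k))) + ?L $ 2 $ 3 * (s k * cos (\<theta> k)) = 0"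
    using k unfolding E by (simp add: matrix_vector_mult_def sum_3 rs)
  then have "s k * (?L $ 2 $ 3 * cos (\<theta> k) - ?L $ 2 $ 2 * sin (\<theta> k)) = 0" by (simp add: algebra_simps)
  then have "(p, a) \<in> incidence_bad"
    using p by (auto simp: incidence_bad_def a_def vector_5 intro!: exI[of _ k])
  ultimately show "w \<in> {w. vec_lambda w \<in> incidence_param ` incidence_bad}" by auto
qed

text \<open>A differentiable map between spaces of equal dimension preserves negligible sets, and
  the Gaussian law has a density. Negligible sets need not be Borel, hence the detour through the
  completed measure.\<close>

lemma AE_not_ess_bad: "AE w in Pi\<^sub>M UNIV (\<lambda>_::5. gauss3 \<Otimes>\<^sub>M gauss3). w \<notin> ess_bad"
proof -
  interpret g: prob_space gauss3 by (rule prob_space_gauss3)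
  interpret gg: pair_prob_space gauss3 gauss3 ..
  have "negligible (incidence_param ` incidence_bad)"
    using differentiable_incidence_param
    by (intro negligible_differentiable_image_negligible negligible_incidence_bad)
       (auto simp: differentiable_on_def intro: differentiable_at_withinI)
  then have "AE W in lebesgue. W \<notin> incidence_param ` incidence_bad"
    unfolding negligible_iff_null_sets by (rule AE_not_in)
  then have "AE W in lborel. W \<notin> incidence_param ` incidence_bad"
    by (simp add: AE_completion_iff)
  then have "AE W in distr (Pi\<^sub>M UNIV (\<lambda>_::5. lborel)) borel (\<lambda>f. \<chi> i. f i). W \<notin> incidence_param ` incidence_bad"
    unfolding lborel_eq_distr_PiM_vec .
  from AE_distrD[OF measurable_vec_lambda_lborel this]
  have 1: "AE w in Pi\<^sub>M UNIV (\<lambda>_::5. lborel). w \<notin> ess_bad"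
    by (rule AE_mp) (use ess_bad_subset in auto)
  have d: "gauss3 \<Otimes>\<^sub>M gauss3 = density lborel (\<lambda>(x, y). ennreal (gauss3_density x) * ennreal (gauss3_density y))"
    unfolding gauss3_def lborel_prod[symmetric]
    by (rule pair_measure_density)
       (use g.sigma_finite_measure_axioms lborel.sigma_finite_measure_axioms in \<open>simp_all add: gauss3_def\<close>)
  have "Pi\<^sub>M (UNIV :: 5 set) (\<lambda>_. gauss3 \<Otimes>\<^sub>M gauss3)
    = density (Pi\<^sub>M UNIV (\<lambda>_. lborel)) (\<lambda>w. \<Prod>i\<in>UNIV. (\<lambda>(x, y). ennreal (gauss3_density x) * ennreal (gauss3_density y)) (w i))"
    unfolding d
  proof (rule PiM_density)
    show "sigma_finite_measure (density lborel (\<lambda>(x, y). ennreal (gauss3_density x) * ennreal (gauss3_density y)))"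
      unfolding d[symmetric] by (rule gg.sigma_finite_measure_axioms)
    show "(\<lambda>(x, y). ennreal (gauss3_density x) * ennreal (gauss3_density y)) \<in> borel_measurable lborel"
      unfolding lborel_prod[symmetric] by measurable
  qed (auto intro: lborel.sigma_finite_measure_axioms)
  moreover have "(\<lambda>w. \<Prod>i\<in>UNIV. (\<lambda>(x, y). ennreal (gauss3_density x) * ennreal (gauss3_density y)) (w i))
      \<in> borel_measurable (Pi\<^sub>M UNIV (\<lambda>_::5. lborel))"
    unfolding lborel_prod[symmetric] by measurable
  ultimately show ?thesis
    using 1 by (simp only: AE_density) (rule AE_mp[OF 1], simp)
qed

section \<open>The solution map in the base chart\<close>

abbreviation ess_deriv :: "real^5 \<Rightarrow> real^5 \<Rightarrow> real^3^3" where
  "ess_deriv p \<equiv> frechet_derivative ess_param (at p)"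

lemma ess_chart_mat_1: "ess_chart (mat 1) (mat 1) = ess_param"
  by (simp add: fun_eq_iff ess_chart_def transpose_mat)

text \<open>Implicit differentiation of u^T E v = 0, in which only E and the second coordinate of u
  move: (E v)_2 dx + u^T (dE) v = 0.\<close>

lemma has_derivative_solve:
  assumes n: "(ess_param p *v snd (snd \<rho>)) $ 2 \<noteq> 0"
  shows "((\<lambda>p. solve (ess_param p) \<rho>) has_derivative
    (\<lambda>d. - (fst (slice \<rho> (solve (ess_param p) \<rho>)) \<bullet> (ess_deriv p d *v snd (snd \<rho>))) / (ess_param p *v snd (snd \<rho>)) $ 2)) (at p)"
proof -
  let ?v = "snd (snd \<rho>)"
  have d: "((\<lambda>p. (ess_param p *v ?v) $ k) has_derivative (\<lambda>d. (ess_deriv p d *v ?v) $ k)) (at p)" for k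
  proof -
    have "linear (\<lambda>X :: real^3^3. (X *v ?v) $ k)"
      by (rule linearI) (simp_all add: matrix_vector_mult_def sum_3 algebra_simps)
    then show ?thesis
      by (rule bounded_linear.has_derivative[OF linear_conv_bounded_linear[THEN iffD1] C1_has_derivative[OF C1_ess_param]])
  qed
  have "((\<lambda>p. - (fst \<rho> * (ess_param p *v ?v) $ 1 + fst (snd \<rho>) * (ess_param p *v ?v) $ 3) / (ess_param p *v ?v) $ 2) has_derivative
      (\<lambda>d. (- (fst \<rho> * (ess_deriv p d *v ?v) $ 1 + fst (snd \<rho>) * (ess_deriv p d *v ?v) $ 3) * (ess_param p *v ?v) $ 2
        - (- (fst \<rho> * (ess_param p *v ?v) $ 1 + fst (snd \<rho>) * (ess_param p *v ?v) $ 3)) * (ess_deriv p d *v ?v) $ 2)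
       / ((ess_param p *v ?v) $ 2 * (ess_param p *v ?v) $ 2))) (at p)"
    by (intro has_derivative_divide' has_derivative_minus has_derivative_add has_derivative_mult_right d n)
  then show ?thesis
    unfolding solve_def
    by (rule has_derivative_eq_rhs)
       (use n in \<open>simp add: fun_eq_iff slice_def inner_vec_def sum_3 field_simps\<close>)
qed

lemma continuous_on_ess_param_mult: "continuous_on UNIV (\<lambda>p. (ess_param p *v v) $ k)"
  and continuous_on_ess_deriv_mult: "continuous_on UNIV (\<lambda>p. (ess_deriv p d *v v) $ k)"
  unfolding matrix_vector_mult_def
  by (simp_all, intro continuous_intros C1_continuous[OF C1_ess_param] C1_frechet_continuous[OF C1_ess_param])
     (intro continuous_intros C1_continuous[OF C1_ess_param] C1_frechet_continuous[OF C1_ess_param])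

text \<open>The Jacobian matrix of the five equations with respect to p, with the tuple held
  fixed.\<close>

definition bilin_matrix :: "(5 \<Rightarrow> (real^3) \<times> (real^3)) \<Rightarrow> real^5 \<Rightarrow> real^5^5" where
  "bilin_matrix w p = (\<chi> i j. fst (w i) \<bullet> (ess_deriv p (axis j 1) *v snd (w i)))"

text \<open>The derivative of the solution map has the rows of \<open>bilin_matrix\<close> divided
  by -(E v_i)_2. These divisors combine with the normal densities at the solutions into the factors
  \<open>cond_kernel\<close>. Where some divisor is 0, p is excluded from the count, and the kernel
  is 0 by the convention for division by zero.\<close>

lemma solve_area_formula:
  assumes A: "A \<in> sets borel" "A \<subseteq> ess_patch" and F[measurable]: "F \<in> borel_measurable borel"
  defines "S \<equiv> \<lambda>\<rho> p i. solve (ess_param p) (\<rho> i)"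
  shows "(\<integral>\<^sup>+x. (\<Prod>i\<in>UNIV. ennreal (std_normal_density (x $ i))) * F x
        * emeasure (count_space UNIV) {p\<in>A. (\<forall>i. (ess_param p *v snd (snd (\<rho> i))) $ 2 \<noteq> 0) \<and> (\<chi> i. S \<rho> p i) = x} \<partial>lborel)
    = (\<integral>\<^sup>+p. (\<Prod>i\<in>UNIV. ennreal (cond_kernel (ess_param p) (\<rho> i)))
        * (F (\<chi> i. S \<rho> p i) * ennreal \<bar>det (bilin_matrix (\<lambda>i. slice (\<rho> i) (S \<rho> p i)) p)\<bar>) * indicator A p \<partial>lborel)"
proof -
  let ?n = "\<lambda>p i. (ess_param p *v snd (snd (\<rho> i))) $ 2"
  let ?u = "\<lambda>p i. fst (slice (\<rho> i) (S \<rho> p i))"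
  define h' where "h' p d = (\<chi> i. - (?u p i \<bullet> (ess_deriv p d *v snd (snd (\<rho> i)))) / ?n p i)" for p d
  define W where "W = {p\<in>ess_patch. \<forall>i. ?n p i \<noteq> 0}"
  have "open (\<Inter>i. {p. ?n p i \<noteq> 0})"
    by (intro open_INT ballI open_Collect_neq continuous_on_ess_param_mult continuous_on_const) simp
  then have "open {p. \<forall>i. ?n p i \<noteq> 0}" by (simp add: Collect_all_eq)
  then have W: "open W"
    using open_Int[OF open_ess_patch] by (simp add: W_def Collect_conj_eq)
  have der: "((\<lambda>p. \<chi> i. S \<rho> p i) has_derivative h' p) (at p)" if "p \<in> W" for p
  proof -
    have "((\<lambda>p. S \<rho> p i) has_derivative (\<lambda>d. h' p d $ i)) (at p)" for i
      using that has_derivative_solve[of p "\<rho> i"] by (simp add: h'_def S_def W_def)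
    then show ?thesis
      unfolding has_derivative_componentwise_within[of _ "h' p"]
      by (auto simp: Basis_vec_def inner_axis)
  qed
  have nc: "continuous_on W (\<lambda>p. (ess_param p *v v) $ k)" for v k
    by (rule continuous_on_subset[OF continuous_on_ess_param_mult]) simp
  have cS: "continuous_on W (\<lambda>p. S \<rho> p i)" for i
    unfolding S_def solve_def by (intro continuous_intros nc) (auto simp: W_def)
  have cont: "continuous_on W (\<lambda>p. h' p d)" for d
  proof -
    have dc: "continuous_on W (\<lambda>p. (ess_deriv p d *v v) $ k)" for v k
      by (rule continuous_on_subset[OF continuous_on_ess_deriv_mult]) simp
    show ?thesis
      unfolding h'_def inner_vec_def sum_3 slice_def
      by (simp, intro continuous_intros nc dc cS) (auto simp: W_def)
  qed
  have AW: "A \<inter> W \<in> sets borel" "A \<inter> W \<subseteq> W" using A W by auto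
  have Sm: "(\<lambda>x :: real^5. (\<Prod>i\<in>UNIV. ennreal (std_normal_density (x $ i))) * F x) \<in> borel_measurable borel" by measurable
  have set: "{p\<in>A. (\<forall>i. ?n p i \<noteq> 0) \<and> (\<chi> i. S \<rho> p i) = x} = {p \<in> A \<inter> W. (\<chi> i. S \<rho> p i) = x}" for x
    using A(2) by (auto simp: W_def)
  have det: "\<bar>det (matrix (h' p))\<bar> = (\<Prod>i\<in>UNIV. 1 / \<bar>?n p i\<bar>) * \<bar>det (bilin_matrix (\<lambda>i. slice (\<rho> i) (S \<rho> p i)) p)\<bar>" for p
  proof -
    have "matrix (h' p) = (\<chi> i. (- 1 / ?n p i) *s (bilin_matrix (\<lambda>i. slice (\<rho> i) (S \<rho> p i)) p $ i))"
      by (simp add: matrix_def h'_def bilin_matrix_def vec_eq_iff slice_def)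
    then have "det (matrix (h' p)) = (\<Prod>i\<in>UNIV. - 1 / ?n p i) * det (bilin_matrix (\<lambda>i. slice (\<rho> i) (S \<rho> p i)) p)"
      by (simp only: det_rows_mul vec_lambda_eta)
    then show ?thesis by (simp add: abs_mult abs_prod)
  qed
  have "(\<integral>\<^sup>+x. (\<Prod>i\<in>UNIV. ennreal (std_normal_density (x $ i))) * F x
      * emeasure (count_space UNIV) {p\<in>A. (\<forall>i. ?n p i \<noteq> 0) \<and> (\<chi> i. S \<rho> p i) = x} \<partial>lborel)
    = (\<integral>\<^sup>+p. (\<Prod>i\<in>UNIV. ennreal (std_normal_density ((\<chi> i. S \<rho> p i) $ i))) * F (\<chi> i. S \<rho> p i)
      * ennreal \<bar>det (matrix (h' p))\<bar> * indicator (A \<inter> W) p \<partial>lborel)"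
    unfolding set by (rule area_formula[OF W der cont AW Sm])
  also have "\<dots> = (\<integral>\<^sup>+p. (\<Prod>i\<in>UNIV. ennreal (cond_kernel (ess_param p) (\<rho> i)))
        * (F (\<chi> i. S \<rho> p i) * ennreal \<bar>det (bilin_matrix (\<lambda>i. slice (\<rho> i) (S \<rho> p i)) p)\<bar>) * indicator A p \<partial>lborel)"
  proof (rule nn_integral_cong)
    fix p
    show "(\<Prod>i\<in>UNIV. ennreal (std_normal_density ((\<chi> i. S \<rho> p i) $ i))) * F (\<chi> i. S \<rho> p i)
      * ennreal \<bar>det (matrix (h' p))\<bar> * indicator (A \<inter> W) p
      = (\<Prod>i\<in>UNIV. ennreal (cond_kernel (ess_param p) (\<rho> i)))
        * (F (\<chi> i. S \<rho> p i) * ennreal \<bar>det (bilin_matrix (\<lambda>i. slice (\<rho> i) (S \<rho> p i)) p)\<bar>) * indicator A p"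
    proof (cases "p \<in> A \<and> p \<notin> W")
      case True
      then obtain i where "?n p i = 0" using A(2) by (auto simp: W_def)
      then have "cond_kernel (ess_param p) (\<rho> i) = 0" by (simp add: cond_kernel_def)
      then have "(\<Prod>i\<in>UNIV. ennreal (cond_kernel (ess_param p) (\<rho> i))) = 0" by (auto simp: prod_zero_iff intro!: exI[of _ i])
      with True show ?thesis by simp
    next
      case False
      have "(\<Prod>i\<in>UNIV. ennreal (cond_kernel (ess_param p) (\<rho> i)))
        = (\<Prod>i\<in>UNIV. ennreal (std_normal_density (S \<rho> p i))) * (\<Prod>i\<in>UNIV. ennreal (1 / \<bar>?n p i\<bar>))"
        unfolding prod.distrib[symmetric]
        by (intro prod.cong refl) (simp add: cond_kernel_def S_def ennreal_mult'[symmetric])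
      then show ?thesis
        using False
        by (auto simp: det ennreal_mult' prod_nonneg prod_ennreal mult_ac indicator_def)
    qed
  qed
  finally show ?thesis .
qed

section \<open>Measurability of the integrands\<close>

lemma borel_measurable_ess_param [measurable]: "ess_param \<in> borel_measurable borel"
  and borel_measurable_ess_deriv [measurable]: "(\<lambda>p. ess_deriv p d) \<in> borel_measurable borel"
  by (intro borel_measurable_continuous_onI C1_continuous C1_frechet_continuous C1_ess_param)+

lemma borel_measurable_det [measurable]:
  fixes f :: "'x \<Rightarrow> real^'n^'n"
  assumes "\<And>i j. (\<lambda>x. f x $ i $ j) \<in> borel_measurable M"
  shows "(\<lambda>x. det (f x)) \<in> borel_measurable M"
  unfolding det_def by (intro borel_measurable_sum borel_measurable_times borel_measurable_prod borel_measurable_const assms)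

lemma borel_measurable_bilin_det:
  assumes w: "w \<in> measurable M (Pi\<^sub>M UNIV (\<lambda>_. borel \<Otimes>\<^sub>M borel))" and p[measurable]: "p \<in> borel_measurable M"
  shows "(\<lambda>x. det (bilin_matrix (w x) (p x))) \<in> borel_measurable M"
proof (rule borel_measurable_det)
  fix i j
  have [measurable]: "(\<lambda>x. w x i) \<in> measurable M (borel \<Otimes>\<^sub>M borel)"
    by (rule measurable_compose[OF w measurable_component_singleton]) simp
  show "(\<lambda>x. bilin_matrix (w x) (p x) $ i $ j) \<in> borel_measurable M"
    unfolding bilin_matrix_def by simp
qed

lemma borel_measurable_vec_PiM_pair:
  "(\<lambda>w. \<chi> i. w i) \<in> borel_measurable (Pi\<^sub>M UNIV (\<lambda>_::'i::finite. borel \<Otimes>\<^sub>M borel :: ((real^3) \<times> (real^3)) measure))"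
  unfolding borel_prod by (rule measurable_vec_lambda)

text \<open>The incidence conditions are closed in p and the tuple jointly. The tuple is turned into
  a vector because the counting lemma takes its parameter in a Euclidean space.\<close>

lemma borel_measurable_chart_count:
  assumes "fsigma A"
  shows "(\<lambda>w. emeasure (count_space UNIV) {p\<in>A. \<forall>i. fst (w i) \<bullet> (ess_param p *v snd (w i)) = 0})
    \<in> borel_measurable (Pi\<^sub>M UNIV (\<lambda>_::5. borel \<Otimes>\<^sub>M borel))"
proof -
  have m: "continuous_on UNIV (\<lambda>z :: (real^5) \<times> (((real^3) \<times> (real^3))^5). ess_param (fst z))"
    by (intro continuous_on_compose2[OF C1_continuous[OF C1_ess_param]] continuous_intros) auto
  have "closed {(p, W :: ((real^3) \<times> (real^3))^5). \<forall>i. fst (W $ i) \<bullet> (ess_param p *v snd (W $ i)) = 0}"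
    unfolding case_prod_beta matrix_vector_mult_def inner_vec_def
    by (intro closed_Collect_all closed_Collect_eq continuous_intros) (simp, intro continuous_intros m)
  from borel_measurable_count_solutions[OF assms this]
  show ?thesis
    by (auto dest: measurable_compose[OF borel_measurable_vec_PiM_pair])
qed

lemma measurable_phi: "phi \<in> measurable tuple_law (borel \<Otimes>\<^sub>M borel)"
  and borel_measurable_zvec: "(\<lambda>a. zvec a $ k) \<in> borel_measurable tuple_law"
proof -
  have "phi \<in> measurable borel (borel \<Otimes>\<^sub>M borel)"
    unfolding phi_def borel_prod[symmetric] by measurable
  then show "phi \<in> measurable tuple_law (borel \<Otimes>\<^sub>M borel)"
    by (simp add: measurable_cong_sets[OF sets_tuple_law refl])
  have "(\<lambda>a. zvec a $ k) \<in> borel_measurable borel"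
    using exhaust_5[of k] unfolding zvec_def borel_prod[symmetric] by (auto simp: vector_5 case_prod_beta)
  then show "(\<lambda>a. zvec a $ k) \<in> borel_measurable tuple_law"
    by (simp add: measurable_cong_sets[OF sets_tuple_law refl])
qed

lemma measurable_phi_PiM:
  "(\<lambda>a i. (U *v fst (phi (a i)), V *v snd (phi (a i)))) \<in> measurable (Pi\<^sub>M UNIV (\<lambda>_::'i::finite. tuple_law))
     (Pi\<^sub>M UNIV (\<lambda>_. borel \<Otimes>\<^sub>M borel))"
proof (rule measurable_lambda_PiM_UNIV)
  fix i
  note measurable_phi[measurable]
  show "(\<lambda>a. (U *v fst (phi (a i)), V *v snd (phi (a i)))) \<in> measurable (Pi\<^sub>M UNIV (\<lambda>_::'i. tuple_law)) (borel \<Otimes>\<^sub>M borel)"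
    by measurable
qed

lemma borel_measurable_zvec_det:
  "(\<lambda>a. ennreal \<bar>det (transpose (\<chi> i. zvec (a i)))\<bar>) \<in> borel_measurable (Pi\<^sub>M UNIV (\<lambda>_. tuple_law))"
proof -
  note borel_measurable_zvec[measurable]
  have "(\<lambda>a. det (transpose (\<chi> i. zvec (a i)))) \<in> borel_measurable (Pi\<^sub>M UNIV (\<lambda>_. tuple_law))"
    by (rule borel_measurable_det) (simp add: transpose_def)
  then show ?thesis by measurable
qed

text \<open>The two conclusions have one proof. \<open>U\<close> and \<open>V\<close> are arbitrary
  selections, so the measurability of the integrand in p cannot come from them; it holds because the
  integrand is 8 times the integral over \<open>\<rho>\<close> of a jointly measurable kernel which
  mentions neither. Only the relation of \<open>ess_param p\<close> to the rotations, up to sign,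
  enters.\<close>

lemma
  assumes A: "fsigma A" "A \<subseteq> ess_patch"
    and F[measurable]: "F \<in> borel_measurable (Pi\<^sub>M UNIV (\<lambda>_::5. borel \<Otimes>\<^sub>M borel))"
    and UV: "\<And>p. p \<in> A \<Longrightarrow> rotation_matrix (U p) \<and> rotation_matrix (V p)"
    and c: "\<And>p. p \<in> A \<Longrightarrow> \<exists>c. c * c = 1 \<and> ess_param p = c *\<^sub>R ess_rot (U p) (V p)"
  defines "I \<equiv> \<lambda>p. \<integral>\<^sup>+a. F (\<lambda>i. (U p *v fst (phi (a i)), V p *v snd (phi (a i))))
      * ennreal \<bar>det (transpose (\<chi> i. zvec (a i)))\<bar> \<partial>Pi\<^sub>M UNIV (\<lambda>_. tuple_law)"
  shows borel_measurable_chart_integrand: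
      "(\<lambda>p. ennreal (vol_density ess_param p) * I p * indicator A p) \<in> borel_measurable lborel"
    and nn_integral_chart_count:
      "(\<integral>\<^sup>+w. F w * emeasure (count_space UNIV) {p\<in>A. \<forall>i. fst (w i) \<bullet> (ess_param p *v snd (w i)) = 0}
          \<partial>Pi\<^sub>M UNIV (\<lambda>_. gauss3 \<Otimes>\<^sub>M gauss3))
        = ennreal (1/8) * (\<integral>\<^sup>+p. ennreal (vol_density ess_param p) * I p * indicator A p \<partial>lborel)"
proof -
  let ?N = "\<lambda>w :: 5 \<Rightarrow> (real^3) \<times> (real^3). emeasure (count_space UNIV) {p\<in>A. \<forall>i. fst (w i) \<bullet> (ess_param p *v snd (w i)) = 0}"
  let ?C = "Pi\<^sub>M (UNIV :: 5 set) (\<lambda>_. cond_base)"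
  define S where "S \<rho> p i = solve (ess_param p) (\<rho> i)" for \<rho> :: "5 \<Rightarrow> real \<times> real \<times> (real^3)" and p i
  \<comment> \<open>The kernel for Tonelli: its integral over p is the count for fixed
    \<open>\<rho>\<close>, by the area formula, and its integral over \<open>\<rho>\<close> is an
    expectation over tuples, by \<open>slice_law_PiM\<close>.\<close>
  define K where "K p \<rho> = (\<Prod>i\<in>UNIV. ennreal (cond_kernel (ess_param p) (\<rho> i)))
    * (F (\<lambda>i. slice (\<rho> i) (S \<rho> p i)) * ennreal \<bar>det (bilin_matrix (\<lambda>i. slice (\<rho> i) (S \<rho> p i)) p)\<bar>) * indicator A p" for p \<rho>
  interpret b: prob_space ?C by (rule prob_space_PiM[OF prob_space_cond_base])
  have Ab[measurable]: "A \<in> sets borel" using A(1) by cases auto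
  have Km: "(\<lambda>(p, \<rho>). K p \<rho>) \<in> borel_measurable (lborel \<Otimes>\<^sub>M ?C)"
  proof -
    have s: "(\<lambda>z i. slice (snd z i) (S (snd z) (fst z) i)) \<in> measurable (lborel \<Otimes>\<^sub>M ?C) (Pi\<^sub>M UNIV (\<lambda>_. borel \<Otimes>\<^sub>M borel))"
      unfolding S_def by (rule measurable_lambda_PiM_UNIV) measurable
    have [measurable]: "(\<lambda>z. F (\<lambda>i. slice (snd z i) (S (snd z) (fst z) i))) \<in> borel_measurable (lborel \<Otimes>\<^sub>M ?C)"
      by (rule measurable_compose[OF s F])
    have [measurable]: "(\<lambda>z. det (bilin_matrix (\<lambda>i. slice (snd z i) (S (snd z) (fst z) i)) (fst z))) \<in> borel_measurable (lborel \<Otimes>\<^sub>M ?C)"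
      by (rule borel_measurable_bilin_det[OF s]) measurable
    show ?thesis unfolding K_def case_prod_beta by measurable
  qed
  have KI: "(\<integral>\<^sup>+\<rho>. K p \<rho> \<partial>?C) = ennreal (1/8) * (ennreal (vol_density ess_param p) * I p * indicator A p)" for p
  proof (cases "p \<in> A")
    case True
    then obtain c where c: "c * c = 1" "ess_param p = c *\<^sub>R ess_rot (U p) (V p)" using c by blast
    have r: "rotation_matrix (U p)" "rotation_matrix (V p)" using UV True by auto
    have lp: "local_param ess_variety ess_patch ess_param"
      using local_param_ess_chart[of "mat 1" "mat 1"] by (simp add: ess_chart_mat_1 rotation_matrix_mat_1)
    have pp: "p \<in> ess_patch" using True A by auto
    note bd = local_param_bilinear_det[OF lp pp r[THEN rotation_matrix_orthogonal] c(2,1)]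
    have "left_rot p $ 2 $ 2 \<noteq> 0" using pp by (simp add: ess_patch_def)
    \<comment> \<open>Applied to \<open>right_rot p\<close> e_3, the matrix gives
      \<open>left_rot p\<close> (e_1 x e_3), whose second coordinate is -L_22 for L =
      \<open>left_rot p\<close>. Its nonvanishing is built into \<open>ess_patch\<close>.\<close>
    have E2: "ess_param p $ 2 \<noteq> 0"
    proof
      assume "ess_param p $ 2 = 0"
      then have "(ess_param p *v (right_rot p *v axis 3 1)) $ 2 = 0" by (simp add: matrix_vector_mult_def)
      moreover have "ess_param p *v (right_rot p *v axis 3 1) = left_rot p *v (E0 *v ((transpose (right_rot p) ** right_rot p) *v axis 3 1))"
        by (simp only: ess_param_def ess_rot_def matrix_vector_mul_assoc matrix_mul_assoc)
      moreover have "transpose (right_rot p) ** right_rot p = mat 1"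
        using rotation_matrix_orthogonal[OF rotation_right_rot] by (simp add: orthogonal_matrix)
      ultimately have "(left_rot p *v cross3 (axis 1 1) (axis 3 1)) $ 2 = 0" by (simp add: E0_vec)
      with \<open>left_rot p $ 2 $ 2 \<noteq> 0\<close> show False
        by (simp add: matrix_vector_mult_def sum_3 cross3_def axis_def)
    qed
    define H where "H w = F w * ennreal \<bar>det (bilin_matrix w p)\<bar>" for w
    have [measurable]: "(\<lambda>w. det (bilin_matrix w p)) \<in> borel_measurable (Pi\<^sub>M UNIV (\<lambda>_. borel \<Otimes>\<^sub>M borel))"
      by (rule borel_measurable_bilin_det) measurable
    have H: "H \<in> borel_measurable (Pi\<^sub>M UNIV (\<lambda>_. borel \<Otimes>\<^sub>M borel))" unfolding H_def by measurable
    have p2: "(\<Prod>i\<in>UNIV. ennreal (2 * cond_kernel (ess_param p) (\<rho> i))) = 32 * (\<Prod>i\<in>UNIV. ennreal (cond_kernel (ess_param p) (\<rho> i)))"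
      for \<rho> :: "5 \<Rightarrow> real \<times> real \<times> (real^3)"
      by (simp add: ennreal_mult' prod.distrib)
    have Kp: "K p \<in> borel_measurable ?C"
      using measurable_compose[OF measurable_Pair1' Km, of p] by simp
    have Fm: "(\<lambda>a. F (\<lambda>i. (U p *v fst (phi (a i)), V p *v snd (phi (a i))))
        * ennreal \<bar>det (transpose (\<chi> i. zvec (a i)))\<bar>) \<in> borel_measurable (Pi\<^sub>M UNIV (\<lambda>_. tuple_law))"
      by (intro borel_measurable_times_ennreal measurable_compose[OF measurable_phi_PiM F] borel_measurable_zvec_det)
    have "32 * (\<integral>\<^sup>+\<rho>. K p \<rho> \<partial>?C) = (\<integral>\<^sup>+\<rho>. (\<Prod>i\<in>UNIV. ennreal (2 * cond_kernel (ess_param p) (\<rho> i))) * H (\<lambda>i. slice (\<rho> i) (S \<rho> p i)) \<partial>?C)"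
      by (subst nn_integral_cmult[symmetric, OF Kp], intro nn_integral_cong)
         (use True in \<open>simp add: K_def H_def p2 mult.assoc\<close>)
    also have "\<dots> = (\<integral>\<^sup>+a. H (\<lambda>i. (U p *v fst (phi (a i)), V p *v snd (phi (a i)))) \<partial>Pi\<^sub>M UNIV (\<lambda>_. tuple_law))"
      unfolding S_def by (rule slice_law_PiM[OF r c(2,1) E2 H])
    also have "\<dots> = (\<integral>\<^sup>+a. ennreal (4 * vol_density ess_param p) * (F (\<lambda>i. (U p *v fst (phi (a i)), V p *v snd (phi (a i))))
        * ennreal \<bar>det (transpose (\<chi> i. zvec (a i)))\<bar>) \<partial>Pi\<^sub>M UNIV (\<lambda>_. tuple_law))"
      by (intro nn_integral_cong) (use bd in \<open>simp add: H_def bilin_matrix_def ennreal_mult' mult_ac\<close>)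
    also have "\<dots> = ennreal (4 * vol_density ess_param p) * I p"
      unfolding I_def by (rule nn_integral_cmult[OF Fm])
    finally have e: "32 * (\<integral>\<^sup>+\<rho>. K p \<rho> \<partial>?C) = 4 * (ennreal (vol_density ess_param p) * I p)"
      by (simp add: ennreal_mult' mult.assoc)
    have "(\<integral>\<^sup>+\<rho>. K p \<rho> \<partial>?C) = ennreal (1/32) * 32 * (\<integral>\<^sup>+\<rho>. K p \<rho> \<partial>?C)"
      by (simp flip: ennreal_numeral ennreal_mult')
    also have "\<dots> = ennreal (1/32) * 4 * (ennreal (vol_density ess_param p) * I p)"
      by (simp only: mult.assoc e)
    also have "ennreal (1/32) * 4 = ennreal (1/8)"
      by (simp flip: ennreal_numeral ennreal_mult')
    finally show ?thesis using True by simp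
  qed (simp add: K_def)
  have Ki: "(\<lambda>p. \<integral>\<^sup>+\<rho>. K p \<rho> \<partial>?C) \<in> borel_measurable lborel"
    by (rule b.borel_measurable_nn_integral[OF Km])
  have "(\<lambda>p. 8 * (\<integral>\<^sup>+\<rho>. K p \<rho> \<partial>?C)) \<in> borel_measurable lborel" using Ki by measurable
  moreover have "8 * (\<integral>\<^sup>+\<rho>. K p \<rho> \<partial>?C) = ennreal (vol_density ess_param p) * I p * indicator A p" for p
  proof -
    have "8 * ennreal (1/8) = 1" by (simp flip: ennreal_numeral ennreal_mult')
    then show ?thesis unfolding KI mult.assoc[symmetric] by simp
  qed
  ultimately show m: "(\<lambda>p. ennreal (vol_density ess_param p) * I p * indicator A p) \<in> borel_measurable lborel" by simp
  have Nm[measurable]: "?N \<in> borel_measurable (Pi\<^sub>M UNIV (\<lambda>_. borel \<Otimes>\<^sub>M borel))"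
    by (rule borel_measurable_chart_count[OF A(1)])
  have inner: "(\<integral>\<^sup>+x. F (\<lambda>i. slice (\<rho> i) (x i)) * ?N (\<lambda>i. slice (\<rho> i) (x i)) \<partial>Pi\<^sub>M UNIV (\<lambda>_. std_gauss)) = (\<integral>\<^sup>+p. K p \<rho> \<partial>lborel)"
    if "AE x in Pi\<^sub>M UNIV (\<lambda>_. std_gauss). (\<lambda>i. slice (\<rho> i) (x i)) \<notin> ess_bad" for \<rho>
  proof -
    have sl: "(\<lambda>x i. slice (\<rho> i) (x i)) \<in> measurable (Pi\<^sub>M UNIV (\<lambda>_. borel)) (Pi\<^sub>M UNIV (\<lambda>_. borel \<Otimes>\<^sub>M borel))"
    proof (rule measurable_lambda_PiM_UNIV)
      fix i
      have "(\<lambda>x. slice (\<rho> i) x) \<in> measurable borel (borel \<Otimes>\<^sub>M borel)"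
        by (intro measurable_slice measurable_const) (simp_all add: space_pair_measure)
      then show "(\<lambda>x. slice (\<rho> i) (x i)) \<in> measurable (Pi\<^sub>M UNIV (\<lambda>_. borel)) (borel \<Otimes>\<^sub>M borel)"
        by (rule measurable_compose[OF measurable_component_singleton, rotated]) simp
    qed
    have FN: "(\<lambda>x. F (\<lambda>i. slice (\<rho> i) (x i)) * ?N (\<lambda>i. slice (\<rho> i) (x i))) \<in> borel_measurable (Pi\<^sub>M UNIV (\<lambda>_. borel))"
      by (intro borel_measurable_times_ennreal measurable_compose[OF sl F] measurable_compose[OF sl Nm])
    have nm: "(\<lambda>x :: real^5. \<lambda>i. x $ i) \<in> measurable borel (Pi\<^sub>M UNIV (\<lambda>_. borel))"
      by (rule measurable_lambda_PiM_UNIV) measurable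
    have Fx: "(\<lambda>x :: real^5. F (\<lambda>i. slice (\<rho> i) (x $ i))) \<in> borel_measurable borel"
      using measurable_compose[OF nm measurable_compose[OF sl F]] .
    have "(\<integral>\<^sup>+x. F (\<lambda>i. slice (\<rho> i) (x i)) * ?N (\<lambda>i. slice (\<rho> i) (x i)) \<partial>Pi\<^sub>M UNIV (\<lambda>_. std_gauss))
      = (\<integral>\<^sup>+x. (\<Prod>i\<in>UNIV. ennreal (std_normal_density (x $ i))) * (F (\<lambda>i. slice (\<rho> i) (x $ i)) * ?N (\<lambda>i. slice (\<rho> i) (x $ i))) \<partial>lborel)"
      by (rule nn_integral_PiM_std_gauss[OF FN])
    also have "\<dots> = (\<integral>\<^sup>+x. (\<Prod>i\<in>UNIV. ennreal (std_normal_density (x $ i))) * F (\<lambda>i. slice (\<rho> i) (x $ i))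
        * emeasure (count_space UNIV) {p\<in>A. (\<forall>i. (ess_param p *v snd (snd (\<rho> i))) $ 2 \<noteq> 0) \<and> (\<chi> i. S \<rho> p i) = x} \<partial>lborel)"
      using AE_PiM_std_gauss[OF that]
    proof (intro nn_integral_cong_AE, eventually_elim)
      case (elim x)
      have "{p\<in>A. \<forall>i. fst (slice (\<rho> i) (x $ i)) \<bullet> (ess_param p *v snd (slice (\<rho> i) (x $ i))) = 0}
        = {p\<in>A. (\<forall>i. (ess_param p *v snd (snd (\<rho> i))) $ 2 \<noteq> 0) \<and> (\<chi> i. S \<rho> p i) = x}"
      proof -
        \<comment> \<open>A solution with vanishing coefficient would place the tuple in
          \<open>ess_bad\<close>.\<close>
        have g: "\<forall>i. (ess_param p *v snd (snd (\<rho> i))) $ 2 \<noteq> 0"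
          if "p \<in> A" "\<forall>i. fst (slice (\<rho> i) (x $ i)) \<bullet> (ess_param p *v snd (slice (\<rho> i) (x $ i))) = 0" for p
          using elim that A(2) by (auto simp: ess_bad_def slice_def)
        have s: "fst (slice (\<rho> i) (x $ i)) \<bullet> (ess_param p *v snd (slice (\<rho> i) (x $ i))) = 0 \<longleftrightarrow> S \<rho> p i = x $ i"
          if "(ess_param p *v snd (snd (\<rho> i))) $ 2 \<noteq> 0" for p i
          using that by (auto simp: slice_def S_def solve_def inner_vec_def sum_3 field_simps)
        have "p \<in> A \<and> (\<forall>i. fst (slice (\<rho> i) (x $ i)) \<bullet> (ess_param p *v snd (slice (\<rho> i) (x $ i))) = 0)
          \<longleftrightarrow> p \<in> A \<and> (\<forall>i. (ess_param p *v snd (snd (\<rho> i))) $ 2 \<noteq> 0) \<and> (\<forall>i. S \<rho> p i = x $ i)" for p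
          using g[of p] s[of p] by metis
        then show ?thesis
          by (simp add: vec_eq_iff)
      qed
      then show ?case by (simp only: mult.assoc)
    qed
    also have "\<dots> = (\<integral>\<^sup>+p. K p \<rho> \<partial>lborel)"
      using solve_area_formula[OF Ab A(2) Fx, of \<rho>] by (simp add: K_def S_def)
    finally show ?thesis .
  qed
  have "(\<integral>\<^sup>+w. F w * ?N w \<partial>Pi\<^sub>M UNIV (\<lambda>_. gauss3 \<Otimes>\<^sub>M gauss3))
      = (\<integral>\<^sup>+\<rho>. \<integral>\<^sup>+x. F (\<lambda>i. slice (\<rho> i) (x i)) * ?N (\<lambda>i. slice (\<rho> i) (x i)) \<partial>Pi\<^sub>M UNIV (\<lambda>_. std_gauss) \<partial>?C)"
    by (rule nn_integral_gauss3_pair_PiM) measurable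
  also have "\<dots> = (\<integral>\<^sup>+\<rho>. \<integral>\<^sup>+p. K p \<rho> \<partial>lborel \<partial>?C)"
    using AE_gauss3_pair_PiM[OF AE_not_ess_bad]
    by (intro nn_integral_cong_AE, eventually_elim) (rule inner)
  also have "\<dots> = (\<integral>\<^sup>+p. \<integral>\<^sup>+\<rho>. K p \<rho> \<partial>?C \<partial>lborel)"
    by (rule nn_integral_swap[OF lborel.sigma_finite_measure_axioms b.sigma_finite_measure_axioms Km])
  also have "\<dots> = ennreal (1/8) * (\<integral>\<^sup>+p. ennreal (vol_density ess_param p) * I p * indicator A p \<partial>lborel)"
    unfolding KI by (rule nn_integral_cmult[OF m])
  finally show "(\<integral>\<^sup>+w. F w * ?N w \<partial>Pi\<^sub>M UNIV (\<lambda>_. gauss3 \<Otimes>\<^sub>M gauss3))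
        = ennreal (1/8) * (\<integral>\<^sup>+p. ennreal (vol_density ess_param p) * I p * indicator A p \<partial>lborel)" .
qed

section \<open>Summation over the charts\<close>

context atlas
begin

text \<open>Only the product of f with the volume density is known to be measurable in the charts.
  Dividing by the positive density recovers f there, and the inverse of each chart carries it to the
  corresponding piece of M.\<close>

lemma borel_measurable_SM:
  fixes f :: "(real^3^3) proj_space \<Rightarrow> ennreal"
  assumes m: "\<And>k. k < n \<Longrightarrow> (\<lambda>x. ennreal (vol_density (\<psi> k) x) * f (chart (\<psi> k) x) * indicator (pdom k) x) \<in> borel_measurable borel"
    and pos: "\<And>k x. k < n \<Longrightarrow> x \<in> pdom k \<Longrightarrow> 0 < vol_density (\<psi> k) x"
  shows "f \<in> borel_measurable SM"
proof (rule measurableI)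
  fix B :: "ennreal set" assume B: "B \<in> sets borel"
  have "{E \<in> piece k. f E \<in> B} \<in> sets SM" if k: "k < n" for k
  proof -
    have d: "(\<lambda>x. ennreal (vol_density (\<psi> k) x) * indicator (pdom k) x) \<in> borel_measurable borel"
      by (rule measurable_vol_density[OF param[OF k] dom_borel[OF k] dom_subset])
    define h where "h x = (ennreal (vol_density (\<psi> k) x) * f (chart (\<psi> k) x) * indicator (pdom k) x)
      / (ennreal (vol_density (\<psi> k) x) * indicator (pdom k) x)" for x
    have hm: "h \<in> borel_measurable borel"
      unfolding h_def by (rule borel_measurable_divide_ennreal[OF m[OF k] d])
    have h: "h x = f (chart (\<psi> k) x)" if "x \<in> pdom k" for x
    proof -
      have "ennreal (vol_density (\<psi> k) x) \<noteq> 0" using pos[OF k that] by simp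
      then show ?thesis using that
        by (simp add: h_def ennreal_mult_divide_eq mult.commute[of "ennreal (vol_density (\<psi> k) x)"])
    qed
    obtain g where g: "homeomorphism (W k) (chart (\<psi> k) ` W k) (chart (\<psi> k)) g"
      using param[OF k] by (auto simp: local_param_def)
    have pk: "piece k \<subseteq> chart (\<psi> k) ` W k" "piece k \<subseteq> M"
      using piece_eq[of k] dom_subset[of k] piece_cover k by auto
    have "continuous_on (piece k) g"
      using g pk(1) by (auto simp: homeomorphism_def intro: continuous_on_subset)
    then have "(\<lambda>E. h (g E)) \<in> borel_measurable (restrict_space borel (piece k))"
      by (intro measurable_compose[OF _ hm] borel_measurable_continuous_on_restrict)
    then have "{E \<in> piece k. h (g E) \<in> B} \<in> sets (restrict_space borel (piece k))"
      by (rule back_subst[of "\<lambda>X. X \<in> _", OF measurable_sets[OF _ B]]) (auto simp: space_restrict_space)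
    then obtain X where X: "X \<in> sets borel" "{E \<in> piece k. h (g E) \<in> B} = piece k \<inter> X"
      by (auto simp: sets_restrict_space)
    have "h (g E) = f E" if "E \<in> piece k" for E
    proof -
      obtain x where x: "x \<in> pdom k" "E = chart (\<psi> k) x" using \<open>E \<in> piece k\<close> piece_eq[of k] by auto
      then have "g E = x" using g dom_subset[of k] by (auto simp: homeomorphism_def)
      with x h show ?thesis by simp
    qed
    then have "{E \<in> piece k. f E \<in> B} = {E \<in> piece k. h (g E) \<in> B}" by auto
    then have "{E \<in> piece k. f E \<in> B} = piece k \<inter> (M \<inter> X)" using X(2) pk(2) by auto
    moreover have "M \<inter> X \<in> sets SM" using X(1) by (auto simp: sets_restrict_space)
    ultimately show ?thesis using piece_sets[OF k] by auto
  qed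
  then have "(\<Union>k<n. {E \<in> piece k. f E \<in> B}) \<in> sets SM" by auto
  moreover have "f -` B \<inter> space SM = (\<Union>k<n. {E \<in> piece k. f E \<in> B})"
    unfolding space_SM using piece_cover by auto
  ultimately show "f -` B \<inter> space SM \<in> sets SM" by simp
qed simp

end

section \<open>From projective points to vectors and from the variety to the base chart\<close>

lemma epipolar_proj_pt:
  assumes "x \<noteq> 0" "E \<noteq> 0" "y \<noteq> 0"
  shows "epipolar (proj_pt x) (proj_pt E) (proj_pt y) \<longleftrightarrow> x \<bullet> (E *v y) = 0"
  unfolding epipolar_def line_of_proj_pt[OF assms(1)] line_of_proj_pt[OF assms(2)] line_of_proj_pt[OF assms(3)] span_singleton
proof
  assume "\<forall>a\<in>range (\<lambda>k. k *\<^sub>R x). \<forall>A\<in>range (\<lambda>k. k *\<^sub>R E). \<forall>b\<in>range (\<lambda>k. k *\<^sub>R y). a \<bullet> (A *v b) = 0"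
  then have "(1 *\<^sub>R x) \<bullet> ((1 *\<^sub>R E) *v (1 *\<^sub>R y)) = 0" by blast
  then show "x \<bullet> (E *v y) = 0" by simp
qed (auto simp: matrix_vector_mult_scaleR scaleR_matrix_vector_assoc[symmetric])

lemma nn_integral_PiM_pair_distr:
  assumes M: "prob_space M" and N: "prob_space N"
    and f[measurable]: "f \<in> measurable M M'" and g[measurable]: "g \<in> measurable N N'"
    and G: "G \<in> borel_measurable (Pi\<^sub>M UNIV (\<lambda>_. M' \<Otimes>\<^sub>M N'))"
  shows "(\<integral>\<^sup>+w. G w \<partial>Pi\<^sub>M UNIV (\<lambda>_::'i::finite. distr M M' f \<Otimes>\<^sub>M distr N N' g))
    = (\<integral>\<^sup>+w. G (\<lambda>i. (f (fst (w i)), g (snd (w i)))) \<partial>Pi\<^sub>M UNIV (\<lambda>_. M \<Otimes>\<^sub>M N))"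
proof -
  interpret M: prob_space M by (rule M)
  interpret N: prob_space N by (rule N)
  interpret MN: pair_prob_space M N ..
  interpret N': prob_space "distr N N' g" by (rule N.prob_space_distr[OF g])
  have "distr M M' f \<Otimes>\<^sub>M distr N N' g = distr (M \<Otimes>\<^sub>M N) (M' \<Otimes>\<^sub>M N') (\<lambda>(x, y). (f x, g y))"
    by (rule pair_measure_distr[OF f g N'.sigma_finite_measure_axioms])
  then have d: "distr M M' f \<Otimes>\<^sub>M distr N N' g = distr (M \<Otimes>\<^sub>M N) (M' \<Otimes>\<^sub>M N') (\<lambda>z. (f (fst z), g (snd z)))"
    by (simp add: case_prod_beta')
  have fg: "(\<lambda>z. (f (fst z), g (snd z))) \<in> measurable (M \<Otimes>\<^sub>M N) (M' \<Otimes>\<^sub>M N')" by measurable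
  have m: "(\<lambda>w i. (f (fst (w i)), g (snd (w i)))) \<in> measurable (Pi\<^sub>M (UNIV :: 'i set) (\<lambda>_. M \<Otimes>\<^sub>M N)) (Pi\<^sub>M UNIV (\<lambda>_. M' \<Otimes>\<^sub>M N'))"
    by (rule measurable_lambda_PiM_UNIV) measurable
  show ?thesis
    unfolding d PiM_distr[OF MN.prob_space_axioms fg]
    by (subst nn_integral_distr[OF m]) (simp_all add: G)
qed

lemma nn_integral_gauss3_pairs_rotate:
  assumes A: "orthogonal_matrix A" and B: "orthogonal_matrix B"
    and F: "F \<in> borel_measurable (Pi\<^sub>M UNIV (\<lambda>_. borel \<Otimes>\<^sub>M borel))"
  shows "(\<integral>\<^sup>+w. F (\<lambda>i. (A *v fst (w i), B *v snd (w i))) \<partial>Pi\<^sub>M UNIV (\<lambda>_::'i::finite. gauss3 \<Otimes>\<^sub>M gauss3))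
    = (\<integral>\<^sup>+w. F w \<partial>Pi\<^sub>M UNIV (\<lambda>_. gauss3 \<Otimes>\<^sub>M gauss3))"
proof -
  have m: "(*v) A \<in> measurable gauss3 borel" "(*v) B \<in> measurable gauss3 borel" by simp_all
  show ?thesis
    using nn_integral_PiM_pair_distr[OF prob_space_gauss3 prob_space_gauss3 m F]
    by (simp add: gauss3_orthogonal[OF A] gauss3_orthogonal[OF B])
qed

lemma AE_gauss3_pairs_nonzero:
  "AE w in Pi\<^sub>M UNIV (\<lambda>_::'i::finite. gauss3 \<Otimes>\<^sub>M gauss3). \<forall>i. fst (w i) \<noteq> 0 \<and> snd (w i) \<noteq> 0"
proof -
  interpret g: prob_space gauss3 by (rule prob_space_gauss3)
  interpret gg: pair_prob_space gauss3 gauss3 ..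
  have z: "AE x in gauss3. x \<noteq> 0"
    unfolding gauss3_def using AE_lborel_singleton[of 0] by (subst AE_density) auto
  have "AE z in gauss3 \<Otimes>\<^sub>M gauss3. fst z \<noteq> 0 \<and> snd z \<noteq> 0"
  proof -
    have "{z \<in> space (gauss3 \<Otimes>\<^sub>M gauss3). fst z \<noteq> 0 \<and> snd z \<noteq> 0} \<in> sets (gauss3 \<Otimes>\<^sub>M gauss3)" by measurable
    then show ?thesis
    proof (rule gg.AE_pair_measure)
      from z show "AE x in gauss3. AE y in gauss3. fst (x, y) \<noteq> 0 \<and> snd (x, y) \<noteq> 0"
        by eventually_elim (use z in simp)
    qed
  qed
  then have "AE w in Pi\<^sub>M UNIV (\<lambda>_::'i. gauss3 \<Otimes>\<^sub>M gauss3). fst (w i) \<noteq> 0 \<and> snd (w i) \<noteq> 0" for i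
    by (intro AE_PiM_component[where P = "\<lambda>z. fst z \<noteq> 0 \<and> snd z \<noteq> 0"] gg.prob_space_axioms) simp_all
  then show ?thesis by (simp add: AE_all_countable)
qed

definition chart_count :: "(real^5) set \<Rightarrow> (5 \<Rightarrow> (real^3) \<times> (real^3)) \<Rightarrow> ennreal" where
  "chart_count X w = emeasure (count_space UNIV) {p\<in>X. \<forall>i. fst (w i) \<bullet> (ess_param p *v snd (w i)) = 0}"

text \<open>The pieces partition the variety, and each chart is injective on its domain. In x^T (A E
  B^T) y the rotations are shifted to the vectors, so the base parametrization alone
  remains.\<close>

lemma ess_count_eq:
  assumes at: "atlas ess_variety n (\<lambda>_. ess_patch) (\<lambda>k. ess_chart (A k) (B k))"
    and nz: "\<And>i. x i \<noteq> 0" "\<And>i. y i \<noteq> 0"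
  shows "emeasure (count_space UNIV) {E\<in>ess_variety. \<forall>i. epipolar (proj_pt (x i)) E (proj_pt (y i))}
    = (\<Sum>k<n. chart_count (atlas_dom (\<lambda>_. ess_patch) (\<lambda>k. ess_chart (A k) (B k)) k)
        (\<lambda>i. (transpose (A k) *v x i, transpose (B k) *v y i)))"
proof -
  interpret atlas ess_variety n "\<lambda>_. ess_patch" "\<lambda>k. ess_chart (A k) (B k)" by (rule at)
  let ?P = "\<lambda>E. \<forall>i. epipolar (proj_pt (x i)) E (proj_pt (y i))"
  let ?S = "\<lambda>k. {p\<in>pdom k. \<forall>i. (transpose (A k) *v x i) \<bullet> (ess_param p *v (transpose (B k) *v y i)) = 0}"
  have "{E\<in>ess_variety. ?P E} = (\<Union>k<n. {E \<in> piece k. ?P E})"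
    unfolding piece_cover[symmetric] by auto
  then have "emeasure (count_space UNIV) {E\<in>ess_variety. ?P E} = emeasure (count_space UNIV) (\<Union>k<n. {E \<in> piece k. ?P E})" by simp
  also have "\<dots> = (\<Sum>k<n. emeasure (count_space UNIV) {E \<in> piece k. ?P E})"
    using piece_disjoint by (subst sum_emeasure) (auto simp: disjoint_family_on_def)
  also have "\<dots> = (\<Sum>k<n. emeasure (count_space UNIV) (?S k))"
  proof (rule sum.cong[OF refl])
    fix k assume "k \<in> {..<n}"
    then have k: "k < n" by simp
    have eq: "?P (chart (ess_chart (A k) (B k)) p) \<longleftrightarrow> (\<forall>i. (transpose (A k) *v x i) \<bullet> (ess_param p *v (transpose (B k) *v y i)) = 0)"
      if "p \<in> pdom k" for p
    proof -
      have "ess_chart (A k) (B k) p \<noteq> 0" using local_paramD(6)[OF param[OF k]] that dom_subset[of k] by auto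
      then have iff: "?P (chart (ess_chart (A k) (B k)) p) \<longleftrightarrow> (\<forall>i. x i \<bullet> (ess_chart (A k) (B k) p *v y i) = 0)"
        by (simp add: epipolar_proj_pt nz)
      have "x i \<bullet> (ess_chart (A k) (B k) p *v y i) = (transpose (A k) *v x i) \<bullet> (ess_param p *v (transpose (B k) *v y i))" for i
        unfolding ess_chart_def matrix_vector_mul_assoc[symmetric] transpose_matrix_vector dot_lmul_matrix ..
      then show ?thesis using iff by simp
    qed
    have "{E \<in> piece k. ?P E} = chart (ess_chart (A k) (B k)) ` ?S k"
      unfolding piece_eq using eq by auto
    moreover have "inj_on (chart (ess_chart (A k) (B k))) (?S k)"
      using local_paramD(10)[OF param[OF k]] dom_subset[of k] by (auto intro: inj_on_subset)
    ultimately show "emeasure (count_space UNIV) {E \<in> piece k. ?P E} = emeasure (count_space UNIV) (?S k)"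
      by (simp add: emeasure_count_space card_image finite_image_iff)
  qed
  finally show ?thesis by (simp add: chart_count_def)
qed

lemma measurable_chart_count:
  assumes "fsigma X" and f: "f \<in> measurable M (Pi\<^sub>M UNIV (\<lambda>_. borel \<Otimes>\<^sub>M borel))"
  shows "(\<lambda>x. chart_count X (f x)) \<in> borel_measurable M"
  unfolding chart_count_def by (rule measurable_compose[OF f borel_measurable_chart_count[OF assms(1)]])

lemma measurable_matrix_pairs:
  "(\<lambda>w i. (A *v fst (w i), B *v snd (w i))) \<in> measurable (Pi\<^sub>M UNIV (\<lambda>_::'i::finite. borel \<Otimes>\<^sub>M borel))
     (Pi\<^sub>M UNIV (\<lambda>_. borel \<Otimes>\<^sub>M borel))" for A B :: "real^3^3"
  by (rule measurable_lambda_PiM_UNIV) measurable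

lemma measurable_proj_pt_pairs:
  "(\<lambda>w i. (proj_pt (fst (w i)), proj_pt (snd (w i)))) \<in> measurable
     (Pi\<^sub>M UNIV (\<lambda>_::'i::finite. borel \<Otimes>\<^sub>M borel :: ((real^3) \<times> (real^3)) measure)) (Pi\<^sub>M UNIV (\<lambda>_. borel \<Otimes>\<^sub>M borel))"
  by (rule measurable_lambda_PiM_UNIV) measurable

lemma measurable_proj_sec_pairs:
  "(\<lambda>w i. (proj_sec (fst (w i)), proj_sec (snd (w i)))) \<in> measurable
     (Pi\<^sub>M UNIV (\<lambda>_::'i::finite. borel \<Otimes>\<^sub>M borel)) (Pi\<^sub>M UNIV (\<lambda>_. borel \<Otimes>\<^sub>M borel))"
  by (rule measurable_lambda_PiM_UNIV) measurable

text \<open>Both matrices are unit representatives of one line and so agree up to sign; undoing A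
  and B keeps that sign.\<close>

lemma ess_rot_relative:
  assumes UV: "rotation_matrix U" "rotation_matrix V" and AB: "rotation_matrix A" "rotation_matrix B"
    and eq: "proj_pt (ess_chart A B p) = proj_pt (ess_rot U V)"
  shows "\<exists>c. c * c = 1 \<and> ess_param p = c *\<^sub>R ess_rot (transpose A ** U) (transpose B ** V)"
proof -
  note o = UV[THEN rotation_matrix_orthogonal] AB[THEN rotation_matrix_orthogonal]
  have "mat_inner (ess_rot U V) (ess_rot U V) = 1" by (rule mat_inner_ess_rot[OF o(1,2)])
  moreover have "mat_inner (ess_chart A B p) (ess_chart A B p) = 1"
    unfolding ess_chart_rot using AB
    by (intro mat_inner_ess_rot rotation_matrix_orthogonal rotation_matrix_mul rotation_left_rot rotation_right_rot)
  ultimately obtain c where c: "ess_chart A B p = c *\<^sub>R ess_rot U V" "c = 1 \<or> c = -1"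
    using unit_proj_pt_eq eq by metis
  have "ess_param p = transpose A ** ess_chart A B p ** B"
    by (simp add: ess_chart_def matrix_mul_assoc orthogonal_matrix_cancel[OF o(3)] orthogonal_matrix_cancel[OF o(4)])
  also have "\<dots> = c *\<^sub>R ess_rot (transpose A ** U) (transpose B ** V)"
    unfolding c(1) ess_rot_def
    by (simp add: matrix_transpose_mul matrix_mul_assoc matrix_scaleR_left matrix_scaleR_right)
  finally have "ess_param p = c *\<^sub>R ess_rot (transpose A ** U) (transpose B ** V)" .
  moreover have "c * c = 1" using c(2) by auto
  ultimately show ?thesis by blast
qed

theorem theorem4p2:
  fixes \<Psi> :: "(5 \<Rightarrow> (real^3) proj_space \<times> (real^3) proj_space) \<Rightarrow> real"
    and U V :: "(real^3^3) proj_space \<Rightarrow> real^3^3"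
  assumes "\<Psi> \<in> borel_measurable (\<Pi>\<^sub>M i\<in>UNIV. borel \<Otimes>\<^sub>M borel)"
    and "\<And>w. 0 \<le> \<Psi> w"
    and "\<And>E. E \<in> ess_variety \<Longrightarrow> rotation_matrix (U E) \<and> rotation_matrix (V E) \<and>
            E = proj_pt (U E ** E0 ** transpose (V E))"
  shows "(\<integral>\<^sup>+ w. ennreal (\<Psi> w) *
              emeasure (count_space UNIV)
                {E \<in> ess_variety. \<forall>i. epipolar (fst (w i)) E (snd (w i))}
            \<partial>(\<Pi>\<^sub>M i\<in>(UNIV :: 5 set). unif_RP2 \<Otimes>\<^sub>M unif_RP2))
       = emeasure ess_volume ess_variety / 2 ^ 3 *
         (\<integral>\<^sup>+ E. (\<integral>\<^sup>+ a.
              ennreal (\<Psi> (\<lambda>i. (proj_pt (U E *v fst (phi (a i))), proj_pt (V E *v snd (phi (a i)))))) *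
              ennreal \<bar>det (transpose (\<chi> i. zvec (a i)))\<bar>
            \<partial>(\<Pi>\<^sub>M i\<in>(UNIV :: 5 set). tuple_law)) \<partial>unif_ess)"
proof (rule ess_atlas)
  fix n and A B :: "nat \<Rightarrow> real^3^3"
  assume AB: "\<And>k. k < n \<Longrightarrow> rotation_matrix (A k)" "\<And>k. k < n \<Longrightarrow> rotation_matrix (B k)"
    and at: "atlas ess_variety n (\<lambda>_. ess_patch) (\<lambda>k. ess_chart (A k) (B k))"
  interpret atlas ess_variety n "\<lambda>_. ess_patch" "\<lambda>k. ess_chart (A k) (B k)" by (rule at)
  let ?\<chi> = "\<lambda>k p. chart (ess_chart (A k) (B k)) p"
  let ?G = "Pi\<^sub>M (UNIV :: 5 set) (\<lambda>_. gauss3 \<Otimes>\<^sub>M gauss3)"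
  let ?pr = "\<lambda>w :: 5 \<Rightarrow> (real^3) \<times> (real^3). \<lambda>i. (proj_pt (fst (w i)), proj_pt (snd (w i)))"
  define \<Phi> where "\<Phi> w = ennreal (\<Psi> w)" for w
  have \<Phi>: "\<Phi> \<in> borel_measurable (Pi\<^sub>M UNIV (\<lambda>_. borel \<Otimes>\<^sub>M borel))"
    unfolding \<Phi>_def using assms(1) by measurable
  define N where "N w = emeasure (count_space UNIV) {E \<in> ess_variety. \<forall>i. epipolar (fst (w i)) E (snd (w i))}"
    for w :: "5 \<Rightarrow> (real^3) proj_space \<times> (real^3) proj_space"
  define rot where "rot k w i = (transpose (A k) *v fst (w i), transpose (B k) *v snd (w i))"
    for k and w :: "5 \<Rightarrow> (real^3) \<times> (real^3)" and i
  define I where "I E = (\<integral>\<^sup>+ a. \<Phi> (\<lambda>i. (proj_pt (U E *v fst (phi (a i))), proj_pt (V E *v snd (phi (a i))))) *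
    ennreal \<bar>det (transpose (\<chi> i. zvec (a i)))\<bar> \<partial>Pi\<^sub>M UNIV (\<lambda>_. tuple_law))" for E
  have rm: "rot k \<in> measurable (Pi\<^sub>M UNIV (\<lambda>_. borel \<Otimes>\<^sub>M borel)) (Pi\<^sub>M UNIV (\<lambda>_. borel \<Otimes>\<^sub>M borel))" for k
    unfolding rot_def[abs_def] by (rule measurable_matrix_pairs)
  have Npr: "N (?pr w) = (\<Sum>k<n. chart_count (pdom k) (rot k w))" if "\<forall>i. fst (w i) \<noteq> 0 \<and> snd (w i) \<noteq> 0" for w
    using ess_count_eq[OF at, of "\<lambda>i. fst (w i)" "\<lambda>i. snd (w i)"] that by (simp add: N_def rot_def[abs_def])
  have Nm: "N \<in> borel_measurable (Pi\<^sub>M UNIV (\<lambda>_. borel \<Otimes>\<^sub>M borel))"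
  proof -
    \<comment> \<open>Composition with the Borel section \<open>proj_sec\<close> expresses the count
      at projective points through counts at vectors.\<close>
    let ?s = "\<lambda>w :: 5 \<Rightarrow> (real^3) proj_space \<times> (real^3) proj_space. \<lambda>i. (proj_sec (fst (w i)), proj_sec (snd (w i)))"
    have "N w = (\<Sum>k<n. chart_count (pdom k) (rot k (?s w)))" for w
      using Npr[of "?s w"] by (simp add: proj_sec)
    moreover have "(\<lambda>w. \<Sum>k<n. chart_count (pdom k) (rot k (?s w))) \<in> borel_measurable (Pi\<^sub>M UNIV (\<lambda>_. borel \<Otimes>\<^sub>M borel))"
      by (intro borel_measurable_sum measurable_chart_count measurable_compose[OF measurable_proj_sec_pairs rm] fsigma_dom) simp
    ultimately show ?thesis by (subst measurable_cong) auto
  qed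
  have cm: "(\<lambda>w. chart_count (pdom k) w) \<in> borel_measurable (Pi\<^sub>M UNIV (\<lambda>_. borel \<Otimes>\<^sub>M borel))" if "k < n" for k
    by (rule measurable_chart_count[OF fsigma_dom[OF that]]) simp
  define F where "F k w = \<Phi> (?pr (\<lambda>i. (A k *v fst (w i), B k *v snd (w i))))" for k w
  have Fm: "F k \<in> borel_measurable (Pi\<^sub>M UNIV (\<lambda>_. borel \<Otimes>\<^sub>M borel))" for k
    unfolding F_def[abs_def]
    by (rule measurable_compose[OF measurable_matrix_pairs measurable_compose[OF measurable_proj_pt_pairs \<Phi>]])
  \<comment> \<open>The given rotations relative to the chart: they take \<open>E0\<close> to
    \<open>ess_param p\<close> up to sign, as the formula in the base chart demands.\<close>
  define U' where "U' k p = transpose (A k) ** U (?\<chi> k p)" for k p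
  define V' where "V' k p = transpose (B k) ** V (?\<chi> k p)" for k p
  have UV': "rotation_matrix (U' k p) \<and> rotation_matrix (V' k p)"
      "\<exists>c. c * c = 1 \<and> ess_param p = c *\<^sub>R ess_rot (U' k p) (V' k p)" if k: "k < n" and p: "p \<in> pdom k" for k p
  proof -
    have "?\<chi> k p \<in> ess_variety" using local_paramD(7)[OF param[OF k]] dom_subset[of k] p by auto
    note a = assms(3)[OF this]
    show "rotation_matrix (U' k p) \<and> rotation_matrix (V' k p)"
      using a AB[OF k] by (simp add: U'_def V'_def rotation_matrix_mul rotation_matrix_transpose)
    show "\<exists>c. c * c = 1 \<and> ess_param p = c *\<^sub>R ess_rot (U' k p) (V' k p)"
      unfolding U'_def V'_def
      by (rule ess_rot_relative) (use a AB[OF k] in \<open>simp_all add: ess_rot_def[symmetric]\<close>)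
  qed
  have I': "(\<integral>\<^sup>+a. F k (\<lambda>i. (U' k p *v fst (phi (a i)), V' k p *v snd (phi (a i))))
      * ennreal \<bar>det (transpose (\<chi> i. zvec (a i)))\<bar> \<partial>Pi\<^sub>M UNIV (\<lambda>_. tuple_law)) = I (?\<chi> k p)" if k: "k < n" for k p
  proof -
    note o = AB[OF k, THEN rotation_matrix_orthogonal]
    have "A k *v (U' k p *v x) = U (?\<chi> k p) *v x" "B k *v (V' k p *v x) = V (?\<chi> k p) *v x" for x
      unfolding U'_def V'_def matrix_vector_mul_assoc matrix_mul_assoc
      using o by (simp_all add: orthogonal_matrix_def)
    then show ?thesis by (simp add: F_def I_def)
  qed
  have vd: "vol_density (ess_chart (A k) (B k)) p = vol_density ess_param p" if "k < n" for k p
    using AB[OF that] by (intro vol_density_ess_chart rotation_matrix_orthogonal)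
  have Im: "I \<in> borel_measurable SM"
  proof (rule borel_measurable_SM)
    fix k assume k: "k < n"
    have "(\<lambda>p. ennreal (vol_density (ess_chart (A k) (B k)) p) * I (?\<chi> k p) * indicator (pdom k) p) \<in> borel_measurable lborel"
      using borel_measurable_chart_integrand[OF fsigma_dom[OF k] dom_subset Fm[of k] UV'(1)[OF k] UV'(2)[OF k]]
      by (simp only: I'[OF k] vd[OF k])
    then show "(\<lambda>p. ennreal (vol_density (ess_chart (A k) (B k)) p) * I (?\<chi> k p) * indicator (pdom k) p) \<in> borel_measurable borel"
      by simp
    show "0 < vol_density (ess_chart (A k) (B k)) p" if "p \<in> pdom k" for p
      using vol_density_ess_patch(1) AB[OF k] dom_subset[of k] that by blast
  qed
  have chart: "(\<integral>\<^sup>+w. \<Phi> (?pr w) * chart_count (pdom k) (rot k w) \<partial>?G)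
    = ennreal (1/8) * (\<integral>\<^sup>+p. I (?\<chi> k p) * (ennreal (vol_density (ess_chart (A k) (B k)) p) * indicator (pdom k) p) \<partial>lborel)"
    if k: "k < n" for k
  proof -
    note o = AB[OF k, THEN rotation_matrix_orthogonal]
    \<comment> \<open>The map \<open>rot k\<close> is undone inside the integrand, so that the whole
      integrand becomes a function of \<open>rot k w\<close>. Rotational invariance of the Gaussian
      law then removes \<open>rot k\<close>.\<close>
    have "?pr w = ?pr (\<lambda>i. (A k *v fst (rot k w i), B k *v snd (rot k w i)))" for w
      unfolding rot_def fst_conv snd_conv matrix_vector_mul_assoc
      using o by (simp add: orthogonal_matrix_def)
    then have "(\<integral>\<^sup>+w. \<Phi> (?pr w) * chart_count (pdom k) (rot k w) \<partial>?G) = (\<integral>\<^sup>+w. F k (rot k w) * chart_count (pdom k) (rot k w) \<partial>?G)"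
      by (simp add: F_def)
    also have "\<dots> = (\<integral>\<^sup>+w. F k w * chart_count (pdom k) w \<partial>?G)"
      unfolding rot_def[abs_def]
      by (rule nn_integral_gauss3_pairs_rotate)
         (use o in \<open>simp_all add: orthogonal_matrix_transpose borel_measurable_times_ennreal[OF Fm cm[OF k]]\<close>)
    also have "\<dots> = ennreal (1/8) * (\<integral>\<^sup>+p. ennreal (vol_density ess_param p) * I (?\<chi> k p) * indicator (pdom k) p \<partial>lborel)"
      using nn_integral_chart_count[OF fsigma_dom[OF k] dom_subset Fm[of k] UV'(1)[OF k] UV'(2)[OF k]]
      by (simp only: chart_count_def I'[OF k])
    also have "\<dots> = ennreal (1/8) * (\<integral>\<^sup>+p. I (?\<chi> k p) * (ennreal (vol_density (ess_chart (A k) (B k)) p) * indicator (pdom k) p) \<partial>lborel)"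
      by (simp only: vd[OF k] mult_ac)
    finally show ?thesis .
  qed
  have prG: "\<Phi> \<circ> ?pr \<in> borel_measurable (Pi\<^sub>M UNIV (\<lambda>_. borel \<Otimes>\<^sub>M borel))"
    unfolding comp_def by (rule measurable_compose[OF measurable_proj_pt_pairs \<Phi>])
  have mG: "borel_measurable ?G = (borel_measurable (Pi\<^sub>M UNIV (\<lambda>_. borel \<Otimes>\<^sub>M borel)) :: (_ \<Rightarrow> ennreal) set)"
    by (rule measurable_cong_sets[OF sets_PiM_borel_pair refl])
  have \<Phi>N: "(\<lambda>w. \<Phi> w * N w) \<in> borel_measurable (Pi\<^sub>M UNIV (\<lambda>_. borel \<Otimes>\<^sub>M borel))"
    by (rule borel_measurable_times_ennreal[OF \<Phi> Nm])
  have pm: "proj_pt \<in> measurable gauss3 (borel :: (real^3) proj_space measure)" by simp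
  have "(\<integral>\<^sup>+w. \<Phi> w * N w \<partial>Pi\<^sub>M UNIV (\<lambda>_. unif_RP2 \<Otimes>\<^sub>M unif_RP2)) = (\<integral>\<^sup>+w. \<Phi> (?pr w) * N (?pr w) \<partial>?G)"
    unfolding unif_RP2_eq by (rule nn_integral_PiM_pair_distr[OF prob_space_gauss3 prob_space_gauss3 pm pm \<Phi>N])
  also have "\<dots> = (\<integral>\<^sup>+w. (\<Sum>k<n. \<Phi> (?pr w) * chart_count (pdom k) (rot k w)) \<partial>?G)"
    using AE_gauss3_pairs_nonzero by (intro nn_integral_cong_AE, eventually_elim) (simp add: Npr sum_distrib_left)
  also have "\<dots> = (\<Sum>k<n. \<integral>\<^sup>+w. \<Phi> (?pr w) * chart_count (pdom k) (rot k w) \<partial>?G)"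
    by (rule nn_integral_sum)
       (use prG in \<open>auto simp: mG comp_def intro!: borel_measurable_times_ennreal measurable_chart_count fsigma_dom rm\<close>)
  also have "\<dots> = ennreal (1/8) * (\<integral>\<^sup>+E. I E \<partial>vol)"
    unfolding nn_integral_vol[OF Im] sum_distrib_left by (rule sum.cong) (simp_all add: chart)
  also have "\<dots> = emeasure ess_volume ess_variety / 2 ^ 3 * (\<integral>\<^sup>+E. I E \<partial>unif_ess)"
  proof -
    have sv: "sets ess_volume = sets SM" using sets_vol by (simp add: riemannian_volume_eq)
    then have sp: "space ess_volume = ess_variety" using sets_eq_imp_space_eq[OF sv] by (simp add: space_SM)
    have M: "ess_variety \<in> sets ess_volume" using sets.top[of ess_volume] unfolding sp .
    have Im': "I \<in> borel_measurable ess_volume" using Im measurable_cong_sets[OF sv refl] by blast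
    have "(\<integral>\<^sup>+E. I E \<partial>unif_ess) = (\<integral>\<^sup>+E. I E * indicator ess_variety E \<partial>ess_volume) / emeasure ess_volume ess_variety"
      unfolding unif_ess_def by (rule nn_integral_uniform_measure[OF Im' M])
    also have "(\<integral>\<^sup>+E. I E * indicator ess_variety E \<partial>ess_volume) = (\<integral>\<^sup>+E. I E \<partial>vol)"
      unfolding riemannian_volume_eq[symmetric] by (intro nn_integral_cong) (simp add: sp)
    finally have e: "(\<integral>\<^sup>+E. I E \<partial>unif_ess) = (\<integral>\<^sup>+E. I E \<partial>vol) / emeasure ess_volume ess_variety" .
    \<comment> \<open>The normalization in \<open>unif_ess\<close> cancels because the volume is
      neither 0 nor infinite.\<close>
    have "emeasure ess_volume ess_variety * (\<integral>\<^sup>+E. I E \<partial>unif_ess) = (\<integral>\<^sup>+E. I E \<partial>vol)"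
      unfolding e using emeasure_ess_volume
      by (simp add: ennreal_times_divide mult.commute[of "emeasure ess_volume ess_variety"] ennreal_mult_divide_eq)
    moreover have "x / 2 ^ 3 * y = ennreal (1/8) * (x * y)" for x y :: ennreal
    proof -
      have "(2 ^ 3 :: ennreal) = ennreal 8" by (simp flip: ennreal_numeral add: ennreal_power)
      then have "inverse (2 ^ 3 :: ennreal) = ennreal (1/8)" using inverse_ennreal[of 8] by (simp only: inverse_eq_divide zero_less_numeral)
      then show ?thesis by (simp add: divide_ennreal_def mult_ac)
    qed
    ultimately show ?thesis by simp
  qed
  finally show ?thesis unfolding \<Phi>_def N_def I_def .
qed

end
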